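(* Let $N,M\in\mathbb{N}$, $q\in(0,1)$, $s=q^{-1/2}$, $\mathbf u=(u_1,\dots,u_N)$ with all $u_i>s$, $\mathbf v=(v_1,\dots,v_M)$ with all $v_j>0$, and $\max_{i,j}u_iv_j<1$. Let $k$ and $m_1,\dots,m_k$ be positive integers with $1\le k\le m_1\le m_2\le\dots\le m_k\le N$. Then $$\mathbb{P}_{\mathbf u,\mathbf v}(Y_1^1\le m_1,\dots,Y_k^k\le m_k)=\left(\prod_{j=1}^M\frac{1-qsv_j}{1-sv_j}\right)^k\prod_{r=1}^k\left(\prod_{i=1}^{m_r}\frac{u_i-s}{u_i-sq}\right)\frac{q^{-k}}{(2\pi\iota)^k}\int_\gamma\cdots\int_\gamma\ \prod_{1\le i<j\le k}\frac{z_i-z_j}{z_i-qz_j}$$ $$\times\prod_{r=1}^k\left(\prod_{i=1}^{m_r}\frac{qz_r-u_i}{z_r-u_i}\right)\left(\frac{z_r-sq}{z_r-s}\right)^{k-r+1}\prod_{j=1}^M\frac{1-z_rv_j}{1-qz_rv_j}\ \frac{dz_r}{z_r(1-sz_r)},$$ where $\iota=\sqrt{-1}$ and $\gamma$ is a positively oriented contour that contains $u_1,\dots,u_N$ and excludes all other singularities of the integrand (such a contour exists provided the $u_i$ are sufficiently close to each other, and the formula is asserted when it exists).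
   Context: Signatures: $\mathsf{Sign}_N^+$ is the set of integer sequences $\lambda_1\ge\dots\ge\lambda_N\ge0$. Path collections: let $D_N=\mathbb{Z}_{\ge0}\times\{1,\dots,N\}$. $\mathcal{P}_N$ is the set of collections $\omega$ of $N$ up-right lattice paths in $D_N$ such that a path enters each point $(0,m)$, $1\le m\le N$, through the horizontal arrow from $(-1,m)$, all paths exit through the top boundary, and no two paths share a horizontal or a vertical edge. $\omega(i,j)=(i_1,j_1;i_2,j_2)$ records the numbers of arrows at $(i,j)$ entering from below, entering from the left, leaving upwards, leaving to the right. $\lambda^k(\omega)=(\lambda_1^k\ge\dots\ge\lambda_k^k)$ is the ordered list of $x$-coordinates of the intersections of $\omega$ with the line $y=k+1/2$. Weights: for $g\in\mathbb{Z}_{\ge0}$ let $w_u(g,0;g,0)=\frac{1-sq^gu}{1-su}$, $w_u(g+1,0;g,1)=\frac{(1-s^2q^g)u}{1-su}$, $w_u(g,1;g,1)=\frac{u-sq^g}{1-su}$, $w_u(g,1;g+1,0)=\frac{1-q^{g+1}}{1-su}$; $w^c_u(g,0;g,0)=\frac{1-sq^gu}{1-su}$, $w^c_u(g+1,0;g,1)=\frac{(1-q^{g+1})u}{1-su}$, $w^c_u(g,1;g,1)=\frac{u-sq^g}{1-su}$, $w^c_u(g,1;g+1,0)=\frac{1-s^2q^{g}}{1-su}$; all other weights are $0$. For $\lambda,\nu\in\mathsf{Sign}_N^+$, $\mathsf{G}^c_{\lambda/\nu}(v_1,\dots,v_M)$ is the sum of $\prod_{i\ge0}\prod_{j=1}^M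 w^c_{v_j}(\omega'(i,j))$ over all collections $\omega'$ of $N$ up-right paths in $\mathbb{Z}_{\ge0}\times\{1,\dots,M\}$ starting with the vertical edges $(\nu_i,0)\to(\nu_i,1)$ and ending with the vertical edges $(\lambda_i,M)\to(\lambda_i,M+1)$, $1\le i\le N$ (vertical edges may be shared, horizontal ones may not). Measure: for $\lambda\in\mathsf{Sign}_N^+$ put $$f(\lambda)=(-1)^N\sum_{\nu_1>\dots>\nu_N\ge1}\ \prod_{j=1}^N(-s)^{\nu_j}\ \mathsf{G}^c_{\lambda/\nu}(v_1,\dots,v_M),\qquad \mathcal{W}(\omega)=\prod_{i=0}^\infty\prod_{j=1}^N w_{u_j}(\omega(i,j))\cdot f(\lambda^N(\omega)).$$ The weights $\mathcal{W}(\omega)$, $\omega\in\mathcal{P}_N$, are nonnegative with finite positive sum, and $\mathbb{P}_{\mathbf u,\mathbf v}(\omega)=\mathcal{W}(\omega)/\sum_{\omega'\in\mathcal{P}_N}\mathcal{W}(\omega')$. The variables $Y$: for $\omega\in\mathcal{P}_N$, $Y_i^j(\omega)$ is the $i$-th smallest $y$-coordinate of a vertex in the column $\{(j,y):1\le y\le N\}$ that has no outgoing horizontal arrow (i.e. $j_2=0$), or $+\infty$ if there are fewer than $i$ such vertices. *)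

theory Defs
  imports "HOL-Complex_Analysis.Complex_Analysis" "HOL-Library.Extended_Nat"
begin

section \<open>Up-right paths and their arrow configurations\<close>

type_synonym point = "int \<times> nat"

text \<open>\<open>strip n\<close> is the set of points with \<open>x \<ge> 0\<close> and \<open>1 \<le> y \<le> n\<close>; it is the
  domain \<open>D\<^sub>N\<close> for \<open>n = N\<close>.\<close>

definition strip :: "nat \<Rightarrow> point set" where
  "strip n = {(x, y). 0 \<le> x \<and> 1 \<le> y \<and> y \<le> n}"

definition up_right_step :: "point \<Rightarrow> point \<Rightarrow> bool" where
  "up_right_step a b \<longleftrightarrow> b = (fst a + 1, snd a) \<or> b = (fst a, snd a + 1)"

text \<open>The end points \<open>a\<close> and \<open>b\<close> are the outer ends of the entering and of the exiting arrow and
  lie outside \<open>D\<close>; all the other points of the path lie in \<open>D\<close>.\<close>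

definition up_right_path :: "point set \<Rightarrow> point \<Rightarrow> point \<Rightarrow> point list \<Rightarrow> bool" where
  "up_right_path D a b \<pi> \<longleftrightarrow>
     (\<exists>p. \<pi> = a # p @ [b] \<and> set p \<subseteq> D \<and> successively up_right_step \<pi>)"

definition path_edges :: "point list \<Rightarrow> (point \<times> point) set" where
  "path_edges \<pi> = set (zip \<pi> (tl \<pi>))"

text \<open>A collection of paths is identified with the function counting the arrows on each lattice
  edge: collections that differ only in how paths meeting at a vertex are continued
  (crossing or bouncing off) are the same.\<close>

type_synonym arrows = "point \<times> point \<Rightarrow> nat"

definition arrows_of :: "'i set \<Rightarrow> ('i \<Rightarrow> point list) \<Rightarrow> arrows" where
  "arrows_of I \<pi> e = card {i \<in> I. e \<in> path_edges (\<pi> i)}"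

text \<open>\<open>vertex \<omega> i j = (i\<^sub>1, j\<^sub>1, i\<^sub>2, j\<^sub>2)\<close>: arrows from below, from the left, upwards, to the right.\<close>

definition vertex :: "arrows \<Rightarrow> int \<Rightarrow> nat \<Rightarrow> nat \<times> nat \<times> nat \<times> nat" where
  "vertex \<omega> i j =
     (\<omega> ((i, j - 1), (i, j)), \<omega> ((i - 1, j), (i, j)),
      \<omega> ((i, j), (i, j + 1)), \<omega> ((i, j), (i + 1, j)))"

text \<open>A path from \<open>(-1, m)\<close> has its next point in \<open>strip N\<close> and hence enters \<open>(0, m)\<close>
  horizontally; one that ends in \<open>(x, N + 1)\<close> with \<open>x \<ge> 0\<close> leaves through the top
  boundary.\<close>

definition path_collections :: "nat \<Rightarrow> arrows set" where
  "path_collections N =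
     {\<omega>. \<exists>\<pi>. \<omega> = arrows_of {1..N} \<pi> \<and>
            (\<forall>m\<in>{1..N}. \<exists>x\<ge>0. up_right_path (strip N) (-1, m) (x, N + 1) (\<pi> m)) \<and>
            (\<forall>e. \<omega> e \<le> 1)}"

text \<open>The ordered list of \<open>x\<close>-coordinates of the intersections with the line \<open>y = k + 1/2\<close>,
  as a weakly decreasing list; the part \<open>\<lambda>\<^sub>i\<close> of a signature is the list entry with index
  \<open>i - 1\<close>.\<close>

definition signature_at :: "nat \<Rightarrow> arrows \<Rightarrow> int list" where
  "signature_at k \<omega> =
     (THE l. sorted_wrt (\<ge>) l \<and> (\<forall>x. count_list l x = \<omega> ((x, k), (x, k + 1))))"

section \<open>Weights\<close>

definition weight :: "real \<Rightarrow> real \<Rightarrow> real \<Rightarrow> nat \<times> nat \<times> nat \<times> nat \<Rightarrow> real" where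
  "weight q s u = (\<lambda>(i\<^sub>1, j\<^sub>1, i\<^sub>2, j\<^sub>2).
     if j\<^sub>1 = 0 \<and> j\<^sub>2 = 0 \<and> i\<^sub>1 = i\<^sub>2 then (1 - s * q ^ i\<^sub>1 * u) / (1 - s * u)
     else if j\<^sub>1 = 0 \<and> j\<^sub>2 = 1 \<and> i\<^sub>1 = i\<^sub>2 + 1 then (1 - s\<^sup>2 * q ^ i\<^sub>2) * u / (1 - s * u)
     else if j\<^sub>1 = 1 \<and> j\<^sub>2 = 1 \<and> i\<^sub>1 = i\<^sub>2 then (u - s * q ^ i\<^sub>1) / (1 - s * u)
     else if j\<^sub>1 = 1 \<and> j\<^sub>2 = 0 \<and> i\<^sub>2 = i\<^sub>1 + 1 then (1 - q ^ (i\<^sub>1 + 1)) / (1 - s * u)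
     else 0)"

definition weight_c :: "real \<Rightarrow> real \<Rightarrow> real \<Rightarrow> nat \<times> nat \<times> nat \<times> nat \<Rightarrow> real" where
  "weight_c q s u = (\<lambda>(i\<^sub>1, j\<^sub>1, i\<^sub>2, j\<^sub>2).
     if j\<^sub>1 = 0 \<and> j\<^sub>2 = 0 \<and> i\<^sub>1 = i\<^sub>2 then (1 - s * q ^ i\<^sub>1 * u) / (1 - s * u)
     else if j\<^sub>1 = 0 \<and> j\<^sub>2 = 1 \<and> i\<^sub>1 = i\<^sub>2 + 1 then (1 - q ^ (i\<^sub>2 + 1)) * u / (1 - s * u)
     else if j\<^sub>1 = 1 \<and> j\<^sub>2 = 1 \<and> i\<^sub>1 = i\<^sub>2 then (u - s * q ^ i\<^sub>1) / (1 - s * u)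
     else if j\<^sub>1 = 1 \<and> j\<^sub>2 = 0 \<and> i\<^sub>2 = i\<^sub>1 + 1 then (1 - s\<^sup>2 * q ^ i\<^sub>1) / (1 - s * u)
     else 0)"

text \<open>The collections over which \<open>G\<^sup>c\<close> sums. Matching the \<open>i\<close>-th start with the \<open>i\<close>-th end is no
  restriction on the arrow configuration, since paths that cross may be exchanged at a common
  vertex.\<close>

definition skew_collections :: "nat \<Rightarrow> int list \<Rightarrow> int list \<Rightarrow> arrows set" where
  "skew_collections M l n =
     {\<omega>. \<exists>\<pi>. \<omega> = arrows_of {..<length l} \<pi> \<and>
            (\<forall>i<length l. up_right_path (strip M) (n ! i, 0) (l ! i, M + 1) (\<pi> i)) \<and>
            (\<forall>x y. \<omega> ((x, y), (x + 1, y)) \<le> 1)}"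

definition G_c :: "real \<Rightarrow> real \<Rightarrow> nat \<Rightarrow> (nat \<Rightarrow> real) \<Rightarrow> int list \<Rightarrow> int list \<Rightarrow> real" where
  "G_c q s M v l n =
     (\<Sum>\<omega>\<in>skew_collections M l n. \<Prod>i. \<Prod>j=1..M. weight_c q s (v j) (vertex \<omega> (int i) j))"

text \<open>Only finitely many terms of the sum defining \<open>f\<close> are nonzero, as \<open>\<nu>\<^sub>i \<le> \<lambda>\<^sub>i\<close> is
  necessary for \<open>G\<^sup>c \<noteq> 0\<close>.\<close>

definition boundary_f :: "real \<Rightarrow> real \<Rightarrow> nat \<Rightarrow> (nat \<Rightarrow> real) \<Rightarrow> int list \<Rightarrow> real" where
  "boundary_f q s M v l =
     (-1) ^ length l *
     (\<Sum>\<^sub>\<infinity>n\<in>{n. length n = length l \<and> sorted_wrt (>) n \<and> (\<forall>x\<in>set n. x \<ge> 1)}.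
        (\<Prod>j<length l. (- s) powi (n ! j)) * G_c q s M v l n)"

definition total_weight ::
  "real \<Rightarrow> real \<Rightarrow> nat \<Rightarrow> nat \<Rightarrow> (nat \<Rightarrow> real) \<Rightarrow> (nat \<Rightarrow> real) \<Rightarrow> arrows \<Rightarrow> real" where
  "total_weight q s N M u v \<omega> =
     (\<Prod>i. \<Prod>j=1..N. weight q s (u j) (vertex \<omega> (int i) j)) *
     boundary_f q s M v (signature_at N \<omega>)"

definition path_prob ::
  "real \<Rightarrow> real \<Rightarrow> nat \<Rightarrow> nat \<Rightarrow> (nat \<Rightarrow> real) \<Rightarrow> (nat \<Rightarrow> real) \<Rightarrow> (arrows \<Rightarrow> bool) \<Rightarrow> real" where
  "path_prob q s N M u v E =
     (\<Sum>\<^sub>\<infinity>\<omega>\<in>{\<omega>\<in>path_collections N. E \<omega>}.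
        total_weight q s N M u v \<omega> /
        (\<Sum>\<^sub>\<infinity>\<omega>'\<in>path_collections N. total_weight q s N M u v \<omega>'))"

text \<open>\<open>Y N j i \<omega>\<close> is the variable with column (upper index) \<open>j\<close> and rank (lower index)
  \<open>i \<ge> 1\<close>.\<close>

definition Y :: "nat \<Rightarrow> nat \<Rightarrow> nat \<Rightarrow> arrows \<Rightarrow> enat" where
  "Y N j i \<omega> =
     (let S = {y\<in>{1..N}. \<omega> ((int j, y), (int j + 1, y)) = 0}
      in if card S < i then \<infinity> else enat (sorted_list_of_set S ! (i - 1)))"

section \<open>Contours and the integrand\<close>

definition positively_oriented_contour :: "(real \<Rightarrow> complex) \<Rightarrow> bool" where
  "positively_oriented_contour \<gamma> \<longleftrightarrow>
     valid_path \<gamma> \<and> simple_path \<gamma> \<and> pathfinish \<gamma> = pathstart \<gamma> \<and>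
     (\<forall>z\<in>inside (path_image \<gamma>). winding_number \<gamma> z = 1)"

text \<open>The integral of \<open>F\<close> over all variables \<open>z 1, \<dots>, z k\<close> running through \<open>\<gamma>\<close>;
  \<open>z 1\<close> is the innermost one.\<close>

primrec iterated_contour_integral ::
  "nat \<Rightarrow> (real \<Rightarrow> complex) \<Rightarrow> ((nat \<Rightarrow> complex) \<Rightarrow> complex) \<Rightarrow> complex" where
  "iterated_contour_integral 0 \<gamma> F = F (\<lambda>_. 0)"
| "iterated_contour_integral (Suc k) \<gamma> F =
     contour_integral \<gamma> (\<lambda>w. iterated_contour_integral k \<gamma> (\<lambda>z. F (z(Suc k := w))))"

definition one_variable_factor ::
  "real \<Rightarrow> real \<Rightarrow> nat \<Rightarrow> (nat \<Rightarrow> real) \<Rightarrow> (nat \<Rightarrow> real) \<Rightarrow> nat \<Rightarrow> (nat \<Rightarrow> nat) \<Rightarrow> nat \<Rightarrow> complex \<Rightarrow> complex"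
where
  "one_variable_factor q s M u v k m r z =
     (\<Prod>i=1..m r. (q * z - u i) / (z - u i)) *
     ((z - s * q) / (z - s)) ^ (k - r + 1) *
     (\<Prod>j=1..M. (1 - z * v j) / (1 - q * z * v j)) *
     (1 / (z * (1 - s * z)))"

definition integrand ::
  "real \<Rightarrow> real \<Rightarrow> nat \<Rightarrow> (nat \<Rightarrow> real) \<Rightarrow> (nat \<Rightarrow> real) \<Rightarrow> nat \<Rightarrow> (nat \<Rightarrow> nat) \<Rightarrow> (nat \<Rightarrow> complex) \<Rightarrow> complex"
where
  "integrand q s M u v k m z =
     (\<Prod>(i, j)\<in>{(i, j). 1 \<le> i \<and> i < j \<and> j \<le> k}. (z i - z j) / (z i - q * z j)) *
     (\<Prod>r=1..k. one_variable_factor q s M u v k m r (z r))"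

text \<open>The contour contains all \<open>u i\<close> and excludes all other singularities of the integrand in
  every variable: the poles of the one-variable factors, and, for all \<open>i < j\<close>, the points
  \<open>z i = q * z j\<close> with \<open>z j\<close> on the contour and \<open>z j = z i / q\<close> with \<open>z i\<close> on the contour.
  Using poles instead of zeros of denominators disregards the zeros that cancel, in particular
  \<open>1 / s\<close>, which equals \<open>s * q\<close> if \<open>s = q powr (- 1 / 2)\<close>.\<close>

definition admissible_contour ::
  "real \<Rightarrow> real \<Rightarrow> nat \<Rightarrow> nat \<Rightarrow> (nat \<Rightarrow> real) \<Rightarrow> (nat \<Rightarrow> real) \<Rightarrow> nat \<Rightarrow> (nat \<Rightarrow> nat) \<Rightarrow>
    (real \<Rightarrow> complex) \<Rightarrow> bool" where
  "admissible_contour q s N M u v k m \<gamma> \<longleftrightarrow>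
     positively_oriented_contour \<gamma> \<and>
     (\<forall>i\<in>{1..N}. complex_of_real (u i) \<in> inside (path_image \<gamma>)) \<and>
     (\<forall>r\<in>{1..k}. \<forall>p. is_pole (one_variable_factor q s M u v k m r) p \<longrightarrow>
        p \<in> (\<lambda>i. complex_of_real (u i)) ` {1..N} \<or> p \<in> outside (path_image \<gamma>)) \<and>
     (\<forall>i j. 1 \<le> i \<and> i < j \<and> j \<le> k \<longrightarrow>
        (\<forall>z\<in>path_image \<gamma>. q * z \<in> outside (path_image \<gamma>) \<and> z / q \<in> outside (path_image \<gamma>)))"

end

(* After a gauge transformation of the vertical arrows both families of weights become stochastic
   six vertex weights with the parameter p(u) = (u - s) / (u - s q); the rows of G^c have the
   parameter p(1/v) and are to be read upside down, with the horizontal arrows complemented. On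
   functions of the arrow configuration between two rows the two kinds of rows act by operators
   B(u) and D(w), which satisfy exchange relations coming from the Yang-Baxter equation. The event
   says that the columns 1, ..., i are occupied at level m_i. Stripping off the columns one by one
   expands the product of the B(u), u in U, by partial fractions into a sum over l in U, and moving
   the D(w) below the B(u) in a strip of growing width leaves only the factors of the exchange
   relations. For pairwise distinct parameters this gives a nested sum over l_1, l_2, ..., in which
   l_1 is removed from the later sets of parameters.

   The same recursion evaluates the integral, starting from the innermost variable: at the residue
   z_1 = u_l the factor (z_1 - z_j) / (z_1 - q z_j) cancels the pole of the integrand at z_j = u_l.
   Coinciding parameters are perturbed: the probability is squeezed between those for the perturbed
   parameters by monotonicity, and the integral is continuous in the parameters. *)

theory Submission
  imports Defs
begin

text \<open>The choice s^2 q = 1 makes the vertex (1,1;2,0) of w^c vanish, so no vertical edge of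
  G^c is ever doubled and all rows act on Boolean states. The condition nu_N >= 1 forces column 0 to
  stay empty; removing it turns the columns 1, ..., k into the first k of a smaller strip, again
  with an empty state at the bottom. The infinitely many columns are replaced by L columns. On the
  empty state of width L, D(w) acts as w^L, and u_i v_j < 1 becomes p(u_i) < p(1/v_j). After
  division by the L-th powers only those terms survive that keep every D parameter, so the
  coefficients of all other terms of the exchange relations never have to be known. The terms of the
  nested sum have poles where parameters meet, whereas the integral stays continuous; hence limits
  at coinciding parameters are taken in the integral. The squeeze has to hold for all L at once:
  after scaling the D rows are monotone in their parameters, and changing a B parameter costs at
  most one factor per turn of an arrow, of which there are boundedly many, since the number of
  arrows is fixed.\<close>

section \<open>Rows of the stochastic six vertex model\<close>

text \<open>A state records which columns carry a vertical arrow. If the arrows \<open>xs\<close> enter a row from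
  below and \<open>a\<close> from the left, then \<open>row q p a xs h\<close> is the expectation of \<open>h ys r\<close> over the
  arrows \<open>ys\<close> leaving upwards and \<open>r\<close> leaving to the right.\<close>

fun row :: "real \<Rightarrow> real \<Rightarrow> bool \<Rightarrow> bool list \<Rightarrow> (bool list \<Rightarrow> bool \<Rightarrow> real) \<Rightarrow> real" where
  "row q p a [] h = h [] a"
| "row q p False (False # xs) h = row q p False xs (\<lambda>ys. h (False # ys))"
| "row q p True (False # xs) h =
     p * row q p True xs (\<lambda>ys. h (False # ys)) + (1 - p) * row q p False xs (\<lambda>ys. h (True # ys))"
| "row q p False (True # xs) h =
     q * p * row q p False xs (\<lambda>ys. h (True # ys)) +
     (1 - q * p) * row q p True xs (\<lambda>ys. h (False # ys))"
| "row q p True (True # xs) h = row q p True xs (\<lambda>ys. h (True # ys))"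

abbreviation occ :: "bool list \<Rightarrow> nat" where
  "occ xs \<equiv> count_list xs True"

lemma row_add: "row q p a xs (\<lambda>ys r. f ys r + g ys r) = row q p a xs f + row q p a xs g"
proof (induction xs arbitrary: a f g)
  case (Cons x xs)
  show ?case by (cases x; cases a) (simp_all add: Cons.IH algebra_simps)
qed simp

lemma row_scale: "row q p a xs (\<lambda>ys r. c * f ys r) = c * row q p a xs f"
proof (induction xs arbitrary: a f)
  case (Cons x xs)
  show ?case by (cases x; cases a) (simp_all add: Cons.IH algebra_simps)
qed simp

lemma row_zero: "row q p a xs (\<lambda>ys r. 0) = 0"
  using row_scale[of q p a xs 0 "\<lambda>ys r. 0"] by simp

lemma row_sum: "row q p a xs (\<lambda>ys r. \<Sum>i\<in>I. f i ys r) = (\<Sum>i\<in>I. row q p a xs (f i))"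
  by (induction I rule: infinite_finite_induct) (simp_all add: row_zero row_add)

text \<open>The comparison is required only for outputs that conserve the number of arrows. Later
  bounds, whose exponents involve \<open>occ\<close>, rely on this restriction.\<close>

lemma row_le:
  assumes "0 \<le> q" "q \<le> 1" "0 \<le> p" "p \<le> 1"
    and "\<And>ys r. length ys = length xs \<Longrightarrow> occ ys + of_bool r = occ xs + of_bool a \<Longrightarrow> f ys r \<le> g ys r"
  shows "row q p a xs f \<le> row q p a xs g"
proof -
  have qp: "q * p \<le> 1" "0 \<le> q * p" using assms by (auto intro: mult_le_one)
  show ?thesis using assms(5)
  proof (induction xs arbitrary: a f g)
    case Nil
    then show ?case by simp
  next
    case (Cons x xs)
    have F: "row q p b xs (\<lambda>ys. f (y # ys)) \<le> row q p b xs (\<lambda>ys. g (y # ys))"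
      if "of_bool y + of_bool b = of_bool x + (of_bool a :: nat)" for y b
    proof (rule Cons.IH)
      fix ys r assume "length ys = length xs" "occ ys + of_bool r = occ xs + of_bool b"
      with that Cons.prems[of "y # ys" r] show "f (y # ys) r \<le> g (y # ys) r"
        by (cases x; cases y; cases a; cases b) auto
    qed
    show ?case
      using F[of False False] F[of False True] F[of True False] F[of True True] assms qp
      by (cases x; cases a) (auto intro!: add_mono mult_left_mono)
  qed
qed

lemma row_cong:
  assumes "\<And>ys r. length ys = length xs \<Longrightarrow> occ ys + of_bool r = occ xs + of_bool a \<Longrightarrow> f ys r = g ys r"
  shows "row q p a xs f = row q p a xs g"
  using assms
proof (induction xs arbitrary: a f g)
  case Nil
  then show ?case by simp
next
  case (Cons x xs)
  have F: "row q p b xs (\<lambda>ys. f (y # ys)) = row q p b xs (\<lambda>ys. g (y # ys))"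
    if "of_bool y + of_bool b = of_bool x + (of_bool a :: nat)" for y b
  proof (rule Cons.IH)
    fix ys r assume "length ys = length xs" "occ ys + of_bool r = occ xs + of_bool b"
    with that Cons.prems[of "y # ys" r] show "f (y # ys) r = g (y # ys) r"
      by (cases x; cases y; cases a; cases b) auto
  qed
  show ?case
    using F[of False False] F[of False True] F[of True False] F[of True True]
    by (cases x; cases a) auto
qed

lemma row_one: "row q p a xs (\<lambda>ys r. 1) = 1"
proof (induction xs arbitrary: a)
  case (Cons x xs)
  then show ?case by (cases x; cases a) simp_all
qed simp

section \<open>The Yang-Baxter equation and the exchange relations\<close>

text \<open>The entries of the R-matrix, multiplied by their common denominator; \<open>a\<close> and \<open>b\<close> are the
  arrows of the rows with parameters \<open>u\<close> and \<open>w\<close>.\<close>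

definition den :: "real \<Rightarrow> real \<Rightarrow> real \<Rightarrow> real" where
  "den q u w = 1 - (1 + q) * u + q * u * w"

fun rmat :: "real \<Rightarrow> real \<Rightarrow> real \<Rightarrow> bool \<Rightarrow> bool \<Rightarrow> (bool \<Rightarrow> bool \<Rightarrow> real) \<Rightarrow> real" where
  "rmat q u w False False g = den q u w * g False False"
| "rmat q u w False True g = (w - u) * g False True + (den q u w - (w - u)) * g True False"
| "rmat q u w True False g = q * (w - u) * g True False + (den q u w - q * (w - u)) * g False True"
| "rmat q u w True True g = den q u w * g True True"

text \<open>Moving the crossing of the two horizontal lines past a single column is the local
  Yang-Baxter equation, a finite check of the six weights; the induction repeats it column by
  column.\<close>

theorem yang_baxter:
  "rmat q u w a b (\<lambda>c d. row q w d xs (\<lambda>ys r'. row q u c ys (\<lambda>zs r. H zs r r'))) =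
   row q u a xs (\<lambda>ys r. row q w b ys (\<lambda>zs r'. rmat q u w r r' (\<lambda>e f. H zs e f)))"
proof (induction xs arbitrary: a b H)
  case Nil
  then show ?case by simp
next
  case (Cons x xs)
  define X where "X z c d = row q w d xs (\<lambda>ys r'. row q u c ys (\<lambda>zs r. H (z # zs) r r'))" for z c d
  have IH: "row q u a xs (\<lambda>ys r. row q w b ys (\<lambda>zs r'. rmat q u w r r' (\<lambda>e f. H (z # zs) e f)))
     = rmat q u w a b (X z)" for z a b
    using Cons.IH[of a b "\<lambda>zs. H (z # zs)"] by (simp add: X_def[abs_def])
  show ?case
    by (cases x; cases a; cases b)
      (simp_all add: row_add row_scale IH X_def[symmetric], simp_all add: den_def algebra_simps)
qed

text \<open>In \<open>opB\<close> an arrow enters from the left and none leaves to the right, as in the rows of the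
  path ensemble; \<open>opD\<close> describes the rows of \<open>G\<^sup>c\<close> read upside down. The outermost operator is the
  lowest row.\<close>

definition opA :: "real \<Rightarrow> real \<Rightarrow> (bool list \<Rightarrow> real) \<Rightarrow> bool list \<Rightarrow> real" where
  "opA q p h xs = row q p False xs (\<lambda>ys r. if r then 0 else h ys)"

definition opB :: "real \<Rightarrow> real \<Rightarrow> (bool list \<Rightarrow> real) \<Rightarrow> bool list \<Rightarrow> real" where
  "opB q p h xs = row q p True xs (\<lambda>ys r. if r then 0 else h ys)"

definition opD :: "real \<Rightarrow> real \<Rightarrow> (bool list \<Rightarrow> real) \<Rightarrow> bool list \<Rightarrow> real" where
  "opD q p h xs = row q p True xs (\<lambda>ys r. if r then h ys else 0)"

lemma two_rows:
  "opB q w (opB q u h) xs = row q w True xs (\<lambda>ys r'. row q u True ys (\<lambda>zs r. if \<not> r \<and> \<not> r' then h zs else 0))"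
  "opD q w (opD q u h) xs = row q w True xs (\<lambda>ys r'. row q u True ys (\<lambda>zs r. if r \<and> r' then h zs else 0))"
  "opD q w (opB q u h) xs = row q w True xs (\<lambda>ys r'. row q u True ys (\<lambda>zs r. if \<not> r \<and> r' then h zs else 0))"
  "opB q w (opD q u h) xs = row q w True xs (\<lambda>ys r'. row q u True ys (\<lambda>zs r. if r \<and> \<not> r' then h zs else 0))"
  "opA q w (opB q u h) xs = row q w False xs (\<lambda>ys r'. row q u True ys (\<lambda>zs r. if \<not> r \<and> \<not> r' then h zs else 0))"
  "opB q w (opA q u h) xs = row q w True xs (\<lambda>ys r'. row q u False ys (\<lambda>zs r. if \<not> r \<and> \<not> r' then h zs else 0))"
  unfolding opA_def opB_def opD_def
  by (rule row_cong, simp add: row_zero split: if_split; rule impI row_cong; simp)+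

text \<open>Both left arrows are present and both right arrows absent, so on either side the
  R-matrix acts as the scalar \<open>den q u w\<close>, which is then cancelled.\<close>

lemma opB_commute:
  assumes "den q u w \<noteq> 0"
  shows "opB q w (opB q u h) = opB q u (opB q w h)"
proof
  fix xs
  have "row q u True xs (\<lambda>ys r. row q w True ys (\<lambda>zs r'. rmat q u w r r' (\<lambda>e f. if \<not> e \<and> \<not> f then h zs else 0)))
     = row q u True xs (\<lambda>ys r. row q w True ys (\<lambda>zs r'. den q u w * (if \<not> r' \<and> \<not> r then h zs else 0)))"
    by (intro row_cong; case_tac r; case_tac ra) auto
  then show "opB q w (opB q u h) xs = opB q u (opB q w h) xs"
    using yang_baxter[of q u w True True xs "\<lambda>zs r r'. if \<not> r \<and> \<not> r' then h zs else 0"] assms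
    by (simp add: two_rows row_scale)
qed

lemma opD_commute:
  assumes "den q u w \<noteq> 0"
  shows "opD q w (opD q u h) = opD q u (opD q w h)"
proof
  fix xs
  have "row q u True xs (\<lambda>ys r. row q w True ys (\<lambda>zs r'. rmat q u w r r' (\<lambda>e f. if e \<and> f then h zs else 0)))
     = row q u True xs (\<lambda>ys r. row q w True ys (\<lambda>zs r'. den q u w * (if r' \<and> r then h zs else 0)))"
    by (intro row_cong; case_tac r; case_tac ra) auto
  then show "opD q w (opD q u h) xs = opD q u (opD q w h) xs"
    using yang_baxter[of q u w True True xs "\<lambda>zs r r'. if r \<and> r' then h zs else 0"] assms
    by (simp add: two_rows row_scale)
qed

text \<open>In spectral variables, with \<open>u = par x\<close> and \<open>w = par y\<close>, this
  is the usual exchange factor (q x - y) / (x - y); see \<open>al_par\<close>.\<close>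

definition al :: "real \<Rightarrow> real \<Rightarrow> real \<Rightarrow> real" where
  "al q u w = den q u w / (w - u)"

lemma opB_opA:
  assumes "u \<noteq> w"
  shows "opB q w (opA q u h) xs = al q u w * opA q u (opB q w h) xs + (1 - al q u w) * opA q w (opB q u h) xs"
proof -
  have "row q u False xs (\<lambda>ys r. row q w True ys (\<lambda>zs r'. rmat q u w r r' (\<lambda>e f. if \<not> e \<and> \<not> f then h zs else 0)))
     = row q u False xs (\<lambda>ys r. row q w True ys (\<lambda>zs r'. den q u w * (if \<not> r' \<and> \<not> r then h zs else 0)))"
    by (intro row_cong; case_tac r; case_tac ra) auto
  then have "(w - u) * opB q w (opA q u h) xs + (den q u w - (w - u)) * opA q w (opB q u h) xs
      = den q u w * opA q u (opB q w h) xs"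
    using yang_baxter[of q u w False True xs "\<lambda>zs r r'. if \<not> r \<and> \<not> r' then h zs else 0"]
    by (simp add: two_rows row_scale)
  moreover have "den q u w = al q u w * (w - u)"
    using assms by (simp add: al_def)
  ultimately have "(w - u) * (opB q w (opA q u h) xs -
      (al q u w * opA q u (opB q w h) xs + (1 - al q u w) * opA q w (opB q u h) xs)) = 0"
    by (simp add: algebra_simps)
  with assms show ?thesis by simp
qed

lemma opB_opD:
  assumes "u \<noteq> w"
  shows "opB q u (opD q w h) xs = al q u w * opD q w (opB q u h) xs + (q - al q u w) * opD q u (opB q w h) xs"
proof -
  have "row q u True xs (\<lambda>ys r. row q w True ys (\<lambda>zs r'. rmat q u w r r' (\<lambda>e f. if \<not> e \<and> f then h zs else 0)))
     = row q u True xs (\<lambda>ys r. row q w True ys (\<lambda>zs r'. (w - u) * (if r' \<and> \<not> r then h zs else 0) +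
         (den q u w - q * (w - u)) * (if \<not> r' \<and> r then h zs else 0)))"
    by (intro row_cong; case_tac r; case_tac ra) auto
  then have "den q u w * opD q w (opB q u h) xs
      = (w - u) * opB q u (opD q w h) xs + (den q u w - q * (w - u)) * opD q u (opB q w h) xs"
    using yang_baxter[of q u w True True xs "\<lambda>zs r r'. if \<not> r \<and> r' then h zs else 0"]
    by (simp add: two_rows row_scale row_add)
  moreover have "den q u w = al q u w * (w - u)"
    using assms by (simp add: al_def)
  ultimately have "(w - u) * (opB q u (opD q w h) xs -
      (al q u w * opD q w (opB q u h) xs + (q - al q u w) * opD q u (opB q w h) xs)) = 0"
    by (simp add: algebra_simps)
  with assms show ?thesis by simp
qed

text \<open>Commutation is symmetric in the two parameters, so it is enough that one of the two
  scalars can be cancelled.\<close>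

lemma den_nonzero:
  assumes "0 < q" "q < 1" "0 < u" "u < 1" "0 < w" "w < 1"
  shows "den q u w \<noteq> 0 \<or> den q w u \<noteq> 0"
proof (rule ccontr)
  assume "\<not> ?thesis"
  then have 0: "den q u w = 0" "den q w u = 0" by auto
  have "(1 + q) * (w - u) = den q u w - den q w u" by (simp add: den_def algebra_simps)
  with 0 assms have "w = u" by simp
  then have "(1 - u) * (1 - q * u) = 0" using 0 by (simp add: den_def algebra_simps)
  moreover have "q * u < 1" using assms by (metis mult_less_cancel_left1 mult_strict_mono' less_eq_real_def mult_1 mult_strict_right_mono order_less_trans)
  ultimately show False using assms by simp
qed

lemma opB_comm:
  assumes "0 < q" "q < 1" "0 < u" "u < 1" "0 < w" "w < 1"
  shows "opB q w \<circ> opB q u = opB q u \<circ> opB q w"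
  using den_nonzero[OF assms] opB_commute[of q u w] opB_commute[of q w u] by (auto simp: fun_eq_iff)

lemma opD_comm:
  assumes "0 < q" "q < 1" "0 < u" "u < 1" "0 < w" "w < 1"
  shows "opD q w \<circ> opD q u = opD q u \<circ> opD q w"
  using den_nonzero[OF assms] opD_commute[of q u w] opD_commute[of q w u] by (auto simp: fun_eq_iff)

lemma row_zeros: "row q p False (replicate L False) h = h (replicate L False) False"
  by (induction L arbitrary: h) simp_all

lemma opA_zeros: "opA q p h (replicate L False) = h (replicate L False)"
  by (simp add: opA_def row_zeros)

lemma opD_zeros: "opD q p h (replicate L False) = p ^ L * h (replicate L False)"
proof (induction L arbitrary: h)
  case 0
  then show ?case by (simp add: opD_def)
next
  case (Suc L)
  show ?case
    using Suc[of "\<lambda>ys. h (False # ys)"] by (simp add: opD_def row_zeros)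
qed

lemma opB_sum: "opB q p (\<lambda>xs. \<Sum>i\<in>I. c i * f i xs) xs = (\<Sum>i\<in>I. c i * opB q p (f i) xs)"
proof -
  have "opB q p (\<lambda>xs. \<Sum>i\<in>I. c i * f i xs) xs =
      row q p True xs (\<lambda>ys r. \<Sum>i\<in>I. c i * (if r then 0 else f i ys))"
    unfolding opB_def by (intro row_cong) simp
  also have "\<dots> = (\<Sum>i\<in>I. c i * opB q p (f i) xs)"
    by (simp add: row_sum row_scale opB_def)
  finally show ?thesis .
qed

lemma opB_add: "opB q p (\<lambda>xs. f xs + g xs) xs = opB q p f xs + opB q p g xs"
  unfolding opB_def row_add[symmetric] by (intro row_cong) auto

lemma opB_scale: "opB q p (\<lambda>xs. c * f xs) xs = c * opB q p f xs"
  unfolding opB_def row_scale[symmetric] by (intro row_cong) auto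

lemma opB_Cons:
  "opB q p h (False # xs) = p * opB q p (\<lambda>ys. h (False # ys)) xs + (1 - p) * opA q p (\<lambda>ys. h (True # ys)) xs"
  "opB q p h (True # xs) = opB q p (\<lambda>ys. h (True # ys)) xs"
  by (simp_all add: opB_def opA_def)

lemma opD_Cons_True: "opD q p h (True # xs) = opD q p (\<lambda>ys. h (True # ys)) xs"
  by (simp add: opD_def)

lemma opB_plus_opD: "opB q p (\<lambda>_. 1) xs + opD q p (\<lambda>_. 1) xs = 1"
proof -
  have "opB q p (\<lambda>_. 1) xs + opD q p (\<lambda>_. 1) xs = row q p True xs (\<lambda>ys r. 1)"
    unfolding opB_def opD_def row_add[symmetric] by (intro row_cong) auto
  then show ?thesis by (simp add: row_one)
qed

section \<open>Products of commuting operators and the removal of one column\<close>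

definition fold_set :: "(real \<Rightarrow> 'a \<Rightarrow> 'a) \<Rightarrow> real set \<Rightarrow> 'a \<Rightarrow> 'a" where
  "fold_set f S h = foldr f (sorted_list_of_set S) h"

lemma foldr_permute:
  assumes "\<And>x y. x \<in> set xs \<Longrightarrow> y \<in> set xs \<Longrightarrow> f x \<circ> f y = f y \<circ> f x" "mset xs = mset ys"
  shows "foldr f xs h = foldr f ys h"
  unfolding foldr_conv_fold
  by (rule arg_cong[where f = "\<lambda>g. g h"], rule fold_multiset_equiv) (use assms in auto)

lemma foldr_eq_fold_set:
  assumes "\<And>x y. x \<in> set xs \<Longrightarrow> y \<in> set xs \<Longrightarrow> f x \<circ> f y = f y \<circ> f x" "distinct xs"
  shows "foldr f xs h = fold_set f (set xs) h"
  unfolding fold_set_def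
  by (rule foldr_permute) (use assms in \<open>auto simp: set_eq_iff_mset_eq_distinct[symmetric]\<close>)

lemma fold_set_empty [simp]: "fold_set f {} h = h"
  by (simp add: fold_set_def)

lemma fold_set_insert:
  assumes "\<And>x y. x \<in> insert u S \<Longrightarrow> y \<in> insert u S \<Longrightarrow> f x \<circ> f y = f y \<circ> f x" "finite S" "u \<notin> S"
  shows "fold_set f (insert u S) h = f u (fold_set f S h)"
  using foldr_eq_fold_set[of "u # sorted_list_of_set S" f h] assms by (simp add: fold_set_def)

lemma fold_set_remove:
  assumes "\<And>x y. x \<in> S \<Longrightarrow> y \<in> S \<Longrightarrow> f x \<circ> f y = f y \<circ> f x" "finite S" "u \<in> S"
  shows "f u (fold_set f (S - {u}) h) = fold_set f S h"
  using fold_set_insert[of u "S - {u}" f h] assms by (simp add: insert_absorb)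

lemma foldr_opB_True: "foldr (opB q) us H (True # xs) = foldr (opB q) us (\<lambda>ys. H (True # ys)) xs"
proof (induction us arbitrary: xs)
  case (Cons u us)
  then show ?case by (simp add: opB_Cons)
qed simp

lemma foldr_opD_True: "foldr (opD q) us H (True # xs) = foldr (opD q) us (\<lambda>ys. H (True # ys)) xs"
proof (induction us arbitrary: xs)
  case (Cons u us)
  then show ?case by (simp add: opD_Cons_True)
qed simp

text \<open>Row \<open>l\<close> turns up in the removed column, with weight \<open>1 - l\<close>.
  If it is the innermost row, every other row \<open>i\<close> crosses this column with weight
  \<open>i\<close>, and moving \<open>opA q l\<close> outwards past \<open>opB q i\<close> gives
  \<open>al q l i\<close>.\<close>

definition coef :: "real \<Rightarrow> real \<Rightarrow> real set \<Rightarrow> real" where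
  "coef q l V = (1 - l) * (\<Prod>i\<in>V - {l}. i * al q l i)"

lemma coef_insert:
  assumes "finite V" "u \<notin> V" "l \<in> V"
  shows "coef q l (insert u V) = coef q l V * (u * al q l u)"
proof -
  have "insert u V - {l} = insert u (V - {l})" using assms by auto
  with assms show ?thesis by (simp add: coef_def)
qed

lemma al_identities:
  assumes "u \<noteq> w" "l \<noteq> u" "l \<noteq> w"
  shows "w * al q u w * (1 - u) = (1 - u) + u * (1 - w) * (1 - al q w u)"
    and "al q u w * (1 - al q l u) = (1 - al q l w) * (1 - al q w u) + al q l w * (1 - al q l u)"
proof -
  have d: "w - u \<noteq> 0" "u - w \<noteq> 0" "u - l \<noteq> 0" "w - l \<noteq> 0" using assms by auto
  have 1: "al q w u = - den q w u / (w - u)" using d by (simp add: al_def field_simps)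
  have 2: "den q u w = 1 - (1 + q) * u + q * u * w" "den q w u = 1 - (1 + q) * w + q * u * w"
    by (simp_all add: den_def)
  have "w * den q u w * (1 - u) = (1 - u) * (w - u) + u * (1 - w) * (w - u + den q w u)"
    unfolding 2 by (simp add: algebra_simps)
  then show "w * al q u w * (1 - u) = (1 - u) + u * (1 - w) * (1 - al q w u)"
    unfolding 1 al_def[of q u w] using d by (simp add: field_simps)
  have "den q u w * (u - l - den q l u) * (w - l) =
     (w - l - den q l w) * (w - u + den q w u) * (u - l) + den q l w * (u - l - den q l u) * (w - u)"
    unfolding den_def by (simp add: algebra_simps)
  then show "al q u w * (1 - al q l u) = (1 - al q l w) * (1 - al q w u) + al q l w * (1 - al q l u)"
    unfolding 1 al_def[of q u w] al_def[of q l u] al_def[of q l w] using d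
    by (simp add: divide_simps) (simp add: algebra_simps)?
qed

text \<open>This is the consistency of \<open>coef\<close> when a row \<open>u\<close> is added
  outermost: its coefficient collects its own turn, \<open>1 - u\<close>, and the second terms of
  \<open>opB_opA\<close> for all earlier \<open>l\<close>. As functions of \<open>u\<close> the two
  sides are a product and its partial fractions, with poles at the points of
  \<open>V\<close>.\<close>

lemma partial_fractions:
  assumes "finite V" "u \<notin> V"
  shows "(1 - u) * (\<Prod>i\<in>V. i * al q u i) = (1 - u) + u * (\<Sum>l\<in>V. coef q l V * (1 - al q l u))"
  using assms
proof (induction V arbitrary: u rule: finite_induct)
  case empty
  then show ?case by simp
next
  case (insert w V)
  have uw: "u \<noteq> w" "u \<notin> V" using insert by auto
  have cw: "coef q w (insert w V) = (1 - w) + w * (\<Sum>l\<in>V. coef q l V * (1 - al q l w))"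
    using insert.IH[of w] insert.hyps by (simp add: coef_def)
  have "(1 - u) * (\<Prod>i\<in>insert w V. i * al q u i) = w * al q u w * ((1 - u) * (\<Prod>i\<in>V. i * al q u i))"
    using insert.hyps by simp
  also have "\<dots> = w * al q u w * (1 - u) + u * w * (\<Sum>l\<in>V. coef q l V * (al q u w * (1 - al q l u)))"
    unfolding insert.IH[OF uw(2)] by (simp add: algebra_simps sum_distrib_left)
  also have "(\<Sum>l\<in>V. coef q l V * (al q u w * (1 - al q l u))) =
      (\<Sum>l\<in>V. coef q l V * ((1 - al q l w) * (1 - al q w u) + al q l w * (1 - al q l u)))"
    using uw insert.hyps by (intro sum.cong refl arg_cong2[where f = "(*)"] al_identities(2)) auto
  also have "\<dots> = (1 - al q w u) * (\<Sum>l\<in>V. coef q l V * (1 - al q l w)) +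
      (\<Sum>l\<in>V. coef q l V * (al q l w * (1 - al q l u)))"
    by (simp add: sum.distrib[symmetric] sum_distrib_left algebra_simps)
  \<comment> \<open>The two instances only supply a third number different from \<open>u\<close> and
    \<open>w\<close>; at least one of them does.\<close>
  also have "w * al q u w * (1 - u) = (1 - u) + u * (1 - w) * (1 - al q w u)"
    using al_identities(1)[of u w "u + w + 1"] al_identities(1)[of u w "-1 - \<bar>u\<bar> - \<bar>w\<bar>"] uw by auto
  also have "(1 - u) + u * (1 - w) * (1 - al q w u) +
     u * w * ((1 - al q w u) * (\<Sum>l\<in>V. coef q l V * (1 - al q l w)) +
        (\<Sum>l\<in>V. coef q l V * (al q l w * (1 - al q l u)))) =
     (1 - u) + u * (coef q w (insert w V) * (1 - al q w u) + (\<Sum>l\<in>V. coef q l V * (w * al q l w) * (1 - al q l u)))"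
    unfolding cw by (simp add: algebra_simps sum_distrib_left)
  also have "(\<Sum>l\<in>V. coef q l V * (w * al q l w) * (1 - al q l u)) =
      (\<Sum>l\<in>V. coef q l (insert w V) * (1 - al q l u))"
    using insert.hyps by (intro sum.cong) (simp_all add: coef_insert)
  finally show ?case using insert.hyps by simp
qed

text \<open>The hypothesis on \<open>H\<close> says that the column is occupied in the end, so
  exactly one row turns up in it. A new outermost row \<open>u\<close> either turns itself, which
  produces \<open>opA q u\<close>, or puts \<open>opB q u\<close> in front of an older
  \<open>opA q l\<close>, which \<open>opB_opA\<close> resolves.\<close>

theorem strip_column:
  assumes "0 < q" "q < 1" "finite V" "V \<subseteq> {0<..<1}" "\<And>ys. H (False # ys) = 0"
  shows "fold_set (opB q) V H (False # xs) =
    (\<Sum>l\<in>V. coef q l V * opA q l (fold_set (opB q) (V - {l}) (\<lambda>ys. H (True # ys))) xs)"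
  using assms(3,4)
proof (induction V arbitrary: xs rule: finite_induct)
  case empty
  then show ?case using assms by simp
next
  case (insert u V)
  define G where "G = (\<lambda>ys. H (True # ys))"
  have comm: "opB q x \<circ> opB q y = opB q y \<circ> opB q x" if "x \<in> insert u V" "y \<in> insert u V" for x y
    using that insert.prems assms by (intro opB_comm) auto
  have ins: "fold_set (opB q) (insert u V) K = opB q u (fold_set (opB q) V K)" for K
    using comm insert.hyps by (intro fold_set_insert) auto
  have "opB q u (\<lambda>ys. fold_set (opB q) V H (False # ys)) xs =
      opB q u (\<lambda>ys. \<Sum>l\<in>V. coef q l V * opA q l (fold_set (opB q) (V - {l}) G) ys) xs"
    using insert by (simp add: G_def)
  also have "\<dots> = (\<Sum>l\<in>V. coef q l V * opB q u (opA q l (fold_set (opB q) (V - {l}) G)) xs)"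
    by (rule opB_sum)
  also have "\<dots> = (\<Sum>l\<in>V. coef q l V * (al q l u * opA q l (fold_set (opB q) (insert u V - {l}) G) xs
      + (1 - al q l u) * opA q u (fold_set (opB q) V G) xs))"
  proof (intro sum.cong refl arg_cong2[where f = "(*)"])
    fix l assume l: "l \<in> V"
    have 1: "insert u V - {l} = insert u (V - {l})" using l insert by auto
    have "fold_set (opB q) (insert u V - {l}) G = opB q u (fold_set (opB q) (V - {l}) G)"
      unfolding 1 using comm insert.hyps by (intro fold_set_insert) auto
    moreover have "opB q l (fold_set (opB q) (V - {l}) G) = fold_set (opB q) V G"
      using comm insert.hyps l by (intro fold_set_remove) auto
    moreover have "l \<noteq> u" using l insert by auto
    ultimately show "opB q u (opA q l (fold_set (opB q) (V - {l}) G)) xs =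
        al q l u * opA q l (fold_set (opB q) (insert u V - {l}) G) xs
      + (1 - al q l u) * opA q u (fold_set (opB q) V G) xs"
      by (simp add: opB_opA)
  qed
  finally have B0: "opB q u (\<lambda>ys. fold_set (opB q) V H (False # ys)) xs = \<dots>" .
  have B: "u * opB q u (\<lambda>ys. fold_set (opB q) V H (False # ys)) xs =
     (\<Sum>l\<in>V. coef q l (insert u V) * opA q l (fold_set (opB q) (insert u V - {l}) G) xs) +
     u * (\<Sum>l\<in>V. coef q l V * (1 - al q l u)) * opA q u (fold_set (opB q) V G) xs"
    unfolding B0 using insert.hyps by (simp add: coef_insert sum.distrib sum_subtractf sum_distrib_left sum_distrib_right algebra_simps)
  have T: "(\<lambda>ys. fold_set (opB q) V H (True # ys)) = fold_set (opB q) V G"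
    by (auto simp: fold_set_def foldr_opB_True G_def)
  have cu: "coef q u (insert u V) = (1 - u) + u * (\<Sum>l\<in>V. coef q l V * (1 - al q l u))"
    using partial_fractions[of V u q] insert.hyps by (simp add: coef_def)
  have "fold_set (opB q) (insert u V) H (False # xs) =
     (\<Sum>l\<in>V. coef q l (insert u V) * opA q l (fold_set (opB q) (insert u V - {l}) G) xs) +
     coef q u (insert u V) * opA q u (fold_set (opB q) V G) xs"
    unfolding ins opB_Cons B T cu by (simp add: algebra_simps)
  with insert.hyps show ?case by (simp add: G_def)
qed

lemma row_nonneg:
  assumes "0 \<le> q" "q \<le> 1" "0 \<le> p" "p \<le> 1" "\<And>ys r. f ys r \<ge> 0"
  shows "0 \<le> row q p a xs f"
  using row_le[of q p xs a "\<lambda>_ _. 0" f] assms by (simp add: row_zero)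

lemma opB_mono:
  assumes "0 \<le> q" "q \<le> 1" "0 \<le> p" "p \<le> 1" "\<And>ys. f ys \<le> g ys"
  shows "opB q p f xs \<le> opB q p g xs"
  unfolding opB_def by (intro row_le) (use assms in auto)

lemma opD_mono:
  assumes "0 \<le> q" "q \<le> 1" "0 \<le> p" "p \<le> 1" "\<And>ys. f ys \<le> g ys"
  shows "opD q p f xs \<le> opD q p g xs"
  unfolding opD_def by (intro row_le) (use assms in auto)

lemma opB_zero: "opB q p (\<lambda>_. 0) xs = 0" and opD_zero: "opD q p (\<lambda>_. 0) xs = 0"
  by (simp_all add: opB_def opD_def row_zero)

lemma opB_one:
  assumes "0 \<le> q" "q \<le> 1" "0 \<le> p" "p \<le> 1"
  shows "opB q p (\<lambda>_. 1) xs \<le> 1"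
  using opB_plus_opD[of q p xs] opD_mono[of q p "\<lambda>_. 0" "\<lambda>_. 1" xs] assms by (simp add: opD_zero)

lemma foldr_opB_bounds:
  assumes "0 \<le> q" "q \<le> 1" "set us \<subseteq> {0<..<1}"
  shows "0 \<le> foldr (opB q) us (\<lambda>_. 1) xs \<and> foldr (opB q) us (\<lambda>_. 1) xs \<le> 1"
  using assms(3)
proof (induction us arbitrary: xs)
  case (Cons u us)
  have u: "0 \<le> u" "u \<le> 1" using Cons.prems by auto
  have "opB q u (\<lambda>_. 0) xs \<le> opB q u (foldr (opB q) us (\<lambda>_. 1)) xs"
    "opB q u (foldr (opB q) us (\<lambda>_. 1)) xs \<le> opB q u (\<lambda>_. 1) xs"
    using Cons u assms by (auto intro!: opB_mono)
  then show ?case using opB_one[of q u xs] assms u by (simp add: opB_zero)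
qed simp

section \<open>Operators on a wide empty strip and the Cauchy identity\<close>

locale unit_parameter =
  fixes q :: real
  assumes q: "0 < q" "q < 1"
begin

definition Bs :: "real set \<Rightarrow> (bool list \<Rightarrow> real) \<Rightarrow> bool list \<Rightarrow> real" where
  "Bs = fold_set (opB q)"

definition Ds :: "real set \<Rightarrow> (bool list \<Rightarrow> real) \<Rightarrow> bool list \<Rightarrow> real" where
  "Ds = fold_set (opD q)"

definition zeros_val :: "real set \<Rightarrow> real set \<Rightarrow> nat \<Rightarrow> real" where
  "zeros_val S W L = Bs S (Ds W (\<lambda>_. 1)) (replicate L False)"

lemma Bs_empty [simp]: "Bs {} h = h" and Ds_empty [simp]: "Ds {} h = h"
  by (simp_all add: Bs_def Ds_def)

lemma Bs_insert: "finite S \<Longrightarrow> insert u S \<subseteq> {0<..<1} \<Longrightarrow> u \<notin> S \<Longrightarrow> Bs (insert u S) h = opB q u (Bs S h)"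
  unfolding Bs_def using q by (intro fold_set_insert opB_comm) auto

lemma Bs_remove: "finite S \<Longrightarrow> S \<subseteq> {0<..<1} \<Longrightarrow> u \<in> S \<Longrightarrow> opB q u (Bs (S - {u}) h) = Bs S h"
  unfolding Bs_def using q by (intro fold_set_remove opB_comm) auto

lemma Ds_insert: "finite S \<Longrightarrow> insert u S \<subseteq> {0<..<1} \<Longrightarrow> u \<notin> S \<Longrightarrow> Ds (insert u S) h = opD q u (Ds S h)"
  unfolding Ds_def using q by (intro fold_set_insert opD_comm) auto

lemma Bs_foldr: "set us \<subseteq> {0<..<1} \<Longrightarrow> distinct us \<Longrightarrow> foldr (opB q) us h = Bs (set us) h"
  unfolding Bs_def using q by (intro foldr_eq_fold_set opB_comm) auto

lemma Ds_foldr: "set us \<subseteq> {0<..<1} \<Longrightarrow> distinct us \<Longrightarrow> foldr (opD q) us h = Ds (set us) h"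
  unfolding Ds_def using q by (intro foldr_eq_fold_set opD_comm) auto

lemma Bs_add:
  assumes "finite S" "S \<subseteq> {0<..<1}"
  shows "Bs S (\<lambda>xs. f xs + g xs) xs = Bs S f xs + Bs S g xs"
  using assms
proof (induction S arbitrary: xs rule: finite_induct)
  case (insert u S)
  then have "Bs S (\<lambda>xs. f xs + g xs) = (\<lambda>xs. Bs S f xs + Bs S g xs)" by auto
  with insert show ?case by (simp add: Bs_insert opB_add)
qed simp

lemma Bs_commute1:
  assumes "finite S" "insert u S \<subseteq> {0<..<1}" "u \<notin> S"
  shows "Bs (insert u S) h = Bs S (opB q u h)"
proof -
  have "Bs (insert u S) h = foldr (opB q) (sorted_list_of_set S @ [u]) h"
    using assms by (subst Bs_foldr) auto
  then show ?thesis by (simp add: Bs_def fold_set_def)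
qed

lemma Bs_bounds:
  assumes "finite S" "S \<subseteq> {0<..<1}"
  shows "0 \<le> Bs S (\<lambda>_. 1) xs" "Bs S (\<lambda>_. 1) xs \<le> 1"
  using foldr_opB_bounds[of q "sorted_list_of_set S" xs] q assms by (auto simp: Bs_def fold_set_def)

text \<open>In the unwanted terms the parameter \<open>w\<close> is exchanged with some
  \<open>p\<close> from \<open>S\<close>. Their coefficients may stay unspecified: on the empty
  state \<open>opD q p\<close> contributes \<open>p ^ L\<close>, which is negligible against
  \<open>w ^ L\<close> if \<open>p < w\<close>.\<close>

lemma move_down:
  assumes "finite S" "insert w S \<subseteq> {0<..<1}" "w \<notin> S"
  shows "\<exists>c. \<forall>h xs. Bs S (opD q w h) xs = (\<Prod>u\<in>S. al q u w) * opD q w (Bs S h) xs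
      + (\<Sum>p\<in>S. c p * opD q p (Bs (insert w S - {p}) h) xs)"
  using assms
proof (induction S rule: finite_induct)
  case empty
  then show ?case by simp
next
  case (insert u S)
  then obtain c where c: "\<And>h xs. Bs S (opD q w h) xs = (\<Prod>u\<in>S. al q u w) * opD q w (Bs S h) xs
      + (\<Sum>p\<in>S. c p * opD q p (Bs (insert w S - {p}) h) xs)"
    by auto
  have neq: "u \<noteq> w" "w \<notin> S" using insert by auto
  \<comment> \<open>Every exchange with the new row \<open>u\<close> also yields a term that starts
    with \<open>opD q u\<close> and leaves the set \<open>insert w S\<close>; all these terms add up
    to the coefficient of \<open>u\<close>.\<close>
  define c' where "c' p = (if p = u then (\<Prod>u\<in>S. al q u w) * (q - al q u w) + (\<Sum>p\<in>S. c p * (q - al q u p))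
      else c p * al q u p)" for p
  show ?case
  proof (intro exI allI)
    fix h xs
    have "Bs (insert u S) (opD q w h) xs = opB q u (\<lambda>xs. (\<Prod>u\<in>S. al q u w) * opD q w (Bs S h) xs
      + (\<Sum>p\<in>S. c p * opD q p (Bs (insert w S - {p}) h) xs)) xs"
      using insert by (simp add: Bs_insert c[symmetric])
    also have "\<dots> = (\<Prod>u\<in>S. al q u w) * opB q u (opD q w (Bs S h)) xs
        + (\<Sum>p\<in>S. c p * opB q u (opD q p (Bs (insert w S - {p}) h)) xs)"
      by (simp add: opB_add opB_scale opB_sum)
    also have "opB q u (opD q w (Bs S h)) xs = al q u w * opD q w (Bs (insert u S) h) xs
        + (q - al q u w) * opD q u (Bs (insert w (insert u S) - {u}) h) xs"
    proof -
      have "insert w (insert u S) - {u} = insert w S" using neq insert by auto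
      then show ?thesis using insert neq by (simp add: opB_opD Bs_insert)
    qed
    also have "(\<Sum>p\<in>S. c p * opB q u (opD q p (Bs (insert w S - {p}) h)) xs) =
        (\<Sum>p\<in>S. c p * (al q u p * opD q p (Bs (insert w (insert u S) - {p}) h) xs
         + (q - al q u p) * opD q u (Bs (insert w (insert u S) - {u}) h) xs))"
    proof (intro sum.cong refl arg_cong2[where f = "(*)"])
      fix p assume p: "p \<in> S"
      have 1: "insert w (insert u S) - {p} = insert u (insert w S - {p})"
        "insert w (insert u S) - {u} = insert w S" using p insert neq by auto
      have "Bs (insert u (insert w S - {p})) h = opB q u (Bs (insert w S - {p}) h)"
        using insert p neq by (intro Bs_insert) auto
      moreover have "opB q p (Bs (insert w S - {p}) h) = Bs (insert w S) h"
        using insert p neq by (intro Bs_remove) auto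
      moreover have "u \<noteq> p" using p insert by auto
      ultimately show "opB q u (opD q p (Bs (insert w S - {p}) h)) xs =
         al q u p * opD q p (Bs (insert w (insert u S) - {p}) h) xs
         + (q - al q u p) * opD q u (Bs (insert w (insert u S) - {u}) h) xs"
        unfolding 1 by (simp add: opB_opD)
    qed
    also have "(\<Prod>u\<in>S. al q u w) * (al q u w * opD q w (Bs (insert u S) h) xs
        + (q - al q u w) * opD q u (Bs (insert w (insert u S) - {u}) h) xs) +
        (\<Sum>p\<in>S. c p * (al q u p * opD q p (Bs (insert w (insert u S) - {p}) h) xs
         + (q - al q u p) * opD q u (Bs (insert w (insert u S) - {u}) h) xs)) =
        al q u w * (\<Prod>u\<in>S. al q u w) * opD q w (Bs (insert u S) h) xs +
        (c' u * opD q u (Bs (insert w (insert u S) - {u}) h) xs +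
         (\<Sum>p\<in>S. c p * al q u p * opD q p (Bs (insert w (insert u S) - {p}) h) xs))"
      by (simp add: c'_def sum.distrib algebra_simps sum_distrib_left sum_distrib_right sum_subtractf)
    also have "(\<Sum>p\<in>S. c p * al q u p * opD q p (Bs (insert w (insert u S) - {p}) h) xs) =
        (\<Sum>p\<in>S. c' p * opD q p (Bs (insert w (insert u S) - {p}) h) xs)"
      using insert by (intro sum.cong) (auto simp: c'_def)
    finally show "Bs (insert u S) (opD q w h) xs =
        (\<Prod>u\<in>insert u S. al q u w) * opD q w (Bs (insert u S) h) xs
      + (\<Sum>p\<in>insert u S. c' p * opD q p (Bs (insert w (insert u S) - {p}) h) xs)"
      using insert by simp
  qed
qed

lemma zeros_val_insert:
  assumes "finite S" "finite W" "S \<union> insert w W \<subseteq> {0<..<1}" "w \<notin> S" "w \<notin> W"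
  shows "\<exists>c. \<forall>L. zeros_val S (insert w W) L =
    (\<Prod>u\<in>S. al q u w) * (w ^ L * zeros_val S W L)
      + (\<Sum>p\<in>S. c p * (p ^ L * zeros_val (insert w S - {p}) W L))"
proof -
  from assms obtain c where "\<And>h xs. Bs S (opD q w h) xs = (\<Prod>u\<in>S. al q u w) * opD q w (Bs S h) xs
      + (\<Sum>p\<in>S. c p * opD q p (Bs (insert w S - {p}) h) xs)"
    using move_down[of S w] by auto
  then show ?thesis
    using assms by (intro exI[of _ c]) (simp add: zeros_val_def Ds_insert opD_zeros)
qed

text \<open>Once all D operators are moved out, each term carries the L-th power of a product of
  \<open>card W\<close> parameters from \<open>S \<union> W\<close>, and the remaining B operators
  are bounded by 1. In the induction, a parameter \<open>p\<close> that has been moved out leaves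
  the bound \<open>\<mu> / p\<close> for the others.\<close>

lemma zeros_val_bound:
  assumes "finite W" "finite S" "S \<inter> W = {}" "S \<union> W \<subseteq> {0<..<1}"
    and "\<And>P. P \<subseteq> S \<union> W \<Longrightarrow> card P = card W \<Longrightarrow> \<Prod>P \<le> \<mu>"
  shows "\<exists>C. \<forall>L. \<bar>zeros_val S W L\<bar> \<le> C * \<mu> ^ L"
  using assms
proof (induction W arbitrary: S \<mu> rule: finite_induct)
  case empty
  have "1 \<le> \<mu>" using empty(4)[of "{}"] by simp
  then have "\<bar>zeros_val S {} L\<bar> \<le> 1 * \<mu> ^ L" for L
    using Bs_bounds[of S "replicate L False"] empty(1-3) order.trans[OF _ one_le_power[of \<mu> L]]
    by (simp add: zeros_val_def)
  then show ?case by blast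
next
  case (insert w W)
  have "\<exists>C. \<forall>L. \<bar>zeros_val (insert w S - {p}) W L\<bar> \<le> C * (\<mu> / p) ^ L" if p: "p \<in> insert w S" for p
  proof (rule insert.IH)
    fix P assume P: "P \<subseteq> (insert w S - {p}) \<union> W" "card P = card W"
    have pP: "p \<notin> P" "p \<notin> W" "finite P"
      using P p insert by (auto intro: finite_subset[OF P(1)])
    then have "\<Prod>(insert p P) \<le> \<mu>"
      using P p insert.hyps by (intro insert.prems(4)) auto
    moreover have "p > 0" using p insert by auto
    ultimately show "\<Prod>P \<le> \<mu> / p" using pP by (simp add: field_simps)
  qed (use insert p in auto)
  then obtain C where C: "\<And>p L. p \<in> insert w S \<Longrightarrow> \<bar>zeros_val (insert w S - {p}) W L\<bar> \<le> C p * (\<mu> / p) ^ L"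
    by metis
  have C': "\<bar>p ^ L * zeros_val (insert w S - {p}) W L\<bar> \<le> C p * \<mu> ^ L" if p: "p \<in> insert w S" for p L
  proof -
    have "p > 0" using p insert by auto
    then have "\<bar>p ^ L * zeros_val (insert w S - {p}) W L\<bar> \<le> p ^ L * (C p * (\<mu> / p) ^ L)"
      using C[OF p, of L] by (simp add: abs_mult)
    also have "\<dots> = C p * \<mu> ^ L" using \<open>p > 0\<close> by (simp add: power_divide)
    finally show ?thesis .
  qed
  obtain c where c: "\<And>L. zeros_val S (insert w W) L =
    (\<Prod>u\<in>S. al q u w) * (w ^ L * zeros_val S W L)
      + (\<Sum>p\<in>S. c p * (p ^ L * zeros_val (insert w S - {p}) W L))"
    using zeros_val_insert[of S W w] insert by auto
  have wS: "insert w S - {w} = S" using insert by auto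
  have "\<bar>zeros_val S (insert w W) L\<bar> \<le> (\<bar>\<Prod>u\<in>S. al q u w\<bar> * C w + (\<Sum>p\<in>S. \<bar>c p\<bar> * C p)) * \<mu> ^ L" for L
  proof -
    have "\<bar>zeros_val S (insert w W) L\<bar> \<le> \<bar>\<Prod>u\<in>S. al q u w\<bar> * \<bar>w ^ L * zeros_val S W L\<bar>
      + (\<Sum>p\<in>S. \<bar>c p\<bar> * \<bar>p ^ L * zeros_val (insert w S - {p}) W L\<bar>)"
      unfolding c abs_mult[symmetric] by (intro order.trans[OF abs_triangle_ineq] add_mono order_refl sum_abs)
    also have "\<dots> \<le> \<bar>\<Prod>u\<in>S. al q u w\<bar> * (C w * \<mu> ^ L) + (\<Sum>p\<in>S. \<bar>c p\<bar> * (C p * \<mu> ^ L))"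
      using C'[of w L] C' unfolding wS by (intro add_mono mult_left_mono sum_mono) auto
    also have "\<dots> = (\<bar>\<Prod>u\<in>S. al q u w\<bar> * C w + (\<Sum>p\<in>S. \<bar>c p\<bar> * C p)) * \<mu> ^ L"
      by (simp add: algebra_simps sum_distrib_left sum_distrib_right)
    finally show ?thesis .
  qed
  then show ?case by blast
qed

text \<open>This makes \<open>W\<close> the dominant choice among the sets of parameters that the D
  operators can end up with.\<close>

lemma prod_subset_less:
  fixes S W P :: "real set"
  assumes "finite S" "finite W" "S \<union> W \<subseteq> {0<..<1}" "\<And>u w. u \<in> S \<Longrightarrow> w \<in> W \<Longrightarrow> u < w"
    and P: "P \<subseteq> S \<union> W" "card P = card W" "P \<inter> S \<noteq> {}"
  shows "\<Prod>P < \<Prod>W"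
proof -
  define R where "R = P \<inter> S"
  have disj: "S \<inter> W = {}" using assms(4) by fastforce
  have fin: "finite P" "finite R" using assms by (auto simp: R_def intro: finite_subset)
  have W: "W = (W - P) \<union> (P \<inter> W)" and P': "P = R \<union> (P \<inter> W)" using P by (auto simp: R_def)
  have cR: "card R = card (W - P)"
  proof -
    have "card P = card R + card (P \<inter> W)"
      by (subst P', rule card_Un_disjoint) (use fin assms disj in \<open>auto simp: R_def\<close>)
    moreover have "card W = card (W - P) + card (P \<inter> W)"
      by (subst W, rule card_Un_disjoint) (use fin assms in auto)
    ultimately show ?thesis using P by simp
  qed
  have ne: "R \<noteq> {}" using P by (simp add: R_def)
  then have "card (W - P) > 0" using cR fin by (simp add: card_gt_0_iff flip: cR)
  then have ne': "W - P \<noteq> {}" by (metis card.empty less_irrefl)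
  \<comment> \<open>The elements of \<open>R\<close> lie below \<open>t\<close> and those of
    \<open>W - P\<close> do not. Both sets have the same size, so both products can be compared with
    the same power of \<open>t\<close>.\<close>
  define t where "t = Min W"
  have Wne: "W \<noteq> {}" using ne' by auto
  have t: "t \<in> W" "\<And>w. w \<in> W \<Longrightarrow> t \<le> w" using Wne assms by (auto simp: t_def)
  have "\<Prod>R < (\<Prod>x\<in>R. t)"
  proof -
    obtain r where r: "r \<in> R" using ne by auto
    have *: "0 \<le> x" "x < t" "0 < t" if "x \<in> R" for x
      using that t(1) assms(3,4) by (auto simp: R_def subset_iff less_imp_le)
    show ?thesis
      by (rule prod_mono_strict[OF r]) (use * r fin in \<open>auto simp: less_imp_le\<close>)
  qed
  also have "\<dots> = (\<Prod>x\<in>W - P. t)" by (simp add: cR)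
  also have "\<dots> \<le> \<Prod>(W - P)"
  proof (rule prod_mono)
    have "t > 0" using t(1) assms(3) by auto
    then show "0 \<le> t \<and> t \<le> i" if "i \<in> W - P" for i using that t(2) by auto
  qed
  finally have "\<Prod>R < \<Prod>(W - P)" .
  moreover have "\<Prod>(P \<inter> W) > 0" using assms by (intro prod_pos) auto
  moreover have "\<Prod>P = \<Prod>R * \<Prod>(P \<inter> W)"
    by (subst P', rule prod.union_disjoint) (use fin assms disj in \<open>auto simp: R_def\<close>)
  moreover have "\<Prod>W = \<Prod>(W - P) * \<Prod>(P \<inter> W)"
    by (subst W, rule prod.union_disjoint) (use fin assms in auto)
  ultimately show ?thesis by simp
qed

text \<open>For an innermost row \<open>opB\<close> and \<open>opD\<close> add up to 1, so each
  further row changes the value by a term with a single D operator, which decays geometrically. In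
  other words, in a wide strip almost surely every arrow turns up before the right end.\<close>

lemma Bs_one_limit:
  assumes "finite S" "S \<subseteq> {0<..<1}"
  shows "(\<lambda>L. zeros_val S {} L) \<longlonglongrightarrow> 1"
  using assms
proof (induction S rule: finite_induct)
  case empty
  then show ?case by (simp add: zeros_val_def)
next
  case (insert u S)
  have "zeros_val (insert u S) {} L + zeros_val S {u} L = zeros_val S {} L" for L
  proof -
    have "Ds {u} (\<lambda>_. 1) = opD q u (\<lambda>_. 1)" using insert by (subst Ds_insert) auto
    then show ?thesis using insert
      by (simp add: zeros_val_def Bs_commute1 Bs_add[symmetric] opB_plus_opD)
  qed
  then have eq: "zeros_val (insert u S) {} L = zeros_val S {} L - zeros_val S {u} L" for L
    by (simp add: algebra_simps)
  define \<mu> where "\<mu> = Max (insert u S)"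
  have \<mu>: "\<mu> \<in> insert u S" unfolding \<mu>_def using insert by (intro Max_in) auto
  obtain C where C: "\<And>L. \<bar>zeros_val S {u} L\<bar> \<le> C * \<mu> ^ L"
  proof -
    have "\<exists>C. \<forall>L. \<bar>zeros_val S {u} L\<bar> \<le> C * \<mu> ^ L"
    proof (rule zeros_val_bound)
      fix P assume "P \<subseteq> S \<union> {u}" "card P = card {u}"
      then obtain x where "P = {x}" "x \<in> insert u S" by (auto simp: card_1_singleton_iff)
      then show "\<Prod>P \<le> \<mu>" using insert by (auto simp: \<mu>_def)
    qed (use insert in auto)
    then show ?thesis using that by blast
  qed
  have "(\<lambda>L. C * \<mu> ^ L) \<longlonglongrightarrow> 0"
    using \<mu> insert by (intro tendsto_mult_right_zero LIMSEQ_power_zero) auto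
  then have "(\<lambda>L. zeros_val S {u} L) \<longlonglongrightarrow> 0"
    by (rule Lim_null_comparison[rotated]) (use C in auto)
  then have "(\<lambda>L. zeros_val S {} L - zeros_val S {u} L) \<longlonglongrightarrow> 1 - 0"
    using insert by (intro tendsto_diff) auto
  then show ?case by (simp add: eq)
qed

text \<open>A Cauchy identity, in which the empty state serves as boundary. Moving
  \<open>opD q w\<close> below all B operators gives the factors \<open>al q u w\<close> and the
  power \<open>w ^ L\<close>; terms in which \<open>w\<close> was exchanged for a smaller parameter
  vanish in the limit.\<close>

theorem cauchy_limit:
  assumes "finite W" "finite S" "S \<union> W \<subseteq> {0<..<1}" "\<And>u w. u \<in> S \<Longrightarrow> w \<in> W \<Longrightarrow> u < w"
  shows "(\<lambda>L. zeros_val S W L / (\<Prod>W) ^ L) \<longlonglongrightarrow> (\<Prod>u\<in>S. \<Prod>w\<in>W. al q u w)"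
  using assms
proof (induction W rule: finite_induct)
  case empty
  then show ?case using Bs_one_limit by simp
next
  case (insert w W)
  have disj: "S \<inter> insert w W = {}" using insert.prems(3) by fastforce
  obtain c where c: "\<And>L. zeros_val S (insert w W) L =
    (\<Prod>u\<in>S. al q u w) * (w ^ L * zeros_val S W L)
      + (\<Sum>p\<in>S. c p * (p ^ L * zeros_val (insert w S - {p}) W L))"
    using zeros_val_insert[of S W w] insert disj by auto
  define Z where "Z = \<Prod>(insert w W)"
  have w0: "w > 0" and Z0: "Z > 0" using insert by (auto simp: Z_def intro!: mult_pos_pos prod_pos)
  have Zw: "Z = w * \<Prod>W" using insert by (simp add: Z_def)
  have err: "(\<lambda>L. p ^ L * zeros_val (insert w S - {p}) W L / Z ^ L) \<longlonglongrightarrow> 0" if p: "p \<in> S" for p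
  proof -
    \<comment> \<open>These are the sets of parameters with which the remaining D operators can
      leave. By \<open>prod_subset_less\<close> their products, multiplied by \<open>p\<close>, stay
      below \<open>Z\<close>; the inserted 0 keeps the maximum well defined and nonnegative.\<close>
    define F where "F = {P. P \<subseteq> (insert w S - {p}) \<union> W \<and> card P = card W}"
    define \<mu> where "\<mu> = Max (insert 0 ((\<lambda>P. \<Prod>P) ` F))"
    have fF: "finite F" using insert by (auto simp: F_def)
    have p0: "p > 0" using p insert by auto
    have less: "p * \<Prod>P < Z" if "P \<in> F" for P
    proof -
      have "finite P" "p \<notin> P" using that insert p disj by (auto simp: F_def intro: finite_subset)
      moreover have "\<Prod>(insert p P) < Z" unfolding Z_def
        by (rule prod_subset_less[of S])
          (use \<open>finite P\<close> \<open>p \<notin> P\<close> that insert p in \<open>auto simp: F_def\<close>)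
      ultimately show ?thesis by simp
    qed
    have "\<mu> \<in> insert 0 ((\<lambda>P. \<Prod>P) ` F)" unfolding \<mu>_def using fF by (intro Max_in) auto
    then have \<mu>: "p * \<mu> < Z" using less Z0 by auto
    have "\<exists>C. \<forall>L. \<bar>zeros_val (insert w S - {p}) W L\<bar> \<le> C * \<mu> ^ L"
    proof (rule zeros_val_bound)
      fix P assume "P \<subseteq> (insert w S - {p}) \<union> W" "card P = card W"
      then show "\<Prod>P \<le> \<mu>" unfolding \<mu>_def using fF by (intro Max_ge) (auto simp: F_def)
    qed (use insert disj in auto)
    then obtain C where C: "\<And>L. \<bar>zeros_val (insert w S - {p}) W L\<bar> \<le> C * \<mu> ^ L" by blast
    have \<mu>0: "\<mu> \<ge> 0" unfolding \<mu>_def using fF by (intro Max_ge) auto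
    have "(\<lambda>L. C * (p * \<mu> / Z) ^ L) \<longlonglongrightarrow> 0"
      using \<mu> \<mu>0 p0 Z0 by (intro tendsto_mult_right_zero LIMSEQ_power_zero) auto
    then show ?thesis
    proof (rule Lim_null_comparison[rotated], intro always_eventually allI)
      fix L
      have "norm (p ^ L * zeros_val (insert w S - {p}) W L / Z ^ L) \<le> p ^ L * (C * \<mu> ^ L) / Z ^ L"
        using C[of L] p0 Z0 by (auto simp: abs_mult intro!: divide_right_mono mult_left_mono)
      then show "norm (p ^ L * zeros_val (insert w S - {p}) W L / Z ^ L) \<le> C * (p * \<mu> / Z) ^ L"
        by (simp add: power_mult_distrib power_divide mult_ac)
    qed
  qed
  have "(\<lambda>L. (\<Prod>u\<in>S. al q u w) * (zeros_val S W L / (\<Prod>W) ^ L)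
      + (\<Sum>p\<in>S. c p * (p ^ L * zeros_val (insert w S - {p}) W L / Z ^ L)))
    \<longlonglongrightarrow> (\<Prod>u\<in>S. al q u w) * (\<Prod>u\<in>S. \<Prod>w\<in>W. al q u w) + (\<Sum>p\<in>S. c p * 0)"
    using insert err by (intro tendsto_intros) auto
  moreover have "(\<Prod>u\<in>S. al q u w) * (zeros_val S W L / (\<Prod>W) ^ L)
      + (\<Sum>p\<in>S. c p * (p ^ L * zeros_val (insert w S - {p}) W L / Z ^ L)) =
      zeros_val S (insert w W) L / Z ^ L" for L
    unfolding c using w0 by (simp add: Zw power_mult_distrib add_divide_distrib sum_divide_distrib)
  ultimately show ?case
    using insert by (simp add: prod.distrib Z_def)
qed

end

section \<open>Conditions on occupied columns and the nested sum\<close>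

text \<open>Rows are read in groups \<open>U\<^sub>1, U\<^sub>2, \<dots>\<close>; after the \<open>i\<close>-th group the state has to satisfy the
  condition with index \<open>j + i - 1\<close>.\<close>

fun guarded :: "real \<Rightarrow> (nat \<Rightarrow> bool list \<Rightarrow> bool) \<Rightarrow> nat \<Rightarrow> real list list \<Rightarrow>
    (bool list \<Rightarrow> real) \<Rightarrow> bool list \<Rightarrow> real" where
  "guarded q C j [] h = h"
| "guarded q C j (U # Us) h =
     foldr (opB q) U (\<lambda>xs. if C j xs then guarded q C (Suc j) Us h xs else 0)"

definition full :: "nat \<Rightarrow> bool list \<Rightarrow> bool" where
  "full j xs \<longleftrightarrow> (\<forall>x\<in>set (take j xs). x)"

lemma full_simps [simp]:
  "full 0 xs" "full (Suc j) (True # xs) = full j xs" "\<not> full (Suc j) (False # xs)"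
  by (auto simp: full_def)

lemma guarded_full_True:
  "guarded q full (Suc j) Us h (True # xs) = guarded q full j Us (\<lambda>ys. h (True # ys)) xs"
proof (induction Us arbitrary: j xs)
  case (Cons U Us)
  have "(\<lambda>ys. if full (Suc j) (True # ys) then guarded q full (Suc (Suc j)) Us h (True # ys) else 0) =
     (\<lambda>ys. if full j ys then guarded q full (Suc j) Us (\<lambda>ys. h (True # ys)) ys else 0)"
    using Cons by auto
  then show ?case by (simp add: foldr_opB_True)
qed simp

fun cumul :: "real set \<Rightarrow> real list list \<Rightarrow> real set list" where
  "cumul A [] = []"
| "cumul A (U # Us) = (A \<union> set U) # cumul (A \<union> set U) Us"

lemma length_cumul [simp]: "length (cumul A Us) = length Us"
  by (induction Us arbitrary: A) auto

lemma cumul_minus: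
  assumes "l \<notin> set (concat Us)"
  shows "cumul (A - {l}) Us = map (\<lambda>X. X - {l}) (cumul A Us)"
  using assms
proof (induction Us arbitrary: A)
  case (Cons U Us)
  have "A - {l} \<union> set U = A \<union> set U - {l}" using Cons.prems by auto
  then show ?case using Cons by simp
qed simp

text \<open>The quotient by \<open>z l\<close> takes row \<open>l\<close> out of the Cauchy product
  over all rows.\<close>

fun resum :: "real \<Rightarrow> (real \<Rightarrow> real) \<Rightarrow> nat \<Rightarrow> real set list \<Rightarrow> real" where
  "resum q z 0 Vs = 1"
| "resum q z (Suc n) Vs =
     (\<Sum>l\<in>hd Vs. coef q l (hd Vs) / z l * resum q z n (map (\<lambda>X. X - {l}) (tl Vs)))"

context unit_parameter
begin

text \<open>These are the rows after the last condition, followed by the rows of G^c.\<close>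

definition top :: "real list \<Rightarrow> real list \<Rightarrow> bool list \<Rightarrow> real" where
  "top R ws = foldr (opB q) R (foldr (opD q) ws (\<lambda>_. 1))"

lemma top_True: "top R ws (True # xs) = top R ws xs"
  by (simp add: top_def foldr_opB_True foldr_opD_True)

lemma top_append: "foldr (opB q) U (top R ws) = top (U @ R) ws"
  by (simp add: top_def)

text \<open>For \<open>u < w\<close> the numerator exceeds \<open>den q u u\<close>, which factors
  as (1 - u) (1 - q u).\<close>

lemma al_pos:
  assumes "0 < u" "u < w" "w < 1"
  shows "al q u w > 0"
proof -
  have "q * u * u < q * u * w" using assms q by simp
  moreover have "q * u < 1 * 1" using assms q by (intro mult_strict_mono) auto
  then have "(1 - u) * (1 - q * u) > 0" using assms by simp
  ultimately have "den q u w > 0" by (simp add: den_def algebra_simps)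
  then show ?thesis using assms by (simp add: al_def)
qed

text \<open>With the first column removed, every condition loses one column and the first one
  becomes void. So the rows of \<open>U\<close> other than \<open>l\<close> merge with the next
  group, or with \<open>R\<close> if there is no further group.\<close>

lemma guarded_step:
  assumes "distinct (concat (U # Us) @ R)" "set (concat (U # Us) @ R) \<subseteq> {0<..<1}"
  defines "rest \<equiv> (\<lambda>l. case Us of [] \<Rightarrow> [] | V # Vs \<Rightarrow> (remove1 l U @ V) # Vs)"
    and "R' \<equiv> (\<lambda>l. case Us of [] \<Rightarrow> remove1 l U @ R | V # Vs \<Rightarrow> R)"
  shows "guarded q full (Suc 0) (U # Us) (top R ws) (replicate (Suc L) False) =
    (\<Sum>l\<in>set U. coef q l (set U) * guarded q full (Suc 0) (rest l) (top (R' l) ws) (replicate L False))"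
proof -
  define H where "H xs = (if full (Suc 0) xs then guarded q full (Suc (Suc 0)) Us (top R ws) xs else 0)" for xs
  have U: "distinct U" "set U \<subseteq> {0<..<1}" using assms by auto
  have HT: "(\<lambda>ys. H (True # ys)) = guarded q full (Suc 0) Us (top R ws)"
    by (auto simp: H_def guarded_full_True top_True)
  have "guarded q full (Suc 0) (U # Us) (top R ws) (replicate (Suc L) False) =
      fold_set (opB q) (set U) H (False # replicate L False)"
    using Bs_foldr[of U H] U by (simp add: H_def[abs_def] Bs_def)
  also have "\<dots> = (\<Sum>l\<in>set U. coef q l (set U) *
      opA q l (fold_set (opB q) (set U - {l}) (\<lambda>ys. H (True # ys))) (replicate L False))"
    by (rule strip_column) (use q U in \<open>auto simp: H_def\<close>)
  also have "\<dots> = (\<Sum>l\<in>set U. coef q l (set U) *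
      guarded q full (Suc 0) (rest l) (top (R' l) ws) (replicate L False))"
  proof (intro sum.cong refl arg_cong2[where f = "(*)"])
    fix l
    have "fold_set (opB q) (set U - {l}) (\<lambda>ys. H (True # ys)) =
        foldr (opB q) (remove1 l U) (guarded q full (Suc 0) Us (top R ws))"
    proof -
      have "set (remove1 l U) \<subseteq> {0<..<1}" using U set_remove1_subset[of l U] by blast
      then show ?thesis
        unfolding HT using Bs_foldr[of "remove1 l U"] U by (simp add: Bs_def set_remove1_eq)
    qed
    also have "\<dots> = guarded q full (Suc 0) (rest l) (top (R' l) ws)"
      by (cases Us) (auto simp: rest_def R'_def top_append)
    finally show "opA q l (fold_set (opB q) (set U - {l}) (\<lambda>ys. H (True # ys))) (replicate L False) =
       guarded q full (Suc 0) (rest l) (top (R' l) ws) (replicate L False)"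
      by (simp add: opA_zeros)
  qed
  finally show ?thesis .
qed

text \<open>Each removed column shortens the strip by one, which costs one factor
  \<open>prod_list ws\<close>, and uses up one row, which takes one \<open>z l\<close> out of the
  Cauchy product.\<close>

theorem guarded_limit:
  assumes "distinct (concat Us @ R)" "set (concat Us @ R) \<subseteq> {0<..<1}"
    and "distinct ws" "set ws \<subseteq> {0<..<1}" "\<And>u w. u \<in> set (concat Us @ R) \<Longrightarrow> w \<in> set ws \<Longrightarrow> u < w"
  defines "z \<equiv> (\<lambda>u. \<Prod>w\<in>set ws. al q u w)"
  shows "(\<lambda>L. guarded q full (Suc 0) Us (top R ws) (replicate L False) / prod_list ws ^ L)
    \<longlonglongrightarrow> (\<Prod>u\<in>set (concat Us @ R). z u) * resum q z (length Us) (cumul {} Us) / prod_list ws ^ length Us"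
  using assms(1,2,5)
proof (induction "length Us" arbitrary: Us R)
  case 0
  have pl: "prod_list ws = \<Prod>(set ws)" using assms(3) prod.distinct_set_conv_list[of ws "\<lambda>x. x"] by simp
  have "top R ws = Bs (set R) (Ds (set ws) (\<lambda>_. 1))"
    using 0 assms by (simp add: top_def Bs_foldr Ds_foldr)
  then show ?case
    using cauchy_limit[of "set ws" "set R"] assms 0 by (simp add: pl zeros_val_def z_def)
next
  case (Suc n)
  obtain U Us' where Us: "Us = U # Us'" using Suc.hyps by (cases Us) auto
  have n: "n = length Us'" using Suc.hyps Us by simp
  define rest where "rest = (\<lambda>l. case Us' of [] \<Rightarrow> [] | V # Vs \<Rightarrow> (remove1 l U @ V) # Vs)"
  define R' where "R' = (\<lambda>l. case Us' of [] \<Rightarrow> remove1 l U @ R | V # Vs \<Rightarrow> R)"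
  have len: "length (rest l) = n" for l by (auto simp: rest_def n split: list.split)
  have dist: "distinct (concat (rest l) @ R' l)" for l
    using Suc.prems(1) by (cases Us') (auto simp: Us rest_def R'_def)
  have set_eq: "set (concat (rest l) @ R' l) = set (concat Us @ R) - {l}" if "l \<in> set U" for l
    using Suc.prems(1) that by (cases Us') (auto simp: Us rest_def R'_def)
  \<comment> \<open>Merging the rest of the first group into the second preserves the cumulative
    sets up to the deletion of \<open>l\<close>; this is exactly the argument of the recursive call
    in \<open>resum\<close>.\<close>
  have cum: "cumul {} (rest l) = map (\<lambda>X. X - {l}) (cumul (set U) Us')" if "l \<in> set U" for l
  proof (cases Us')
    case (Cons V Vs)
    have l: "l \<notin> set (concat Us')" using Suc.prems(1) that by (auto simp: Us)
    have "cumul {} (rest l) = cumul (set U - {l}) Us'"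
      using Suc.prems(1) that by (simp add: rest_def Cons Us)
    with l show ?thesis by (simp add: cumul_minus)
  qed (simp add: rest_def)
  have z0: "z u \<noteq> 0" if "u \<in> set (concat Us @ R)" for u
  proof -
    have "\<forall>w\<in>set ws. al q u w > 0" using that Suc.prems assms(4) by (intro ballI al_pos) auto
    then show ?thesis by (auto simp: z_def)
  qed
  define P where "P = prod_list ws"
  have P0: "P \<noteq> 0" using assms(4) by (auto simp: P_def prod_list_zero_iff)
  have "(\<lambda>L. guarded q full (Suc 0) (rest l) (top (R' l) ws) (replicate L False) / P ^ L)
     \<longlonglongrightarrow> (\<Prod>u\<in>set (concat Us @ R) - {l}. z u) * resum q z n (cumul {} (rest l)) / P ^ n"
    if "l \<in> set U" for l
  proof -
    have "set (concat (rest l) @ R' l) \<subseteq> {0<..<1}"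
      "\<And>u w. u \<in> set (concat (rest l) @ R' l) \<Longrightarrow> w \<in> set ws \<Longrightarrow> u < w"
      unfolding set_eq[OF that] using Suc.prems by auto
    from Suc.hyps(1)[OF len[symmetric] dist this] show ?thesis
      unfolding set_eq[OF that] P_def len by simp
  qed
  then have "(\<lambda>L. (\<Sum>l\<in>set U. coef q l (set U) *
        (guarded q full (Suc 0) (rest l) (top (R' l) ws) (replicate L False) / P ^ L)) / P)
     \<longlonglongrightarrow> (\<Sum>l\<in>set U. coef q l (set U) *
        ((\<Prod>u\<in>set (concat Us @ R) - {l}. z u) * resum q z n (cumul {} (rest l)) / P ^ n)) / P"
    by (intro tendsto_divide[OF tendsto_sum tendsto_const P0] tendsto_mult_left)
  also have "(\<Sum>l\<in>set U. coef q l (set U) *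
        ((\<Prod>u\<in>set (concat Us @ R) - {l}. z u) * resum q z n (cumul {} (rest l)) / P ^ n)) / P =
     (\<Prod>u\<in>set (concat Us @ R). z u) * resum q z (length Us) (cumul {} Us) / P ^ length Us"
  proof -
    have "(\<Prod>u\<in>set (concat Us @ R) - {l}. z u) = (\<Prod>u\<in>set (concat Us @ R). z u) / z l" if "l \<in> set U" for l
      using that z0[of l] prod.remove[of "set (concat Us @ R)" l z] by (simp add: Us)
    then show ?thesis
      using cum by (simp add: Us n sum_divide_distrib sum_distrib_left sum_distrib_right mult_ac cong: sum.cong)
  qed
  also have "(\<lambda>L. (\<Sum>l\<in>set U. coef q l (set U) *
        (guarded q full (Suc 0) (rest l) (top (R' l) ws) (replicate L False) / P ^ L)) / P) =
     (\<lambda>L. guarded q full (Suc 0) Us (top R ws) (replicate (Suc L) False) / P ^ Suc L)"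
  proof
    fix L
    show "(\<Sum>l\<in>set U. coef q l (set U) *
        (guarded q full (Suc 0) (rest l) (top (R' l) ws) (replicate L False) / P ^ L)) / P =
      guarded q full (Suc 0) Us (top R ws) (replicate (Suc L) False) / P ^ Suc L"
      using guarded_step[of U Us' R ws L] Suc.prems(1,2)
      by (simp add: Us rest_def R'_def sum_divide_distrib mult_ac del: guarded.simps replicate.simps)
  qed
  finally show ?case unfolding P_def by (rule LIMSEQ_imp_Suc)
qed

end

section \<open>Monotonicity in the parameters and coinciding parameters\<close>

text \<open>Divided by \<open>p\<close> in every column, the weights become 1/p, q, 1, (1 - p)/p and
  (1 - q p)/p, none of which increases with \<open>p\<close>.\<close>

lemma row_rescaled_antimono:
  assumes "0 \<le> q" "q \<le> 1" "0 < p'" "p' \<le> p" "p \<le> 1" "\<And>ys r. f ys r \<ge> 0"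
  shows "row q p a xs f / p ^ length xs \<le> row q p' a xs f / p' ^ length xs"
  using assms(6)
proof (induction xs arbitrary: a f)
  case Nil
  then show ?case by simp
next
  case (Cons x xs)
  define A where "A b y = row q p b xs (\<lambda>ys. f (y # ys)) / p ^ length xs" for b y
  define A' where "A' b y = row q p' b xs (\<lambda>ys. f (y # ys)) / p' ^ length xs" for b y
  have AA: "0 \<le> A b y" "A b y \<le> A' b y" for b y
    unfolding A_def A'_def using assms Cons
    by (auto intro!: divide_nonneg_nonneg row_nonneg zero_le_power)
  have p0: "p > 0" "p' > 0" "q * p' \<le> q * p" "q * p \<le> 1" "p' \<le> 1"
    using assms by (auto intro: mult_left_mono mult_le_one)
  have inv: "1 / p \<le> 1 / p'" using assms p0 by (simp add: frac_le)
  have c1: "(1 - p) / p \<le> (1 - p') / p'" and c2: "(1 - q * p) / p \<le> (1 - q * p') / p'"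
    using inv p0 by (simp_all add: diff_divide_distrib)
  have c0: "(1 - p) / p \<ge> 0" "(1 - q * p) / p \<ge> 0" "1 / p \<ge> 0" using p0 assms by simp_all
  show ?case
  proof (cases x; cases a)
    assume "x" "a"
    then show ?thesis using mult_mono[OF inv AA(2)[of True True]] AA(1) c0 p0
      by (simp add: A_def A'_def)
  next
    assume "x" "\<not> a"
    then have "row q p a (x # xs) f / p ^ length (x # xs) = q * A False True + (1 - q * p) / p * A True False"
      "row q p' a (x # xs) f / p' ^ length (x # xs) = q * A' False True + (1 - q * p') / p' * A' True False"
      using p0 by (simp_all add: A_def A'_def field_simps)
    moreover have "(1 - q * p) / p * A True False \<le> (1 - q * p') / p' * A' True False"
      by (rule mult_mono[OF c2 AA(2)]) (use AA c0 c2 in auto)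
    moreover have "q * A False True \<le> q * A' False True" using AA assms by (intro mult_left_mono) auto
    ultimately show ?thesis by linarith
  next
    assume "\<not> x" "a"
    then have "row q p a (x # xs) f / p ^ length (x # xs) = A True False + (1 - p) / p * A False True"
      "row q p' a (x # xs) f / p' ^ length (x # xs) = A' True False + (1 - p') / p' * A' False True"
      using p0 by (simp_all add: A_def A'_def field_simps)
    moreover have "(1 - p) / p * A False True \<le> (1 - p') / p' * A' False True"
      by (rule mult_mono[OF c1 AA(2)]) (use AA c0 c1 in auto)
    ultimately show ?thesis using AA(2)[of True False] by linarith
  next
    assume "\<not> x" "\<not> a"
    then show ?thesis using mult_mono[OF inv AA(2)[of False False]] AA(1) c0 p0
      by (simp add: A_def A'_def)
  qed
qed

text \<open>From \<open>p\<close> to \<open>p'\<close> only the weights of turns decrease, each at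
  most by the factor \<open>K\<close>. A vertical arrow turns right at most once, and only such an
  arrow or the one from the left can turn up; so the number of turns is at most
  \<open>2 * occ xs + of_bool a\<close>, whatever the width.\<close>

lemma row_le_power:
  assumes "0 \<le> q" "q \<le> 1" "0 \<le> p" "p \<le> p'" "p' \<le> 1" "\<And>ys r. f ys r \<ge> 0"
    and K: "1 \<le> K" "1 - p \<le> K * (1 - p')"
  shows "row q p a xs f \<le> K ^ (2 * occ xs + of_bool a) * row q p' a xs f"
  using assms(6)
proof (induction xs arbitrary: a f)
  case Nil
  show ?case using mult_right_mono[of 1 K "f [] a"] K(1) Nil by (cases a) auto
next
  case (Cons x xs)
  define A where "A b y = row q p b xs (\<lambda>ys. f (y # ys))" for b y
  define A' where "A' b y = row q p' b xs (\<lambda>ys. f (y # ys))" for b y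
  define c where "c = K ^ (2 * occ xs)"
  have c: "c \<ge> 1" unfolding c_def using K by simp
  have A: "0 \<le> A b y" "0 \<le> A' b y" for b y
    unfolding A_def A'_def using assms Cons.prems by (auto intro!: row_nonneg)
  have AF: "A False y \<le> c * A' False y" and AT: "A True y \<le> K * c * A' True y" for y
    using Cons.IH[of "\<lambda>ys. f (y # ys)" False] Cons.IH[of "\<lambda>ys. f (y # ys)" True] Cons.prems
    by (simp_all add: A_def A'_def c_def mult_ac)
  have qp: "q * p \<le> q * p'" "q * p' \<le> 1" using assms by (auto intro: mult_left_mono mult_le_one)
  \<comment> \<open>The right side minus the left side is K (1 - p') - (1 - p) plus (1 - q) (K p' -
    p).\<close>
  have K2: "1 - q * p \<le> K * (1 - q * p')"
  proof -
    have "(1 - q) * (p' * K - p) \<ge> 0"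
      using assms mult_mono[of 1 K p p'] by (intro mult_nonneg_nonneg) (auto simp: mult.commute)
    then show ?thesis using K(2) by (simp add: algebra_simps)
  qed
  have KK: "c * A' b y \<le> K * c * A' b y" for b y
    using K c A by (intro mult_right_mono) auto
  show ?case
  proof (cases x; cases a)
    assume "x" "a"
    have "A True True \<le> K * c * A' True True" by (rule AT)
    also have "\<dots> \<le> K * K * (K * c * A' True True)"
      using mult_mono[of 1 K 1 K] K A c by (intro mult_right_mono[of 1 "K * K", simplified]) auto
    finally show ?thesis using \<open>x\<close> \<open>a\<close> by (simp add: A_def A'_def c_def mult_ac)
  next
    assume "x" "\<not> a"
    have "q * p * A False True \<le> K * K * c * (q * p' * A' False True)"
    proof -
      have "q * p * A False True \<le> q * p' * (c * A' False True)"
        using AF[of True] qp assms A by (intro mult_mono) auto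
      also have "\<dots> \<le> K * K * (q * p' * (c * A' False True))"
        using mult_mono[of 1 K 1 K] K A c assms by (intro mult_right_mono[of 1 "K * K", simplified]) auto
      finally show ?thesis by (simp add: mult_ac)
    qed
    moreover have "(1 - q * p) * A True False \<le> K * K * c * ((1 - q * p') * A' True False)"
    proof -
      have "(1 - q * p) * A True False \<le> K * (1 - q * p') * (K * c * A' True False)"
        using K2 AT[of False] qp assms A K by (intro mult_mono) auto
      then show ?thesis by (simp add: mult_ac)
    qed
    ultimately have "q * p * A False True + (1 - q * p) * A True False \<le>
       K * K * c * (q * p' * A' False True + (1 - q * p') * A' True False)"
      by (simp add: algebra_simps)
    then show ?thesis using \<open>x\<close> \<open>\<not> a\<close> by (simp add: A_def A'_def c_def mult_ac)
  next
    assume "\<not> x" "a"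
    have "p * A True False \<le> K * c * (p' * A' True False)"
      using mult_mono[OF assms(4) AT[of False]] A assms by (simp add: mult_ac)
    moreover have "(1 - p) * A False True \<le> K * c * ((1 - p') * A' False True)"
      using mult_mono[OF K(2) AF[of True]] A assms K by (simp add: mult_ac)
    ultimately have "p * A True False + (1 - p) * A False True \<le>
       K * c * (p' * A' True False + (1 - p') * A' False True)"
      by (simp add: algebra_simps)
    then show ?thesis using \<open>\<not> x\<close> \<open>a\<close> by (simp add: A_def A'_def c_def mult_ac)
  next
    assume "\<not> x" "\<not> a"
    then show ?thesis using AF[of False] by (simp add: A_def A'_def c_def)
  qed
qed

lemma opB_le_power:
  assumes "0 \<le> q" "q \<le> 1" "0 \<le> p" "p \<le> p'" "p' \<le> 1" "1 \<le> K" "1 - p \<le> K * (1 - p')"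
    and "occ xs \<le> T" "0 \<le> c" "\<And>ys. h2 ys \<ge> 0"
    and "\<And>ys. length ys = length xs \<Longrightarrow> occ ys = Suc (occ xs) \<Longrightarrow> h1 ys \<le> c * h2 ys"
  shows "opB q p h1 xs \<le> K ^ (2 * T + 1) * c * opB q p' h2 xs"
proof -
  have "opB q p h1 xs \<le> row q p True xs (\<lambda>ys r. c * (if r then 0 else h2 ys))"
    unfolding opB_def using assms by (intro row_le) auto
  also have "\<dots> = c * opB q p h2 xs" by (simp add: row_scale opB_def)
  finally have 1: "opB q p h1 xs \<le> c * opB q p h2 xs" .
  have "opB q p h2 xs \<le> K ^ (2 * occ xs + of_bool True) * opB q p' h2 xs"
    unfolding opB_def using assms by (intro row_le_power) auto
  also have "\<dots> \<le> K ^ (2 * T + 1) * opB q p' h2 xs"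
    using assms by (intro mult_right_mono power_increasing) (auto simp: opB_def intro!: row_nonneg)
  finally have "c * opB q p h2 xs \<le> c * (K ^ (2 * T + 1) * opB q p' h2 xs)"
    using assms by (intro mult_left_mono) auto
  with 1 show ?thesis by (simp add: mult_ac)
qed

lemma opB_nonneg:
  assumes "0 \<le> q" "q \<le> 1" "0 \<le> p" "p \<le> 1" "\<And>ys. h ys \<ge> 0"
  shows "0 \<le> opB q p h xs"
  unfolding opB_def using assms by (intro row_nonneg) auto

lemma opD_nonneg:
  assumes "0 \<le> q" "q \<le> 1" "0 \<le> p" "p \<le> 1" "\<And>ys. h ys \<ge> 0"
  shows "0 \<le> opD q p h xs"
  unfolding opD_def using assms by (intro row_nonneg) auto

lemma foldr_opB_nonneg:
  assumes "0 \<le> q" "q \<le> 1" "set ps \<subseteq> {0..1}" "\<And>ys. h ys \<ge> 0"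
  shows "0 \<le> foldr (opB q) ps h xs"
  using assms(3) by (induction ps arbitrary: xs) (auto intro!: opB_nonneg assms)

lemma foldr_opD_nonneg:
  assumes "0 \<le> q" "q \<le> 1" "set ps \<subseteq> {0..1}" "\<And>ys. h ys \<ge> 0"
  shows "0 \<le> foldr (opD q) ps h xs"
  using assms(3) by (induction ps arbitrary: xs) (auto intro!: opD_nonneg assms)

lemma guarded_nonneg:
  assumes "0 \<le> q" "q \<le> 1" "set (concat Us) \<subseteq> {0..1}" "\<And>ys. h ys \<ge> 0"
  shows "0 \<le> guarded q C j Us h xs"
  using assms(3)
proof (induction Us arbitrary: j xs)
  case (Cons U Us)
  then show ?case by (auto intro!: foldr_opB_nonneg assms(1,2))
qed (use assms in simp)

text \<open>Every \<open>opB\<close> adds exactly one arrow, so \<open>T\<close> bounds the number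
  of arrows below each of the rows.\<close>

lemma foldr_opB_le_power:
  fixes u u' :: "nat \<Rightarrow> real"
  assumes "0 \<le> q" "q \<le> 1" "1 \<le> K"
    and "\<And>i. i \<in> set I \<Longrightarrow> 0 \<le> u i \<and> u i \<le> u' i \<and> u' i \<le> 1 \<and> 1 - u i \<le> K * (1 - u' i)"
    and "occ xs + length I \<le> T" "0 \<le> c" "\<And>ys. h2 ys \<ge> 0"
    and "\<And>ys. length ys = length xs \<Longrightarrow> occ ys = occ xs + length I \<Longrightarrow> h1 ys \<le> c * h2 ys"
  shows "foldr (opB q) (map u I) h1 xs \<le> (K ^ (2 * T + 1)) ^ length I * c * foldr (opB q) (map u' I) h2 xs"
  using assms(4,5,8)
proof (induction I arbitrary: xs)
  case Nil
  then show ?case by simp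
next
  case (Cons i I)
  have "opB q (u i) (foldr (opB q) (map u I) h1) xs \<le>
    K ^ (2 * T + 1) * ((K ^ (2 * T + 1)) ^ length I * c) * opB q (u' i) (foldr (opB q) (map u' I) h2) xs"
  proof (rule opB_le_power)
    fix ys assume ys: "length ys = length xs" "occ ys = Suc (occ xs)"
    show "foldr (opB q) (map u I) h1 ys \<le> (K ^ (2 * T + 1)) ^ length I * c * foldr (opB q) (map u' I) h2 ys"
      using Cons.prems ys by (intro Cons.IH) auto
  next
    show "0 \<le> foldr (opB q) (map u' I) h2 ys" for ys
      using Cons.prems(1) assms by (intro foldr_opB_nonneg) (force intro: order.trans)+
  qed (use assms Cons.prems in auto)
  then show ?case by (simp add: mult_ac)
qed

lemma guarded_le_power:
  fixes u u' :: "nat \<Rightarrow> real"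
  assumes "0 \<le> q" "q \<le> 1" "1 \<le> K"
    and "\<And>i. i \<in> set (concat Is) \<Longrightarrow> 0 \<le> u i \<and> u i \<le> u' i \<and> u' i \<le> 1 \<and> 1 - u i \<le> K * (1 - u' i)"
    and "occ xs + length (concat Is) \<le> T" "0 \<le> c" "\<And>ys. h2 ys \<ge> 0"
    and "\<And>ys. length ys = length xs \<Longrightarrow> occ ys = occ xs + length (concat Is) \<Longrightarrow> h1 ys \<le> c * h2 ys"
  shows "guarded q C j (map (map u) Is) h1 xs \<le>
    (K ^ (2 * T + 1)) ^ length (concat Is) * c * guarded q C j (map (map u') Is) h2 xs"
  using assms(4,5,8)
proof (induction Is arbitrary: xs j)
  case Nil
  then show ?case by simp
next
  case (Cons I Is)
  define B where "B = K ^ (2 * T + 1)"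
  have B: "B \<ge> 0" using assms by (simp add: B_def)
  have g: "0 \<le> guarded q C (Suc j) (map (map u') Is) h2 ys" for ys
    using Cons.prems(1) assms by (intro guarded_nonneg) (force intro: order.trans)+
  have "foldr (opB q) (map u I) (\<lambda>xs. if C j xs then guarded q C (Suc j) (map (map u) Is) h1 xs else 0) xs \<le>
    B ^ length I * (B ^ length (concat Is) * c) *
    foldr (opB q) (map u' I) (\<lambda>xs. if C j xs then guarded q C (Suc j) (map (map u') Is) h2 xs else 0) xs"
    unfolding B_def
  proof (rule foldr_opB_le_power)
    fix ys assume ys: "length ys = length xs" "occ ys = occ xs + length I"
    have "guarded q C (Suc j) (map (map u) Is) h1 ys \<le>
      B ^ length (concat Is) * c * guarded q C (Suc j) (map (map u') Is) h2 ys"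
      unfolding B_def using Cons.prems ys by (intro Cons.IH) auto
    then show "(if C j ys then guarded q C (Suc j) (map (map u) Is) h1 ys else 0) \<le>
      (K ^ (2 * T + 1)) ^ length (concat Is) * c * (if C j ys then guarded q C (Suc j) (map (map u') Is) h2 ys else 0)"
      by (simp add: B_def)
  qed (use assms Cons.prems g in auto)
  then show ?case by (simp add: B_def power_add mult_ac)
qed

lemma prod_list_map_pos:
  fixes f :: "'b \<Rightarrow> real"
  assumes "\<And>j. j \<in> set J \<Longrightarrow> 0 < f j"
  shows "0 < prod_list (map f J)"
  using assms by (induction J) auto

lemma foldr_opD_rescaled_antimono:
  fixes w w' :: "nat \<Rightarrow> real"
  assumes "0 \<le> q" "q \<le> 1" "\<And>j. j \<in> set J \<Longrightarrow> 0 < w' j \<and> w' j \<le> w j \<and> w j \<le> 1"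
  shows "foldr (opD q) (map w J) (\<lambda>_. 1) xs / prod_list (map w J) ^ length xs \<le>
    foldr (opD q) (map w' J) (\<lambda>_. 1) xs / prod_list (map w' J) ^ length xs"
  using assms(3)
proof (induction J arbitrary: xs)
  case Nil
  then show ?case by simp
next
  case (Cons j J)
  define F where "F = foldr (opD q) (map w J) (\<lambda>_. 1)"
  define F' where "F' = foldr (opD q) (map w' J) (\<lambda>_. 1)"
  define P where "P = prod_list (map w J)"
  define P' where "P' = prod_list (map w' J)"
  have pos: "0 < w' j" "0 < w j" "w j \<le> 1" "w' j \<le> w j" "P > 0" "P' > 0"
    unfolding P_def P'_def using Cons.prems by (force intro!: prod_list_map_pos)+
  have J: "set (map w J) \<subseteq> {0..1}" "set (map w' J) \<subseteq> {0..1}"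
    using Cons.prems by (force intro: less_imp_le order.trans)+
  have F0: "0 \<le> F ys" "0 \<le> F' ys" for ys
    unfolding F_def F'_def using foldr_opD_nonneg[OF assms(1,2) J(1)] foldr_opD_nonneg[OF assms(1,2) J(2)] by auto
  have "opD q (w j) F xs / (w j * P) ^ length xs =
      row q (w j) True xs (\<lambda>ys r. (if r then F ys / P ^ length xs else 0)) / w j ^ length xs"
  proof -
    have "opD q (w j) F xs = row q (w j) True xs (\<lambda>ys r. P ^ length xs * (if r then F ys / P ^ length xs else 0))"
      unfolding opD_def using pos by (intro row_cong) auto
    then show ?thesis unfolding row_scale using pos by (simp add: power_mult_distrib)
  qed
  also have "\<dots> \<le> row q (w j) True xs (\<lambda>ys r. (if r then F' ys / P' ^ length xs else 0)) / w j ^ length xs"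
    using pos assms Cons unfolding F_def F'_def P_def P'_def
    by (intro divide_right_mono row_le) (auto, metis (no_types, lifting))
  also have "\<dots> \<le> row q (w' j) True xs (\<lambda>ys r. (if r then F' ys / P' ^ length xs else 0)) / w' j ^ length xs"
    using pos assms F0 by (intro row_rescaled_antimono) auto
  also have "\<dots> = opD q (w' j) F' xs / (w' j * P') ^ length xs"
  proof -
    have "opD q (w' j) F' xs = row q (w' j) True xs (\<lambda>ys r. P' ^ length xs * (if r then F' ys / P' ^ length xs else 0))"
      unfolding opD_def using pos by (intro row_cong) auto
    then show ?thesis unfolding row_scale using pos by (simp add: power_mult_distrib)
  qed
  finally show ?case by (simp add: F_def F'_def P_def P'_def)
qed

text \<open>An interchange of the limits in \<open>e\<close> and \<open>L\<close>: for each small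
  \<open>e\<close> the bounds hold for all \<open>L\<close>, so \<open>X\<close> is eventually
  enclosed by any neighbourhood of \<open>a e\<close> and \<open>b e\<close>.\<close>

lemma tendsto_squeeze_family:
  fixes X :: "nat \<Rightarrow> real"
  assumes "F \<noteq> bot" "(a \<longlongrightarrow> T) F" "(b \<longlongrightarrow> T) F"
    and "\<forall>\<^sub>F e in F. (lo e \<longlonglongrightarrow> a e) \<and> (hi e \<longlonglongrightarrow> b e) \<and> (\<forall>L. lo e L \<le> X L \<and> X L \<le> hi e L)"
  shows "X \<longlonglongrightarrow> T"
proof (rule order_tendstoI)
  fix y assume "y < T"
  with assms have "\<forall>\<^sub>F e in F. y < a e" by (intro order_tendstoD)
  with assms(4) have "\<forall>\<^sub>F e in F. \<forall>\<^sub>F L in sequentially. y < X L"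
  proof eventually_elim
    case (elim e)
    then have "\<forall>\<^sub>F L in sequentially. y < lo e L" by (auto dest: order_tendstoD)
    then show ?case by eventually_elim (use elim in \<open>auto intro: less_le_trans\<close>)
  qed
  with assms(1) show "\<forall>\<^sub>F L in sequentially. y < X L" by (auto dest: eventually_happens)
next
  fix y assume "T < y"
  with assms have "\<forall>\<^sub>F e in F. b e < y" by (intro order_tendstoD)
  with assms(4) have "\<forall>\<^sub>F e in F. \<forall>\<^sub>F L in sequentially. X L < y"
  proof eventually_elim
    case (elim e)
    then have "\<forall>\<^sub>F L in sequentially. hi e L < y" by (auto dest: order_tendstoD)
    then show ?case by eventually_elim (use elim in \<open>auto intro: le_less_trans\<close>)
  qed
  with assms(1) show "\<forall>\<^sub>F L in sequentially. X L < y" by (auto dest: eventually_happens)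
qed

lemma eventually_inj_on_perturbed:
  fixes x c :: "nat \<Rightarrow> real"
  assumes "finite I" "inj_on c I"
  shows "\<forall>\<^sub>F e in at_right 0. inj_on (\<lambda>i. x i + e * c i) I"
proof -
  have "\<forall>\<^sub>F e in at_right 0. \<forall>i\<in>I. \<forall>j\<in>I. i \<noteq> j \<longrightarrow> x i + e * c i \<noteq> x j + e * c j"
  proof (intro eventually_ball_finite assms ballI)
    fix i j assume ij: "i \<in> I" "j \<in> I"
    show "\<forall>\<^sub>F e in at_right 0. i \<noteq> j \<longrightarrow> x i + e * c i \<noteq> x j + e * c j"
    proof (cases "x i = x j")
      case True
      have "\<forall>\<^sub>F e::real in at_right 0. e > 0" by (simp add: eventually_at_right_less)
      then show ?thesis
        by eventually_elim (use True ij assms in \<open>auto dest: inj_onD\<close>)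
    next
      case False
      have "((\<lambda>e. (x i + e * c i) - (x j + e * c j)) \<longlongrightarrow> (x i + 0 * c i) - (x j + 0 * c j)) (at_right 0)"
        by (intro tendsto_intros)
      then have "\<forall>\<^sub>F e in at_right 0. (x i + e * c i) - (x j + e * c j) \<noteq> 0"
        by (rule tendsto_imp_eventually_ne) (use False in simp)
      then show ?thesis by eventually_elim auto
    qed
  qed
  then show ?thesis by eventually_elim (auto simp: inj_on_def)
qed

text \<open>Only \<open>z\<close> varies, which covers perturbed D parameters. In the row parameters
  the single terms of \<open>resum\<close> have poles where two of them meet.\<close>

lemma tendsto_resum:
  assumes "\<And>V. V \<in> set Vs \<Longrightarrow> finite V" "length Vs = n"
    and "\<And>l. l \<in> \<Union>(set Vs) \<Longrightarrow> ((\<lambda>e. z e l) \<longlongrightarrow> z0 l) F \<and> z0 l \<noteq> 0"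
  shows "((\<lambda>e. resum q (z e) n Vs) \<longlongrightarrow> resum q z0 n Vs) F"
  using assms
proof (induction n arbitrary: Vs)
  case 0
  then show ?case by simp
next
  case (Suc n)
  then obtain V Us where Vs: "Vs = V # Us" by (cases Vs) auto
  have "((\<lambda>e. resum q (z e) n (map (\<lambda>X. X - {l}) Us)) \<longlongrightarrow> resum q z0 n (map (\<lambda>X. X - {l}) Us)) F" for l
    using Suc.prems by (intro Suc.IH) (auto simp: Vs)
  then show ?case
    using Suc.prems unfolding Vs by (auto intro!: tendsto_sum tendsto_mult tendsto_divide)
qed

context unit_parameter
begin

definition ratio :: "nat list list \<Rightarrow> nat list \<Rightarrow> nat list \<Rightarrow> (nat \<Rightarrow> real) \<Rightarrow> (nat \<Rightarrow> real) \<Rightarrow> nat \<Rightarrow> real" where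
  "ratio Is J I' u w L = guarded q full (Suc 0) (map (map u) Is) (top (map u J) (map w I')) (replicate L False)
     / prod_list (map w I') ^ L"

text \<open>The products run over indices and not over values, so that multiplicities are kept when
  entries of \<open>w\<close> coincide.\<close>

definition target :: "nat list list \<Rightarrow> nat list \<Rightarrow> nat list \<Rightarrow> (nat \<Rightarrow> real) \<Rightarrow> (nat \<Rightarrow> real) \<Rightarrow> real" where
  "target Is J I' u w = (\<Prod>i\<in>set (concat Is @ J). \<Prod>j\<in>set I'. al q (u i) (w j)) *
     resum q (\<lambda>x. \<Prod>j\<in>set I'. al q x (w j)) (length Is) (cumul {} (map (map u) Is)) / prod_list (map w I') ^ length Is"

text \<open>The constant does not depend on \<open>L\<close>, and it tends to \<open>1\<close> as the parameters approach each
  other, so that limits for coinciding parameters can be squeezed.\<close>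

lemma ratio_le_power:
  assumes "1 \<le> K"
    and "\<And>i. i \<in> set (concat Is @ J) \<Longrightarrow> 0 \<le> u i \<and> u i \<le> u' i \<and> u' i \<le> 1 \<and> 1 - u i \<le> K * (1 - u' i)"
    and "\<And>j. j \<in> set I' \<Longrightarrow> 0 < w' j \<and> w' j \<le> w j \<and> w j \<le> 1"
  shows "ratio Is J I' u w L \<le> (K ^ (2 * length (concat Is @ J) + 1)) ^ length (concat Is @ J) * ratio Is J I' u' w' L"
proof -
  have q01: "0 \<le> q" "q \<le> 1" using q by auto
  define T where "T = length (concat Is @ J)"
  define B where "B = K ^ (2 * T + 1)"
  define P where "P = prod_list (map w I')"
  define P' where "P' = prod_list (map w' I')"
  have pos: "P > 0" "P' > 0"
    unfolding P_def P'_def using assms(3) by (force intro!: prod_list_map_pos)+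
  have J: "set (map w' I') \<subseteq> {0..1}" using assms(3) by (force intro: less_imp_le order.trans)
  have uJ: "set (map u' J) \<subseteq> {0..1}" using assms(2) by (force intro: order.trans)
  have D: "foldr (opD q) (map w I') (\<lambda>_. 1) ys \<le> P ^ L / P' ^ L * foldr (opD q) (map w' I') (\<lambda>_. 1) ys"
    if "length ys = L" for ys
    using foldr_opD_rescaled_antimono[OF q01, where J = I' and w = w and w' = w' and xs = ys] assms(3) pos that
    by (simp add: P_def[symmetric] P'_def[symmetric] field_simps)
  have t: "top (map u J) (map w I') ys \<le> B ^ length J * (P ^ L / P' ^ L) * top (map u' J) (map w' I') ys"
    if "length ys = L" "occ ys = length (concat Is)" for ys
    unfolding top_def B_def
    by (rule foldr_opB_le_power)
      (use q01 assms that D pos foldr_opD_nonneg[OF q01 J] in \<open>auto simp: T_def\<close>)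
  have t0: "0 \<le> top (map u' J) (map w' I') ys" for ys
    unfolding top_def using foldr_opD_nonneg[OF q01 J] by (intro foldr_opB_nonneg q01 uJ) auto
  have "guarded q full (Suc 0) (map (map u) Is) (top (map u J) (map w I')) (replicate L False) \<le>
     B ^ length (concat Is) * (B ^ length J * (P ^ L / P' ^ L)) *
     guarded q full (Suc 0) (map (map u') Is) (top (map u' J) (map w' I')) (replicate L False)"
    unfolding B_def
    by (rule guarded_le_power)
      (use q01 assms t t0 pos in \<open>auto simp: T_def B_def count_list_0_iff\<close>)
  moreover have "T = length (concat Is) + length J" by (simp add: T_def)
  ultimately show ?thesis
    unfolding ratio_def P_def[symmetric] P'_def[symmetric] T_def[symmetric] B_def[symmetric]
    using pos by (simp add: power_add field_simps)
qed

text \<open>The D parameters may coincide here. They are moved apart, once upwards and once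
  downwards, and the ratio is monotone in them.\<close>

theorem ratio_limit_distinct:
  assumes "distinct (concat Is @ J)" "inj_on u (set (concat Is @ J))" "distinct I'"
    and u: "\<And>i. i \<in> set (concat Is @ J) \<Longrightarrow> 0 < u i \<and> u i < 1"
    and w: "\<And>j. j \<in> set I' \<Longrightarrow> 0 < w j \<and> w j < 1"
    and uw: "\<And>i j. i \<in> set (concat Is @ J) \<Longrightarrow> j \<in> set I' \<Longrightarrow> u i < w j"
  shows "ratio Is J I' u w \<longlonglongrightarrow> target Is J I' u w"
proof -
  have 1: "ratio Is J I' u w' \<longlonglongrightarrow> target Is J I' u w'"
    if "inj_on w' (set I')" and w': "\<And>j. j \<in> set I' \<Longrightarrow> 0 < w' j \<and> w' j < 1"
      "\<And>i j. i \<in> set (concat Is @ J) \<Longrightarrow> j \<in> set I' \<Longrightarrow> u i < w' j" for w'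
  proof -
    have s: "set (concat (map (map u) Is) @ map u J) = u ` set (concat Is @ J)"
      by (auto simp: image_iff)
    have d: "distinct (concat (map (map u) Is) @ map u J)"
      using assms(1,2) distinct_map[of u "concat Is @ J"] by (simp add: map_concat)
    have p: "(\<Prod>x\<in>set (map w' I'). f x) = (\<Prod>j\<in>set I'. f (w' j))" for f :: "real \<Rightarrow> real"
      using that(1) by (simp add: prod.reindex)
    have p': "(\<Prod>x\<in>set (concat (map (map u) Is) @ map u J). f x) = (\<Prod>i\<in>set (concat Is @ J). f (u i))" for f :: "real \<Rightarrow> real"
      unfolding s using assms(2) by (simp add: prod.reindex)
    have "set (concat (map (map u) Is) @ map u J) \<subseteq> {0<..<1}"
      unfolding s using u by (simp only: image_subset_iff greaterThanLessThan_iff) blast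
    moreover have "distinct (map w' I')" using that(1) assms(3) by (simp add: distinct_map)
    moreover have "set (map w' I') \<subseteq> {0<..<1}" using w' by auto
    moreover have "x < y" if "x \<in> set (concat (map (map u) Is) @ map u J)" "y \<in> set (map w' I')" for x y
      using that w' unfolding s by auto
    ultimately have "(\<lambda>L. guarded q full (Suc 0) (map (map u) Is) (top (map u J) (map w' I')) (replicate L False) /
          prod_list (map w' I') ^ L)
      \<longlonglongrightarrow> (\<Prod>x\<in>set (concat (map (map u) Is) @ map u J). \<Prod>y\<in>set (map w' I'). al q x y) *
        resum q (\<lambda>x. \<Prod>y\<in>set (map w' I'). al q x y) (length (map (map u) Is)) (cumul {} (map (map u) Is)) /
        prod_list (map w' I') ^ length (map (map u) Is)"
      by (intro guarded_limit[OF d])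
    then show ?thesis
      unfolding p p' ratio_def[abs_def] target_def by simp
  qed
  \<comment> \<open>Pairwise different multiples of \<open>e\<close> separate equal entries of
    \<open>w\<close> for all small \<open>e\<close>. Larger D parameters decrease the ratio, so
    \<open>wp\<close> yields the lower bound and \<open>wm\<close> the upper one.\<close>
  define wp where "wp e j = w j + e * (real j + 1)" for e j
  define wm where "wm e j = w j + e * (- real j - 1)" for e j
  have lim: "((\<lambda>e. wp e j) \<longlongrightarrow> w j) (at_right 0)" "((\<lambda>e. wm e j) \<longlongrightarrow> w j) (at_right 0)" for j
    unfolding wp_def wm_def by (auto intro!: tendsto_eq_intros)
  have inj: "\<forall>\<^sub>F e in at_right 0. inj_on (wp e) (set I')" "\<forall>\<^sub>F e in at_right 0. inj_on (wm e) (set I')"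
    unfolding wp_def wm_def by (intro eventually_inj_on_perturbed; simp add: inj_on_def)+
  have rng: "\<forall>\<^sub>F e in at_right 0. \<forall>j\<in>set I'. 0 < f e j \<and> f e j < 1"
    "\<forall>\<^sub>F e in at_right 0. \<forall>i\<in>set (concat Is @ J). \<forall>j\<in>set I'. u i < f e j"
    if "\<And>j. ((\<lambda>e. f e j) \<longlongrightarrow> w j) (at_right 0)" for f :: "real \<Rightarrow> nat \<Rightarrow> real"
  proof -
    show "\<forall>\<^sub>F e in at_right 0. \<forall>j\<in>set I'. 0 < f e j \<and> f e j < 1"
      using w by (intro eventually_ball_finite ballI eventually_conj order_tendstoD[OF that]) auto
    show "\<forall>\<^sub>F e in at_right 0. \<forall>i\<in>set (concat Is @ J). \<forall>j\<in>set I'. u i < f e j"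
      by (intro eventually_ball_finite ballI order_tendstoD(1)[OF that uw]) auto
  qed
  have lt: "((\<lambda>e. target Is J I' u (f e)) \<longlongrightarrow> target Is J I' u w) (at_right 0)"
    if "\<And>j. ((\<lambda>e. f e j) \<longlongrightarrow> w j) (at_right 0)" for f :: "real \<Rightarrow> nat \<Rightarrow> real"
  proof -
    have al: "((\<lambda>e. al q (u i) (f e j)) \<longlongrightarrow> al q (u i) (w j)) (at_right 0)"
      if "i \<in> set (concat Is @ J)" "j \<in> set I'" for i j
      unfolding al_def den_def using uw[OF that] \<open>\<And>j. ((\<lambda>e. f e j) \<longlongrightarrow> w j) (at_right 0)\<close>
      by (intro tendsto_intros) auto
    have cz: "\<Union>(set (cumul A (map (map u) Ks))) \<subseteq> A \<union> u ` set (concat Ks)" for A Ks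
    proof (induction Ks arbitrary: A)
      case (Cons K Ks)
      show ?case using Cons[of "A \<union> u ` set K"] by auto
    qed simp
    have cf: "finite A \<Longrightarrow> V \<in> set (cumul A (map (map u) Ks)) \<Longrightarrow> finite V" for A Ks V
    proof (induction Ks arbitrary: A)
      case (Cons K Ks)
      then show ?case using Cons.IH[of "A \<union> u ` set K"] by auto
    qed simp
    have pl: "((\<lambda>e. prod_list (map (f e) Ks)) \<longlongrightarrow> prod_list (map w Ks)) (at_right 0)" for Ks
      using that by (induction Ks) (auto intro!: tendsto_mult)
    have al0: "al q (u i) (w j) > 0" if "i \<in> set (concat Is @ J)" "j \<in> set I'" for i j
      using u w uw that by (intro al_pos) auto
    have res: "((\<lambda>e. resum q (\<lambda>x. \<Prod>j\<in>set I'. al q x (f e j)) (length Is) (cumul {} (map (map u) Is))) \<longlongrightarrow>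
       resum q (\<lambda>x. \<Prod>j\<in>set I'. al q x (w j)) (length Is) (cumul {} (map (map u) Is))) (at_right 0)"
    proof (rule tendsto_resum)
      fix l assume "l \<in> \<Union>(set (cumul {} (map (map u) Is)))"
      then obtain i where i: "i \<in> set (concat Is @ J)" "l = u i"
        using subsetD[OF cz[of "{}" Is], of l] by auto
      then show "((\<lambda>e. \<Prod>j\<in>set I'. al q l (f e j)) \<longlongrightarrow> (\<Prod>j\<in>set I'. al q l (w j))) (at_right 0) \<and>
          (\<Prod>j\<in>set I'. al q l (w j)) \<noteq> 0"
        using al al0 by (fastforce intro!: tendsto_prod)
    qed (use cf in auto)
    have "prod_list (map w I') > 0" using w by (intro prod_list_map_pos) auto
    then show ?thesis unfolding target_def
      by (intro tendsto_divide tendsto_mult tendsto_prod tendsto_power al pl res) auto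
  qed
  show ?thesis
  proof (rule tendsto_squeeze_family[where F = "at_right (0::real)"
        and lo = "\<lambda>e. ratio Is J I' u (wp e)" and hi = "\<lambda>e. ratio Is J I' u (wm e)"])
    show "at_right (0::real) \<noteq> bot" by simp
    show "((\<lambda>e. target Is J I' u (wp e)) \<longlongrightarrow> target Is J I' u w) (at_right 0)" using lim by (intro lt)
    show "((\<lambda>e. target Is J I' u (wm e)) \<longlongrightarrow> target Is J I' u w) (at_right 0)" using lim by (intro lt)
    have "\<forall>\<^sub>F e::real in at_right 0. e > 0" by (simp add: eventually_at_right_less)
    then show "\<forall>\<^sub>F e in at_right 0. (ratio Is J I' u (wp e) \<longlonglongrightarrow> target Is J I' u (wp e)) \<and>
        (ratio Is J I' u (wm e) \<longlonglongrightarrow> target Is J I' u (wm e)) \<and>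
        (\<forall>L. ratio Is J I' u (wp e) L \<le> ratio Is J I' u w L \<and> ratio Is J I' u w L \<le> ratio Is J I' u (wm e) L)"
      using inj rng[of wp, OF lim(1)] rng[of wm, OF lim(2)]
    proof eventually_elim
      case (elim e)
      have "0 \<le> e * (real j + 1)" for j using elim by simp
      then have le: "wm e j \<le> w j" "w j \<le> wp e j" for j
        unfolding wm_def wp_def by (auto simp: algebra_simps)
      have "ratio Is J I' u (wp e) L \<le> ratio Is J I' u w L" for L
        using ratio_le_power[of 1 Is J u u I' w "wp e" L] elim u w le by (fastforce intro: less_imp_le)
      moreover have "ratio Is J I' u w L \<le> ratio Is J I' u (wm e) L" for L
        using ratio_le_power[of 1 Is J u u I' "wm e" w L] elim u w le by (fastforce intro: less_imp_le)
      ultimately show ?case using elim 1[of "wp e"] 1[of "wm e"] by blast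
    qed
  qed
qed

text \<open>The limits \<open>a\<close> and \<open>b\<close> along the perturbed row parameters are
  hypotheses, because their common limit is later supplied by the contour integral instead of the
  nested sum.\<close>

theorem ratio_limit_squeeze:
  assumes u: "\<And>i. i \<in> set (concat Is @ J) \<Longrightarrow> 0 < u i \<and> u i < 1"
    and w: "\<And>j. j \<in> set I' \<Longrightarrow> 0 < w j \<and> w j < 1"
    and ev: "\<forall>\<^sub>F e in F. \<forall>i\<in>set (concat Is @ J). 0 < um e i \<and> um e i \<le> u i \<and> u i \<le> up e i \<and> up e i < 1"
    and lim: "\<And>i. i \<in> set (concat Is @ J) \<Longrightarrow> ((\<lambda>e. um e i) \<longlongrightarrow> u i) F"
      "\<And>i. i \<in> set (concat Is @ J) \<Longrightarrow> ((\<lambda>e. up e i) \<longlongrightarrow> u i) F"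
    and conv: "\<forall>\<^sub>F e in F. (ratio Is J I' (um e) w \<longlonglongrightarrow> a e) \<and> (ratio Is J I' (up e) w \<longlonglongrightarrow> b e)"
    and ab: "(a \<longlongrightarrow> T) F" "(b \<longlongrightarrow> T) F" "F \<noteq> bot"
  shows "ratio Is J I' u w \<longlonglongrightarrow> T"
proof -
  define S where "S = set (concat Is @ J)"
  define n where "n = length (concat Is @ J)"
  \<comment> \<open>All factors are at least 1, so the product dominates each single quotient that
    \<open>ratio_le_power\<close> asks for, and still it tends to 1. The same holds for
    \<open>Kp\<close>.\<close>
  define Km where "Km e = (\<Prod>i\<in>S. (1 - um e i) / (1 - u i))" for e
  define Kp where "Kp e = (\<Prod>i\<in>S. (1 - u i) / (1 - up e i))" for e
  define E where "E K = (K ^ (2 * n + 1)) ^ n" for K :: real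
  have K1: "1 \<le> (\<Prod>i\<in>S. x i / y i) \<and> (\<forall>i\<in>S. x i \<le> (\<Prod>i\<in>S. x i / y i) * y i)"
    if "\<And>i. i \<in> S \<Longrightarrow> 0 < y i \<and> y i \<le> x i" for x y :: "nat \<Rightarrow> real"
  proof -
    have 1: "1 \<le> (\<Prod>i\<in>A. x i / y i)" if "A \<subseteq> S" for A
      using that \<open>\<And>i. i \<in> S \<Longrightarrow> 0 < y i \<and> y i \<le> x i\<close> by (intro prod_ge_1) auto
    moreover have "x i \<le> (\<Prod>i\<in>S. x i / y i) * y i" if i: "i \<in> S" for i
    proof -
      have "x i / y i * 1 \<le> x i / y i * (\<Prod>i\<in>S - {i}. x i / y i)"
        using \<open>\<And>i. i \<in> S \<Longrightarrow> 0 < y i \<and> y i \<le> x i\<close>[OF i] by (intro mult_left_mono 1) auto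
      also have "\<dots> = (\<Prod>i\<in>S. x i / y i)" using i by (subst prod.remove[of S i]) (auto simp: S_def)
      finally show ?thesis using \<open>\<And>i. i \<in> S \<Longrightarrow> 0 < y i \<and> y i \<le> x i\<close>[OF i] by (simp add: field_simps)
    qed
    ultimately show ?thesis by auto
  qed
  have "(Km \<longlongrightarrow> (\<Prod>i\<in>S. (1 - u i) / (1 - u i))) F"
    unfolding Km_def using u lim by (intro tendsto_intros) (force simp: S_def)+
  moreover have "(\<Prod>i\<in>S. (1 - u i) / (1 - u i)) = 1" using u by (intro prod.neutral) (force simp: S_def)
  ultimately have Km: "(Km \<longlongrightarrow> 1) F" by simp
  have "(Kp \<longlongrightarrow> (\<Prod>i\<in>S. (1 - u i) / (1 - u i))) F"
    unfolding Kp_def using u lim by (intro tendsto_intros) (force simp: S_def)+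
  moreover have "(\<Prod>i\<in>S. (1 - u i) / (1 - u i)) = 1" using u by (intro prod.neutral) (force simp: S_def)
  ultimately have Kp: "(Kp \<longlongrightarrow> 1) F" by simp
  have EK: "((\<lambda>e. E (K e)) \<longlongrightarrow> 1) F" if "(K \<longlongrightarrow> 1) F" for K
    unfolding E_def using tendsto_power[OF tendsto_power[OF that, of "2 * n + 1"], of n] by simp
  show ?thesis
  proof (rule tendsto_squeeze_family[where F = F
        and lo = "\<lambda>e L. ratio Is J I' (um e) w L / E (Km e)" and hi = "\<lambda>e L. E (Kp e) * ratio Is J I' (up e) w L"])
    show "F \<noteq> bot" by fact
    show "((\<lambda>e. a e / E (Km e)) \<longlongrightarrow> T) F" using tendsto_divide[OF ab(1) EK[OF Km]] by simp
    show "((\<lambda>e. E (Kp e) * b e) \<longlongrightarrow> T) F" using tendsto_mult[OF EK[OF Kp] ab(2)] by simp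
    show "\<forall>\<^sub>F e in F. ((\<lambda>L. ratio Is J I' (um e) w L / E (Km e)) \<longlonglongrightarrow> a e / E (Km e)) \<and>
        ((\<lambda>L. E (Kp e) * ratio Is J I' (up e) w L) \<longlonglongrightarrow> E (Kp e) * b e) \<and>
        (\<forall>L. ratio Is J I' (um e) w L / E (Km e) \<le> ratio Is J I' u w L \<and>
             ratio Is J I' u w L \<le> E (Kp e) * ratio Is J I' (up e) w L)"
      using ev conv
    proof eventually_elim
      case (elim e)
      have m: "1 \<le> Km e" "\<And>i. i \<in> S \<Longrightarrow> 1 - um e i \<le> Km e * (1 - u i)"
        using K1[of "\<lambda>i. 1 - u i" "\<lambda>i. 1 - um e i"] elim u by (auto simp: Km_def S_def)
      have p: "1 \<le> Kp e" "\<And>i. i \<in> S \<Longrightarrow> 1 - u i \<le> Kp e * (1 - up e i)"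
        using K1[of "\<lambda>i. 1 - up e i" "\<lambda>i. 1 - u i"] elim u by (auto simp: Kp_def S_def)
      have Em: "E (Km e) > 0" using m(1) by (auto simp: E_def)
      have w': "0 < w j \<and> w j \<le> w j \<and> w j \<le> 1" if "j \<in> set I'" for j using w[OF that] by auto
      have "ratio Is J I' (um e) w L \<le> E (Km e) * ratio Is J I' u w L" for L
        unfolding E_def n_def
        by (rule ratio_le_power[OF m(1) _ w']) (use elim u m(2) in \<open>auto simp: S_def less_imp_le\<close>)
      moreover have "ratio Is J I' u w L \<le> E (Kp e) * ratio Is J I' (up e) w L" for L
        unfolding E_def n_def
        by (rule ratio_le_power[OF p(1) _ w']) (use elim u p(2) in \<open>auto simp: S_def less_imp_le\<close>)
      moreover have "(\<lambda>L. ratio Is J I' (um e) w L / E (Km e)) \<longlonglongrightarrow> a e / E (Km e)"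
        "(\<lambda>L. E (Kp e) * ratio Is J I' (up e) w L) \<longlonglongrightarrow> E (Kp e) * b e"
        using elim Em by (auto intro!: tendsto_intros)
      ultimately show ?case using Em by (auto simp: field_simps)
    qed
  qed
qed

end

section \<open>Edges of a single up-right path\<close>

lemma path_edges_iff:
  "(a, b) \<in> path_edges \<pi> \<longleftrightarrow> (\<exists>i. Suc i < length \<pi> \<and> \<pi> ! i = a \<and> \<pi> ! Suc i = b)"
proof
  assume "(a, b) \<in> path_edges \<pi>"
  then obtain i where "\<pi> ! i = a" "tl \<pi> ! i = b" "i < length (tl \<pi>)"
    by (auto simp: path_edges_def in_set_zip)
  then show "\<exists>i. Suc i < length \<pi> \<and> \<pi> ! i = a \<and> \<pi> ! Suc i = b"
    by (intro exI[of _ i]) (simp add: nth_tl)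
next
  assume "\<exists>i. Suc i < length \<pi> \<and> \<pi> ! i = a \<and> \<pi> ! Suc i = b"
  then obtain i where "Suc i < length \<pi>" "\<pi> ! i = a" "\<pi> ! Suc i = b" by blast
  then show "(a, b) \<in> path_edges \<pi>"
    unfolding path_edges_def in_set_zip by (intro exI[of _ i]) (simp add: nth_tl)
qed

lemma up_right_path_iff:
  "up_right_path D a b \<pi> \<longleftrightarrow> length \<pi> \<ge> 2 \<and> \<pi> ! 0 = a \<and> \<pi> ! (length \<pi> - 1) = b \<and>
     (\<forall>i. 0 < i \<and> Suc i < length \<pi> \<longrightarrow> \<pi> ! i \<in> D) \<and>
     (\<forall>i. Suc i < length \<pi> \<longrightarrow> up_right_step (\<pi> ! i) (\<pi> ! Suc i))"
  (is "?L \<longleftrightarrow> ?R")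
proof
  assume ?L
  then obtain p where p: "\<pi> = a # p @ [b]" "set p \<subseteq> D" "successively up_right_step \<pi>"
    by (auto simp: up_right_path_def)
  have "\<pi> ! i \<in> D" if "0 < i" "Suc i < length \<pi>" for i
  proof -
    have "\<pi> ! i \<in> set p" using that p(1) by (cases i) (auto simp: nth_append)
    then show ?thesis using p(2) by blast
  qed
  then show ?R using p by (auto simp: successively_conv_nth nth_append)
next
  assume R: ?R
  then obtain c r where r: "\<pi> = c # r" "r \<noteq> []" by (cases \<pi>) force+
  define p where "p = butlast r"
  have "last r = b" "c = a" using R r by (simp_all add: last_conv_nth nth_Cons' split: if_splits)
  then have pi: "\<pi> = a # p @ [b]"
    using r append_butlast_last_id[of r] by (simp add: p_def)
  have "set p \<subseteq> D"
  proof
    fix x assume "x \<in> set p"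
    then obtain i where "i < length p" "p ! i = x" by (auto simp: in_set_conv_nth)
    then have "\<pi> ! Suc i = x" "Suc (Suc i) < length \<pi>" by (simp_all add: pi nth_append)
    then show "x \<in> D" using R by auto
  qed
  with pi R show ?L unfolding up_right_path_def by (auto simp: successively_conv_nth)
qed

context
  fixes D a b \<pi>
  assumes path: "up_right_path D a b \<pi>"
begin

text \<open>Every step raises x + y by one. Hence a point determines its index on the path, and no
  point is visited twice.\<close>

lemma path_rank: "i < length \<pi> \<Longrightarrow> fst (\<pi> ! i) + int (snd (\<pi> ! i)) = fst a + int (snd a) + int i"
proof (induction i)
  case 0
  then show ?case using path by (simp add: up_right_path_iff)
next
  case (Suc i)
  then have "up_right_step (\<pi> ! i) (\<pi> ! Suc i)" using path by (simp add: up_right_path_iff)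
  then show ?case using Suc by (auto simp: up_right_step_def)
qed

lemma path_fst_mono: "i \<le> j \<Longrightarrow> j < length \<pi> \<Longrightarrow> fst (\<pi> ! i) \<le> fst (\<pi> ! j)"
proof (induction j rule: dec_induct)
  case (step j)
  then have "up_right_step (\<pi> ! j) (\<pi> ! Suc j)" using path by (simp add: up_right_path_iff)
  then show ?case using step by (auto simp: up_right_step_def)
qed simp

lemma path_fst_bounds: "p \<in> set \<pi> \<Longrightarrow> fst a \<le> fst p \<and> fst p \<le> fst b"
  using path_fst_mono[of 0] path_fst_mono[of _ "length \<pi> - 1"] path
  by (auto simp: in_set_conv_nth up_right_path_iff)

lemma path_edge_set: "(p, p') \<in> path_edges \<pi> \<Longrightarrow> p \<in> set \<pi> \<and> p' \<in> set \<pi>"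
  by (auto simp: path_edges_iff)

lemma path_edge_step: "(p, p') \<in> path_edges \<pi> \<Longrightarrow> up_right_step p p'"
  using path by (auto simp: path_edges_iff up_right_path_iff)

lemma path_edge_ends: "(p, p') \<in> path_edges \<pi> \<Longrightarrow> (p = a \<or> p \<in> D) \<and> (p' = b \<or> p' \<in> D)"
proof -
  assume "(p, p') \<in> path_edges \<pi>"
  then obtain i where i: "Suc i < length \<pi>" "\<pi> ! i = p" "\<pi> ! Suc i = p'" by (auto simp: path_edges_iff)
  have "p = a \<or> p \<in> D" using i path by (cases "i = 0") (auto simp: up_right_path_iff)
  moreover have "p' = b \<or> p' \<in> D"
    using i path by (cases "Suc (Suc i) = length \<pi>") (auto simp: up_right_path_iff dest: sym)
  ultimately show ?thesis by simp
qed

lemma path_local: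
  assumes "(x, y) \<in> D" "a \<notin> D" "b \<notin> D" "y \<ge> 1"
  shows "of_bool (((x, y - 1), (x, y)) \<in> path_edges \<pi>) + of_bool (((x - 1, y), (x, y)) \<in> path_edges \<pi>) =
    (of_bool (((x, y), (x, y + 1)) \<in> path_edges \<pi>) + of_bool (((x, y), (x + 1, y)) \<in> path_edges \<pi>) :: nat)"
proof (cases "(x, y) \<in> set \<pi>")
  case False
  then show ?thesis using path_edge_set by force
next
  case True
  then obtain i where i: "i < length \<pi>" "\<pi> ! i = (x, y)" by (auto simp: in_set_conv_nth)
  have inj: "j = i" if "j < length \<pi>" "\<pi> ! j = (x, y)" for j
    using path_rank[OF that(1)] path_rank[OF i(1)] i that by simp
  \<comment> \<open>Both ends lie outside \<open>D\<close>, so a visited point of \<open>D\<close>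
    has a predecessor and a successor on the path.\<close>
  have "i \<noteq> 0" "i \<noteq> length \<pi> - 1" using i path assms by (metis up_right_path_iff)+
  then obtain k where k: "i = Suc k" "Suc i < length \<pi>" using i by (cases i) auto
  have E: "(p, (x, y)) \<in> path_edges \<pi> \<longleftrightarrow> p = \<pi> ! k" "((x, y), p) \<in> path_edges \<pi> \<longleftrightarrow> p = \<pi> ! Suc i" for p
    using i k inj unfolding path_edges_iff by (metis Suc_inject Suc_lessD)+
  have st: "\<forall>i. Suc i < length \<pi> \<longrightarrow> up_right_step (\<pi> ! i) (\<pi> ! Suc i)"
    using path by (simp add: up_right_path_iff)
  obtain xk yk xi yi where c: "\<pi> ! k = (xk, yk)" "\<pi> ! Suc i = (xi, yi)" by (metis surj_pair)
  have "up_right_step (xk, yk) (x, y)" "up_right_step (x, y) (xi, yi)"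
    using st[rule_format, of k] st[rule_format, of i] i k c by auto
  then have "xk = x - 1 \<and> yk = y \<or> xk = x \<and> yk = y - 1" "xi = x + 1 \<and> yi = y \<or> xi = x \<and> yi = y + 1"
    by (auto simp: up_right_step_def)
  then show ?thesis unfolding E c using assms(4) by auto
qed

end

lemma arrows_of_sum: "finite I \<Longrightarrow> arrows_of I \<pi> e = (\<Sum>i\<in>I. of_bool (e \<in> path_edges (\<pi> i)))"
  by (simp add: arrows_of_def sum_of_bool_eq Collect_conj_eq Int_commute)

section \<open>Path collections and arrow configurations\<close>

definition conserving :: "nat \<Rightarrow> arrows \<Rightarrow> bool" where
  "conserving n \<omega> \<longleftrightarrow> (\<forall>x y. 0 \<le> x \<longrightarrow> 1 \<le> y \<longrightarrow> y \<le> n \<longrightarrow>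
     \<omega> ((x, y - 1), (x, y)) + \<omega> ((x - 1, y), (x, y)) = \<omega> ((x, y), (x, y + 1)) + \<omega> ((x, y), (x + 1, y)))"

definition supported :: "nat \<Rightarrow> nat \<Rightarrow> arrows \<Rightarrow> bool" where
  "supported L n \<omega> \<longleftrightarrow> (\<forall>e. \<omega> e \<noteq> 0 \<longrightarrow>
     (\<exists>x y. 0 \<le> x \<and> x < int L \<and> y \<le> n \<and> e = ((x, y), (x, y + 1))) \<or>
     (\<exists>x y. -1 \<le> x \<and> x < int L - 1 \<and> 1 \<le> y \<and> y \<le> n \<and> e = ((x, y), (x + 1, y))))"

lemma arrows_of_conserving:
  assumes "finite I" "\<And>i. i \<in> I \<Longrightarrow> up_right_path (strip n) (a i) (b i) (\<pi> i)"
    and "\<And>i. i \<in> I \<Longrightarrow> a i \<notin> strip n \<and> b i \<notin> strip n"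
  shows "conserving n (arrows_of I \<pi>)"
  unfolding conserving_def
proof (intro allI impI)
  fix x y assume "0 \<le> (x::int)" "1 \<le> (y::nat)" "y \<le> n"
  then have D: "(x, y) \<in> strip n" by (simp add: strip_def)
  show "arrows_of I \<pi> ((x, y - 1), x, y) + arrows_of I \<pi> ((x - 1, y), x, y) =
       arrows_of I \<pi> ((x, y), x, y + 1) + arrows_of I \<pi> ((x, y), x + 1, y)"
    unfolding arrows_of_sum[OF assms(1)] sum.distrib[symmetric]
  proof (rule sum.cong)
    fix i assume "i \<in> I"
    from path_local[OF assms(2)[OF this] D] assms(3)[OF this] \<open>1 \<le> y\<close>
    show "of_bool (((x, y - 1), x, y) \<in> path_edges (\<pi> i)) + of_bool (((x - 1, y), x, y) \<in> path_edges (\<pi> i)) =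
      (of_bool (((x, y), x, y + 1) \<in> path_edges (\<pi> i)) + of_bool (((x, y), x + 1, y) \<in> path_edges (\<pi> i)) :: nat)"
      by auto
  qed simp
qed

lemma arrows_of_nonzero: "arrows_of I \<pi> e \<noteq> 0 \<Longrightarrow> \<exists>i\<in>I. e \<in> path_edges (\<pi> i)"
  by (auto simp: arrows_of_def card_eq_0_iff)

lemma path_collections_conserving:
  assumes "\<omega> \<in> path_collections N" "\<And>x. x \<ge> int L \<Longrightarrow> \<omega> ((x, N), (x, N + 1)) = 0"
  shows "conserving N \<omega>" "supported L N \<omega>" "\<And>e. \<omega> e \<le> 1"
    "\<And>y. 1 \<le> y \<Longrightarrow> y \<le> N \<Longrightarrow> \<omega> ((-1, y), (0, y)) = 1" "\<And>x. \<omega> ((x, 0), (x, Suc 0)) = 0"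
proof -
  from assms(1) obtain \<pi> where \<omega>: "\<omega> = arrows_of {1..N} \<pi>"
    and ex: "\<forall>m\<in>{1..N}. \<exists>x\<ge>0. up_right_path (strip N) (-1, m) (x, N + 1) (\<pi> m)"
    and le: "\<And>e. \<omega> e \<le> 1"
    by (auto simp: path_collections_def)
  from bchoice[OF ex] obtain X
    where "\<forall>m\<in>{1..N}. X m \<ge> 0 \<and> up_right_path (strip N) (-1, m) (X m, N + 1) (\<pi> m)" by blast
  then have X: "\<And>m. m \<in> {1..N} \<Longrightarrow> X m \<ge> 0"
    "\<And>m. m \<in> {1..N} \<Longrightarrow> up_right_path (strip N) (-1, m) (X m, N + 1) (\<pi> m)" by blast+
  show "\<omega> e \<le> 1" for e by (rule le)
  show "conserving N \<omega>" unfolding \<omega>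
    by (rule arrows_of_conserving[where a = "\<lambda>m. (-1, m)" and b = "\<lambda>m. (X m, N + 1)"])
      (use X in \<open>auto simp: strip_def\<close>)
  have last: "((X m, N), (X m, N + 1)) \<in> path_edges (\<pi> m)" if m: "m \<in> {1..N}" for m
  proof -
    define i where "i = length (\<pi> m) - 2"
    have p: "length (\<pi> m) \<ge> 2" "\<pi> m ! 0 = (-1, m)" "\<pi> m ! (length (\<pi> m) - 1) = (X m, N + 1)"
      "\<forall>i. 0 < i \<and> Suc i < length (\<pi> m) \<longrightarrow> \<pi> m ! i \<in> strip N"
      "\<forall>i. Suc i < length (\<pi> m) \<longrightarrow> up_right_step (\<pi> m ! i) (\<pi> m ! Suc i)"
      using X(2)[OF m] by (auto simp: up_right_path_iff)
    have i: "Suc i < length (\<pi> m)" "Suc i = length (\<pi> m) - 1" using p by (auto simp: i_def)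
    have st: "up_right_step (\<pi> m ! i) (X m, N + 1)" using p i by metis
    have "snd (\<pi> m ! i) \<le> N"
    proof (cases "i = 0")
      case False
      then have "\<pi> m ! i \<in> strip N" using p i by auto
      then show ?thesis by (auto simp: strip_def)
    qed (use p m in auto)
    then have "\<pi> m ! i = (X m, N)" using st by (auto simp: up_right_step_def prod_eq_iff)
    then show ?thesis using i p by (auto simp: path_edges_iff intro!: exI[of _ i])
  qed
  have XL: "X m < int L" if m: "m \<in> {1..N}" for m
  proof (rule ccontr)
    assume "\<not> X m < int L"
    then have "\<omega> ((X m, N), (X m, N + 1)) = 0" using assms(2) by simp
    then have "{i \<in> {1..N}. ((X m, N), (X m, N + 1)) \<in> path_edges (\<pi> i)} = {}"
      by (simp add: \<omega> arrows_of_def)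
    then show False using last[OF m] m by auto
  qed
  show "supported L N \<omega>"
    unfolding supported_def
  proof (intro allI impI)
    fix e assume "\<omega> e \<noteq> 0"
    then obtain m where m: "m \<in> {1..N}" "e \<in> path_edges (\<pi> m)"
      using arrows_of_nonzero[of "{1..N}" \<pi> e] unfolding \<omega> by blast
    obtain x y x' y' where e: "e = ((x, y), (x', y'))" by (metis surj_pair)
    note X2 = X(2)[OF m(1)]
    have st: "up_right_step (x, y) (x', y')" using path_edge_step[OF X2] m e by auto
    have b: "x \<ge> -1" "x' < int L"
      using path_fst_bounds[OF X2] path_edge_set[OF X2, of "(x, y)" "(x', y')"] m e XL[OF m(1)] by fastforce+
    have en: "(x, y) = (-1, m) \<or> (x, y) \<in> strip N" "(x', y') = (X m, N + 1) \<or> (x', y') \<in> strip N"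
      using path_edge_ends[OF X2] m e by auto
    show "(\<exists>x y. 0 \<le> x \<and> x < int L \<and> y \<le> N \<and> e = ((x, y), (x, y + 1))) \<or>
      (\<exists>x y. -1 \<le> x \<and> x < int L - 1 \<and> 1 \<le> y \<and> y \<le> N \<and> e = ((x, y), (x + 1, y)))"
      using st b en m X(1)[OF m(1)] unfolding e by (auto simp: up_right_step_def strip_def)
  qed
  show "\<omega> ((-1, y), (0, y)) = 1" if y: "1 \<le> y" "y \<le> N" for y
  proof -
    have "{m \<in> {1..N}. ((-1, y), (0, y)) \<in> path_edges (\<pi> m)} = {y}"
    proof (intro equalityI subsetI)
      fix m assume m: "m \<in> {m \<in> {1..N}. ((-1, y), (0, y)) \<in> path_edges (\<pi> m)}"
      then have "(-1, y) = (-1, m) \<or> (-1, y) \<in> strip N" using path_edge_ends[OF X(2)[of m]] by blast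
      then show "m \<in> {y}" by (auto simp: strip_def)
    next
      fix m assume "m \<in> {y}"
      then have m: "m = y" by simp
      have p: "length (\<pi> y) \<ge> 2" "\<pi> y ! 0 = (-1, y)" "\<pi> y ! (length (\<pi> y) - 1) = (X y, N + 1)"
        "\<forall>i. 0 < i \<and> Suc i < length (\<pi> y) \<longrightarrow> \<pi> y ! i \<in> strip N"
        "\<forall>i. Suc i < length (\<pi> y) \<longrightarrow> up_right_step (\<pi> y ! i) (\<pi> y ! Suc i)"
        using X(2)[of y] y by (auto simp: up_right_path_iff)
      have st: "up_right_step (-1, y) (\<pi> y ! 1)" using p by (metis One_nat_def Suc_1 Suc_le_lessD)
      have "fst (\<pi> y ! 1) \<ge> 0"
      proof (cases "length (\<pi> y) = 2")
        case True
        then show ?thesis using p X(1)[of y] y by auto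
      next
        case False
        then have "\<pi> y ! 1 \<in> strip N" using p by auto
        then show ?thesis by (auto simp: strip_def)
      qed
      then have "\<pi> y ! 1 = (0, y)" using st by (auto simp: up_right_step_def)
      then show "m \<in> {m \<in> {1..N}. ((-1, y), (0, y)) \<in> path_edges (\<pi> m)}"
        using p y by (auto simp: m path_edges_iff intro!: exI[of _ 0])
    qed
    then show ?thesis by (simp add: \<omega> arrows_of_def)
  qed
  show "\<omega> ((x, 0), (x, Suc 0)) = 0" for x
  proof (rule ccontr)
    assume "\<omega> ((x, 0), (x, Suc 0)) \<noteq> 0"
    then obtain m where m: "m \<in> {1..N}" "((x, 0), (x, Suc 0)) \<in> path_edges (\<pi> m)"
      using arrows_of_nonzero[of "{1..N}" \<pi>] unfolding \<omega> by blast
    then have "(x, 0) = (-1, m) \<or> (x, 0) \<in> strip N" using path_edge_ends[OF X(2)[of m]] by blast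
    then show False using m by (auto simp: strip_def)
  qed
qed

text \<open>The value \<open>f (Suc j)\<close> is the x-coordinate of the vertical edge by which the
  path leaves row \<open>j\<close>, and \<open>f y\<close> that of its starting point.\<close>

fun stair :: "(nat \<Rightarrow> int) \<Rightarrow> nat \<Rightarrow> nat \<Rightarrow> point list" where
  "stair f y 0 = [(f y, y)]"
| "stair f y (Suc d) = map (\<lambda>x. (x, y)) [f y..f (Suc y)] @ stair f (Suc y) d"

lemma stair_basic:
  assumes "\<And>j. y \<le> j \<Longrightarrow> j < y + d \<Longrightarrow> f j \<le> f (Suc j)"
  shows "stair f y d \<noteq> [] \<and> hd (stair f y d) = (f y, y) \<and> last (stair f y d) = (f (y + d), y + d) \<and>
    set (stair f y d) = {(x, j). y \<le> j \<and> j < y + d \<and> f j \<le> x \<and> x \<le> f (Suc j)} \<union> {(f (y + d), y + d)}"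
  using assms
proof (induction d arbitrary: y)
  case 0
  then show ?case by auto
next
  case (Suc d)
  have le: "f y \<le> f (Suc y)" using Suc.prems[of y] by simp
  then have u: "[f y..f (Suc y)] = f y # [f y + 1..f (Suc y)]" by (simp add: upto_rec1)
  have IH: "stair f (Suc y) d \<noteq> []" "last (stair f (Suc y) d) = (f (Suc y + d), Suc y + d)"
    "set (stair f (Suc y) d) = {(x, j). Suc y \<le> j \<and> j < Suc y + d \<and> f j \<le> x \<and> x \<le> f (Suc j)} \<union> {(f (Suc y + d), Suc y + d)}"
    using Suc.IH[of "Suc y"] Suc.prems by auto
  have "set (stair f y (Suc d)) = (\<lambda>x. (x, y)) ` {f y..f (Suc y)} \<union> set (stair f (Suc y) d)" by simp
  also have "\<dots> = {(x, j). y \<le> j \<and> j < y + Suc d \<and> f j \<le> x \<and> x \<le> f (Suc j)} \<union> {(f (y + Suc d), y + Suc d)}"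
    unfolding IH(3) by (auto simp: Suc_le_eq le_less)
  finally show ?case using u IH(1,2) by simp
qed

lemma path_edges_append:
  "xs \<noteq> [] \<Longrightarrow> ys \<noteq> [] \<Longrightarrow> path_edges (xs @ ys) = path_edges xs \<union> {(last xs, hd ys)} \<union> path_edges ys"
proof (induction xs)
  case (Cons x xs)
  show ?case
  proof (cases "xs = []")
    case True
    then show ?thesis using Cons by (cases ys) (auto simp: path_edges_def)
  next
    case False
    then obtain z zs where "xs = z # zs" by (cases xs) auto
    then show ?thesis using Cons by (auto simp: path_edges_def)
  qed
qed simp

lemma path_edges_row:
  assumes "a \<le> b"
  shows "path_edges (map (\<lambda>x. (x, y)) [a..b]) = {((x, y), (x + 1, y)) |x. a \<le> x \<and> x < (b::int)}"
proof -
  have "(p, p') \<in> path_edges (map (\<lambda>x. (x, y)) [a..b]) \<longleftrightarrow> (\<exists>x. p = (x, y) \<and> p' = (x + 1, y) \<and> a \<le> x \<and> x < b)" for p p'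
  proof
    assume "(p, p') \<in> path_edges (map (\<lambda>x. (x, y)) [a..b])"
    then obtain i where "Suc i < length [a..b]" "p = ([a..b] ! i, y)" "p' = ([a..b] ! Suc i, y)"
      by (auto simp: path_edges_iff)
    then show "\<exists>x. p = (x, y) \<and> p' = (x + 1, y) \<and> a \<le> x \<and> x < b"
      by (intro exI[of _ "a + int i"]) (auto simp: nth_upto)
  next
    assume "\<exists>x. p = (x, y) \<and> p' = (x + 1, y) \<and> a \<le> x \<and> x < b"
    then obtain x where x: "p = (x, y)" "p' = (x + 1, y)" "a \<le> x" "x < b" by blast
    then show "(p, p') \<in> path_edges (map (\<lambda>x. (x, y)) [a..b])"
      unfolding path_edges_iff by (intro exI[of _ "nat (x - a)"]) (auto simp: nth_upto)
  qed
  then show ?thesis by auto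
qed

lemma stair_edges:
  assumes "\<And>j. y \<le> j \<Longrightarrow> j < y + d \<Longrightarrow> f j \<le> f (Suc j)"
  shows "path_edges (stair f y d) =
    {((f (Suc j), j), (f (Suc j), Suc j)) |j. y \<le> j \<and> j < y + d} \<union>
    {((x, j), (x + 1, j)) |x j. y \<le> j \<and> j < y + d \<and> f j \<le> x \<and> x < f (Suc j)}"
  using assms
proof (induction d arbitrary: y)
  case 0
  then show ?case by (auto simp: path_edges_def)
next
  case (Suc d)
  have le: "f y \<le> f (Suc y)" using Suc.prems[of y] by simp
  have b: "stair f (Suc y) d \<noteq> []" "hd (stair f (Suc y) d) = (f (Suc y), Suc y)"
    using stair_basic[of "Suc y" d f] Suc.prems by auto
  have l: "last (map (\<lambda>x. (x, y)) [f y..f (Suc y)]) = (f (Suc y), y)"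
    using le by (simp add: last_map upto_rec2)
  have "path_edges (stair f y (Suc d)) = {((x, y), (x + 1, y)) |x. f y \<le> x \<and> x < f (Suc y)} \<union>
      {((f (Suc y), y), (f (Suc y), Suc y))} \<union> path_edges (stair f (Suc y) d)"
    using le b l by (simp add: path_edges_append path_edges_row)
  also have "path_edges (stair f (Suc y) d) =
    {((f (Suc j), j), (f (Suc j), Suc j)) |j. Suc y \<le> j \<and> j < Suc y + d} \<union>
    {((x, j), (x + 1, j)) |x j. Suc y \<le> j \<and> j < Suc y + d \<and> f j \<le> x \<and> x < f (Suc j)}"
    using Suc.prems by (intro Suc.IH) auto
  also have "{((x, y), (x + 1, y)) |x. f y \<le> x \<and> x < f (Suc y)} \<union>
      {((f (Suc y), y), (f (Suc y), Suc y))} \<union> \<dots> =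
    {((f (Suc j), j), (f (Suc j), Suc j)) |j. y \<le> j \<and> j < y + Suc d} \<union>
    {((x, j), (x + 1, j)) |x j. y \<le> j \<and> j < y + Suc d \<and> f j \<le> x \<and> x < f (Suc j)}"
    by (auto simp: Suc_le_eq le_less)
  finally show ?case .
qed

lemma stair_successively:
  assumes "\<And>j. y \<le> j \<Longrightarrow> j < y + d \<Longrightarrow> f j \<le> f (Suc j)"
  shows "successively up_right_step (stair f y d)"
proof -
  have "up_right_step p p'" if "(p, p') \<in> path_edges (stair f y d)" for p p'
    using that stair_edges[of y d f] assms by (auto simp: up_right_step_def)
  then show ?thesis
    unfolding successively_conv_nth path_edges_iff by blast
qed

lemma up_right_pathI:
  assumes "successively up_right_step \<pi>" "length \<pi> \<ge> 2" "hd \<pi> = a" "last \<pi> = b" "set \<pi> - {a, b} \<subseteq> D"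
  shows "up_right_path D a b \<pi>"
proof -
  have "\<pi> \<noteq> []" using assms(2) by auto
  then have U: "up_right_path UNIV a b \<pi>"
    using assms unfolding up_right_path_iff by (auto simp: hd_conv_nth last_conv_nth successively_conv_nth)
  have "\<pi> ! i \<in> D" if i: "0 < i" "Suc i < length \<pi>" for i
  proof -
    have "fst (\<pi> ! i) + int (snd (\<pi> ! i)) = fst a + int (snd a) + int i"
      "fst b + int (snd b) = fst a + int (snd a) + int (length \<pi> - 1)"
      using path_rank[OF U, of i] path_rank[OF U, of "length \<pi> - 1"] U i by (auto simp: up_right_path_iff)
    then have "\<pi> ! i \<noteq> a" "\<pi> ! i \<noteq> b" using i by auto
    then show ?thesis using assms(5) i by auto
  qed
  then show ?thesis using U by (auto simp: up_right_path_iff)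
qed

lemma stair_path:
  assumes "\<And>j. y \<le> j \<Longrightarrow> j < y + d \<Longrightarrow> f j \<le> f (Suc j)" "d \<ge> 1" "a = (f y, y)" "b = (f (y + d), y + d)"
    and "\<And>x j. y \<le> j \<Longrightarrow> j < y + d \<Longrightarrow> f j \<le> x \<Longrightarrow> x \<le> f (Suc j) \<Longrightarrow> (x, j) \<noteq> a \<Longrightarrow> (x, j) \<in> D"
  shows "up_right_path D a b (stair f y d)"
proof (rule up_right_pathI)
  note B = stair_basic[of y d f, OF assms(1)]
  have "hd (stair f y d) \<noteq> last (stair f y d)" using B assms(2) by auto
  with B show "length (stair f y d) \<ge> 2"
    by (cases "stair f y d" rule: list.exhaust; cases "tl (stair f y d)") auto
  show "set (stair f y d) - {a, b} \<subseteq> D" using B assms by auto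
qed (use stair_basic[of y d f] stair_successively[of y d f] assms in auto)

section \<open>Positions of paths and the balance of arrows\<close>

definition count_le :: "int set \<Rightarrow> int \<Rightarrow> nat" where
  "count_le A x = card {a \<in> A. a \<le> x}"

definition kth :: "int set \<Rightarrow> nat \<Rightarrow> int" where
  "kth A j = sorted_list_of_set A ! (j - 1)"

text \<open>This Galois connection translates the balance of arrow numbers into inequalities between
  positions of paths.\<close>

lemma kth_le_iff:
  assumes "finite A" "1 \<le> j" "j \<le> card A"
  shows "kth A j \<le> x \<longleftrightarrow> j \<le> count_le A x"
proof -
  define xs where "xs = sorted_list_of_set A"
  have xs: "sorted xs" "distinct xs" "set xs = A" "length xs = card A"
    using assms by (auto simp: xs_def)
  define I where "I = {i. i < length xs \<and> xs ! i \<le> x}"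
  have "{a \<in> A. a \<le> x} = (\<lambda>i. xs ! i) ` I" by (auto simp: I_def xs(3)[symmetric] in_set_conv_nth)
  then have c: "count_le A x = card I"
    unfolding count_le_def using xs(2) by (auto simp: I_def inj_on_def nth_eq_iff_index_eq intro!: card_image)
  have fin: "finite I" by (simp add: I_def)
  show ?thesis
  proof
    assume "kth A j \<le> x"
    then have "xs ! i \<le> x" if "i < j" for i
    proof -
      have "xs ! i \<le> xs ! (j - 1)" using that assms xs by (intro sorted_nth_mono) auto
      then show ?thesis using \<open>kth A j \<le> x\<close> by (simp add: kth_def xs_def)
    qed
    then have "{..<j} \<subseteq> I" using assms xs by (auto simp: I_def)
    then have "card {..<j} \<le> card I" by (rule card_mono[OF fin])
    then show "j \<le> count_le A x" unfolding c by simp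
  next
    assume j: "j \<le> count_le A x"
    show "kth A j \<le> x"
    proof (rule ccontr)
      assume k: "\<not> kth A j \<le> x"
      have "i < j - 1" if "i \<in> I" for i
      proof (rule ccontr)
        assume "\<not> i < j - 1"
        then have "xs ! (j - 1) \<le> xs ! i" using that xs by (intro sorted_nth_mono) (auto simp: I_def)
        then show False using k that by (simp add: I_def kth_def xs_def)
      qed
      then have "I \<subseteq> {..<j - 1}" by auto
      then have "card I \<le> j - 1" using card_mono[of "{..<j - 1}" I] by simp
      then show False using j assms unfolding c by simp
    qed
  qed
qed

lemma kth_mem: "finite A \<Longrightarrow> 1 \<le> j \<Longrightarrow> j \<le> card A \<Longrightarrow> kth A j \<in> A"
  unfolding kth_def using nth_mem[of "j - 1" "sorted_list_of_set A"] by simp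

lemma count_le_le: "finite A \<Longrightarrow> count_le A x \<le> card A"
  unfolding count_le_def by (intro card_mono) auto

lemma card_kth_le:
  assumes "finite A" "card A = c"
  shows "card {m \<in> {1..c}. kth A (c + 1 - m) \<le> x} = count_le A x"
proof -
  have "{m \<in> {1..c}. kth A (c + 1 - m) \<le> x} = {m \<in> {1..c}. c + 1 - m \<le> count_le A x}"
    using kth_le_iff[OF assms(1)] assms(2) by auto
  also have "\<dots> = {c + 1 - count_le A x..c}" using count_le_le[OF assms(1), of x] assms(2) by auto
  finally show ?thesis using count_le_le[OF assms(1), of x] assms(2) by simp
qed

lemma count_le_step: "finite A \<Longrightarrow> count_le A x = count_le A (x - 1) + of_bool (x \<in> A)"
proof -
  assume "finite A"
  have "{a \<in> A. a \<le> x} = {a \<in> A. a \<le> x - 1} \<union> {a. a = x \<and> a \<in> A}" by auto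
  then have "count_le A x = count_le A (x - 1) + card {a. a = x \<and> a \<in> A}"
    unfolding count_le_def using \<open>finite A\<close> by (simp add: card_Un_disjoint disjoint_iff)
  moreover have "card {a. a = x \<and> a \<in> A} = of_bool (x \<in> A)"
    by (cases "x \<in> A") (auto simp: Collect_conv_if)
  ultimately show ?thesis by simp
qed

lemma card_kth_eq:
  assumes "finite A" "card A = c"
  shows "card {m \<in> {1..c}. kth A (c + 1 - m) = x} = of_bool (x \<in> A)"
proof -
  have eq: "{m \<in> {1..c}. kth A (c + 1 - m) = x} =
     {m \<in> {1..c}. kth A (c + 1 - m) \<le> x} - {m \<in> {1..c}. kth A (c + 1 - m) \<le> x - 1}" by auto
  then have "card {m \<in> {1..c}. kth A (c + 1 - m) = x} = count_le A x - count_le A (x - 1)"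
    using card_kth_le[OF assms, of x] card_kth_le[OF assms, of "x - 1"]
    unfolding eq by (subst card_Diff_subset) auto
  then show ?thesis using count_le_step[OF assms(1), of x] by simp
qed

definition vset :: "arrows \<Rightarrow> nat \<Rightarrow> int set" where
  "vset \<omega> y = {x. \<omega> ((x, y), (x, y + 1)) \<noteq> 0}"

lemma supported_vertical:
  assumes "supported L n \<omega>" "\<omega> ((x, y), (x, y + 1)) \<noteq> 0"
  shows "0 \<le> x \<and> x < int L \<and> y \<le> n"
proof -
  from assms(1)[unfolded supported_def, rule_format, OF assms(2)] show ?thesis
    by (elim disjE exE conjE) simp_all
qed

lemma supported_horizontal:
  assumes "supported L n \<omega>" "\<omega> ((x, y), (x + 1, y)) \<noteq> 0"
  shows "-1 \<le> x \<and> x < int L - 1 \<and> 1 \<le> y \<and> y \<le> n"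
proof -
  from assms(1)[unfolded supported_def, rule_format, OF assms(2)] show ?thesis
    by (elim disjE exE conjE) simp_all
qed

lemma supported_vset: "supported L n \<omega> \<Longrightarrow> vset \<omega> y \<subseteq> {0..<int L}"
proof
  assume s: "supported L n \<omega>"
  fix x assume "x \<in> vset \<omega> y"
  then have "\<omega> ((x, y), (x, y + 1)) \<noteq> 0" by (simp add: vset_def)
  from supported_vertical[OF s this] show "x \<in> {0..<int L}" by simp
qed

lemma supported_finite_vset: "supported L n \<omega> \<Longrightarrow> finite (vset \<omega> y)"
  by (rule finite_subset[OF supported_vset]) auto

text \<open>Conservation summed over the columns up to \<open>x\<close>: whatever enters this part
  of the row and does not leave it upwards crosses its right boundary.\<close>

lemma row_balance:
  assumes "conserving n \<omega>" "supported L n \<omega>" "\<And>e. \<omega> e \<le> 1" "1 \<le> y" "y \<le> n" "-1 \<le> x"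
  shows "\<omega> ((x, y), (x + 1, y)) + count_le (vset \<omega> y) x = \<omega> ((-1, y), (0, y)) + count_le (vset \<omega> (y - 1)) x"
  using assms(6)
proof (induction x rule: int_ge_induct)
  case base
  have "count_le (vset \<omega> y) (-1) = 0" for y
  proof -
    have "{a \<in> vset \<omega> y. a \<le> -1} = {}" using supported_vset[OF assms(2), of y] by force
    then show ?thesis unfolding count_le_def by (metis card.empty)
  qed
  then show ?case by simp
next
  case (step x)
  have w: "\<omega> ((x + 1, z), (x + 1, z + 1)) = of_bool (x + 1 \<in> vset \<omega> z)" for z
    using assms(3)[of "((x + 1, z), (x + 1, z + 1))"] by (auto simp: vset_def le_Suc_eq)
  have "\<omega> ((x + 1, y - 1), (x + 1, y)) + \<omega> ((x, y), (x + 1, y)) =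
      \<omega> ((x + 1, y), (x + 1, y + 1)) + \<omega> ((x + 1, y), (x + 1 + 1, y))"
    using assms(1)[unfolded conserving_def, rule_format, of "x + 1" y] step(1) assms(4,5) by simp
  then show ?case
    using step w[of y] w[of "y - 1"] assms(4) count_le_step[OF supported_finite_vset[OF assms(2)], of y "x + 1"]
      count_le_step[OF supported_finite_vset[OF assms(2)], of "y - 1" "x + 1"]
    by simp
qed

lemma card_balance:
  assumes "conserving n \<omega>" "supported L n \<omega>" "\<And>e. \<omega> e \<le> 1" "1 \<le> y" "y \<le> n"
  shows "card (vset \<omega> y) = \<omega> ((-1, y), (0, y)) + card (vset \<omega> (y - 1))"
proof -
  have "count_le (vset \<omega> z) (int L) = card (vset \<omega> z)" for z
    using supported_vset[OF assms(2), of z] unfolding count_le_def by (intro arg_cong[where f = card]) force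
  moreover have "\<omega> ((int L, y), (int L + 1, y)) = 0"
  proof (rule ccontr)
    assume "\<omega> ((int L, y), (int L + 1, y)) \<noteq> 0"
    from supported_horizontal[OF assms(2) this] show False by simp
  qed
  ultimately show ?thesis using row_balance[OF assms, of "int L"] by simp
qed

lemma arrows_eqI:
  assumes "supported L n \<omega>" "supported L' n \<omega>'"
    and "\<And>x y. y \<le> n \<Longrightarrow> \<omega> ((x, y), (x, y + 1)) = \<omega>' ((x, y), (x, y + 1))"
    and "\<And>x y. 1 \<le> y \<Longrightarrow> y \<le> n \<Longrightarrow> -1 \<le> x \<Longrightarrow> \<omega> ((x, y), (x + 1, y)) = \<omega>' ((x, y), (x + 1, y))"
  shows "\<omega> = \<omega>'"
proof
  fix e
  show "\<omega> e = \<omega>' e"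
  proof (cases "\<omega> e = 0 \<and> \<omega>' e = 0")
    case False
    then have "(\<exists>x y. y \<le> n \<and> e = ((x, y), (x, y + 1))) \<or> (\<exists>x y. -1 \<le> x \<and> 1 \<le> y \<and> y \<le> n \<and> e = ((x, y), (x + 1, y)))"
      using assms(1)[unfolded supported_def, rule_format, of e] assms(2)[unfolded supported_def, rule_format, of e]
      by blast
    then show ?thesis using assms(3,4) by (elim disjE exE conjE) auto
  qed simp
qed

lemma arrows_of_stairs:
  assumes "finite I" "\<And>i j. i \<in> I \<Longrightarrow> y0 i \<le> j \<Longrightarrow> j \<le> n \<Longrightarrow> f i j \<le> f i (Suc j)" "\<And>i. i \<in> I \<Longrightarrow> y0 i \<le> n"
  defines "\<omega> \<equiv> arrows_of I (\<lambda>i. stair (f i) (y0 i) (n + 1 - y0 i))"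
  shows "\<omega> ((x, y), (x, y + 1)) = card {i \<in> I. y0 i \<le> y \<and> y \<le> n \<and> f i (Suc y) = x}"
    and "\<omega> ((x, y), (x + 1, y)) = card {i \<in> I. y0 i \<le> y \<and> y \<le> n \<and> f i y \<le> x \<and> x < f i (Suc y)}"
    and "\<omega> e \<noteq> 0 \<Longrightarrow> \<exists>i\<in>I. (\<exists>y. y0 i \<le> y \<and> y \<le> n \<and> e = ((f i (Suc y), y), (f i (Suc y), y + 1))) \<or>
       (\<exists>x y. y0 i \<le> y \<and> y \<le> n \<and> f i y \<le> x \<and> x < f i (Suc y) \<and> e = ((x, y), (x + 1, y)))"
proof -
  have E: "path_edges (stair (f i) (y0 i) (n + 1 - y0 i)) =
    {((f i (Suc j), j), (f i (Suc j), Suc j)) |j. y0 i \<le> j \<and> j \<le> n} \<union>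
    {((x, j), (x + 1, j)) |x j. y0 i \<le> j \<and> j \<le> n \<and> f i j \<le> x \<and> x < f i (Suc j)}" if "i \<in> I" for i
    using stair_edges[of "y0 i" "n + 1 - y0 i" "f i"] assms(2,3)[OF that] by (simp add: less_Suc_eq_le)
  show "\<omega> ((x, y), (x, y + 1)) = card {i \<in> I. y0 i \<le> y \<and> y \<le> n \<and> f i (Suc y) = x}"
    unfolding \<omega>_def arrows_of_def using E by (intro arg_cong[where f = card]) auto
  show "\<omega> ((x, y), (x + 1, y)) = card {i \<in> I. y0 i \<le> y \<and> y \<le> n \<and> f i y \<le> x \<and> x < f i (Suc y)}"
    unfolding \<omega>_def arrows_of_def using E by (intro arg_cong[where f = card]) auto
  assume "\<omega> e \<noteq> 0"
  then obtain i where i: "i \<in> I" "e \<in> path_edges (stair (f i) (y0 i) (n + 1 - y0 i))"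
    unfolding \<omega>_def using arrows_of_nonzero by blast
  show "\<exists>i\<in>I. (\<exists>y. y0 i \<le> y \<and> y \<le> n \<and> e = ((f i (Suc y), y), (f i (Suc y), y + 1))) \<or>
       (\<exists>x y. y0 i \<le> y \<and> y \<le> n \<and> f i y \<le> x \<and> x < f i (Suc y) \<and> e = ((x, y), (x + 1, y)))"
    using i(2) unfolding E[OF i(1)] by (intro bexI[OF _ i(1)]) auto
qed

text \<open>The paths are rebuilt without crossings: above row \<open>j\<close> the vertical arrows,
  read from the left, are given to the paths j, j - 1, ..., 1 in this order. The row balance shows
  that each path then moves to the right only.\<close>

lemma path_collectionsI:
  assumes "conserving N \<omega>" "supported L N \<omega>" "\<And>e. \<omega> e \<le> 1"
    "\<And>y. 1 \<le> y \<Longrightarrow> y \<le> N \<Longrightarrow> \<omega> ((-1, y), (0, y)) = 1" "\<And>x. \<omega> ((x, 0), (x, Suc 0)) = 0"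
  shows "\<omega> \<in> path_collections N"
proof -
  define A where "A = vset \<omega>"
  have fin: "finite (A y)" for y using supported_finite_vset[OF assms(2)] by (simp add: A_def)
  have A0: "A y \<subseteq> {0..<int L}" for y using supported_vset[OF assms(2)] by (simp add: A_def)
  have c: "card (A y) = y" if "y \<le> N" for y
    using that
  proof (induction y)
    case 0
    then show ?case using assms(5) by (simp add: A_def vset_def)
  next
    case (Suc y)
    then show ?case using card_balance[OF assms(1-3), of "Suc y"] assms(4)[of "Suc y"] by (simp add: A_def)
  qed
  have bal: "\<omega> ((x, y), (x + 1, y)) + count_le (A y) x = 1 + count_le (A (y - 1)) x" if "1 \<le> y" "y \<le> N" "-1 \<le> x" for x y
    using row_balance[OF assms(1-3) that] assms(4)[OF that(1,2)] by (simp add: A_def)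
  \<comment> \<open>Path \<open>m\<close> starts at x = -1 in row \<open>m\<close>. Of the
    \<open>j - 1\<close> arrows entering a later row \<open>j\<close> from below, it uses the one
    that is (j - m)-th from the left.\<close>
  define f where "f m j = (if j = m then -1 else kth (A (j - 1)) (j - m))" for m j
  have f0: "f m (Suc j) \<ge> 0" "f m (Suc j) < int L" if "1 \<le> m" "m \<le> j" "j \<le> N" for m j
  proof -
    have "kth (A j) (Suc j - m) \<in> A j" using that c[of j] by (intro kth_mem fin) auto
    then show "f m (Suc j) \<ge> 0" "f m (Suc j) < int L" using A0[of j] that by (auto simp: f_def)
  qed
  have mono: "f m j \<le> f m (Suc j)" if "1 \<le> m" "m \<le> j" "j \<le> N" for m j
  proof (cases "j = m")
    case True
    then show ?thesis using f0[OF that] by (simp add: f_def)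
  next
    case False
    define x where "x = f m (Suc j)"
    have x: "x = kth (A j) (Suc j - m)" using that by (simp add: x_def f_def)
    have "Suc j - m \<le> count_le (A j) x"
      using kth_le_iff[OF fin, of "Suc j - m" j x] that c[of j] x by simp
    then have "j - m \<le> count_le (A (j - 1)) x"
      using bal[of j x] f0[OF that] that assms(3)[of "((x, j), (x + 1, j))"] by (simp add: x_def)
    then have "kth (A (j - 1)) (j - m) \<le> x"
      using kth_le_iff[OF fin, of "j - m" "j - 1" x] that c[of "j - 1"] False by simp
    then show ?thesis using False by (simp add: f_def x_def)
  qed
  define \<pi> where "\<pi> m = stair (f m) m (N + 1 - m)" for m
  have \<pi>: "\<pi> = (\<lambda>i. stair (f i) i (N + 1 - i))" by (simp add: \<pi>_def fun_eq_iff)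
  have mono': "\<And>i j. i \<in> {1..N} \<Longrightarrow> i \<le> j \<Longrightarrow> j \<le> N \<Longrightarrow> f i j \<le> f i (Suc j)" "\<And>i. i \<in> {1..N} \<Longrightarrow> i \<le> N"
    using mono by auto
  note S = arrows_of_stairs[where I = "{1..N}" and ?y0.0 = "\<lambda>m. m" and n = N and f = f, OF _ mono', folded \<pi>]
  have S1: "arrows_of {1..N} \<pi> ((x, y), (x, y + 1)) = card {i \<in> {1..N}. i \<le> y \<and> y \<le> N \<and> f i (Suc y) = x}" for x y
    by (rule S(1)) auto
  have S2: "arrows_of {1..N} \<pi> ((x, y), (x + 1, y)) =
      card {i \<in> {1..N}. i \<le> y \<and> y \<le> N \<and> f i y \<le> x \<and> x < f i (Suc y)}" for x y
    by (rule S(2)) auto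
  have S3: "\<exists>i\<in>{1..N}. (\<exists>y. i \<le> y \<and> y \<le> N \<and> e = ((f i (Suc y), y), (f i (Suc y), y + 1))) \<or>
      (\<exists>x y. i \<le> y \<and> y \<le> N \<and> f i y \<le> x \<and> x < f i (Suc y) \<and> e = ((x, y), (x + 1, y)))"
    if "arrows_of {1..N} \<pi> e \<noteq> 0" for e
    by (rule S(3)[OF _ _ _ _ _ that]) auto
  have path: "up_right_path (strip N) (-1, m) (f m (N + 1), N + 1) (\<pi> m)" if "m \<in> {1..N}" for m
    unfolding \<pi>_def
  proof (rule stair_path)
    fix x j assume h: "m \<le> j" "j < m + (N + 1 - m)" "f m j \<le> x" "x \<le> f m (Suc j)" "(x, j) \<noteq> (-1, m)"
    have "x \<ge> 0"
    proof (cases "j = m")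
      case True
      then show ?thesis using h by (simp add: f_def)
    next
      case False
      then obtain i where "j = Suc i" "m \<le> i" using h by (cases j) auto
      then show ?thesis using h f0[of m i] that by auto
    qed
    then show "(x, j) \<in> strip N" using h that by (auto simp: strip_def)
  qed (use that mono in \<open>auto simp: f_def\<close>)
  have "\<omega> = arrows_of {1..N} \<pi>"
  proof (rule arrows_eqI)
    show "supported L N \<omega>" by fact
    show "supported L N (arrows_of {1..N} \<pi>)"
      unfolding supported_def
    proof (intro allI impI)
      fix e assume "arrows_of {1..N} \<pi> e \<noteq> 0"
      then obtain m where m: "1 \<le> m" "m \<le> N"
        "(\<exists>y. m \<le> y \<and> y \<le> N \<and> e = ((f m (Suc y), y), (f m (Suc y), y + 1))) \<or>
         (\<exists>x y. m \<le> y \<and> y \<le> N \<and> f m y \<le> x \<and> x < f m (Suc y) \<and> e = ((x, y), (x + 1, y)))"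
        using S3[of e] by (metis atLeastAtMost_iff)
      have fm: "f m y \<ge> -1" if "m \<le> y" "y \<le> N" for y
        using f0[of m "y - 1"] m that by (cases "y = m"; cases y) (auto simp: f_def)
      from m(3) show "(\<exists>x y. 0 \<le> x \<and> x < int L \<and> y \<le> N \<and> e = ((x, y), (x, y + 1))) \<or>
        (\<exists>x y. -1 \<le> x \<and> x < int L - 1 \<and> 1 \<le> y \<and> y \<le> N \<and> e = ((x, y), (x + 1, y)))"
      proof (elim disjE exE conjE)
        fix y assume "m \<le> y" "y \<le> N" "e = ((f m (Suc y), y), (f m (Suc y), y + 1))"
        then show ?thesis using f0[of m y] m by (intro disjI1 exI[of _ "f m (Suc y)"] exI[of _ y]) auto
      next
        fix x y assume "m \<le> y" "y \<le> N" "f m y \<le> x" "x < f m (Suc y)" "e = ((x, y), (x + 1, y))"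
        then show ?thesis using f0[of m y] fm[of y] m by (intro disjI2 exI[of _ x] exI[of _ y]) auto
      qed
    qed
  next
    fix x y assume y: "y \<le> N"
    have "{m \<in> {1..N}. m \<le> y \<and> y \<le> N \<and> f m (Suc y) = x} = {m \<in> {1..y}. kth (A y) (y + 1 - m) = x}"
      using y by (auto simp: f_def)
    then have "arrows_of {1..N} \<pi> ((x, y), (x, y + 1)) = of_bool (x \<in> A y)"
      unfolding S1 using card_kth_eq[OF fin c[OF y], of x] by simp
    also have "\<dots> = \<omega> ((x, y), (x, y + 1))"
      using assms(3)[of "((x, y), (x, y + 1))"] by (auto simp: A_def vset_def le_Suc_eq)
    finally show "\<omega> ((x, y), (x, y + 1)) = arrows_of {1..N} \<pi> ((x, y), (x, y + 1))" by simp
  next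
    fix x y assume y: "1 \<le> y" "y \<le> N" and x: "-1 \<le> (x::int)"
    have "{m \<in> {1..N}. m \<le> y \<and> y \<le> N \<and> f m y \<le> x \<and> x < f m (Suc y)} =
        {m \<in> {1..y}. f m y \<le> x} - {m \<in> {1..y}. f m (Suc y) \<le> x}"
      using y by auto
    moreover have "{m \<in> {1..y}. f m (Suc y) \<le> x} \<subseteq> {m \<in> {1..y}. f m y \<le> x}"
      using mono y by force
    moreover have "card {m \<in> {1..y}. f m (Suc y) \<le> x} = count_le (A y) x"
    proof -
      have "{m \<in> {1..y}. f m (Suc y) \<le> x} = {m \<in> {1..y}. kth (A y) (y + 1 - m) \<le> x}"
        by (auto simp: f_def)
      then show ?thesis using card_kth_le[OF fin c, of y x] y by simp
    qed
    moreover have "card {m \<in> {1..y}. f m y \<le> x} = 1 + count_le (A (y - 1)) x"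
    proof -
      have "{m \<in> {1..y}. f m y \<le> x} = insert y {m \<in> {1..y - 1}. kth (A (y - 1)) ((y - 1) + 1 - m) \<le> x}"
        using y x by (auto simp: f_def)
      moreover have "y \<notin> {m \<in> {1..y - 1}. kth (A (y - 1)) ((y - 1) + 1 - m) \<le> x}" using y by auto
      ultimately show ?thesis using card_kth_le[OF fin c, of "y - 1" x] y by simp
    qed
    ultimately have "arrows_of {1..N} \<pi> ((x, y), (x + 1, y)) = 1 + count_le (A (y - 1)) x - count_le (A y) x"
      unfolding S2 by (simp add: card_Diff_subset)
    then show "\<omega> ((x, y), (x + 1, y)) = arrows_of {1..N} \<pi> ((x, y), (x + 1, y))"
      using bal[of y x] y x by simp
  qed
  moreover have "\<exists>x\<ge>0. up_right_path (strip N) (-1, m) (x, N + 1) (\<pi> m)" if "m \<in> {1..N}" for m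
    using path[OF that] f0[of m N] that by auto
  ultimately show ?thesis using assms(3) unfolding path_collections_def by auto
qed

definition desc :: "int set \<Rightarrow> int list" where
  "desc A = rev (sorted_list_of_set A)"

lemma desc_nth: "finite A \<Longrightarrow> i < card A \<Longrightarrow> desc A ! i = kth A (card A - i)"
  by (simp add: desc_def kth_def rev_nth)

lemma length_desc [simp]: "length (desc A) = card A"
  by (simp add: desc_def)

lemma card_lessThan_shift: "card {i \<in> {..<c}. P (Suc i)} = card {m \<in> {1..c}. P m}"
proof -
  have "{m \<in> {1..c}. P m} = Suc ` {i \<in> {..<c}. P (Suc i)}"
    by (auto simp: image_iff Bex_def) (metis Suc_le_D Suc_le_lessD Suc_pred less_eq_Suc_le)
  then show ?thesis by (simp add: card_image)
qed

lemma skew_collectionsI: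
  assumes "conserving M \<omega>" "supported L M \<omega>" "\<And>e. \<omega> e \<le> 1"
    "\<And>y. 1 \<le> y \<Longrightarrow> y \<le> M \<Longrightarrow> \<omega> ((-1, y), (0, y)) = 0"
  shows "\<omega> \<in> skew_collections M (desc (vset \<omega> M)) (desc (vset \<omega> 0))"
proof -
  define A where "A = vset \<omega>"
  define c where "c = card (A 0)"
  have fin: "finite (A y)" for y using supported_finite_vset[OF assms(2)] by (simp add: A_def)
  have A0: "A y \<subseteq> {0..<int L}" for y using supported_vset[OF assms(2)] by (simp add: A_def)
  have c: "card (A y) = c" if "y \<le> M" for y
    using that
  proof (induction y)
    case (Suc y)
    then show ?case using card_balance[OF assms(1-3), of "Suc y"] assms(4)[of "Suc y"] by (simp add: A_def)
  qed (simp add: c_def)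
  have bal: "\<omega> ((x, y), (x + 1, y)) + count_le (A y) x = count_le (A (y - 1)) x" if "1 \<le> y" "y \<le> M" "-1 \<le> x" for x y
    using row_balance[OF assms(1-3) that] assms(4)[OF that(1,2)] by (simp add: A_def)
  define f where "f i j = kth (A (j - 1)) (c - i)" for i j
  have f0: "f i (Suc j) \<ge> 0" "f i (Suc j) < int L" if "i < c" "j \<le> M" for i j
  proof -
    have "kth (A j) (c - i) \<in> A j" using that c[of j] by (intro kth_mem fin) auto
    then show "f i (Suc j) \<ge> 0" "f i (Suc j) < int L" using A0[of j] that by (auto simp: f_def)
  qed
  have mono: "f i j \<le> f i (Suc j)" if "i < c" "j \<le> M" for i j
  proof (cases "j = 0")
    case False
    define x where "x = f i (Suc j)"
    have x: "x = kth (A j) (c - i)" by (simp add: x_def f_def)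
    have "c - i \<le> count_le (A j) x"
      using kth_le_iff[OF fin, of "c - i" j x] that c[of j] x by simp
    then have "c - i \<le> count_le (A (j - 1)) x"
      using bal[of j x] f0[OF that] that False by (simp add: x_def)
    then have "kth (A (j - 1)) (c - i) \<le> x"
      using kth_le_iff[OF fin, of "c - i" "j - 1" x] that c[of "j - 1"] by simp
    then show ?thesis by (simp add: f_def x_def)
  qed (simp add: f_def)
  define \<pi> where "\<pi> i = stair (f i) 0 (M + 1)" for i
  have \<pi>: "\<pi> = (\<lambda>i. stair (f i) 0 (M + 1 - 0))" by (simp add: \<pi>_def fun_eq_iff)
  have mono': "\<And>i j. i \<in> {..<c} \<Longrightarrow> 0 \<le> j \<Longrightarrow> j \<le> M \<Longrightarrow> f i j \<le> f i (Suc j)" "\<And>i. i \<in> {..<c} \<Longrightarrow> 0 \<le> M"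
    using mono by auto
  note S = arrows_of_stairs[where I = "{..<c}" and ?y0.0 = "\<lambda>_. 0" and n = M and f = f, OF _ mono', folded \<pi>]
  have S1: "arrows_of {..<c} \<pi> ((x, y), (x, y + 1)) = card {i \<in> {..<c}. 0 \<le> y \<and> y \<le> M \<and> f i (Suc y) = x}" for x y
    by (rule S(1)) auto
  have S2: "arrows_of {..<c} \<pi> ((x, y), (x + 1, y)) =
      card {i \<in> {..<c}. 0 \<le> y \<and> y \<le> M \<and> f i y \<le> x \<and> x < f i (Suc y)}" for x y
    by (rule S(2)) auto
  have S3: "\<exists>i\<in>{..<c}. (\<exists>y. 0 \<le> y \<and> y \<le> M \<and> e = ((f i (Suc y), y), (f i (Suc y), y + 1))) \<or>
      (\<exists>x y. 0 \<le> y \<and> y \<le> M \<and> f i y \<le> x \<and> x < f i (Suc y) \<and> e = ((x, y), (x + 1, y)))"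
    if "arrows_of {..<c} \<pi> e \<noteq> 0" for e
    by (rule S(3)[OF _ _ _ _ _ that]) auto
  have path: "up_right_path (strip M) (f i 0, 0) (f i (M + 1), M + 1) (\<pi> i)" if "i < c" for i
    unfolding \<pi>_def
  proof (rule stair_path)
    fix x j assume h: "0 \<le> j" "j < 0 + (M + 1)" "f i j \<le> x" "x \<le> f i (Suc j)" "(x, j) \<noteq> (f i 0, 0)"
    have j: "j \<noteq> 0"
    proof
      assume "j = 0"
      with h show False by (simp add: f_def)
    qed
    then obtain j' where "j = Suc j'" by (cases j) auto
    then have "x \<ge> 0" using h f0[of i j'] that by auto
    then show "(x, j) \<in> strip M" using h j by (auto simp: strip_def)
  qed (use that mono in \<open>auto simp: f_def\<close>)
  have "\<omega> = arrows_of {..<c} \<pi>"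
  proof (rule arrows_eqI)
    show "supported L M \<omega>" by fact
    show "supported L M (arrows_of {..<c} \<pi>)"
      unfolding supported_def
    proof (intro allI impI)
      fix e assume "arrows_of {..<c} \<pi> e \<noteq> 0"
      then obtain i where i: "i < c"
        "(\<exists>y. 0 \<le> y \<and> y \<le> M \<and> e = ((f i (Suc y), y), (f i (Suc y), y + 1))) \<or>
         (\<exists>x y. 0 \<le> y \<and> y \<le> M \<and> f i y \<le> x \<and> x < f i (Suc y) \<and> e = ((x, y), (x + 1, y)))"
        using S3[of e] by (metis lessThan_iff)
      from i(2) show "(\<exists>x y. 0 \<le> x \<and> x < int L \<and> y \<le> M \<and> e = ((x, y), (x, y + 1))) \<or>
        (\<exists>x y. -1 \<le> x \<and> x < int L - 1 \<and> 1 \<le> y \<and> y \<le> M \<and> e = ((x, y), (x + 1, y)))"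
      proof (elim disjE exE conjE)
        fix y assume "y \<le> M" "e = ((f i (Suc y), y), (f i (Suc y), y + 1))"
        then show ?thesis using f0[of i y] i by (intro disjI1 exI[of _ "f i (Suc y)"] exI[of _ y]) auto
      next
        fix x y assume h: "y \<le> M" "f i y \<le> x" "x < f i (Suc y)" "e = ((x, y), (x + 1, y))"
        have "y \<noteq> 0"
        proof
          assume "y = 0"
          with h show False by (simp add: f_def)
        qed
        then obtain y' where "y = Suc y'" by (cases y) auto
        then show ?thesis using h f0[of i y] f0[of i y'] i by (intro disjI2 exI[of _ x] exI[of _ y]) auto
      qed
    qed
  next
    fix x y assume y: "y \<le> M"
    have "{i \<in> {..<c}. 0 \<le> y \<and> y \<le> M \<and> f i (Suc y) = x} = {i \<in> {..<c}. kth (A y) (c + 1 - Suc i) = x}"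
      using y by (auto simp: f_def)
    then have "arrows_of {..<c} \<pi> ((x, y), (x, y + 1)) = of_bool (x \<in> A y)"
      unfolding S1 using card_kth_eq[OF fin c[OF y], of x] card_lessThan_shift[of c "\<lambda>m. kth (A y) (c + 1 - m) = x"]
      by simp
    also have "\<dots> = \<omega> ((x, y), (x, y + 1))"
      using assms(3)[of "((x, y), (x, y + 1))"] by (auto simp: A_def vset_def le_Suc_eq)
    finally show "\<omega> ((x, y), (x, y + 1)) = arrows_of {..<c} \<pi> ((x, y), (x, y + 1))" by simp
  next
    fix x y assume y: "1 \<le> y" "y \<le> M" and x: "-1 \<le> (x::int)"
    have "{i \<in> {..<c}. 0 \<le> y \<and> y \<le> M \<and> f i y \<le> x \<and> x < f i (Suc y)} =
        {i \<in> {..<c}. f i y \<le> x} - {i \<in> {..<c}. f i (Suc y) \<le> x}"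
      using y by auto
    moreover have "{i \<in> {..<c}. f i (Suc y) \<le> x} \<subseteq> {i \<in> {..<c}. f i y \<le> x}"
      using mono y by force
    moreover have "card {i \<in> {..<c}. f i (Suc z) \<le> x} = count_le (A z) x" if "z \<le> M" for z
      using card_kth_le[OF fin c[OF that], of x] card_lessThan_shift[of c "\<lambda>m. kth (A z) (c + 1 - m) \<le> x"]
      by (simp add: f_def)
    from this[of y] this[of "y - 1"] have "card {i \<in> {..<c}. f i (Suc y) \<le> x} = count_le (A y) x"
      "card {i \<in> {..<c}. f i y \<le> x} = count_le (A (y - 1)) x" using y by simp_all
    ultimately have "arrows_of {..<c} \<pi> ((x, y), (x + 1, y)) = count_le (A (y - 1)) x - count_le (A y) x"
      unfolding S2 by (simp add: card_Diff_subset)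
    then show "\<omega> ((x, y), (x + 1, y)) = arrows_of {..<c} \<pi> ((x, y), (x + 1, y))"
      using bal[of y x] y x by simp
  qed
  moreover have "up_right_path (strip M) (desc (A 0) ! i, 0) (desc (A M) ! i, M + 1) (\<pi> i)" if "i < c" for i
    using path[OF that] that c[of 0] c[of M] fin by (simp add: desc_nth f_def)
  moreover have "length (desc (A M)) = c" using c[of M] by simp
  ultimately show ?thesis
    using assms(3) unfolding skew_collections_def A_def[symmetric] by auto
qed

lemma skew_collections_conserving:
  assumes "\<omega> \<in> skew_collections M l n" "\<And>x. x \<in> set l \<Longrightarrow> 0 \<le> x \<and> x < int L" "length n = length l"
    "\<And>x. x \<in> set n \<Longrightarrow> 0 \<le> x" "M \<ge> 1"
  shows "conserving M \<omega>" "supported L M \<omega>" "\<And>x y. \<omega> ((x, y), (x + 1, y)) \<le> 1"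
    "\<And>y. 1 \<le> y \<Longrightarrow> y \<le> M \<Longrightarrow> \<omega> ((-1, y), (0, y)) = 0"
    "\<And>x. \<omega> ((x, 0), (x, Suc 0)) = count_list n x" "\<And>x. \<omega> ((x, M), (x, Suc M)) = count_list l x"
    "\<And>x. x \<in> set n \<Longrightarrow> x < int L"
proof -
  from assms(1) obtain \<pi> where \<omega>: "\<omega> = arrows_of {..<length l} \<pi>"
    and P: "\<And>i. i < length l \<Longrightarrow> up_right_path (strip M) (n ! i, 0) (l ! i, M + 1) (\<pi> i)"
    and le: "\<And>x y. \<omega> ((x, y), (x + 1, y)) \<le> 1"
    by (auto simp: skew_collections_def)
  show "\<omega> ((x, y), (x + 1, y)) \<le> 1" for x y by (rule le)
  show "conserving M \<omega>" unfolding \<omega>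
    by (rule arrows_of_conserving[where a = "\<lambda>i. (n ! i, 0)" and b = "\<lambda>i. (l ! i, M + 1)"])
      (use P in \<open>auto simp: strip_def\<close>)
  have nl: "0 \<le> n ! i" "0 \<le> l ! i" "l ! i < int L" if "i < length l" for i
    using assms(2)[of "l ! i"] assms(4)[of "n ! i"] assms(3) that by auto
  have nl': "n ! i \<le> l ! i" if "i < length l" for i
  proof -
    have "(n ! i, 0::nat) \<in> set (\<pi> i)" using P[OF that] by (auto simp: up_right_path_def)
    then show ?thesis using path_fst_bounds[OF P[OF that]] by fastforce
  qed
  show "x < int L" if "x \<in> set n" for x
    using that nl nl' assms(3) by (auto simp: in_set_conv_nth) (metis order.strict_trans1)
  have ends: "x \<ge> 0 \<and> x' < int L \<and> ((x, y) = (n ! i, 0) \<or> (x, y) \<in> strip M) \<and> ((x', y') = (l ! i, M + 1) \<or> (x', y') \<in> strip M)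
     \<and> up_right_step (x, y) (x', y')"
    if "((x, y), (x', y')) \<in> path_edges (\<pi> i)" "i < length l" for x y x' y' i
    using path_edge_ends[OF P[OF that(2)] that(1)] path_edge_step[OF P[OF that(2)] that(1)]
      path_fst_bounds[OF P[OF that(2)], of "(x, y)"] path_fst_bounds[OF P[OF that(2)], of "(x', y')"]
      path_edge_set[OF P[OF that(2)] that(1)] nl[OF that(2)] by auto
  have edge: "\<exists>i<length l. e \<in> path_edges (\<pi> i)" if "\<omega> e \<noteq> 0" for e
    using that arrows_of_nonzero[of "{..<length l}" \<pi> e] unfolding \<omega> by blast
  show "supported L M \<omega>"
    unfolding supported_def
  proof (intro allI impI)
    fix e assume "\<omega> e \<noteq> 0"
    then obtain i where i: "i < length l" "e \<in> path_edges (\<pi> i)" using edge by blast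
    obtain x y x' y' where e: "e = ((x, y), (x', y'))" by (metis surj_pair)
    show "(\<exists>x y. 0 \<le> x \<and> x < int L \<and> y \<le> M \<and> e = ((x, y), (x, y + 1))) \<or>
      (\<exists>x y. -1 \<le> x \<and> x < int L - 1 \<and> 1 \<le> y \<and> y \<le> M \<and> e = ((x, y), (x + 1, y)))"
      using ends[OF i(2)[unfolded e] i(1)] assms(5) unfolding e by (auto simp: up_right_step_def strip_def)
  qed
  show "\<omega> ((-1, y), (0, y)) = 0" if "1 \<le> y" "y \<le> M" for y
    using edge[of "((-1, y), (0, y))"] ends[of "-1" y 0 y] by force
  have card_idx: "card {i \<in> {..<length xs}. xs ! i = x} = count_list xs x" for xs :: "int list" and x
    by (auto simp: count_list_eq_length_filter length_filter_conv_card intro!: arg_cong[where f = card])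
  have first: "((x, 0), (x, Suc 0)) \<in> path_edges (\<pi> i) \<longleftrightarrow> n ! i = x" if i: "i < length l" for i x
  proof
    assume "((x, 0), (x, Suc 0)) \<in> path_edges (\<pi> i)"
    from ends[OF this i] show "n ! i = x" by (auto simp: strip_def)
  next
    assume x: "n ! i = x"
    have p: "length (\<pi> i) \<ge> 2" "\<pi> i ! 0 = (x, 0)" "\<pi> i ! (length (\<pi> i) - 1) = (l ! i, M + 1)"
      "\<forall>j. 0 < j \<and> Suc j < length (\<pi> i) \<longrightarrow> \<pi> i ! j \<in> strip M"
      "\<forall>j. Suc j < length (\<pi> i) \<longrightarrow> up_right_step (\<pi> i ! j) (\<pi> i ! Suc j)"
      using P[OF i] x by (auto simp: up_right_path_iff)
    have st: "up_right_step (x, 0) (\<pi> i ! 1)" using p by (metis One_nat_def Suc_1 Suc_le_lessD)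
    have "snd (\<pi> i ! 1) \<ge> 1"
    proof (cases "length (\<pi> i) = 2")
      case False
      then have "\<pi> i ! 1 \<in> strip M" using p by auto
      then show ?thesis by (auto simp: strip_def)
    qed (use p in auto)
    then have "\<pi> i ! 1 = (x, 1)" using st by (auto simp: up_right_step_def)
    then show "((x, 0), (x, Suc 0)) \<in> path_edges (\<pi> i)"
      using p by (auto simp: path_edges_iff intro!: exI[of _ 0])
  qed
  have "{i \<in> {..<length l}. ((x, 0), (x, Suc 0)) \<in> path_edges (\<pi> i)} = {i \<in> {..<length n}. n ! i = x}" for x
    using first assms(3) by auto
  then show "\<omega> ((x, 0), (x, Suc 0)) = count_list n x" for x
    unfolding \<omega> arrows_of_def card_idx[symmetric] by simp
  have last: "((x, M), (x, Suc M)) \<in> path_edges (\<pi> i) \<longleftrightarrow> l ! i = x" if i: "i < length l" for i x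
  proof
    assume "((x, M), (x, Suc M)) \<in> path_edges (\<pi> i)"
    from ends[OF this i] show "l ! i = x" by (auto simp: strip_def)
  next
    assume x: "l ! i = x"
    define j where "j = length (\<pi> i) - 2"
    have p: "length (\<pi> i) \<ge> 2" "\<pi> i ! 0 = (n ! i, 0)" "\<pi> i ! (length (\<pi> i) - 1) = (x, M + 1)"
      "\<forall>j. 0 < j \<and> Suc j < length (\<pi> i) \<longrightarrow> \<pi> i ! j \<in> strip M"
      "\<forall>j. Suc j < length (\<pi> i) \<longrightarrow> up_right_step (\<pi> i ! j) (\<pi> i ! Suc j)"
      using P[OF i] x by (auto simp: up_right_path_iff)
    have j: "Suc j < length (\<pi> i)" "Suc j = length (\<pi> i) - 1" using p by (auto simp: j_def)
    have st: "up_right_step (\<pi> i ! j) (x, M + 1)" using p j by metis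
    have "snd (\<pi> i ! j) \<le> M"
    proof (cases "j = 0")
      case False
      then have "\<pi> i ! j \<in> strip M" using p j by auto
      then show ?thesis by (auto simp: strip_def)
    qed (use p in auto)
    then have "\<pi> i ! j = (x, M)" using st by (auto simp: up_right_step_def prod_eq_iff)
    then show "((x, M), (x, Suc M)) \<in> path_edges (\<pi> i)"
      using j p by (auto simp: path_edges_iff intro!: exI[of _ j])
  qed
  have "{i \<in> {..<length l}. ((x, M), (x, Suc M)) \<in> path_edges (\<pi> i)} = {i \<in> {..<length l}. l ! i = x}" for x
    using last by auto
  then show "\<omega> ((x, M), (x, Suc M)) = count_list l x" for x
    unfolding \<omega> arrows_of_def card_idx[symmetric] by simp
qed

section \<open>Weights of arrow configurations\<close>

definition states :: "nat \<Rightarrow> bool list set" where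
  "states L = {xs. length xs = L}"

lemma states_0: "states 0 = {[]}" by (auto simp: states_def)

lemma states_Suc: "states (Suc L) = Cons False ` states L \<union> Cons True ` states L"
proof -
  have "xs \<in> Cons False ` states L \<union> Cons True ` states L" if "length xs = Suc L" for xs
    using that by (cases xs; cases "hd xs") (auto simp: states_def)
  then show ?thesis by (auto simp: states_def)
qed

lemma finite_states [simp]: "finite (states L)"
  by (induction L) (simp_all add: states_0 states_Suc)

lemma sum_states_Suc: "(\<Sum>ys\<in>states (Suc L). f ys) = (\<Sum>ys\<in>states L. f (False # ys)) + (\<Sum>ys\<in>states L. f (True # ys))"
  unfolding states_Suc by (subst sum.union_disjoint) (auto simp: sum.reindex)

text \<open>Horizontal arrows are not part of the data, since conservation determines them from the
  vertical ones. The last equation forbids an arrow leaving to the right.\<close>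

fun row_weight :: "(nat \<times> nat \<times> nat \<times> nat \<Rightarrow> real) \<Rightarrow> int \<Rightarrow> bool list \<Rightarrow> bool list \<Rightarrow> real" where
  "row_weight f a (x # xs) (y # ys) =
     (let b = a + of_bool x - of_bool y in
      if b = 0 \<or> b = 1 then f (of_bool x, nat a, of_bool y, nat b) * row_weight f b xs ys else 0)"
| "row_weight f a xs ys = of_bool (xs = [] \<and> ys = [] \<and> a = 0)"

text \<open>Conjugation by these factors makes the rows of both weights stochastic.\<close>

fun gauge :: "real \<Rightarrow> nat \<Rightarrow> bool list \<Rightarrow> real" where
  "gauge s i [] = 1"
| "gauge s i (x # xs) = (if x then - s\<^sup>2 * (- s) ^ i else 1) * gauge s (Suc i) xs"

locale sixv = unit_parameter +
  fixes s :: real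
  assumes s0: "s > 0" and s2q: "s\<^sup>2 * q = 1"
begin

definition par :: "real \<Rightarrow> real" where
  "par u = (u - s) / (u - s * q)"

lemma sq: "s * q = 1 / s"
  using s2q s0 by (simp add: field_simps power2_eq_square)

lemma q_eq: "q = 1 / s\<^sup>2"
  using s2q s0 by (simp add: field_simps)

lemma s1: "s > 1"
proof -
  have "s\<^sup>2 > 1" using q s0 unfolding q_eq by (simp add: field_simps)
  then show ?thesis using s0 by (simp add: power2_eq_square) (metis less_1_mult' mult_le_one linorder_not_less order_less_imp_le)
qed

lemma weight_values:
  assumes "s * u \<noteq> 1"
  shows "weight q s u (0, 0, 0, 0) = 1"
    "weight q s u (0, Suc 0, 0, Suc 0) = - par u / s"
    "weight q s u (0, Suc 0, Suc 0, 0) = - (1 - par u) / s\<^sup>2"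
    "weight q s u (Suc 0, 0, Suc 0, 0) = q * par u"
    "weight q s u (Suc 0, 0, 0, Suc 0) = (1 - q * par u) * s"
    "weight q s u (Suc 0, Suc 0, Suc 0, Suc 0) = - 1 / s"
proof -
  have d: "1 - s * u \<noteq> 0" "s * u - 1 \<noteq> 0" using assms by auto
  have p: "par u = s * (u - s) / (s * u - 1)" unfolding par_def sq using s0 d by (simp add: field_simps)
  have ss: "s * (s * q) = 1" using s2q by (simp add: power2_eq_square)
  show "weight q s u (0, 0, 0, 0) = 1" using d by (simp add: weight_def)
  show "weight q s u (0, Suc 0, 0, Suc 0) = - par u / s"
    using d s0 by (simp add: weight_def p) (simp add: field_simps)
  show "weight q s u (0, Suc 0, Suc 0, 0) = - (1 - par u) / s\<^sup>2"
    using d s0 unfolding p unfolding q_eq by (simp add: weight_def) (simp add: field_simps power2_eq_square)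
  show "weight q s u (Suc 0, 0, Suc 0, 0) = q * par u"
    using d s0 unfolding p unfolding q_eq by (simp add: weight_def) (simp add: field_simps power2_eq_square)
  have "q * par u = (u - s) / (s * (s * u - 1))"
    unfolding p unfolding q_eq using d s0 by (simp add: field_simps power2_eq_square)
  then have "(1 - q * par u) * s = (s - (u - s) / (s * u - 1))"
    using d s0 by (simp add: field_simps)
  also have "\<dots> = (1 - s\<^sup>2) * u / (1 - s * u)"
    using d by (simp add: divide_simps) (simp add: algebra_simps power2_eq_square)
  finally show "weight q s u (Suc 0, 0, 0, Suc 0) = (1 - q * par u) * s"
    by (simp add: weight_def)
  show "weight q s u (Suc 0, Suc 0, Suc 0, Suc 0) = - 1 / s"
    using d s0 unfolding q_eq by (simp add: weight_def) (simp add: field_simps power2_eq_square)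
qed

lemma par_inverse:
  assumes "0 < v" "s * v < 1"
  shows "par (1 / v) = s * (1 - s * v) / (s - v)" "par (1 / v) > 0" "s - v > 0"
proof -
  have "v * 1 < s * v" using assms s1 by simp
  then have sv: "s - v > 0" using assms s1 by linarith
  show "par (1 / v) = s * (1 - s * v) / (s - v)"
    unfolding par_def sq using s0 assms sv by (simp add: field_simps)
  then show "par (1 / v) > 0" using assms s0 sv by simp
  show "s - v > 0" by (rule sv)
qed

lemma weight_c_values:
  assumes "0 < v" "s * v < 1"
  shows "weight_c q s v (0, 0, 0, 0) = 1"
    "weight_c q s v (0, Suc 0, 0, Suc 0) = - s / par (1 / v)"
    "weight_c q s v (0, Suc 0, Suc 0, 0) = - s\<^sup>2 * (1 - q * par (1 / v)) / par (1 / v)"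
    "weight_c q s v (Suc 0, 0, Suc 0, 0) = 1 / par (1 / v)"
    "weight_c q s v (Suc 0, 0, 0, Suc 0) = (1 - par (1 / v)) / (par (1 / v) * s)"
    "weight_c q s v (Suc 0, Suc 0, Suc 0, Suc 0) = - q * s"
proof -
  note p = par_inverse[OF assms]
  have d: "1 - s * v \<noteq> 0" "s - v \<noteq> 0" using assms p(3) by auto
  show "weight_c q s v (0, 0, 0, 0) = 1" using d by (simp add: weight_c_def)
  show "weight_c q s v (0, Suc 0, 0, Suc 0) = - s / par (1 / v)"
    using d s0 by (simp add: weight_c_def p(1)) (simp add: field_simps)
  have "q * par (1 / v) = (1 / s - v) / (s - v)"
    unfolding p(1) unfolding q_eq using d s0 by (simp add: field_simps power2_eq_square)
  then have "1 - q * par (1 / v) = (s - 1 / s) / (s - v)"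
    using d by (simp add: field_simps)
  then have "- s\<^sup>2 * (1 - q * par (1 / v)) / par (1 / v) = - s\<^sup>2 * (s - 1 / s) / (s * (1 - s * v))"
    using d s0 unfolding p(1) by simp
  also have "\<dots> = (1 - s\<^sup>2) / (1 - s * v)"
    using d s0 by (simp add: divide_simps) (simp add: algebra_simps power2_eq_square)
  finally show "weight_c q s v (0, Suc 0, Suc 0, 0) = - s\<^sup>2 * (1 - q * par (1 / v)) / par (1 / v)"
    by (simp add: weight_c_def)
  show "weight_c q s v (Suc 0, 0, Suc 0, 0) = 1 / par (1 / v)"
    using d s0 unfolding p(1) unfolding q_eq by (simp add: weight_c_def) (simp add: field_simps power2_eq_square)
  show "weight_c q s v (Suc 0, 0, 0, Suc 0) = (1 - par (1 / v)) / (par (1 / v) * s)"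
  proof -
    have "1 - par (1 / v) = (s\<^sup>2 - 1) * v / (s - v)"
      unfolding p(1) using d by (simp add: divide_simps) (simp add: algebra_simps power2_eq_square)
    then have "(1 - par (1 / v)) / (par (1 / v) * s) = (s\<^sup>2 - 1) * v / (s * s * (1 - s * v))"
      unfolding p(1) using d s0 by (simp add: divide_simps)
    also have "\<dots> = (1 - q) * v / (1 - s * v)"
      unfolding q_eq using d s0 by (simp add: divide_simps) (simp add: algebra_simps power2_eq_square)
    finally show ?thesis by (simp add: weight_c_def)
  qed
  show "weight_c q s v (Suc 0, Suc 0, Suc 0, Suc 0) = - q * s"
    using d s0 unfolding q_eq by (simp add: weight_c_def) (simp add: field_simps power2_eq_square)
qed

definition weighted_sum :: "(nat \<times> nat \<times> nat \<times> nat \<Rightarrow> real) \<Rightarrow> nat \<Rightarrow> bool \<Rightarrow> bool list \<Rightarrow> (bool list \<Rightarrow> real) \<Rightarrow> real" where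
  "weighted_sum f i a xs h = (\<Sum>ys\<in>states (length xs). row_weight f (of_bool a) xs ys * gauge s i ys * h ys)"

definition weighted_sum' :: "(nat \<times> nat \<times> nat \<times> nat \<Rightarrow> real) \<Rightarrow> nat \<Rightarrow> bool \<Rightarrow> bool list \<Rightarrow> (bool list \<Rightarrow> real) \<Rightarrow> real" where
  "weighted_sum' f i a xs h = (\<Sum>ys\<in>states (length xs). row_weight f (of_bool a) ys xs * gauge s i ys * h ys)"

lemma weighted_sum_Cons:
  "weighted_sum f i True (True # xs) h = - s\<^sup>2 * (- s) ^ i * f (1, 1, 1, 1) * weighted_sum f (Suc i) True xs (\<lambda>ys. h (True # ys))"
  "weighted_sum f i False (False # xs) h = f (0, 0, 0, 0) * weighted_sum f (Suc i) False xs (\<lambda>ys. h (False # ys))"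
  "weighted_sum f i True (False # xs) h = f (0, 1, 0, 1) * weighted_sum f (Suc i) True xs (\<lambda>ys. h (False # ys)) +
     - s\<^sup>2 * (- s) ^ i * f (0, 1, 1, 0) * weighted_sum f (Suc i) False xs (\<lambda>ys. h (True # ys))"
  "weighted_sum f i False (True # xs) h = f (1, 0, 0, 1) * weighted_sum f (Suc i) True xs (\<lambda>ys. h (False # ys)) +
     - s\<^sup>2 * (- s) ^ i * f (1, 0, 1, 0) * weighted_sum f (Suc i) False xs (\<lambda>ys. h (True # ys))"
  by (simp_all add: weighted_sum_def sum_states_Suc sum_distrib_left mult_ac sum_negf)

lemma weighted_sum'_Cons:
  "weighted_sum' f i True (True # xs) h = - s\<^sup>2 * (- s) ^ i * f (1, 1, 1, 1) * weighted_sum' f (Suc i) True xs (\<lambda>ys. h (True # ys)) +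
     f (0, 1, 1, 0) * weighted_sum' f (Suc i) False xs (\<lambda>ys. h (False # ys))"
  "weighted_sum' f i False (False # xs) h = f (0, 0, 0, 0) * weighted_sum' f (Suc i) False xs (\<lambda>ys. h (False # ys)) +
     - s\<^sup>2 * (- s) ^ i * f (1, 0, 0, 1) * weighted_sum' f (Suc i) True xs (\<lambda>ys. h (True # ys))"
  "weighted_sum' f i True (False # xs) h = f (0, 1, 0, 1) * weighted_sum' f (Suc i) True xs (\<lambda>ys. h (False # ys))"
  "weighted_sum' f i False (True # xs) h =
     - s\<^sup>2 * (- s) ^ i * f (1, 0, 1, 0) * weighted_sum' f (Suc i) False xs (\<lambda>ys. h (True # ys))"
  by (simp_all add: weighted_sum'_def sum_states_Suc sum_distrib_left mult_ac sum_negf)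

text \<open>A horizontal arrow entering column \<open>i\<close> carries the factor
  \<open>(- s) ^ i\<close>, a vertical one in this column \<open>- s\<^sup>2 * (- s) ^ i\<close>.
  With these factors on both sides, each of the six weights turns into a transition
  probability.\<close>

lemma weighted_sum_weight:
  assumes "s * u \<noteq> 1"
  shows "weighted_sum (weight q s u) i a xs h =
    gauge s i xs * ((- s) ^ i) ^ (of_bool a) * row q (par u) a xs (\<lambda>ys r. if r then 0 else h ys)"
proof (induction xs arbitrary: i a h)
  case Nil
  then show ?case by (simp add: weighted_sum_def states_0)
next
  case (Cons x xs)
  show ?case
    using s0 by (cases x; cases a)
      (simp add: weighted_sum_Cons weight_values[OF assms] Cons.IH;
       (simp add: divide_simps)?; (simp add: algebra_simps power2_eq_square)?)+
qed

text \<open>The sum runs over the lower state, which transposes the row. After complementing the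
  horizontal arrows, the weights become probabilities when multiplied by \<open>par (1 / v)\<close>
  in every column; this is the origin of the division by L-th powers.\<close>

lemma weighted_sum'_weight_c:
  assumes "0 < v" "s * v < 1"
  shows "weighted_sum' (weight_c q s v) i a xs h =
    gauge s i xs *
    (row q (par (1 / v)) (\<not> a) xs (\<lambda>ys r. if r then h ys else 0) / par (1 / v) ^ length xs) / ((- s) ^ i) ^ (of_bool a)"
proof (induction xs arbitrary: i a h)
  case Nil
  then show ?case by (simp add: weighted_sum'_def states_0)
next
  case (Cons x xs)
  show ?case
    using s0 par_inverse(2)[OF assms] by (cases x; cases a)
      (simp add: weighted_sum'_Cons weight_c_values[OF assms] Cons.IH;
       (simp add: divide_simps)?; (simp add: algebra_simps power2_eq_square)?)+
qed

end

section \<open>Arrow configurations as sequences of states\<close>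

definition seqs :: "nat \<Rightarrow> nat \<Rightarrow> bool list list set" where
  "seqs n L = {ss. set ss \<subseteq> states L \<and> length ss = n}"

lemma finite_seqs [simp]: "finite (seqs n L)"
  unfolding seqs_def by (rule finite_lists_length_eq) simp

lemma seqs_0: "seqs 0 L = {[]}" by (auto simp: seqs_def)

lemma sum_seqs_Suc: "(\<Sum>ss\<in>seqs (Suc n) L. F ss) = (\<Sum>y\<in>states L. \<Sum>ss\<in>seqs n L. F (y # ss))"
proof -
  have "seqs (Suc n) L = (\<lambda>(y, ss). y # ss) ` (states L \<times> seqs n L)"
    by (auto simp: seqs_def length_Suc_conv image_iff)
  then show ?thesis
    by (simp add: sum.reindex inj_on_def case_prod_unfold sum.cartesian_product prod_eq_iff)
qed

fun leveled :: "real \<Rightarrow> (nat \<Rightarrow> bool list \<Rightarrow> bool) \<Rightarrow> nat \<Rightarrow> real list \<Rightarrow> (bool list \<Rightarrow> real) \<Rightarrow> bool list \<Rightarrow> real" where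
  "leveled q C k [] h xs = h xs"
| "leveled q C k (u # us) h xs = opB q u (\<lambda>ys. if C (Suc k) ys then leveled q C (Suc k) us h ys else 0) xs"

text \<open>This is the number of horizontal arrows entering column \<open>i\<close> that
  conservation forces. It is an integer, so that for inadmissible pairs of states it can leave the
  values 0 and 1.\<close>

definition hz :: "int \<Rightarrow> bool list \<Rightarrow> bool list \<Rightarrow> nat \<Rightarrow> int" where
  "hz a xs ys i = a + (\<Sum>j<i. of_bool (xs ! j) - of_bool (ys ! j))"

definition row_ok :: "int \<Rightarrow> bool list \<Rightarrow> bool list \<Rightarrow> bool" where
  "row_ok a xs ys \<longleftrightarrow> (\<forall>i\<le>length xs. hz a xs ys i \<in> {0, 1}) \<and> hz a xs ys (length xs) = 0"

lemma hz_0 [simp]: "hz a xs ys 0 = a" by (simp add: hz_def)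

lemma hz_Suc: "hz a xs ys (Suc i) = hz a xs ys i + of_bool (xs ! i) - of_bool (ys ! i)"
  by (simp add: hz_def)

lemma hz_Cons: "hz a (x # xs) (y # ys) (Suc i) = hz (a + of_bool x - of_bool y) xs ys i"
  unfolding hz_def by (subst sum.lessThan_Suc_shift) simp

lemma row_weight_ok:
  assumes "row_weight f a xs ys \<noteq> 0" "length ys = length xs" "a = 0 \<or> a = 1"
  shows "row_ok a xs ys"
  using assms
proof (induction f a xs ys rule: row_weight.induct)
  case (1 f a x xs y ys)
  define b where "b = a + of_bool x - of_bool y"
  have b: "b = 0 \<or> b = 1" "row_weight f b xs ys \<noteq> 0"
    using 1(2) by (auto simp: b_def[symmetric] Let_def split: if_splits)
  have IH: "row_ok b xs ys" using 1(1)[OF b_def b(1)] 1(3) b by simp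
  have "hz a (x # xs) (y # ys) i \<in> {0, 1}" if "i \<le> length (x # xs)" for i
    using that IH 1(4) by (cases i) (auto simp: hz_Cons b_def[symmetric] row_ok_def)
  then show ?case using IH by (simp add: row_ok_def hz_Cons b_def[symmetric])
qed (auto simp: row_ok_def)

definition state_at :: "arrows \<Rightarrow> nat \<Rightarrow> nat \<Rightarrow> bool list" where
  "state_at \<omega> L y = map (\<lambda>i. \<omega> ((int i, y), (int i, y + 1)) = 1) [0..<L]"

lemma length_state_at [simp]: "length (state_at \<omega> L y) = L" by (simp add: state_at_def)

lemma state_at_mem [simp]: "state_at \<omega> L y \<in> states L" by (simp add: states_def)

definition confs :: "nat \<Rightarrow> nat \<Rightarrow> nat \<Rightarrow> arrows set" where
  "confs l L n = {\<omega>. conserving n \<omega> \<and> supported L n \<omega> \<and> (\<forall>e. \<omega> e \<le> 1) \<and>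
     (\<forall>y. 1 \<le> y \<and> y \<le> n \<longrightarrow> \<omega> ((-1, y), (0, y)) = l)}"

lemma confs_le: "\<omega> \<in> confs l L n \<Longrightarrow> \<omega> e \<le> 1"
  unfolding confs_def by blast

lemma confs_01: "\<omega> \<in> confs l L n \<Longrightarrow> \<omega> e = 0 \<or> \<omega> e = 1"
  using confs_le[of \<omega> l L n e] by linarith

lemma confs_horizontal_end:
  "\<omega> \<in> confs l L n \<Longrightarrow> \<omega> ((int L - 1, y), (int L, y)) = 0"
  using supported_horizontal[of L n \<omega> "int L - 1" y] by (auto simp: confs_def)

lemma confs_hz:
  assumes "\<omega> \<in> confs l L n" "1 \<le> y" "y \<le> n" "i \<le> L"
  shows "hz (int l) (state_at \<omega> L (y - 1)) (state_at \<omega> L y) i = int (\<omega> ((int i - 1, y), (int i, y)))"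
  using assms(4)
proof (induction i)
  case 0
  then show ?case using assms by (simp add: confs_def)
next
  case (Suc i)
  have le: "\<omega> e \<le> 1" for e using assms(1) by (rule confs_le)
  have v: "int (\<omega> ((int i, z), (int i, z + 1))) = of_bool (state_at \<omega> L z ! i)" for z
    using Suc.prems le[of "((int i, z), (int i, z + 1))"] by (auto simp: state_at_def le_Suc_eq)
  have "\<omega> ((int i, y - 1), (int i, y)) + \<omega> ((int i - 1, y), (int i, y)) =
     \<omega> ((int i, y), (int i, y + 1)) + \<omega> ((int i, y), (int i + 1, y))"
    using assms(1)[unfolded confs_def conserving_def] assms(2,3) by auto
  then have "int (\<omega> ((int i, y), (int i + 1, y))) = int (\<omega> ((int i - 1, y), (int i, y))) +
     of_bool (state_at \<omega> L (y - 1) ! i) - of_bool (state_at \<omega> L y ! i)"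
    using v[of y] v[of "y - 1"] assms(2) by simp
  then show ?case using Suc by (simp add: hz_Suc add.commute)
qed

lemma row_weight_vertex:
  assumes "\<omega> \<in> confs l L n" "1 \<le> y" "y \<le> n"
  shows "row_weight f (int l) (state_at \<omega> L (y - 1)) (state_at \<omega> L y) = (\<Prod>i<L. f (vertex \<omega> (int i) y))"
proof -
  define X Y where "X = state_at \<omega> L (y - 1)" and "Y = state_at \<omega> L y"
  define H where "H i = \<omega> ((int i - 1, y), (int i, y))" for i
  have le: "\<omega> e = 0 \<or> \<omega> e = 1" for e using assms(1) by (rule confs_01)
  have L: "length X = L" "length Y = L" by (simp_all add: X_def Y_def)
  have "row_weight f (int (H i)) (drop i X) (drop i Y) = (\<Prod>j\<in>{i..<L}. f (vertex \<omega> (int j) y))" if "i \<le> L" for i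
    using that
  proof (induction i rule: inc_induct)
    case base
    then show ?case using confs_horizontal_end[OF assms(1), of y] by (simp add: L H_def)
  next
    case (step i)
    have d: "drop i X = X ! i # drop (Suc i) X" "drop i Y = Y ! i # drop (Suc i) Y"
      using step L by (simp_all add: Cons_nth_drop_Suc)
    have b: "int (H i) + of_bool (X ! i) - of_bool (Y ! i) = int (H (Suc i))"
      using confs_hz[OF assms, of i] confs_hz[OF assms, of "Suc i"] step
      by (simp add: hz_Suc H_def X_def Y_def)
    have b01: "H (Suc i) = 0 \<or> H (Suc i) = 1" "H i = 0 \<or> H i = 1" using le by (simp_all add: H_def)
    have v: "(of_bool (X ! i), H i, of_bool (Y ! i), H (Suc i)) = vertex \<omega> (int i) y"
      using step le[of "((int i, y - 1), (int i, y))"] le[of "((int i, y), (int i, y + 1))"] assms(2)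
      by (auto simp: vertex_def X_def Y_def state_at_def H_def add.commute)
    have "row_weight f (int (H i)) (drop i X) (drop i Y) =
        f (vertex \<omega> (int i) y) * row_weight f (int (H (Suc i))) (drop (Suc i) X) (drop (Suc i) Y)"
      unfolding d using b b01 v[symmetric] by (simp add: Let_def)
    also have "\<dots> = f (vertex \<omega> (int i) y) * (\<Prod>j\<in>{Suc i..<L}. f (vertex \<omega> (int j) y))"
      using step by simp
    also have "\<dots> = (\<Prod>j\<in>{i..<L}. f (vertex \<omega> (int j) y))"
      using step by (subst (2) prod.atLeast_Suc_lessThan) auto
    finally show ?case .
  qed
  from this[of 0] have "row_weight f (int (H 0)) X Y = (\<Prod>j<L. f (vertex \<omega> (int j) y))"
    by (simp add: atLeast0LessThan)
  moreover have "H 0 = l" using assms by (simp add: H_def confs_def)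
  ultimately show ?thesis by (simp add: X_def Y_def)
qed

text \<open>This inverts the passage from a configuration to its states; the horizontal arrows are
  the forced ones.\<close>

definition conf_of :: "nat \<Rightarrow> nat \<Rightarrow> nat \<Rightarrow> bool list list \<Rightarrow> arrows" where
  "conf_of l L n S = (\<lambda>((x, y), (x', y')).
     if x' = x \<and> y' = y + 1 \<and> 0 \<le> x \<and> x < int L \<and> y \<le> n then of_bool (S ! y ! nat x)
     else if x' = x + 1 \<and> y' = y \<and> -1 \<le> x \<and> x < int L - 1 \<and> 1 \<le> y \<and> y \<le> n
       then nat (hz (int l) (S ! (y - 1)) (S ! y) (nat (x + 1)))
     else 0)"

lemma conf_of_confs:
  assumes "L \<ge> 1" "l \<le> 1" "length S = Suc n" "set S \<subseteq> states L"
    and ok: "\<And>y. 1 \<le> y \<Longrightarrow> y \<le> n \<Longrightarrow> row_ok (int l) (S ! (y - 1)) (S ! y)"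
  shows "conf_of l L n S \<in> confs l L n" "y \<le> n \<Longrightarrow> state_at (conf_of l L n S) L y = S ! y"
proof -
  define \<omega> where "\<omega> = conf_of l L n S"
  have len: "length (S ! y) = L" if "y \<le> n" for y
  proof -
    have "S ! y \<in> states L" using that assms(3,4) nth_mem[of y S] by auto
    then show ?thesis by (simp add: states_def)
  qed
  have V: "\<omega> ((x, y), (x, y + 1)) = (if 0 \<le> x \<and> x < int L \<and> y \<le> n then of_bool (S ! y ! nat x) else 0)" for x y
    by (simp add: \<omega>_def conf_of_def)
  have H: "\<omega> ((x, y), (x + 1, y)) = (if -1 \<le> x \<and> x < int L - 1 \<and> 1 \<le> y \<and> y \<le> n
      then nat (hz (int l) (S ! (y - 1)) (S ! y) (nat (x + 1))) else 0)" for x y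
    by (simp add: \<omega>_def conf_of_def)
  have hz01: "hz (int l) (S ! (y - 1)) (S ! y) i = 0 \<or> hz (int l) (S ! (y - 1)) (S ! y) i = 1"
    if "1 \<le> y" "y \<le> n" "i \<le> L" for y i
    using ok[OF that(1,2)] that len[of "y - 1"] by (auto simp: row_ok_def)
  have hzL: "hz (int l) (S ! (y - 1)) (S ! y) L = 0" if "1 \<le> y" "y \<le> n" for y
    using ok[OF that(1,2)] that len[of "y - 1"] by (auto simp: row_ok_def)
  have "supported L n \<omega>"
    unfolding supported_def
  proof (intro allI impI)
    fix e assume e: "\<omega> e \<noteq> 0"
    obtain x y x' y' where e': "e = ((x, y), (x', y'))" by (metis surj_pair)
    show "(\<exists>x y. 0 \<le> x \<and> x < int L \<and> y \<le> n \<and> e = ((x, y), x, y + 1)) \<or>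
         (\<exists>x y. - 1 \<le> x \<and> x < int L - 1 \<and> 1 \<le> y \<and> y \<le> n \<and> e = ((x, y), x + 1, y))"
      using e unfolding e' \<omega>_def conf_of_def by (auto split: if_splits)
  qed
  moreover have "\<omega> e \<le> 1" for e
  proof -
    obtain x y x' y' where e': "e = ((x, y), (x', y'))" by (metis surj_pair)
    have "nat (x + 1) \<le> L" if "x < int L - 1" using that by (simp add: nat_le_iff)
    then show ?thesis using hz01[of y "nat (x + 1)"] unfolding e' \<omega>_def conf_of_def by auto
  qed
  moreover have "\<omega> ((-1, y), (0, y)) = l" if "1 \<le> y" "y \<le> n" for y
    using H[of "-1" y] that assms(1) by simp
  moreover have "conserving n \<omega>"
    unfolding conserving_def
  proof (intro allI impI)
    fix x :: int and y :: nat assume xy: "0 \<le> x" "1 \<le> y" "y \<le> n"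
    define i where "i = nat x"
    have x: "x = int i" using xy by (simp add: i_def)
    have y1: "y - Suc 0 \<le> n" using xy by simp
    have l: "\<omega> ((x, y - 1), (x, y)) = (if i < L then of_bool (S ! (y - 1) ! i) else 0)"
      "\<omega> ((x, y), (x, y + 1)) = (if i < L then of_bool (S ! y ! i) else 0)"
      using V[of x "y - 1"] V[of x y] xy y1 by (simp_all add: x)
    have r: "int (\<omega> ((x - 1, y), (x, y))) = (if i < L then hz (int l) (S ! (y - 1)) (S ! y) i else 0)"
      using H[of "x - 1" y] xy hz01[of y i] by (auto simp: x)
    have r': "int (\<omega> ((x, y), (x + 1, y))) = (if i < L then hz (int l) (S ! (y - 1)) (S ! y) (Suc i) else 0)"
    proof (cases "Suc i = L")
      case True
      then show ?thesis using H[of x y] hzL xy by (auto simp: x)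
    next
      case False
      have "nat (int i + 1) = Suc i" by simp
      then show ?thesis using H[of x y] xy hz01[of y "Suc i"] False by (auto simp: x)
    qed
    have "int (\<omega> ((x, y - 1), (x, y)) + \<omega> ((x - 1, y), (x, y))) = int (\<omega> ((x, y), (x, y + 1)) + \<omega> ((x, y), (x + 1, y)))"
      unfolding of_nat_add r r' unfolding l by (simp add: hz_Suc)
    then show "\<omega> ((x, y - 1), (x, y)) + \<omega> ((x - 1, y), (x, y)) = \<omega> ((x, y), (x, y + 1)) + \<omega> ((x, y), (x + 1, y))"
      by (simp only: of_nat_eq_iff)
  qed
  ultimately show "conf_of l L n S \<in> confs l L n" by (simp add: confs_def \<omega>_def)
  show "state_at (conf_of l L n S) L y = S ! y" if "y \<le> n"
    using that len[OF that] V unfolding \<omega>_def[symmetric] by (intro nth_equalityI) (auto simp: state_at_def)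
qed

lemma vset_state_at:
  assumes "\<omega> \<in> confs l L n"
  shows "vset \<omega> y = {int i |i. i < L \<and> state_at \<omega> L y ! i}"
proof -
  have s: "supported L n \<omega>" using assms by (simp add: confs_def)
  have le: "\<omega> e = 0 \<or> \<omega> e = 1" for e using assms by (rule confs_01)
  show ?thesis
  proof (intro equalityI subsetI)
    fix x assume x: "x \<in> vset \<omega> y"
    then have "x \<in> {0..<int L}" using supported_vset[OF s, of y] by blast
    then have "0 \<le> x" "x < int L" by simp_all
    then obtain i where i: "x = int i" "i < L" by (metis nonneg_int_cases of_nat_less_iff)
    have "\<omega> ((x, y), (x, y + 1)) = 1" using x le[of "((x, y), (x, y + 1))"] by (simp add: vset_def)
    then show "x \<in> {int i |i. i < L \<and> state_at \<omega> L y ! i}" using i by (auto simp: state_at_def)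
  next
    fix x assume "x \<in> {int i |i. i < L \<and> state_at \<omega> L y ! i}"
    then obtain i where i: "x = int i" "i < L" "state_at \<omega> L y ! i" by blast
    then have "\<omega> ((x, y), (x, y + 1)) = 1" by (simp add: state_at_def)
    then show "x \<in> vset \<omega> y" by (simp add: vset_def)
  qed
qed

text \<open>By \<open>row_balance\<close> the horizontal arrows are functions of the vertical ones
  and of the arrows entering from the left.\<close>

lemma confs_inj:
  assumes "\<omega> \<in> confs l L n" "\<omega>' \<in> confs l L n" "\<And>y. y \<le> n \<Longrightarrow> state_at \<omega> L y = state_at \<omega>' L y"
  shows "\<omega> = \<omega>'"
proof (rule arrows_eqI)
  show "supported L n \<omega>" "supported L n \<omega>'" using assms by (simp_all add: confs_def)
  have v: "vset \<omega> y = vset \<omega>' y" if "y \<le> n" for y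
    using assms(3)[OF that] vset_state_at[OF assms(1)] vset_state_at[OF assms(2)] by simp
  have le: "\<omega> e = 0 \<or> \<omega> e = 1" "\<omega>' e = 0 \<or> \<omega>' e = 1" for e
    using confs_01[OF assms(1), of e] confs_01[OF assms(2), of e] by auto
  show "\<omega> ((x, y), (x, y + 1)) = \<omega>' ((x, y), (x, y + 1))" if "y \<le> n" for x y
  proof -
    have "x \<in> vset \<omega> y \<longleftrightarrow> x \<in> vset \<omega>' y" using v[OF that] by simp
    then have "\<omega> ((x, y), (x, y + 1)) \<noteq> 0 \<longleftrightarrow> \<omega>' ((x, y), (x, y + 1)) \<noteq> 0"
      by (simp only: vset_def mem_Collect_eq)
    then show ?thesis using le(1)[of "((x, y), (x, y + 1))"] le(2)[of "((x, y), (x, y + 1))"] by linarith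
  qed
  show "\<omega> ((x, y), (x + 1, y)) = \<omega>' ((x, y), (x + 1, y))" if "1 \<le> y" "y \<le> n" "-1 \<le> x" for x y
  proof -
    have c: "conserving n \<omega>" "supported L n \<omega>" "\<omega> ((-1, y), (0, y)) = l"
      "conserving n \<omega>'" "supported L n \<omega>'" "\<omega>' ((-1, y), (0, y)) = l"
      using assms(1,2) that by (simp_all add: confs_def)
    have "y - 1 \<le> n" using that by simp
    then show ?thesis
      using row_balance[OF c(1,2) confs_le[OF assms(1)] that] row_balance[OF c(4,5) confs_le[OF assms(2)] that]
        v[of y] v[of "y - 1"] that c(3,6) by simp
  qed
qed

text \<open>Sequences of states that come from no configuration violate \<open>row_ok\<close> in
  some row and contribute 0. So the sum extends over all sequences, as in a product of
  matrices.\<close>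

lemma sum_confs:
  assumes "L \<ge> 1" "l \<le> 1" and F: "\<And>S y. length S = Suc n \<Longrightarrow> set S \<subseteq> states L \<Longrightarrow> P S \<Longrightarrow> 1 \<le> y \<Longrightarrow> y \<le> n \<Longrightarrow>
      \<not> row_ok (int l) (S ! (y - 1)) (S ! y) \<Longrightarrow> F S = 0"
  shows "(\<Sum>\<omega>\<in>{\<omega> \<in> confs l L n. P (map (state_at \<omega> L) [0..<Suc n])}. F (map (state_at \<omega> L) [0..<Suc n])) =
    (\<Sum>S\<in>{S. length S = Suc n \<and> set S \<subseteq> states L \<and> P S}. F S)" (is "sum ?f ?A = sum F ?B")
proof -
  define \<Phi> where "\<Phi> \<omega> = map (state_at \<omega> L) [0..<Suc n]" for \<omega>
  have \<Phi>n: "\<Phi> \<omega> ! y = state_at \<omega> L y" if "y \<le> n" for \<omega> y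
    using that nth_map_upt[of y "Suc n" 0 "state_at \<omega> L"] unfolding \<Phi>_def by simp
  have fB: "finite ?B"
    by (rule finite_subset[OF _ finite_lists_length_eq[of "states L" "Suc n"]]) auto
  have inj: "inj_on \<Phi> ?A"
  proof (rule inj_onI)
    fix \<omega> \<omega>' assume "\<omega> \<in> ?A" "\<omega>' \<in> ?A" "\<Phi> \<omega> = \<Phi> \<omega>'"
    then show "\<omega> = \<omega>'" using \<Phi>n by (intro confs_inj[of \<omega> l L n]) (auto, metis)
  qed
  have sub: "\<Phi> ` ?A \<subseteq> ?B" by (auto simp: \<Phi>_def simp del: upt_Suc)
  have "F S = 0" if "S \<in> ?B - \<Phi> ` ?A" for S
  proof (rule ccontr)
    assume "F S \<noteq> 0"
    then have ok: "\<And>y. 1 \<le> y \<Longrightarrow> y \<le> n \<Longrightarrow> row_ok (int l) (S ! (y - 1)) (S ! y)" using F that by blast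
    have S: "length S = Suc n" "set S \<subseteq> states L" "P S" using that by auto
    note C = conf_of_confs[OF assms(1,2) S(1,2) ok]
    have eq: "\<Phi> (conf_of l L n S) = S"
      using C(2) S(1) \<Phi>n by (intro nth_equalityI) (auto simp: \<Phi>_def simp del: upt_Suc)
    have "P (\<Phi> (conf_of l L n S))" unfolding eq by (rule S(3))
    then have "conf_of l L n S \<in> ?A" using C(1) unfolding \<Phi>_def by blast
    then have "\<Phi> (conf_of l L n S) \<in> \<Phi> ` ?A" by (rule imageI)
    then show False using that unfolding eq by blast
  qed
  then have "sum F ?B = sum F (\<Phi> ` ?A)" using fB sub by (intro sum.mono_neutral_right) auto
  also have "\<dots> = (\<Sum>\<omega>\<in>?A. F (\<Phi> \<omega>))" by (rule sum.reindex[OF inj, unfolded o_def])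
  finally show ?thesis by (simp add: \<Phi>_def)
qed

lemma finite_confs: "finite (confs l L n)"
proof -
  define \<Phi> where "\<Phi> \<omega> = map (state_at \<omega> L) [0..<Suc n]" for \<omega>
  have \<Phi>n: "\<Phi> \<omega> ! y = state_at \<omega> L y" if "y \<le> n" for \<omega> y
    using that nth_map_upt[of y "Suc n" 0 "state_at \<omega> L"] unfolding \<Phi>_def by simp
  have "inj_on \<Phi> (confs l L n)"
  proof (rule inj_onI)
    fix \<omega> \<omega>' assume "\<omega> \<in> confs l L n" "\<omega>' \<in> confs l L n" "\<Phi> \<omega> = \<Phi> \<omega>'"
    then show "\<omega> = \<omega>'" using \<Phi>n by (intro confs_inj[of \<omega> l L n]) (auto, metis)
  qed
  moreover have "\<Phi> ` confs l L n \<subseteq> {S. set S \<subseteq> states L \<and> length S = Suc n}"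
    by (auto simp: \<Phi>_def simp del: upt_Suc)
  then have "finite (\<Phi> ` confs l L n)" by (rule finite_subset) (rule finite_lists_length_eq, simp)
  ultimately show ?thesis by (metis finite_image_iff)
qed

lemma sum_over_paths:
  "(\<Sum>S\<in>{S. length S = Suc n \<and> set S \<subseteq> states L \<and> S ! 0 = x0 \<and> P S}. F S) =
   (\<Sum>ss\<in>seqs n L. if P (x0 # ss) then F (x0 # ss) else 0)" if "x0 \<in> states L"
proof -
  have "{S. length S = Suc n \<and> set S \<subseteq> states L \<and> S ! 0 = x0 \<and> P S} = Cons x0 ` {ss \<in> seqs n L. P (x0 # ss)}"
    using that by (auto simp: seqs_def length_Suc_conv)
  then show ?thesis by (simp add: sum.reindex sum.inter_filter)
qed

lemma supported_vertex_0:
  assumes "supported L n \<omega>" "i \<ge> L"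
  shows "vertex \<omega> (int i) y = (0, 0, 0, 0)"
proof -
  have "\<omega> ((int i, z), (int i, z + 1)) = 0" for z
    using supported_vertical[OF assms(1), of "int i" z] assms(2) by auto
  moreover have "\<omega> ((int i, y - 1), (int i, y)) = 0"
  proof (rule ccontr)
    assume "\<omega> ((int i, y - 1), (int i, y)) \<noteq> 0"
    from assms(1)[unfolded supported_def, rule_format, OF this] show False
      using assms(2) by (elim disjE exE conjE) simp_all
  qed
  moreover have "\<omega> ((int i, y), (int i + 1, y)) = 0"
    using supported_horizontal[OF assms(1), of "int i" y] assms(2) by auto
  moreover have "\<omega> ((int i - 1, y), (int i, y)) = 0"
    using supported_horizontal[OF assms(1), of "int i - 1" y] assms(2) by auto
  ultimately show ?thesis by (simp add: vertex_def)
qed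

lemma prodinf_vertices:
  assumes "supported L n \<omega>" "\<And>y. 1 \<le> y \<Longrightarrow> y \<le> n \<Longrightarrow> f y (0, 0, 0, 0) = (1::real)"
  shows "(\<Prod>i. \<Prod>y=1..n. f y (vertex \<omega> (int i) y)) = (\<Prod>i<L. \<Prod>y=1..n. f y (vertex \<omega> (int i) y))"
  by (rule prodinf_finite) (use assms supported_vertex_0[OF assms(1)] in \<open>auto intro!: prod.neutral\<close>)

lemma prodinf_confs:
  assumes "\<omega> \<in> confs l L n" "\<And>y. 1 \<le> y \<Longrightarrow> y \<le> n \<Longrightarrow> f y (0, 0, 0, 0) = (1::real)"
  shows "(\<Prod>i. \<Prod>y=1..n. f y (vertex \<omega> (int i) y)) =
    (\<Prod>y=1..n. row_weight (f y) (int l) (state_at \<omega> L (y - 1)) (state_at \<omega> L y))"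
proof -
  have "supported L n \<omega>" using assms(1) by (simp add: confs_def)
  then have "(\<Prod>i. \<Prod>y=1..n. f y (vertex \<omega> (int i) y)) = (\<Prod>i<L. \<Prod>y=1..n. f y (vertex \<omega> (int i) y))"
    using assms(2) by (rule prodinf_vertices)
  also have "\<dots> = (\<Prod>y=1..n. \<Prod>i<L. f y (vertex \<omega> (int i) y))" by (rule prod.swap)
  also have "\<dots> = (\<Prod>y=1..n. row_weight (f y) (int l) (state_at \<omega> L (y - 1)) (state_at \<omega> L y))"
    by (intro prod.cong refl, subst row_weight_vertex[OF assms(1)]) auto
  finally show ?thesis .
qed

definition pos :: "bool list \<Rightarrow> int set" where
  "pos xs = {int i |i. i < length xs \<and> xs ! i}"

lemma pos_image: "pos xs = int ` {i. i < length xs \<and> xs ! i}" by (auto simp: pos_def)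

lemma finite_pos [simp]: "finite (pos xs)" by (simp add: pos_image)

lemma occ_card: "occ xs = card {i. i < length xs \<and> xs ! i}"
  by (simp add: count_list_eq_length_filter length_filter_conv_card eq_commute[of True])

lemma card_pos: "card (pos xs) = occ xs"
  by (simp add: pos_image card_image occ_card)

lemma pos_inject: "length xs = length ys \<Longrightarrow> pos xs = pos ys \<Longrightarrow> xs = ys"
proof (rule nth_equalityI)
  assume len: "length xs = length ys" and eq: "pos xs = pos ys"
  show "xs ! i = ys ! i" if "i < length xs" for i
  proof -
    have "int i \<in> pos xs \<longleftrightarrow> xs ! i" "int i \<in> pos ys \<longleftrightarrow> ys ! i"
      using that len by (auto simp: pos_def)
    then show ?thesis unfolding eq by blast
  qed
qed

lemma vset_pos: "\<omega> \<in> confs l L n \<Longrightarrow> vset \<omega> y = pos (state_at \<omega> L y)"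
  by (simp add: vset_state_at pos_def)

lemma row_ok_occ:
  assumes "row_ok 0 xs ys" "length ys = length xs"
  shows "occ xs = occ ys"
proof -
  have "(\<Sum>j<length xs. of_bool (xs ! j) :: int) = (\<Sum>j<length xs. of_bool (ys ! j))"
    using assms(1) by (simp add: row_ok_def hz_def sum_subtractf)
  moreover have "(\<Sum>j<length zs. of_bool (zs ! j) :: int) = int (occ zs)" for zs
  proof -
    have "(\<Sum>j<length zs. of_bool (zs ! j) :: int) = (\<Sum>j\<in>{j \<in> {..<length zs}. zs ! j}. 1)"
      by (subst sum.inter_filter) (auto simp: of_bool_def)
    then show ?thesis by (simp add: occ_card)
  qed
  ultimately show ?thesis using assms(2) by (metis of_nat_eq_iff)
qed

lemma count_list_distinct: "distinct xs \<Longrightarrow> count_list xs x = of_bool (x \<in> set xs)"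
  by (induction xs) auto

lemma signature_at_confs:
  assumes "\<omega> \<in> confs l L N"
  shows "signature_at N \<omega> = desc (vset \<omega> N)"
proof -
  have fin: "finite (vset \<omega> N)" by (simp add: vset_pos[OF assms])
  have c: "count_list (desc (vset \<omega> N)) x = \<omega> ((x, N), (x, N + 1))" for x
  proof -
    have "count_list (desc (vset \<omega> N)) x = of_bool (x \<in> vset \<omega> N)"
      using fin by (auto simp: desc_def count_list_distinct)
    then show ?thesis using confs_01[OF assms, of "((x, N), (x, N + 1))"] by (auto simp: vset_def)
  qed
  show ?thesis unfolding signature_at_def
  proof (rule the_equality)
    show "sorted_wrt (\<ge>) (desc (vset \<omega> N)) \<and> (\<forall>x. count_list (desc (vset \<omega> N)) x = \<omega> ((x, N), (x, N + 1)))"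
      using c by (simp add: desc_def sorted_wrt_rev)
  next
    fix l' assume l': "sorted_wrt (\<ge>) l' \<and> (\<forall>x. count_list l' x = \<omega> ((x, N), (x, N + 1)))"
    then have "mset l' = mset (desc (vset \<omega> N))" by (intro multiset_eqI) (simp add: count_mset c)
    then have "mset (rev l') = mset (sorted_list_of_set (vset \<omega> N))" by (simp add: desc_def)
    moreover have "sorted (rev l')" using l' by (simp add: sorted_wrt_rev)
    ultimately have "rev l' = sorted_list_of_set (vset \<omega> N)"
      by (metis properties_for_sort sorted_list_of_set.sorted_sorted_key_list_of_set sorted_sort_id)
    then show "l' = desc (vset \<omega> N)" unfolding desc_def by (metis rev_rev_ident)
  qed
qed

section \<open>The path measure in terms of row operators\<close>

context sixv
begin

lemma weighted_sum_opB:
  assumes "s * u \<noteq> 1"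
  shows "gauge s 0 xs * opB q (par u) h xs =
    (\<Sum>ys\<in>states (length xs). row_weight (weight q s u) 1 xs ys * (gauge s 0 ys * h ys))"
  using weighted_sum_weight[OF assms, of 0 True xs h] by (simp add: weighted_sum_def opB_def mult_ac)

lemma weighted_sum_opD:
  assumes "0 < v" "s * v < 1"
  shows "gauge s 0 xs * (opD q (par (1 / v)) h xs / par (1 / v) ^ length xs) =
    (\<Sum>ys\<in>states (length xs). row_weight (weight_c q s v) 0 ys xs * (gauge s 0 ys * h ys))"
  using weighted_sum'_weight_c[OF assms, of 0 False xs h] by (simp add: weighted_sum'_def opD_def mult_ac)

lemma leveled_sum:
  assumes "\<And>u. u \<in> set us \<Longrightarrow> s * u \<noteq> 1" "x0 \<in> states L"
  shows "gauge s 0 x0 * leveled q C k (map par us) h x0 =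
    (\<Sum>ss\<in>seqs (length us) L. (\<Prod>j<length us. row_weight (weight q s (us ! j)) 1 ((x0 # ss) ! j) (ss ! j)) *
      (if \<forall>j<length us. C (k + Suc j) (ss ! j) then gauge s 0 (last (x0 # ss)) * h (last (x0 # ss)) else 0))"
  using assms
proof (induction us arbitrary: x0 k)
  case Nil
  then show ?case by (simp add: seqs_0)
next
  case (Cons u us)
  have L: "length x0 = L" using Cons.prems by (simp add: states_def)
  define T where "T x k ss = (\<Prod>j<length us. row_weight (weight q s (us ! j)) 1 ((x # ss) ! j) (ss ! j)) *
      (if \<forall>j<length us. C (k + Suc j) (ss ! j) then gauge s 0 (last (x # ss)) * h (last (x # ss)) else 0)" for x k ss
  have IH: "gauge s 0 y * leveled q C (Suc k) (map par us) h y = (\<Sum>ss\<in>seqs (length us) L. T y (Suc k) ss)"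
    if "y \<in> states L" for y
    unfolding T_def using Cons.prems that by (intro Cons.IH) auto
  have "gauge s 0 x0 * leveled q C k (map par (u # us)) h x0 =
     (\<Sum>y\<in>states L. row_weight (weight q s u) 1 x0 y *
        (gauge s 0 y * (if C (Suc k) y then leveled q C (Suc k) (map par us) h y else 0)))"
    using weighted_sum_opB[of u x0] Cons.prems(1)[of u] by (simp add: L)
  also have "\<dots> = (\<Sum>y\<in>states L. \<Sum>ss\<in>seqs (length us) L.
      row_weight (weight q s u) 1 x0 y * (if C (Suc k) y then T y (Suc k) ss else 0))"
    using IH by (intro sum.cong refl) (auto simp: sum_distrib_left)
  also have "\<dots> = (\<Sum>ss\<in>seqs (length (u # us)) L. (\<Prod>j<length (u # us). row_weight (weight q s ((u # us) ! j)) 1 ((x0 # ss) ! j) (ss ! j)) *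
      (if \<forall>j<length (u # us). C (k + Suc j) (ss ! j) then gauge s 0 (last (x0 # ss)) * h (last (x0 # ss)) else 0))"
    unfolding length_Cons sum_seqs_Suc
    by (intro sum.cong refl) (auto simp: T_def prod.lessThan_Suc_shift All_less_Suc2 simp del: prod.lessThan_Suc)
  finally show ?case .
qed

text \<open>Here \<open>x0\<close> is the state above the topmost row and \<open>ss\<close>
  descends, as the operators describe transposed rows.\<close>

lemma foldr_opD_sum:
  assumes "\<And>v. v \<in> set vs \<Longrightarrow> 0 < v \<and> s * v < 1" "x0 \<in> states L"
  shows "gauge s 0 x0 * (foldr (opD q) (map (\<lambda>v. par (1 / v)) vs) g x0 / prod_list (map (\<lambda>v. par (1 / v)) vs) ^ L) =
    (\<Sum>ss\<in>seqs (length vs) L. (\<Prod>j<length vs. row_weight (weight_c q s (vs ! j)) 0 (ss ! j) ((x0 # ss) ! j)) *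
      (gauge s 0 (last (x0 # ss)) * g (last (x0 # ss))))"
  using assms
proof (induction vs arbitrary: x0)
  case Nil
  then show ?case by (simp add: seqs_0)
next
  case (Cons v vs)
  have L: "length x0 = L" using Cons.prems by (simp add: states_def)
  define P where "P = prod_list (map (\<lambda>v. par (1 / v)) vs)"
  define H where "H = foldr (opD q) (map (\<lambda>v. par (1 / v)) vs) g"
  define T where "T x ss = (\<Prod>j<length vs. row_weight (weight_c q s (vs ! j)) 0 (ss ! j) ((x # ss) ! j)) *
      (gauge s 0 (last (x # ss)) * g (last (x # ss)))" for x ss
  have IH: "gauge s 0 y * (H y / P ^ L) = (\<Sum>ss\<in>seqs (length vs) L. T y ss)" if "y \<in> states L" for y
    unfolding T_def H_def P_def using Cons.prems that by (intro Cons.IH) auto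
  have v: "0 < v" "s * v < 1" using Cons.prems(1)[of v] by auto
  have "opD q (par (1 / v)) (\<lambda>y. H y / P ^ L) x0 = opD q (par (1 / v)) H x0 / P ^ L"
  proof -
    have "opD q (par (1 / v)) (\<lambda>y. H y / P ^ L) x0 = row q (par (1 / v)) True x0 (\<lambda>ys r. (1 / P ^ L) * (if r then H ys else 0))"
      unfolding opD_def by (intro row_cong) auto
    then show ?thesis unfolding row_scale by (simp add: opD_def)
  qed
  then have "gauge s 0 x0 * (foldr (opD q) (map (\<lambda>v. par (1 / v)) (v # vs)) g x0 / prod_list (map (\<lambda>v. par (1 / v)) (v # vs)) ^ L)
    = gauge s 0 x0 * (opD q (par (1 / v)) (\<lambda>y. H y / P ^ L) x0 / par (1 / v) ^ length x0)"
    by (simp add: H_def P_def power_mult_distrib L)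
  also have "\<dots> = (\<Sum>y\<in>states L. row_weight (weight_c q s v) 0 y x0 * (gauge s 0 y * (H y / P ^ L)))"
    using weighted_sum_opD[OF v, of x0 "\<lambda>y. H y / P ^ L"] by (simp add: L)
  also have "\<dots> = (\<Sum>y\<in>states L. \<Sum>ss\<in>seqs (length vs) L. row_weight (weight_c q s v) 0 y x0 * T y ss)"
    using IH by (intro sum.cong refl) (simp add: sum_distrib_left)
  also have "\<dots> = (\<Sum>ss\<in>seqs (length (v # vs)) L. (\<Prod>j<length (v # vs). row_weight (weight_c q s ((v # vs) ! j)) 0 (ss ! j) ((x0 # ss) ! j)) *
      (gauge s 0 (last (x0 # ss)) * g (last (x0 # ss))))"
    unfolding length_Cons sum_seqs_Suc
    by (intro sum.cong refl) (auto simp: T_def prod.lessThan_Suc_shift simp del: prod.lessThan_Suc)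
  finally show ?case .
qed

lemma gauge_prod: "gauge s i xs = (\<Prod>j<length xs. if xs ! j then - s\<^sup>2 * (- s) ^ (i + j) else 1)"
  by (induction xs arbitrary: i) (auto simp: prod.lessThan_Suc_shift simp del: prod.lessThan_Suc split: if_splits intro!: prod.cong)

text \<open>The product over \<open>pos xs\<close> is the factor that f attaches to a signature nu.
  The prefactor is compensated by \<open>q ^ occ xs\<close>, up to the sign in f, because s^2 q =
  1.\<close>

lemma gauge_pos: "gauge s 0 xs = (- s\<^sup>2) ^ occ xs * (\<Prod>x\<in>pos xs. (- s) powi x)"
proof -
  define I where "I = {i. i < length xs \<and> xs ! i}"
  have "gauge s 0 xs = (\<Prod>j\<in>I. - s\<^sup>2 * (- s) ^ j)"
    unfolding gauge_prod I_def by (subst prod.inter_filter[symmetric]) (auto intro!: prod.cong)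
  also have "\<dots> = (\<Prod>j\<in>I. - s\<^sup>2) * (\<Prod>j\<in>I. (- s) ^ j)" by (rule prod.distrib)
  also have "(\<Prod>j\<in>I. - s\<^sup>2) = (- s\<^sup>2) ^ occ xs" by (simp add: occ_card I_def)
  also have "(\<Prod>j\<in>I. (- s) ^ j) = (\<Prod>x\<in>pos xs. (- s) powi x)"
    unfolding pos_image I_def[symmetric] by (subst prod.reindex) auto
  finally show ?thesis .
qed

text \<open>The sum defining \<open>G_c\<close> also contains configurations with shared vertical
  edges. At the lowest such edge at most one arrow comes from below and at most one from the left,
  so the vertex is (1,1;2,0), whose weight contains the factor 1 - s^2 q = 0.\<close>

lemma G_c_states:
  assumes v: "\<And>j. 1 \<le> j \<Longrightarrow> j \<le> M \<Longrightarrow> 0 < v j \<and> s * v j < 1" and "M \<ge> 1" "L \<ge> 1"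
    and xs: "xs \<in> states L" and zs: "zs \<in> states L" "occ zs = occ xs"
  shows "G_c q s M v (desc (pos xs)) (desc (pos zs)) =
    (\<Sum>S\<in>{S. length S = Suc M \<and> set S \<subseteq> states L \<and> S ! 0 = zs \<and> S ! M = xs}.
       \<Prod>y=1..M. row_weight (weight_c q s (v y)) 0 (S ! (y - 1)) (S ! y))"
proof -
  define l n where "l = desc (pos xs)" and "n = desc (pos zs)"
  define W where "W \<omega> = (\<Prod>i. \<Prod>j=1..M. weight_c q s (v j) (vertex \<omega> (int i) j))" for \<omega>
  define A where "A = skew_collections M l n"
  define A1 where "A1 = {\<omega> \<in> confs 0 L M. state_at \<omega> L 0 = zs \<and> state_at \<omega> L M = xs}"
  have len: "length n = length l" by (simp add: l_def n_def card_pos zs(2))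
  have setl: "set l = pos xs" "set n = pos zs" "distinct l" "distinct n" by (simp_all add: l_def n_def desc_def)
  have xsL: "length xs = L" "length zs = L" using xs zs by (simp_all add: states_def)
  have l0: "\<And>x. x \<in> set l \<Longrightarrow> 0 \<le> x \<and> x < int L" "\<And>x. x \<in> set n \<Longrightarrow> 0 \<le> x"
    using xsL by (auto simp: setl pos_def)
  have w0: "weight_c q s (v j) (0, 0, 0, 0) = 1" if "1 \<le> j" "j \<le> M" for j
    using v[OF that] by (intro weight_c_values) auto
  have K: "conserving M \<omega>" "supported L M \<omega>" "\<And>x y. \<omega> ((x, y), (x + 1, y)) \<le> 1"
    "\<And>y. 1 \<le> y \<Longrightarrow> y \<le> M \<Longrightarrow> \<omega> ((-1, y), (0, y)) = 0"
    "\<And>x. \<omega> ((x, 0), (x, Suc 0)) = count_list n x" "\<And>x. \<omega> ((x, M), (x, Suc M)) = count_list l x"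
    if "\<omega> \<in> skew_collections M l n" for \<omega>
    using skew_collections_conserving[OF that l0(1) len l0(2) \<open>M \<ge> 1\<close>] by blast+
  have A1A: "A1 \<subseteq> A"
  proof
    fix \<omega> assume "\<omega> \<in> A1"
    then have c: "\<omega> \<in> confs 0 L M" "state_at \<omega> L 0 = zs" "state_at \<omega> L M = xs" by (auto simp: A1_def)
    have "\<omega> \<in> skew_collections M (desc (vset \<omega> M)) (desc (vset \<omega> 0))"
      by (rule skew_collectionsI[of M \<omega> L]) (use c confs_le[OF c(1)] in \<open>auto simp: confs_def\<close>)
    then show "\<omega> \<in> A" by (simp add: A_def l_def n_def vset_pos[OF c(1)] c(2,3))
  qed
  \<comment> \<open>A sum over an infinite set would be 0 by default, so discarding the vanishing
    terms requires finiteness of the whole collection.\<close>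
  have finA: "finite A"
  proof -
    define E where "E = {((x, y), (x', y')) |x y x' y'. x \<in> {-1..int L} \<and> y \<in> {0..Suc M} \<and> x' \<in> {-1..int L} \<and> y' \<in> {0..Suc M}}"
    have "E = (\<lambda>((x, y), (x', y')). ((x, y), (x', y'))) ` (({-1..int L} \<times> {0..Suc M}) \<times> ({-1..int L} \<times> {0..Suc M}))"
      unfolding E_def by auto
    then have fE: "finite E" by simp
    have "A \<subseteq> {\<omega>. \<forall>e. (e \<in> E \<longrightarrow> \<omega> e \<in> {0..length l}) \<and> (e \<notin> E \<longrightarrow> \<omega> e = 0)}"
    proof (intro subsetI CollectI allI conjI impI)
      fix \<omega> e assume w: "\<omega> \<in> A"
      then obtain \<pi> where \<pi>: "\<omega> = arrows_of {..<length l} \<pi>" by (auto simp: A_def skew_collections_def)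
      have "arrows_of {..<length l} \<pi> e \<le> card {..<length l}" unfolding arrows_of_def by (rule card_mono) auto
      then show "\<omega> e \<in> {0..length l}" by (simp add: \<pi>)
      assume "e \<notin> E"
      show "\<omega> e = 0"
      proof (rule ccontr)
        assume "\<omega> e \<noteq> 0"
        from K(2)[OF w[unfolded A_def], unfolded supported_def, rule_format, OF this] \<open>e \<notin> E\<close>
        show False unfolding E_def by (elim disjE exE conjE) auto
      qed
    qed
    then show ?thesis by (rule finite_subset) (intro finite_set_of_finite_funs fE, simp)
  qed
  have zero: "W \<omega> = 0" if w: "\<omega> \<in> A - A1" for \<omega>
  proof -
    have wA: "\<omega> \<in> skew_collections M l n" using w by (simp add: A_def)
    note K = K[OF wA]
    have "\<exists>x y. \<omega> ((x, y), (x, y + 1)) \<ge> 2"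
    proof (rule ccontr)
      assume "\<not> ?thesis"
      then have v1: "\<omega> ((x, y), (x, y + 1)) \<le> 1" for x y by (metis not_less_eq_eq Suc_1)
      have "\<omega> e \<le> 1" for e
      proof (cases "\<omega> e = 0")
        case False
        from K(2)[unfolded supported_def, rule_format, OF this] show ?thesis
          using v1 K(3) by (elim disjE exE conjE) auto
      qed simp
      then have c: "\<omega> \<in> confs 0 L M" using K by (simp add: confs_def)
      have "vset \<omega> 0 = pos zs"
        using K(5) setl by (auto simp: vset_def count_list_0_iff)
      moreover have "vset \<omega> M = pos xs"
        using K(6) setl by (auto simp: vset_def count_list_0_iff)
      ultimately have "state_at \<omega> L 0 = zs" "state_at \<omega> L M = xs"
        using xsL by (auto simp: vset_pos[OF c] intro!: pos_inject)
      then show False using w c by (simp add: A1_def)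
    qed
    then obtain y where y: "\<exists>x. \<omega> ((x, y), (x, y + 1)) \<ge> 2" and
      miny: "\<And>y'. y' < y \<Longrightarrow> \<not> (\<exists>x. \<omega> ((x, y'), (x, y' + 1)) \<ge> 2)"
      using exists_least_iff[of "\<lambda>y. \<exists>x. \<omega> ((x, y), (x, y + 1)) \<ge> 2"] by metis
    obtain x where x: "\<omega> ((x, y), (x, y + 1)) \<ge> 2" using y by blast
    have "y \<noteq> 0"
    proof
      assume "y = 0"
      then have "count_list n x \<ge> 2" using x K(5)[of x] by simp
      moreover have "count_list n x \<le> 1" using setl(4) by (simp add: count_list_distinct)
      ultimately show False by simp
    qed
    have sup: "0 \<le> x" "x < int L" "y \<le> M" using supported_vertical[OF K(2), of x y] x by auto
    have le: "\<omega> ((x, y - 1), (x, y)) \<le> 1"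
      using miny[of "y - 1"] \<open>y \<noteq> 0\<close> by (metis One_nat_def Suc_1 Suc_eq_plus1 Suc_pred diff_less not_less_eq_eq neq0_conv zero_less_one)
    have "\<omega> ((x, y - 1), (x, y)) + \<omega> ((x - 1, y), (x, y)) = \<omega> ((x, y), (x, y + 1)) + \<omega> ((x, y), (x + 1, y))"
      using K(1)[unfolded conserving_def, rule_format, of x y] sup \<open>y \<noteq> 0\<close> by simp
    moreover have "\<omega> ((x - 1, y), (x, y)) \<le> 1" using K(3)[of "x - 1" y] by simp
    ultimately have "vertex \<omega> x y = (1, 1, 2, 0)"
      using le x by (simp add: vertex_def)
    then have "weight_c q s (v y) (vertex \<omega> x y) = 0"
      using s2q by (simp add: weight_c_def)
    moreover have "W \<omega> = (\<Prod>i<L. \<Prod>j=1..M. weight_c q s (v j) (vertex \<omega> (int i) j))"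
      unfolding W_def by (rule prodinf_vertices[OF K(2)]) (use w0 in auto)
    moreover have "weight_c q s (v y) (vertex \<omega> (int (nat x)) y) = 0" using calculation(1) sup by simp
    then have "(\<Prod>j=1..M. weight_c q s (v j) (vertex \<omega> (int (nat x)) j)) = 0"
      using sup \<open>y \<noteq> 0\<close> by (intro prod_zero bexI[of _ y]) auto
    then have "(\<Prod>i<L. \<Prod>j=1..M. weight_c q s (v j) (vertex \<omega> (int i) j)) = 0"
      using sup by (intro prod_zero) (simp, rule bexI[of _ "nat x"], auto)
    ultimately show ?thesis by simp
  qed
  have "G_c q s M v l n = sum W A" by (simp add: G_c_def A_def W_def)
  also have "\<dots> = sum W A1" using finA A1A zero by (intro sum.mono_neutral_right) auto
  also have "\<dots> = (\<Sum>\<omega>\<in>A1. \<Prod>y=1..M. row_weight (weight_c q s (v y)) 0 (state_at \<omega> L (y - 1)) (state_at \<omega> L y))"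
  proof (intro sum.cong refl)
    fix \<omega> assume "\<omega> \<in> A1"
    then have "\<omega> \<in> confs 0 L M" by (simp add: A1_def)
    from prodinf_confs[OF this, of "\<lambda>j. weight_c q s (v j)"] w0
    show "W \<omega> = (\<Prod>y=1..M. row_weight (weight_c q s (v y)) 0 (state_at \<omega> L (y - 1)) (state_at \<omega> L y))"
      by (simp add: W_def)
  qed
  also have "\<dots> = (\<Sum>\<omega>\<in>{\<omega> \<in> confs 0 L M. map (state_at \<omega> L) [0..<Suc M] ! 0 = zs \<and> map (state_at \<omega> L) [0..<Suc M] ! M = xs}.
      \<Prod>y=1..M. row_weight (weight_c q s (v y)) 0 (map (state_at \<omega> L) [0..<Suc M] ! (y - 1)) (map (state_at \<omega> L) [0..<Suc M] ! y))"
  proof -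
    have m: "map (state_at \<omega> L) [0..<Suc M] ! y = state_at \<omega> L y" if "y \<le> M" for \<omega> y
      using that nth_map_upt[of y "Suc M" 0 "state_at \<omega> L"] by simp
    show ?thesis by (intro sum.cong prod.cong) (auto simp: A1_def m simp del: upt_Suc)
  qed
  also have "\<dots> = (\<Sum>S\<in>{S. length S = Suc M \<and> set S \<subseteq> states L \<and> S ! 0 = zs \<and> S ! M = xs}.
       \<Prod>y=1..M. row_weight (weight_c q s (v y)) 0 (S ! (y - 1)) (S ! y))"
  proof (rule sum_confs[where l = 0 and P = "\<lambda>S. S ! 0 = zs \<and> S ! M = xs"])
    fix S y assume S: "length S = Suc M" "set S \<subseteq> states L" "1 \<le> y" "y \<le> M" "\<not> row_ok (int 0) (S ! (y - 1)) (S ! y)"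
    have "S ! (y - 1) \<in> states L" "S ! y \<in> states L" using S nth_mem[of "y - 1" S] nth_mem[of y S] by auto
    then have "row_weight (weight_c q s (v y)) 0 (S ! (y - 1)) (S ! y) = 0"
      using row_weight_ok[of "weight_c q s (v y)" 0 "S ! (y - 1)" "S ! y"] S(5) by (auto simp: states_def)
    then show "(\<Prod>y=1..M. row_weight (weight_c q s (v y)) 0 (S ! (y - 1)) (S ! y)) = 0"
      using S by (intro prod_zero) auto
  qed (use \<open>L \<ge> 1\<close> in auto)
  finally show ?thesis by (simp add: l_def n_def)
qed

end

lemma desc_set_of_sorted:
  assumes "sorted_wrt (>) (n :: int list)"
  shows "desc (set n) = n"
proof -
  have "sorted_wrt (<) (rev n)" using assms by (simp add: sorted_wrt_rev)
  then have "sorted_list_of_set (set (rev n)) = rev n"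
    by (intro sorted_list_of_set.idem_if_sorted_distinct) (auto simp: strict_sorted_iff)
  then show ?thesis by (simp add: desc_def)
qed

lemma sorted_desc: "sorted_wrt (>) (desc A)"
  by (simp add: desc_def sorted_wrt_rev)

lemma pos_of_set:
  assumes "A \<subseteq> {0..<int L}"
  shows "pos (map (\<lambda>i. int i \<in> A) [0..<L]) = A"
proof (intro equalityI subsetI)
  fix x assume "x \<in> A"
  then have "x \<in> {0..<int L}" using assms by blast
  then obtain i where "x = int i" "i < L" by (auto elim: nonneg_int_cases)
  then show "x \<in> pos (map (\<lambda>i. int i \<in> A) [0..<L])" using \<open>x \<in> A\<close> by (auto simp: pos_def)
qed (auto simp: pos_def)

lemma prod_nth_desc: "finite A \<Longrightarrow> (\<Prod>j<card A. f (desc A ! j)) = (\<Prod>x\<in>A. f x)"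
proof -
  assume A: "finite A"
  have "bij_betw ((!) (desc A)) {..<card A} A"
    using A bij_betw_nth[of "desc A" "{..<card A}" A] by (simp add: desc_def)
  then show ?thesis by (rule prod.reindex_bij_betw)
qed

context sixv
begin

text \<open>This encodes nu_N >= 1 in the definition of f.\<close>

definition first_empty :: "bool list \<Rightarrow> real" where
  "first_empty zs = (if zs ! 0 then 0 else 1)"

text \<open>The order is reversed, because row \<open>M\<close>, the one adjacent to lambda, is the
  outermost operator.\<close>

definition dual_rows :: "nat \<Rightarrow> (nat \<Rightarrow> real) \<Rightarrow> real list" where
  "dual_rows M v = map (\<lambda>j. par (1 / v j)) (rev [1..<Suc M])"

lemma boundary_f_states:
  assumes v: "\<And>j. 1 \<le> j \<Longrightarrow> j \<le> M \<Longrightarrow> 0 < v j \<and> s * v j < 1" and "M \<ge> 1" "L \<ge> 1"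
    and xs: "xs \<in> states L"
  shows "boundary_f q s M v (desc (pos xs)) = q ^ occ xs *
    (gauge s 0 xs * (foldr (opD q) (dual_rows M v) first_empty xs / prod_list (dual_rows M v) ^ L))"
proof -
  define N where "N = occ xs"
  define l where "l = desc (pos xs)"
  define d where "d zs = desc (pos zs)" for zs
  define Ns where "Ns = {n :: int list. length n = N \<and> sorted_wrt (>) n \<and> (\<forall>x\<in>set n. x \<ge> 1)}"
  define Zs where "Zs = {zs \<in> states L. occ zs = N \<and> \<not> zs ! 0}"
  define t where "t n = (\<Prod>j<N. (- s) powi (n ! j)) * G_c q s M v l n" for n
  define W where "W S = (\<Prod>y=1..M. row_weight (weight_c q s (v y)) 0 (S ! (y - 1)) (S ! y))" for S
  define B where "B = {S. length S = Suc M \<and> set S \<subseteq> states L \<and> S ! M = xs}"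
  have lenl: "length l = N" by (simp add: l_def N_def card_pos)
  have xsL: "length xs = L" using xs by (simp add: states_def)
  have finB: "finite B"
    by (rule finite_subset[OF _ finite_lists_length_eq[of "states L" "Suc M"]]) (auto simp: B_def)
  have finZ: "finite Zs" by (simp add: Zs_def)
  \<comment> \<open>Paths move to the right only, so nu_i is at most lambda_i and hence less than
    \<open>L\<close>. Signatures that are not positions of a state of width \<open>L\<close>
    contribute 0.\<close>
  have "infsum t Ns = infsum t (d ` Zs)"
  proof (rule infsum_cong_neutral)
    fix n assume "n \<in> d ` Zs - Ns"
    then obtain zs where zs: "zs \<in> Zs" "n = d zs" "n \<notin> Ns" by auto
    have "x \<ge> 1" if "x \<in> pos zs" for x
    proof -
      obtain i where i: "x = int i" "zs ! i" using \<open>x \<in> pos zs\<close> by (auto simp: pos_def)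
      then have "i \<noteq> 0" using zs(1) by (metis (mono_tags, lifting) Zs_def mem_Collect_eq)
      then show ?thesis using i by simp
    qed
    then have "n \<in> Ns" using zs(1) unfolding Ns_def zs(2) d_def
      by (simp add: card_pos Zs_def sorted_desc) (simp add: desc_def)
    then show "t n = 0" using zs by simp
  next
    fix n assume n: "n \<in> Ns - d ` Zs"
    have "skew_collections M l n = {}"
    proof (rule ccontr)
      assume "skew_collections M l n \<noteq> {}"
      then obtain \<omega> where w: "\<omega> \<in> skew_collections M l n" by auto
      have l0: "\<And>x. x \<in> set l \<Longrightarrow> 0 \<le> x \<and> x < int L"
        using xsL by (auto simp: l_def desc_def pos_def)
      have n0: "\<And>x. x \<in> set n \<Longrightarrow> 0 \<le> x" "\<And>x. x \<in> set n \<Longrightarrow> 1 \<le> x" "length n = length l"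
        using n lenl by (force simp: Ns_def)+
      have "x < int L" if "x \<in> set n" for x
        using skew_collections_conserving(7)[OF w l0 n0(3) n0(1) \<open>M \<ge> 1\<close> that] by blast
      then have sub: "set n \<subseteq> {0..<int L}" using n0(1) by auto
      define zs where "zs = map (\<lambda>i. int i \<in> set n) [0..<L]"
      have pz: "pos zs = set n" unfolding zs_def by (rule pos_of_set[OF sub])
      have so: "sorted_wrt (>) n" using n by (simp add: Ns_def)
      have "d zs = n" unfolding d_def pz by (rule desc_set_of_sorted[OF so])
      moreover have "zs \<in> Zs"
      proof -
        have "occ zs = N" using n \<open>d zs = n\<close> by (simp add: card_pos[symmetric] d_def Ns_def flip: length_desc)
        moreover have "\<not> zs ! 0" using \<open>L \<ge> 1\<close> n0(2)[of 0] by (auto simp: zs_def)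
        ultimately show ?thesis by (simp add: Zs_def states_def) (simp add: zs_def)
      qed
      ultimately show False using n by blast
    qed
    then show "t n = 0" by (simp add: t_def G_c_def)
  qed simp
  also have "\<dots> = (\<Sum>zs\<in>Zs. t (d zs))"
  proof -
    have "inj_on d Zs"
    proof (rule inj_onI)
      fix zs zs' assume z: "zs \<in> Zs" "zs' \<in> Zs" "d zs = d zs'"
      then have "set (desc (pos zs)) = set (desc (pos zs'))" by (simp add: d_def)
      then have "pos zs = pos zs'" by (simp add: desc_def)
      then show "zs = zs'" using z by (intro pos_inject) (auto simp: Zs_def states_def)
    qed
    then show ?thesis using finZ by (simp add: infsum_finite sum.reindex)
  qed
  finally have 1: "infsum t Ns = (\<Sum>zs\<in>Zs. t (d zs))" .
  have 2: "(-1) ^ N * t (d zs) = q ^ N * (gauge s 0 zs * (\<Sum>S\<in>{S \<in> B. S ! 0 = zs}. W S))" if zs: "zs \<in> Zs" for zs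
  proof -
    have "(\<Prod>j<N. (- s) powi (d zs ! j)) = (\<Prod>x\<in>pos zs. (- s) powi x)"
      using prod_nth_desc[of "pos zs" "\<lambda>x. (- s) powi x"] zs by (simp add: card_pos Zs_def d_def)
    moreover have "G_c q s M v l (d zs) = (\<Sum>S\<in>{S \<in> B. S ! 0 = zs}. W S)"
      unfolding l_def d_def W_def using zs N_def
      by (subst G_c_states[OF v \<open>M \<ge> 1\<close> \<open>L \<ge> 1\<close> xs]) (auto simp: Zs_def B_def intro!: sum.cong)
    moreover have "q ^ N * gauge s 0 zs = (-1) ^ N * (\<Prod>x\<in>pos zs. (- s) powi x)"
    proof -
      have "q ^ N * (- s\<^sup>2) ^ N = (-1) ^ N"
        using s2q by (simp add: power_mult_distrib[symmetric] mult.commute)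
      then show ?thesis using zs by (simp add: gauge_pos Zs_def mult.assoc[symmetric])
    qed
    ultimately show ?thesis by (simp add: t_def)
  qed
  have zero: "W S * first_empty (S ! 0) = 0" if S: "S \<in> B" "S ! 0 \<notin> Zs" for S
  proof (rule ccontr)
    assume "W S * first_empty (S ! 0) \<noteq> 0"
    then have nz: "W S \<noteq> 0" "\<not> S ! 0 ! 0" by (auto simp: first_empty_def split: if_splits)
    have st: "S ! y \<in> states L" if "y \<le> M" for y using S that nth_mem[of y S] by (auto simp: B_def)
    have "occ (S ! y) = occ (S ! 0)" if "y \<le> M" for y
      using that
    proof (induction y)
      case (Suc y)
      have "row_weight (weight_c q s (v (Suc y))) 0 (S ! y) (S ! Suc y) \<noteq> 0"
        using nz(1) Suc.prems unfolding W_def by (auto simp: prod_zero_iff dest!: bspec[of _ _ "Suc y"])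
      then have "row_ok 0 (S ! y) (S ! Suc y)"
        using st[of y] st[of "Suc y"] Suc.prems by (intro row_weight_ok) (auto simp: states_def)
      then have "occ (S ! y) = occ (S ! Suc y)"
        using st[of y] st[of "Suc y"] Suc.prems by (intro row_ok_occ) (auto simp: states_def)
      then show ?case using Suc by simp
    qed simp
    from this[of M] have "occ (S ! 0) = N" using S by (simp add: B_def N_def)
    then show False using S nz st[of 0] by (simp add: Zs_def)
  qed
  have "boundary_f q s M v l = (-1) ^ N * infsum t Ns"
    unfolding boundary_f_def lenl Ns_def t_def ..
  also have "\<dots> = (\<Sum>zs\<in>Zs. (-1) ^ N * t (d zs))" unfolding 1 by (simp add: sum_distrib_left)
  also have "\<dots> = (\<Sum>zs\<in>Zs. q ^ N * (gauge s 0 zs * (\<Sum>S\<in>{S \<in> B. S ! 0 = zs}. W S)))"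
    by (intro sum.cong refl 2)
  also have "\<dots> = q ^ N * (\<Sum>zs\<in>Zs. \<Sum>S\<in>{S \<in> B. S ! 0 = zs}. W S * (gauge s 0 (S ! 0) * first_empty (S ! 0)))"
    unfolding sum_distrib_left
    by (intro sum.cong refl) (auto simp: Zs_def first_empty_def mult_ac)
  also have "(\<Sum>zs\<in>Zs. \<Sum>S\<in>{S \<in> B. S ! 0 = zs}. W S * (gauge s 0 (S ! 0) * first_empty (S ! 0))) =
      (\<Sum>zs\<in>states L. \<Sum>S\<in>{S \<in> B. S ! 0 = zs}. W S * (gauge s 0 (S ! 0) * first_empty (S ! 0)))"
  proof (rule sum.mono_neutral_left)
    show "\<forall>zs\<in>states L - Zs. (\<Sum>S\<in>{S \<in> B. S ! 0 = zs}. W S * (gauge s 0 (S ! 0) * first_empty (S ! 0))) = 0"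
      using zero by (intro ballI sum.neutral) (auto simp: mult_ac)
  qed (auto simp: Zs_def)
  also have "\<dots> = (\<Sum>S\<in>B. W S * (gauge s 0 (S ! 0) * first_empty (S ! 0)))"
    by (rule sum.group[OF finB finite_states]) (auto simp: B_def)
  \<comment> \<open>The lists in \<open>B\<close> run from the bottom to the top, those in
    \<open>foldr_opD_sum\<close> from the top to the bottom.\<close>
  also have "\<dots> = (\<Sum>rs\<in>seqs M L. W (rev (xs # rs)) * (gauge s 0 (rev (xs # rs) ! 0) * first_empty (rev (xs # rs) ! 0)))"
  proof -
    have "B = (\<lambda>rs. rev (xs # rs)) ` seqs M L"
    proof (intro equalityI subsetI)
      fix S assume S: "S \<in> B"
      then have ne: "S \<noteq> []" by (auto simp: B_def)
      then have "last S = xs" using S by (simp add: B_def last_conv_nth)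
      then have "S = rev (xs # rev (butlast S))" using ne by (metis append_butlast_last_id rev.simps(2) rev_rev_ident)
      moreover have "rev (butlast S) \<in> seqs M L"
        using S by (auto simp: seqs_def B_def dest: in_set_butlastD)
      ultimately show "S \<in> (\<lambda>rs. rev (xs # rs)) ` seqs M L" by blast
    next
      fix S assume "S \<in> (\<lambda>rs. rev (xs # rs)) ` seqs M L"
      then show "S \<in> B" using xs by (auto simp: B_def seqs_def nth_append)
    qed
    moreover have "inj_on (\<lambda>rs. rev (xs # rs)) (seqs M L)" by (rule inj_onI) simp
    ultimately show ?thesis by (simp only: sum.reindex o_def)
  qed
  also have "\<dots> = (\<Sum>rs\<in>seqs M L. (\<Prod>j<M. row_weight (weight_c q s (v (M - j))) 0 (rs ! j) ((xs # rs) ! j)) *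
      (gauge s 0 (last (xs # rs)) * first_empty (last (xs # rs))))"
  proof (intro sum.cong refl arg_cong2[where f = "(*)"])
    fix rs assume rs: "rs \<in> seqs M L"
    then have len: "length rs = M" by (simp add: seqs_def)
    have r: "rev (xs # rs) ! y = (xs # rs) ! (M - y)" if "y \<le> M" for y
      using that len by (subst rev_nth) auto
    show "W (rev (xs # rs)) = (\<Prod>j<M. row_weight (weight_c q s (v (M - j))) 0 (rs ! j) ((xs # rs) ! j))"
      unfolding W_def
    proof (rule prod.reindex_bij_witness[of _ "\<lambda>j. M - j" "\<lambda>y. M - y"])
      fix y assume y: "y \<in> {1..M}"
      then have "(xs # rs) ! (M - (y - 1)) = rs ! (M - y)" by (simp add: nth_Cons' Suc_diff_le)
      then show "row_weight (weight_c q s (v (M - (M - y)))) 0 (rs ! (M - y)) ((xs # rs) ! (M - y)) =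
          row_weight (weight_c q s (v y)) 0 (rev (xs # rs) ! (y - 1)) (rev (xs # rs) ! y)"
        using y r[of y] r[of "y - 1"] le_trans[OF diff_le_self, of y M 1] by simp
    qed auto
    have "last (xs # rs) = (xs # rs) ! (length (xs # rs) - 1)" by (rule last_conv_nth) simp
    then have "rev (xs # rs) ! 0 = last (xs # rs)"
      using r[of 0] by (simp only: len length_Cons diff_Suc_1 diff_zero)
    then show "gauge s 0 (rev (xs # rs) ! 0) = gauge s 0 (last (xs # rs))"
      "first_empty (rev (xs # rs) ! 0) = first_empty (last (xs # rs))" by simp_all
  qed
  also have "\<dots> = gauge s 0 xs * (foldr (opD q) (dual_rows M v) first_empty xs / prod_list (dual_rows M v) ^ L)"
  proof -
    define vs where "vs = map v (rev [1..<Suc M])"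
    have dr: "dual_rows M v = map (\<lambda>v. par (1 / v)) vs" by (simp add: dual_rows_def vs_def del: upt_Suc)
    have lv: "length vs = M" by (simp add: vs_def del: upt_Suc)
    have nv: "vs ! j = v (M - j)" if "j < M" for j
      using that by (simp add: vs_def rev_nth Suc_diff_Suc del: upt_Suc)
    have vv: "\<And>x. x \<in> set vs \<Longrightarrow> 0 < x \<and> s * x < 1" using v by (auto simp: vs_def simp del: upt_Suc)
    have "gauge s 0 xs * (foldr (opD q) (dual_rows M v) first_empty xs / prod_list (dual_rows M v) ^ L) =
      (\<Sum>ss\<in>seqs (length vs) L. (\<Prod>j<length vs. row_weight (weight_c q s (vs ! j)) 0 (ss ! j) ((xs # ss) ! j)) *
        (gauge s 0 (last (xs # ss)) * first_empty (last (xs # ss))))"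
      unfolding dr by (rule foldr_opD_sum) (use vv xs in auto)
    then show ?thesis unfolding lv
      by (simp only:) (intro sum.cong refl arg_cong2[where f = "(*)"] prod.cong; simp add: nv)
  qed
  finally show ?thesis by (simp add: l_def N_def)
qed

lemma total_weight_states:
  assumes v: "\<And>j. 1 \<le> j \<Longrightarrow> j \<le> M \<Longrightarrow> 0 < v j \<and> s * v j < 1" and "M \<ge> 1" "L \<ge> 1"
    and u: "\<And>i. 1 \<le> i \<Longrightarrow> i \<le> N \<Longrightarrow> s * u i \<noteq> 1"
    and \<omega>: "\<omega> \<in> confs 1 L N" "\<And>x. \<omega> ((x, 0), (x, Suc 0)) = 0"
  shows "total_weight q s N M u v \<omega> = q ^ N *
    ((\<Prod>y=1..N. row_weight (weight q s (u y)) 1 (state_at \<omega> L (y - 1)) (state_at \<omega> L y)) *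
     (gauge s 0 (state_at \<omega> L N) *
      (foldr (opD q) (dual_rows M v) first_empty (state_at \<omega> L N) / prod_list (dual_rows M v) ^ L)))"
proof -
  have c: "conserving N \<omega>" "supported L N \<omega>" using \<omega> by (simp_all add: confs_def)
  have "card (vset \<omega> y) = y" if "y \<le> N" for y
    using that
  proof (induction y)
    case 0
    then show ?case using \<omega>(2) by (simp add: vset_def)
  next
    case (Suc y)
    have "\<omega> ((-1, Suc y), (0, Suc y)) = 1" using \<omega>(1) Suc.prems by (auto simp: confs_def)
    then show ?case
      using card_balance[OF c confs_le[OF \<omega>(1)], of "Suc y"] Suc by simp
  qed
  then have occ: "occ (state_at \<omega> L N) = N"
    by (metis card_pos order_refl vset_pos[OF \<omega>(1)])
  have "boundary_f q s M v (signature_at N \<omega>) = q ^ N * (gauge s 0 (state_at \<omega> L N) *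
      (foldr (opD q) (dual_rows M v) first_empty (state_at \<omega> L N) / prod_list (dual_rows M v) ^ L))"
    using boundary_f_states[OF v \<open>M \<ge> 1\<close> \<open>L \<ge> 1\<close> state_at_mem[of \<omega> L N]] occ
    by (simp add: signature_at_confs[OF \<omega>(1)] vset_pos[OF \<omega>(1)])
  moreover have "(\<Prod>i. \<Prod>j=1..N. weight q s (u j) (vertex \<omega> (int i) j)) =
      (\<Prod>y=1..N. row_weight (weight q s (u y)) 1 (state_at \<omega> L (y - 1)) (state_at \<omega> L y))"
    using prodinf_confs[OF \<omega>(1), of "\<lambda>j. weight q s (u j)"] u by (simp add: weight_values)
  ultimately show ?thesis by (simp add: total_weight_def)
qed

lemma path_collections_confs:
  assumes "L \<ge> 1"
  shows "{\<omega> \<in> path_collections N. \<forall>x\<ge>int L. \<omega> ((x, N), (x, N + 1)) = 0} =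
    {\<omega> \<in> confs 1 L N. state_at \<omega> L 0 = replicate L False}" (is "?A = ?B")
proof (intro equalityI subsetI)
  fix \<omega> assume w: "\<omega> \<in> ?A"
  then have "\<omega> \<in> path_collections N" "\<And>x. x \<ge> int L \<Longrightarrow> \<omega> ((x, N), (x, N + 1)) = 0" by auto
  note K = path_collections_conserving[OF this]
  have "\<omega> \<in> confs 1 L N" using K by (simp add: confs_def)
  moreover have "state_at \<omega> L 0 = replicate L False"
    using K(5) by (intro nth_equalityI) (auto simp: state_at_def)
  ultimately show "\<omega> \<in> ?B" by simp
next
  fix \<omega> assume "\<omega> \<in> ?B"
  then have w: "\<omega> \<in> confs 1 L N" "state_at \<omega> L 0 = replicate L False" by auto
  have c: "conserving N \<omega>" "supported L N \<omega>" using w by (simp_all add: confs_def)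
  have "vset \<omega> 0 = {}" unfolding vset_pos[OF w(1)] w(2) by (auto simp: pos_def)
  then have "\<omega> ((x, 0), (x, Suc 0)) = 0" for x by (auto simp: vset_def)
  moreover have "\<omega> ((-1, y), (0, y)) = 1" if "1 \<le> y" "y \<le> N" for y using w(1) that by (simp add: confs_def)
  ultimately have "\<omega> \<in> path_collections N"
    using path_collectionsI[OF c confs_le[OF w(1)]] by blast
  moreover have "\<omega> ((x, N), (x, N + 1)) = 0" if "x \<ge> int L" for x
  proof (rule ccontr)
    assume "\<omega> ((x, N), (x, N + 1)) \<noteq> 0"
    from supported_vertical[OF c(2) this] that show False by simp
  qed
  ultimately show "\<omega> \<in> ?A" by simp
qed

theorem sum_total_weight:
  assumes v: "\<And>j. 1 \<le> j \<Longrightarrow> j \<le> M \<Longrightarrow> 0 < v j \<and> s * v j < 1" and "M \<ge> 1" "L \<ge> 1"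
    and u: "\<And>i. 1 \<le> i \<Longrightarrow> i \<le> N \<Longrightarrow> s * u i \<noteq> 1" and "N \<ge> 1"
  shows "(\<Sum>\<omega>\<in>{\<omega> \<in> path_collections N. (\<forall>x\<ge>int L. \<omega> ((x, N), (x, N + 1)) = 0) \<and>
      (\<forall>y. 1 \<le> y \<and> y \<le> N \<longrightarrow> C y (state_at \<omega> L y))}. total_weight q s N M u v \<omega>) =
    q ^ N * leveled q C 0 (map (\<lambda>i. par (u i)) [1..<Suc N])
      (\<lambda>xs. foldr (opD q) (dual_rows M v) first_empty xs / prod_list (dual_rows M v) ^ L) (replicate L False)"
proof -
  define x0 where "x0 = replicate L False"
  define h where "h = (\<lambda>xs. foldr (opD q) (dual_rows M v) first_empty xs / prod_list (dual_rows M v) ^ L)"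
  define F where "F S = q ^ N * ((\<Prod>y=1..N. row_weight (weight q s (u y)) 1 (S ! (y - 1)) (S ! y)) *
     (gauge s 0 (S ! N) * h (S ! N)))" for S
  define P where "P S \<longleftrightarrow> (\<forall>y. 1 \<le> y \<and> y \<le> N \<longrightarrow> C y (S ! y))" for S :: "bool list list"
  have m: "map (state_at \<omega> L) [0..<Suc N] ! y = state_at \<omega> L y" if "y \<le> N" for \<omega> y
    using that nth_map_upt[of y "Suc N" 0 "state_at \<omega> L"] by simp
  have x0: "x0 \<in> states L" by (simp add: x0_def states_def)
  have "{\<omega> \<in> path_collections N. (\<forall>x\<ge>int L. \<omega> ((x, N), (x, N + 1)) = 0) \<and>
      (\<forall>y. 1 \<le> y \<and> y \<le> N \<longrightarrow> C y (state_at \<omega> L y))} =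
    {\<omega> \<in> {\<omega> \<in> path_collections N. \<forall>x\<ge>int L. \<omega> ((x, N), (x, N + 1)) = 0}.
      \<forall>y. 1 \<le> y \<and> y \<le> N \<longrightarrow> C y (state_at \<omega> L y)}" by blast
  also have "\<dots> = {\<omega> \<in> confs 1 L N. map (state_at \<omega> L) [0..<Suc N] ! 0 = x0 \<and> P (map (state_at \<omega> L) [0..<Suc N])}"
    unfolding path_collections_confs[OF \<open>L \<ge> 1\<close>] P_def x0_def using m by (auto simp del: upt_Suc)
  finally have set_eq: "{\<omega> \<in> path_collections N. (\<forall>x\<ge>int L. \<omega> ((x, N), (x, N + 1)) = 0) \<and>
      (\<forall>y. 1 \<le> y \<and> y \<le> N \<longrightarrow> C y (state_at \<omega> L y))} =
    {\<omega> \<in> confs 1 L N. map (state_at \<omega> L) [0..<Suc N] ! 0 = x0 \<and> P (map (state_at \<omega> L) [0..<Suc N])}" .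
  have "(\<Sum>\<omega>\<in>{\<omega> \<in> path_collections N. (\<forall>x\<ge>int L. \<omega> ((x, N), (x, N + 1)) = 0) \<and>
      (\<forall>y. 1 \<le> y \<and> y \<le> N \<longrightarrow> C y (state_at \<omega> L y))}. total_weight q s N M u v \<omega>) =
    (\<Sum>\<omega>\<in>{\<omega> \<in> confs 1 L N. map (state_at \<omega> L) [0..<Suc N] ! 0 = x0 \<and> P (map (state_at \<omega> L) [0..<Suc N])}.
      F (map (state_at \<omega> L) [0..<Suc N]))"
  proof (rule sum.cong[OF set_eq])
    fix \<omega> assume "\<omega> \<in> {\<omega> \<in> confs 1 L N. map (state_at \<omega> L) [0..<Suc N] ! 0 = x0 \<and> P (map (state_at \<omega> L) [0..<Suc N])}"
    then have w: "\<omega> \<in> confs 1 L N" "state_at \<omega> L 0 = x0" using m[of 0] by auto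
    have "vset \<omega> 0 = {}" unfolding vset_pos[OF w(1)] w(2) by (auto simp: pos_def x0_def)
    then have b: "\<omega> ((x, 0), (x, Suc 0)) = 0" for x by (auto simp: vset_def)
    have E: "(\<Prod>y=1..N. row_weight (weight q s (u y)) 1 (state_at \<omega> L (y - 1)) (state_at \<omega> L y)) =
       (\<Prod>y=1..N. row_weight (weight q s (u y)) 1 (map (state_at \<omega> L) [0..<Suc N] ! (y - 1)) (map (state_at \<omega> L) [0..<Suc N] ! y))"
      by (intro prod.cong refl) (auto simp: m simp del: upt_Suc)
    have "total_weight q s N M u v \<omega> = q ^ N *
      ((\<Prod>y=1..N. row_weight (weight q s (u y)) 1 (state_at \<omega> L (y - 1)) (state_at \<omega> L y)) *
       (gauge s 0 (state_at \<omega> L N) * h (state_at \<omega> L N)))"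
      unfolding h_def by (rule total_weight_states) (use v u \<open>M \<ge> 1\<close> \<open>L \<ge> 1\<close> w b in auto)
    then show "total_weight q s N M u v \<omega> = F (map (state_at \<omega> L) [0..<Suc N])"
      unfolding F_def E by (simp only: m order_refl)
  qed
  also have "\<dots> = (\<Sum>S\<in>{S. length S = Suc N \<and> set S \<subseteq> states L \<and> S ! 0 = x0 \<and> P S}. F S)"
  proof (rule sum_confs[where l = 1 and P = "\<lambda>S. S ! 0 = x0 \<and> P S"])
    fix S y assume S: "length S = Suc N" "set S \<subseteq> states L" "1 \<le> y" "y \<le> N" "\<not> row_ok (int 1) (S ! (y - 1)) (S ! y)"
    have "S ! (y - 1) \<in> states L" "S ! y \<in> states L" using S nth_mem[of "y - 1" S] nth_mem[of y S] by auto
    then have "row_weight (weight q s (u y)) 1 (S ! (y - 1)) (S ! y) = 0"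
      using row_weight_ok[of "weight q s (u y)" 1 "S ! (y - 1)" "S ! y"] S(5) by (auto simp: states_def)
    then have "(\<Prod>y=1..N. row_weight (weight q s (u y)) 1 (S ! (y - 1)) (S ! y)) = 0"
      using S by (intro prod_zero) auto
    then show "F S = 0" by (simp add: F_def)
  qed (use \<open>L \<ge> 1\<close> in auto)
  also have "\<dots> = (\<Sum>ss\<in>seqs N L. if P (x0 # ss) then F (x0 # ss) else 0)"
    by (rule sum_over_paths[OF x0])
  also have "\<dots> = q ^ N * (\<Sum>ss\<in>seqs N L. (\<Prod>j<N. row_weight (weight q s (map u [1..<Suc N] ! j)) 1 ((x0 # ss) ! j) (ss ! j)) *
      (if \<forall>j<N. C (0 + Suc j) (ss ! j) then gauge s 0 (last (x0 # ss)) * h (last (x0 # ss)) else 0))"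
    unfolding sum_distrib_left
  proof (intro sum.cong refl)
    fix ss assume ss: "ss \<in> seqs N L"
    have pe: "P (x0 # ss) \<longleftrightarrow> (\<forall>j<N. C (0 + Suc j) (ss ! j))"
    proof
      assume P: "P (x0 # ss)"
      show "\<forall>j<N. C (0 + Suc j) (ss ! j)"
      proof (intro allI impI)
        fix j assume "j < N"
        then show "C (0 + Suc j) (ss ! j)" using P unfolding P_def by (auto dest!: spec[of _ "Suc j"])
      qed
    next
      assume Q: "\<forall>j<N. C (0 + Suc j) (ss ! j)"
      show "P (x0 # ss)" unfolding P_def
      proof (intro allI impI)
        fix y assume "1 \<le> y \<and> y \<le> N"
        then show "C y ((x0 # ss) ! y)" using Q by (cases y) auto
      qed
    qed
    have ln: "(x0 # ss) ! N = last (x0 # ss)"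
    proof -
      have len: "length ss = N" using ss by (simp add: seqs_def)
      have "last (x0 # ss) = (x0 # ss) ! (length (x0 # ss) - 1)" by (rule last_conv_nth) simp
      then show ?thesis by (simp only: len length_Cons diff_Suc_1)
    qed
    have pr: "(\<Prod>y=1..N. row_weight (weight q s (u y)) 1 ((x0 # ss) ! (y - 1)) ((x0 # ss) ! y)) =
        (\<Prod>j<N. row_weight (weight q s (map u [1..<Suc N] ! j)) 1 ((x0 # ss) ! j) (ss ! j))"
      by (rule prod.reindex_bij_witness[of _ Suc "\<lambda>y. y - 1"]) (auto simp del: upt_Suc)
    show "(if P (x0 # ss) then F (x0 # ss) else 0) = q ^ N *
        ((\<Prod>j<N. row_weight (weight q s (map u [1..<Suc N] ! j)) 1 ((x0 # ss) ! j) (ss ! j)) *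
      (if \<forall>j<N. C (0 + Suc j) (ss ! j) then gauge s 0 (last (x0 # ss)) * h (last (x0 # ss)) else 0))"
      unfolding pe[symmetric] F_def ln pr
      by (cases "P (x0 # ss)") (simp_all only: if_True if_False mult_zero_right)
  qed
  also have "\<dots> = q ^ N * (gauge s 0 x0 * leveled q C 0 (map par (map u [1..<Suc N])) h x0)"
  proof -
    have us: "\<And>x. x \<in> set (map u [1..<Suc N]) \<Longrightarrow> s * x \<noteq> 1" using u by (auto simp del: upt_Suc)
    have len: "length (map u [1..<Suc N]) = N" by (simp del: upt_Suc)
    have "gauge s 0 x0 * leveled q C 0 (map par (map u [1..<Suc N])) h x0 =
      (\<Sum>ss\<in>seqs (length (map u [1..<Suc N])) L.
        (\<Prod>j<length (map u [1..<Suc N]). row_weight (weight q s (map u [1..<Suc N] ! j)) 1 ((x0 # ss) ! j) (ss ! j)) *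
        (if \<forall>j<length (map u [1..<Suc N]). C (0 + Suc j) (ss ! j)
         then gauge s 0 (last (x0 # ss)) * h (last (x0 # ss)) else 0))"
      by (rule leveled_sum) (use us x0 in auto)
    then show ?thesis unfolding len by (simp only:)
  qed
  also have "gauge s 0 x0 = 1" by (simp add: gauge_prod x0_def)
  finally show ?thesis by (simp add: h_def x0_def o_def del: upt_Suc)
qed

end

section \<open>Removal of the empty column 0 and the conditions on occupied columns\<close>

lemma opA_zero: "opA q p (\<lambda>_. 0) xs = 0"
  by (simp add: opA_def row_zero)

text \<open>A column that is occupied stays occupied in all later rows. As \<open>h\<close> vanishes
  on occupied first columns, this column is empty at every level, and each row crosses it with its
  own parameter as weight.\<close>

lemma leveled_first_column:
  assumes "\<And>ys. h (True # ys) = 0"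
  shows "leveled q C k us h (True # xs) = 0"
    "leveled q C k us h (False # xs) = prod_list us * leveled q (\<lambda>y ys. C y (False # ys)) k us (\<lambda>ys. h (False # ys)) xs"
proof -
  have 1: "leveled q C k us h (True # xs) = 0" for us k xs
    by (induction us arbitrary: k xs) (simp_all add: assms opB_Cons opB_zero cong: if_cong)
  then show "leveled q C k us h (True # xs) = 0" .
  show "leveled q C k us h (False # xs) = prod_list us * leveled q (\<lambda>y ys. C y (False # ys)) k us (\<lambda>ys. h (False # ys)) xs"
  proof (induction us arbitrary: k xs)
    case (Cons u us)
    have "(\<lambda>ys. if C (Suc k) (False # ys) then leveled q C (Suc k) us h (False # ys) else 0) =
      (\<lambda>ys. prod_list us * (if C (Suc k) (False # ys) then leveled q (\<lambda>y ys. C y (False # ys)) (Suc k) us (\<lambda>ys. h (False # ys)) ys else 0))"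
      by (auto simp: Cons.IH)
    moreover have "(\<lambda>ys. if C (Suc k) (True # ys) then leveled q C (Suc k) us h (True # ys) else 0) = (\<lambda>_. 0)"
      by (auto simp: 1)
    ultimately show ?case by (simp add: opB_Cons opA_zero opB_scale)
  qed simp
qed

lemma foldr_opD_first_column:
  assumes "\<And>ys. g (True # ys) = 0"
  shows "foldr (opD q) ws g (True # xs) = 0"
    "foldr (opD q) ws g (False # xs) = prod_list ws * foldr (opD q) ws (\<lambda>ys. g (False # ys)) xs"
proof -
  have 1: "foldr (opD q) ws g (True # xs) = 0" for ws xs
    by (induction ws arbitrary: xs) (simp_all add: assms opD_Cons_True opD_zero)
  then show "foldr (opD q) ws g (True # xs) = 0" .
  show "foldr (opD q) ws g (False # xs) = prod_list ws * foldr (opD q) ws (\<lambda>ys. g (False # ys)) xs"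
  proof (induction ws arbitrary: xs)
    case (Cons w ws)
    define P where "P = prod_list ws"
    define h where "h = foldr (opD q) ws (\<lambda>ys. g (False # ys))"
    have "foldr (opD q) (w # ws) g (False # xs) =
        w * row q w True xs (\<lambda>ys r. if r then foldr (opD q) ws g (False # ys) else 0) +
        (1 - w) * row q w False xs (\<lambda>ys r. if r then foldr (opD q) ws g (True # ys) else 0)"
      by (simp add: opD_def)
    also have "row q w False xs (\<lambda>ys r. if r then foldr (opD q) ws g (True # ys) else 0) = 0"
    proof -
      have "(\<lambda>ys r. if r then foldr (opD q) ws g (True # ys) else 0) = (\<lambda>ys r. 0)"
        by (auto simp: 1 fun_eq_iff)
      then show ?thesis by (simp only: row_zero)
    qed
    also have "row q w True xs (\<lambda>ys r. if r then foldr (opD q) ws g (False # ys) else 0) =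
        row q w True xs (\<lambda>ys r. P * (if r then h ys else 0))"
      by (intro row_cong) (auto simp: Cons.IH P_def h_def)
    also have "\<dots> = P * opD q w h xs" by (simp add: row_scale opD_def)
    finally show ?case by (simp add: P_def h_def)
  qed simp
qed

lemma leveled_cong:
  assumes "\<And>y ys. k < y \<Longrightarrow> length ys = length xs \<Longrightarrow> C y ys = C' y ys"
  shows "leveled q C k us h xs = leveled q C' k us h xs"
  using assms
proof (induction us arbitrary: k xs)
  case (Cons u us)
  show ?case unfolding leveled.simps opB_def
  proof (rule row_cong)
    fix ys :: "bool list" and r assume len: "length ys = length xs"
    have "leveled q C (Suc k) us h ys = leveled q C' (Suc k) us h ys"
      by (rule Cons.IH) (use Cons.prems len in auto)
    moreover have "C (Suc k) ys = C' (Suc k) ys" using Cons.prems[of "Suc k" ys] len by simp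
    ultimately show "(if r then 0 else if C (Suc k) ys then leveled q C (Suc k) us h ys else 0) =
      (if r then 0 else if C' (Suc k) ys then leveled q C' (Suc k) us h ys else 0)" by simp
  qed
qed simp

lemma leveled_trivial:
  assumes "\<And>y ys. k < y \<Longrightarrow> C y ys"
  shows "leveled q C k us h = foldr (opB q) us h"
  using assms
proof (induction us arbitrary: k)
  case (Cons u us)
  have "leveled q C (Suc k) us h = foldr (opB q) us h" by (rule Cons.IH) (use Cons.prems in auto)
  then show ?case using Cons.prems[of "Suc k"] by (auto simp: fun_eq_iff)
qed (auto simp: fun_eq_iff)

lemma leveled_scale:
  "leveled q C k us (\<lambda>xs. h xs * c) xs = leveled q C k us h xs * c"
proof (induction us arbitrary: k xs)
  case (Cons u us)
  have "(\<lambda>ys. if C (Suc k) ys then leveled q C (Suc k) us (\<lambda>xs. h xs * c) ys else 0) =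
     (\<lambda>ys. c * (if C (Suc k) ys then leveled q C (Suc k) us h ys else 0))"
    by (auto simp: Cons.IH)
  then show ?case by (simp add: opB_scale)
qed simp

lemma leveled_nonneg:
  assumes "0 \<le> q" "q \<le> 1" "set us \<subseteq> {0..1}" "\<And>ys. h ys \<ge> 0"
  shows "0 \<le> leveled q C k us h xs"
  using assms(3) by (induction us arbitrary: k xs) (auto intro!: opB_nonneg assms)

text \<open>Rows between two consecutive conditions; the value 0 stands in for \<open>m 0\<close>,
  which may be arbitrary.\<close>

definition segment :: "(nat \<Rightarrow> nat) \<Rightarrow> nat \<Rightarrow> nat list" where
  "segment m i = [Suc (if i = 1 then 0 else m (i - 1))..<Suc (m i)]"

definition level_cond :: "(nat \<Rightarrow> nat) \<Rightarrow> nat \<Rightarrow> nat \<Rightarrow> nat \<Rightarrow> bool list \<Rightarrow> bool" where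
  "level_cond m k j y xs \<longleftrightarrow> (\<forall>i\<in>{j..k}. m i = y \<longrightarrow> full i xs)"

context
  fixes q :: real and m :: "nat \<Rightarrow> nat" and k N :: nat and p :: "nat \<Rightarrow> real" and h :: "bool list \<Rightarrow> real"
  assumes m1: "k \<ge> 1 \<Longrightarrow> 1 \<le> m 1" and mono: "\<And>r. 1 \<le> r \<Longrightarrow> r < k \<Longrightarrow> m r \<le> m (Suc r)" and mk: "k \<ge> 1 \<Longrightarrow> m k \<le> N"
begin

lemma m_mono: "i \<le> j \<Longrightarrow> 1 \<le> i \<Longrightarrow> j \<le> k \<Longrightarrow> m i \<le> m j"
proof (induction j rule: dec_induct)
  case (step j)
  then show ?case using mono[of j] by simp
qed simp

text \<open>Conditions at the same height correspond to empty groups in between. The outer induction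
  descends from the last condition, the inner one from the height \<open>m j\<close> of the current
  condition.\<close>

lemma guarded_leveled_aux:
  assumes "1 \<le> j" "j \<le> k" "y \<le> m j"
  shows "guarded q full j (map (map p) ([Suc y..<Suc (m j)] # map (segment m) [Suc j..<Suc k]))
      (foldr (opB q) (map p [Suc (m k)..<Suc N]) h) xs =
    (if level_cond m k j y xs then leveled q (level_cond m k j) y (map p [Suc y..<Suc N]) h xs else 0)"
  using assms(2,1,3)
proof (induction j arbitrary: y xs rule: inc_induct)
  case base
  show ?case using base.prems(2)
  proof (induction y arbitrary: xs rule: inc_induct)
    case base
    have "leveled q (level_cond m k k) (m k) (map p [Suc (m k)..<Suc N]) h = foldr (opB q) (map p [Suc (m k)..<Suc N]) h"
      by (rule leveled_trivial) (auto simp: level_cond_def)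
    moreover have "level_cond m k k (m k) xs = full k xs" by (simp add: level_cond_def)
    ultimately show ?case by (simp del: upt_Suc)
  next
    case (step y)
    have "[Suc y..<Suc (m k)] = Suc y # [Suc (Suc y)..<Suc (m k)]" using step by (simp add: upt_conv_Cons del: upt_Suc)
    moreover have "[Suc y..<Suc N] = Suc y # [Suc (Suc y)..<Suc N]"
      using step mk base.prems by (simp add: upt_conv_Cons del: upt_Suc)
    moreover have "level_cond m k k y xs" using step by (auto simp: level_cond_def)
    moreover have "guarded q full k (map (map p) ([Suc (Suc y)..<Suc (m k)] # map (segment m) [Suc k..<Suc k]))
        (foldr (opB q) (map p [Suc (m k)..<Suc N]) h) =
      (\<lambda>xs. if level_cond m k k (Suc y) xs then leveled q (level_cond m k k) (Suc y) (map p [Suc (Suc y)..<Suc N]) h xs else 0)"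
      by (rule ext) (rule step.IH)
    ultimately show ?case by (simp del: upt_Suc)
  qed
next
  case (step j)
  note outer = step.IH and jk = step.hyps
  have j1: "1 \<le> j" and mjN: "m j \<le> N" using step.prems jk m_mono[of j k] mk by auto
  show ?case using step.prems(2)
  proof (induction y arbitrary: xs rule: inc_induct)
    case base
    have sg: "(segment m) (Suc j) = [Suc (m j)..<Suc (m (Suc j))]" using j1 by (simp add: segment_def)
    have "map (segment m) [Suc j..<Suc k] = [Suc (m j)..<Suc (m (Suc j))] # map (segment m) [Suc (Suc j)..<Suc k]"
      using jk by (simp add: upt_conv_Cons sg del: upt_Suc)
    then have "guarded q full (Suc j) (map (map p) (map (segment m) [Suc j..<Suc k])) (foldr (opB q) (map p [Suc (m k)..<Suc N]) h) xs =
        (if level_cond m k (Suc j) (m j) xs then leveled q (level_cond m k (Suc j)) (m j) (map p [Suc (m j)..<Suc N]) h xs else 0)"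
      using outer[of "m j" xs] mono[of j] jk j1 by (simp del: upt_Suc)
    moreover have "leveled q (level_cond m k (Suc j)) (m j) (map p [Suc (m j)..<Suc N]) h xs =
        leveled q (level_cond m k j) (m j) (map p [Suc (m j)..<Suc N]) h xs"
    proof (rule leveled_cong)
      fix y ys assume "m j < y"
      then show "level_cond m k (Suc j) y ys = level_cond m k j y ys"
        unfolding level_cond_def by (metis Suc_leD Suc_leI atLeastAtMost_iff le_eq_less_or_eq less_irrefl)
    qed
    moreover have "level_cond m k j (m j) xs \<longleftrightarrow> full j xs \<and> level_cond m k (Suc j) (m j) xs"
    proof -
      have "{j..k} = insert j {Suc j..k}" using jk by auto
      then show ?thesis by (auto simp: level_cond_def)
    qed
    ultimately show ?case by (simp del: upt_Suc)
  next
    case (step y)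
    have "[Suc y..<Suc (m j)] = Suc y # [Suc (Suc y)..<Suc (m j)]" using step by (simp add: upt_conv_Cons del: upt_Suc)
    moreover have "[Suc y..<Suc N] = Suc y # [Suc (Suc y)..<Suc N]"
      using step mjN by (simp add: upt_conv_Cons del: upt_Suc)
    moreover have "level_cond m k j y xs" using step m_mono[of j] j1 by (force simp: level_cond_def)
    moreover have "guarded q full j (map (map p) ([Suc (Suc y)..<Suc (m j)] # map (segment m) [Suc j..<Suc k]))
        (foldr (opB q) (map p [Suc (m k)..<Suc N]) h) =
      (\<lambda>xs. if level_cond m k j (Suc y) xs then leveled q (level_cond m k j) (Suc y) (map p [Suc (Suc y)..<Suc N]) h xs else 0)"
      by (rule ext) (rule step.IH)
    ultimately show ?case by (simp del: upt_Suc)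
  qed
qed

lemma guarded_leveled:
  "guarded q full 1 (map (map p) (map (segment m) [1..<Suc k]))
      (foldr (opB q) (map p [Suc (if k = 0 then 0 else m k)..<Suc N]) h) xs =
    leveled q (level_cond m k 1) 0 (map p [1..<Suc N]) h xs"
proof (cases "k = 0")
  case True
  have "leveled q (level_cond m k 1) 0 (map p [1..<Suc N]) h = foldr (opB q) (map p [1..<Suc N]) h"
    by (rule leveled_trivial) (unfold level_cond_def, use True in auto)
  then show ?thesis using True by (simp del: upt_Suc)
next
  case False
  then have k: "k \<ge> 1" by simp
  have "map (segment m) [1..<Suc k] = [Suc 0..<Suc (m 1)] # map (segment m) [Suc 1..<Suc k]"
    using k by (simp add: upt_conv_Cons segment_def del: upt_Suc)
  moreover have "level_cond m k 1 0 xs"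
    using m_mono[of 1] m1[OF k] by (force simp: level_cond_def)
  ultimately show ?thesis using guarded_leveled_aux[of 1 0 xs] k by (simp del: upt_Suc)
qed

end

lemma full_iff_occ: "i \<le> length xs \<Longrightarrow> full i xs \<longleftrightarrow> i \<le> occ (take i xs)"
proof (induction xs arbitrary: i)
  case (Cons x xs)
  have "occ (take j ys) \<le> j" for j and ys :: "bool list"
    using count_le_length[of "take j ys" True] by simp
  from this[of "i - 1" xs] show ?case
    using Cons by (cases i; cases x) auto
qed simp

lemma count_le_pos: "count_le (pos xs) (int i) = occ (take (Suc i) xs)"
proof -
  have "{a \<in> pos xs. a \<le> int i} = pos (take (Suc i) xs)"
    by (auto simp: pos_def)
  then show ?thesis by (simp add: count_le_def card_pos)
qed

text \<open>In each row one arrow enters from the left, so by \<open>row_balance\<close> the arrows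
  in the columns 0, ..., j increase by one exactly when no arrow leaves column \<open>j\<close> to
  the right. Counting such rows up to height \<open>n\<close> therefore counts the vertical arrows
  in these columns, which explains \<open>Suc j\<close>.\<close>

lemma Y_le_iff:
  assumes "\<omega> \<in> confs 1 L N" "\<And>x. \<omega> ((x, 0), (x, Suc 0)) = 0" "1 \<le> i" "n \<le> N"
  shows "Y N j i \<omega> \<le> enat n \<longleftrightarrow> i \<le> occ (take (Suc j) (state_at \<omega> L n))"
proof -
  define S where "S = {y\<in>{1..N}. \<omega> ((int j, y), (int j + 1, y)) = 0}"
  have fin: "finite S" by (simp add: S_def)
  define xs where "xs = sorted_list_of_set S"
  have xs: "sorted xs" "distinct xs" "set xs = S" "length xs = card S" using fin by (auto simp: xs_def)
  have c: "conserving N \<omega>" "supported L N \<omega>" using assms(1) by (simp_all add: confs_def)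
  have cnt: "card {y \<in> {1..n}. \<omega> ((int j, y), (int j + 1, y)) = 0} = count_le (vset \<omega> n) (int j)"
    using assms(4)
  proof (induction n)
    case 0
    then show ?case using assms(2) by (simp add: vset_def count_le_def)
  next
    case (Suc n)
    have l: "\<omega> ((-1, Suc n), (0, Suc n)) = 1" using assms(1) Suc.prems by (auto simp: confs_def)
    have b: "\<omega> ((int j, Suc n), (int j + 1, Suc n)) + count_le (vset \<omega> (Suc n)) (int j) = 1 + count_le (vset \<omega> n) (int j)"
      using row_balance[OF c confs_le[OF assms(1)], of "Suc n" "int j"] Suc.prems l by simp
    have "{y \<in> {1..Suc n}. \<omega> ((int j, y), (int j + 1, y)) = 0} = {y \<in> {1..n}. \<omega> ((int j, y), (int j + 1, y)) = 0} \<union>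
        (if \<omega> ((int j, Suc n), (int j + 1, Suc n)) = 0 then {Suc n} else {})"
      by (auto simp: le_Suc_eq)
    then have "card {y \<in> {1..Suc n}. \<omega> ((int j, y), (int j + 1, y)) = 0} = card {y \<in> {1..n}. \<omega> ((int j, y), (int j + 1, y)) = 0} +
        (if \<omega> ((int j, Suc n), (int j + 1, Suc n)) = 0 then 1 else 0)"
      by (subst \<open>_ = _ \<union> _\<close>, subst card_Un_disjoint) auto
    then show ?case using Suc b confs_01[OF assms(1), of "((int j, Suc n), (int j + 1, Suc n))"] by auto
  qed
  have S_le: "{y \<in> S. y \<le> n} = {y \<in> {1..n}. \<omega> ((int j, y), (int j + 1, y)) = 0}"
    using assms(4) by (auto simp: S_def)
  have "Y N j i \<omega> \<le> enat n \<longleftrightarrow> i \<le> card {y \<in> S. y \<le> n}"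
  proof (cases "card S < i")
    case True
    have "card {y \<in> S. y \<le> n} \<le> card S" using fin by (intro card_mono) auto
    moreover have "Y N j i \<omega> = \<infinity>" unfolding Y_def S_def[symmetric] Let_def using True by simp
    ultimately show ?thesis using True by simp
  next
    case False
    have "Y N j i \<omega> = enat (xs ! (i - 1))"
      unfolding Y_def S_def[symmetric] Let_def xs_def using False by simp
    then have "Y N j i \<omega> \<le> enat n \<longleftrightarrow> xs ! (i - 1) \<le> n" by simp
    also have "\<dots> \<longleftrightarrow> i \<le> card {y \<in> S. y \<le> n}"
    proof -
      have cI: "card {y \<in> S. y \<le> n} = card {a. a < length xs \<and> xs ! a \<le> n}"
      proof -
        have "{y \<in> S. y \<le> n} = (\<lambda>a. xs ! a) ` {a. a < length xs \<and> xs ! a \<le> n}"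
          by (auto simp: xs(3)[symmetric] in_set_conv_nth)
        moreover have "inj_on (\<lambda>a. xs ! a) {a. a < length xs \<and> xs ! a \<le> n}"
          using xs(2) by (auto simp: inj_on_def nth_eq_iff_index_eq)
        ultimately show ?thesis by (simp add: card_image)
      qed
      have len: "i - 1 < length xs" using False assms(3) xs(4) by simp
      show ?thesis
      proof
        assume le: "xs ! (i - 1) \<le> n"
        have "{..<i} \<subseteq> {a. a < length xs \<and> xs ! a \<le> n}"
        proof
          fix a assume "a \<in> {..<i}"
          then have "a \<le> i - 1" by auto
          then show "a \<in> {a. a < length xs \<and> xs ! a \<le> n}"
            using len le sorted_nth_mono[OF xs(1) \<open>a \<le> i - 1\<close> len] by auto
        qed
        then have "card {..<i} \<le> card {a. a < length xs \<and> xs ! a \<le> n}" by (intro card_mono) auto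
        then show "i \<le> card {y \<in> S. y \<le> n}" unfolding cI by simp
      next
        assume i: "i \<le> card {y \<in> S. y \<le> n}"
        show "xs ! (i - 1) \<le> n"
        proof (rule ccontr)
          assume nle: "\<not> xs ! (i - 1) \<le> n"
          have "{a. a < length xs \<and> xs ! a \<le> n} \<subseteq> {..<i - 1}"
          proof
            fix a assume a: "a \<in> {a. a < length xs \<and> xs ! a \<le> n}"
            show "a \<in> {..<i - 1}"
            proof (rule ccontr)
              assume "a \<notin> {..<i - 1}"
              then have "xs ! (i - 1) \<le> xs ! a" using a by (intro sorted_nth_mono[OF xs(1)]) auto
              then show False using a nle by auto
            qed
          qed
          then have "card {a. a < length xs \<and> xs ! a \<le> n} \<le> card {..<i - 1}" by (intro card_mono) auto
          then show False using i assms(3) unfolding cI by simp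
        qed
      qed
    qed
    finally show ?thesis .
  qed
  then show ?thesis unfolding S_le cnt vset_pos[OF assms(1)] count_le_pos .
qed

definition event :: "nat \<Rightarrow> nat \<Rightarrow> (nat \<Rightarrow> nat) \<Rightarrow> arrows \<Rightarrow> bool" where
  "event N k m \<omega> \<longleftrightarrow> (\<forall>i\<in>{1..k}. Y N i i \<omega> \<le> enat (m i))"

section \<open>The probability as a limit of ratios\<close>

context sixv
begin

definition event_ratio :: "nat \<Rightarrow> nat \<Rightarrow> (nat \<Rightarrow> real) \<Rightarrow> (nat \<Rightarrow> real) \<Rightarrow> nat \<Rightarrow> (nat \<Rightarrow> nat) \<Rightarrow> nat \<Rightarrow> real" where
  "event_ratio N M p w k m = ratio (map (segment m) [1..<Suc k]) [Suc (if k = 0 then 0 else m k)..<Suc N] (rev [1..<Suc M]) p w"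

definition dual :: "(nat \<Rightarrow> real) \<Rightarrow> nat \<Rightarrow> real" where
  "dual v j = par (1 / v j)"

lemma dual_rows: "dual_rows M v = map (dual v) (rev [1..<Suc M])"
  by (simp add: dual_rows_def dual_def del: upt_Suc)

lemma par_bounds:
  assumes "s < x"
  shows "0 < par x" "par x < 1"
proof -
  have "s * q < s * 1" using s0 q by (intro mult_strict_left_mono) auto
  then show "0 < par x" "par x < 1" using assms by (simp_all add: par_def)
qed

lemma par_less:
  assumes "s < x" "x < y"
  shows "par x < par y"
proof -
  have l: "s * q < s * 1" using s0 q by (intro mult_strict_left_mono) auto
  have "par z = 1 - s * (1 - q) / (z - s * q)" if "s < z" for z
    using that l by (simp add: par_def divide_simps) (simp add: algebra_simps)
  moreover have "s * (1 - q) / (y - s * q) < s * (1 - q) / (x - s * q)"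
  proof -
    have "0 < x - s * q" "0 < y - s * q" using assms l by linarith+
    then show ?thesis using assms s0 q by (intro divide_strict_left_mono mult_pos_pos) auto
  qed
  ultimately show ?thesis using assms by simp
qed

context
  fixes N M :: nat and u v :: "nat \<Rightarrow> real"
  assumes N: "N \<ge> 1" and M: "M \<ge> 1"
    and u: "\<And>i. 1 \<le> i \<Longrightarrow> i \<le> N \<Longrightarrow> s < u i"
    and v: "\<And>j. 1 \<le> j \<Longrightarrow> j \<le> M \<Longrightarrow> 0 < v j"
    and uv: "\<And>i j. 1 \<le> i \<Longrightarrow> i \<le> N \<Longrightarrow> 1 \<le> j \<Longrightarrow> j \<le> M \<Longrightarrow> u i * v j < 1"
begin

lemma v_bound: "1 \<le> j \<Longrightarrow> j \<le> M \<Longrightarrow> 0 < v j \<and> s * v j < 1"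
proof -
  assume j: "1 \<le> j" "j \<le> M"
  have "s * v j < u 1 * v j" using u[of 1] N v[OF j] by simp
  then show ?thesis using uv[of 1 j] N j v[OF j] by linarith
qed

lemma su_neq: "1 \<le> i \<Longrightarrow> i \<le> N \<Longrightarrow> s * u i \<noteq> 1"
proof -
  assume i: "1 \<le> i" "i \<le> N"
  have "1 * 1 < s * u i" using s1 u[OF i] by (intro mult_strict_mono) auto
  then show ?thesis by simp
qed

lemma dual_bounds: "1 \<le> j \<Longrightarrow> j \<le> M \<Longrightarrow> 0 < dual v j \<and> dual v j < 1"
  using v_bound[of j] par_bounds[of "1 / v j"] by (simp add: dual_def field_simps)

text \<open>Paths move to the right only, so a bound on their exits confines them altogether. These
  finite sets exhaust the path collections.\<close>

definition top_bounded :: "nat \<Rightarrow> arrows set" where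
  "top_bounded L = {\<omega> \<in> path_collections N. \<forall>x\<ge>int L. \<omega> ((x, N), (x, N + 1)) = 0}"

lemma top_bounded_confs: "L \<ge> 1 \<Longrightarrow> top_bounded L = {\<omega> \<in> confs 1 L N. state_at \<omega> L 0 = replicate L False}"
  unfolding top_bounded_def by (rule path_collections_confs)

lemma finite_top_bounded: "finite (top_bounded L)"
proof (rule finite_subset)
  show "top_bounded L \<subseteq> top_bounded (Suc L)" by (auto simp: top_bounded_def)
  show "finite (top_bounded (Suc L))"
    unfolding top_bounded_confs[of "Suc L", simplified] by (rule finite_subset[OF _ finite_confs[of 1 "Suc L" N]]) auto
qed

lemma top_bounded_mono: "L \<le> L' \<Longrightarrow> top_bounded L \<subseteq> top_bounded L'"
  by (auto simp: top_bounded_def)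

lemma in_top_bounded:
  assumes "\<omega> \<in> path_collections N"
  shows "\<exists>L. \<omega> \<in> top_bounded L"
proof -
  from assms obtain \<pi> where \<omega>: "\<omega> = arrows_of {1..N} \<pi>"
    and ex: "\<forall>m\<in>{1..N}. \<exists>x\<ge>0. up_right_path (strip N) (-1, m) (x, N + 1) (\<pi> m)"
    by (auto simp: path_collections_def)
  from bchoice[OF ex] obtain X
    where X: "\<forall>m\<in>{1..N}. X m \<ge> 0 \<and> up_right_path (strip N) (-1, m) (X m, N + 1) (\<pi> m)" by blast
  define L where "L = nat (Max (X ` {1..N}) + 1)"
  have "\<omega> ((x, N), (x, N + 1)) = 0" if "x \<ge> int L" for x
  proof (rule ccontr)
    assume "\<omega> ((x, N), (x, N + 1)) \<noteq> 0"
    then obtain m where m: "m \<in> {1..N}" "((x, N), (x, N + 1)) \<in> path_edges (\<pi> m)"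
      using arrows_of_nonzero[of "{1..N}" \<pi>] unfolding \<omega> by blast
    have p: "up_right_path (strip N) (-1, m) (X m, N + 1) (\<pi> m)" using X m(1) by blast
    have "x \<le> X m" using path_fst_bounds[OF p] path_edge_set[OF p m(2)] by force
    moreover have "X m \<le> Max (X ` {1..N})" using m(1) by (intro Max_ge) auto
    moreover have "0 \<le> X m" using X m(1) by blast
    moreover have "Max (X ` {1..N}) + 1 \<le> int L" by (simp add: L_def)
    ultimately show False using that by linarith
  qed
  then show ?thesis using assms by (auto simp: top_bounded_def)
qed

lemma sum_top_bounded:
  assumes "L \<ge> 1"
  shows "(\<Sum>\<omega>\<in>{\<omega> \<in> top_bounded L. \<forall>y. 1 \<le> y \<and> y \<le> N \<longrightarrow> C y (state_at \<omega> L y)}. total_weight q s N M u v \<omega>) =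
    q ^ N * leveled q C 0 (map (\<lambda>i. par (u i)) [1..<Suc N])
      (\<lambda>xs. foldr (opD q) (dual_rows M v) first_empty xs / prod_list (dual_rows M v) ^ L) (replicate L False)"
proof -
  have "(\<Sum>\<omega>\<in>{\<omega> \<in> path_collections N. (\<forall>x\<ge>int L. \<omega> ((x, N), (x, N + 1)) = 0) \<and>
      (\<forall>y. 1 \<le> y \<and> y \<le> N \<longrightarrow> C y (state_at \<omega> L y))}. total_weight q s N M u v \<omega>) =
    q ^ N * leveled q C 0 (map (\<lambda>i. par (u i)) [1..<Suc N])
      (\<lambda>xs. foldr (opD q) (dual_rows M v) first_empty xs / prod_list (dual_rows M v) ^ L) (replicate L False)"
    by (rule sum_total_weight) (use v_bound su_neq M N assms in auto)
  moreover have "{\<omega> \<in> top_bounded L. \<forall>y. 1 \<le> y \<and> y \<le> N \<longrightarrow> C y (state_at \<omega> L y)} =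
     {\<omega> \<in> path_collections N. (\<forall>x\<ge>int L. \<omega> ((x, N), (x, N + 1)) = 0) \<and>
      (\<forall>y. 1 \<le> y \<and> y \<le> N \<longrightarrow> C y (state_at \<omega> L y))}"
    unfolding top_bounded_def by blast
  ultimately show ?thesis by (simp only:)
qed

lemma dual_rows_01: "set (dual_rows M v) \<subseteq> {0..1}" "prod_list (dual_rows M v) > 0"
proof -
  show "set (dual_rows M v) \<subseteq> {0..1}"
    unfolding dual_rows
  proof
    fix x assume "x \<in> set (map (dual v) (rev [1..<Suc M]))"
    then obtain j where "x = dual v j" "1 \<le> j" "j \<le> M" by (auto simp del: upt_Suc)
    then show "x \<in> {0..1}" using dual_bounds[of j] by simp
  qed
  show "prod_list (dual_rows M v) > 0"
    unfolding dual_rows by (rule prod_list_map_pos) (use dual_bounds in \<open>auto simp del: upt_Suc\<close>)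
qed

text \<open>Single vertex weights may be negative. The states single out one configuration, so its
  weight is itself an instance of the operator formula, in which everything is nonnegative.\<close>

lemma total_weight_nonneg:
  assumes "\<omega> \<in> path_collections N"
  shows "0 \<le> total_weight q s N M u v \<omega>"
proof -
  obtain L where "\<omega> \<in> top_bounded L" using in_top_bounded[OF assms] by blast
  then have w: "\<omega> \<in> top_bounded (Suc L)" using top_bounded_mono[of L "Suc L"] by auto
  have "{\<omega>' \<in> top_bounded (Suc L). \<forall>y. 1 \<le> y \<and> y \<le> N \<longrightarrow> state_at \<omega>' (Suc L) y = state_at \<omega> (Suc L) y} = {\<omega>}"
  proof (intro equalityI subsetI)
    fix \<omega>' assume w': "\<omega>' \<in> {\<omega>' \<in> top_bounded (Suc L). \<forall>y. 1 \<le> y \<and> y \<le> N \<longrightarrow> state_at \<omega>' (Suc L) y = state_at \<omega> (Suc L) y}"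
    have "state_at \<omega>' (Suc L) y = state_at \<omega> (Suc L) y" if "y \<le> N" for y
      using w w' that top_bounded_confs[of "Suc L"] by (cases "y = 0") auto
    then have "\<omega>' = \<omega>" using w w' top_bounded_confs[of "Suc L"] by (intro confs_inj[of \<omega>' 1 "Suc L" N \<omega>]) auto
    then show "\<omega>' \<in> {\<omega>}" by simp
  qed (use w in auto)
  then have "total_weight q s N M u v \<omega> =
    (\<Sum>\<omega>'\<in>{\<omega>' \<in> top_bounded (Suc L). \<forall>y. 1 \<le> y \<and> y \<le> N \<longrightarrow> state_at \<omega>' (Suc L) y = state_at \<omega> (Suc L) y}. total_weight q s N M u v \<omega>')"
    by simp
  also have "\<dots> \<ge> 0"
  proof -
    have "set (map (\<lambda>i. par (u i)) [1..<Suc N]) \<subseteq> {0..1}"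
    proof
      fix x assume "x \<in> set (map (\<lambda>i. par (u i)) [1..<Suc N])"
      then obtain i where "x = par (u i)" "1 \<le> i" "i \<le> N" by (auto simp del: upt_Suc)
      then show "x \<in> {0..1}" using par_bounds[OF u[of i]] by simp
    qed
    moreover have "0 \<le> foldr (opD q) (dual_rows M v) first_empty xs / prod_list (dual_rows M v) ^ L" for xs L
      using dual_rows_01 q by (intro divide_nonneg_nonneg foldr_opD_nonneg) (auto simp: first_empty_def)
    ultimately show ?thesis
      using q by (subst sum_top_bounded) (auto intro!: mult_nonneg_nonneg leveled_nonneg simp del: upt_Suc power_Suc)
  qed
  finally show ?thesis .
qed

lemma first_column_stripped:
  "leveled q C 0 (map (\<lambda>i. par (u i)) [1..<Suc N])
      (\<lambda>xs. foldr (opD q) (dual_rows M v) first_empty xs / prod_list (dual_rows M v) ^ Suc L) (replicate (Suc L) False) =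
    prod_list (map (\<lambda>i. par (u i)) [1..<Suc N]) *
    (leveled q (\<lambda>y ys. C y (False # ys)) 0 (map (\<lambda>i. par (u i)) [1..<Suc N])
      (foldr (opD q) (dual_rows M v) (\<lambda>_. 1)) (replicate L False) / prod_list (dual_rows M v) ^ L)"
proof -
  define P where "P = prod_list (dual_rows M v)"
  define h where "h xs = foldr (opD q) (dual_rows M v) first_empty xs / P ^ Suc L" for xs
  have f: "first_empty (True # ys) = 0" "(\<lambda>ys. first_empty (False # ys)) = (\<lambda>_. 1)" for ys
    by (auto simp: first_empty_def)
  have hT: "h (True # ys) = 0" for ys
    unfolding h_def using foldr_opD_first_column(1)[of first_empty q "dual_rows M v" ys] f(1) by simp
  have hF: "(\<lambda>ys. h (False # ys)) = (\<lambda>ys. foldr (opD q) (dual_rows M v) (\<lambda>_. 1) ys * (1 / P ^ L))"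
  proof
    fix ys
    have "foldr (opD q) (dual_rows M v) first_empty (False # ys) = P * foldr (opD q) (dual_rows M v) (\<lambda>_. 1) ys"
      using foldr_opD_first_column(2)[of first_empty q "dual_rows M v" ys] f by (simp add: P_def)
    moreover have "P > 0" unfolding P_def by (rule dual_rows_01)
    ultimately show "h (False # ys) = foldr (opD q) (dual_rows M v) (\<lambda>_. 1) ys * (1 / P ^ L)"
      by (simp add: h_def)
  qed
  have "leveled q C 0 (map (\<lambda>i. par (u i)) [1..<Suc N]) h (False # replicate L False) =
     prod_list (map (\<lambda>i. par (u i)) [1..<Suc N]) *
     leveled q (\<lambda>y ys. C y (False # ys)) 0 (map (\<lambda>i. par (u i)) [1..<Suc N]) (\<lambda>ys. h (False # ys)) (replicate L False)"
    by (rule leveled_first_column(2)) (rule hT)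
  then show ?thesis unfolding hF leveled_scale by (simp add: h_def[abs_def] P_def del: upt_Suc)
qed

context
  fixes k :: nat and m :: "nat \<Rightarrow> nat"
  assumes m1: "k \<ge> 1 \<Longrightarrow> 1 \<le> m 1" and mono: "\<And>r. 1 \<le> r \<Longrightarrow> r < k \<Longrightarrow> m r \<le> m (Suc r)" and mk: "k \<ge> 1 \<Longrightarrow> m k \<le> N"
    and kN: "k \<le> N"
begin

lemma m_range: "i \<in> {1..k} \<Longrightarrow> 1 \<le> m i \<and> m i \<le> N"
  using m_mono[OF m1 mono mk, of 1 i] m_mono[OF m1 mono mk, of i k] m1 mk by fastforce

lemma sum_event:
  assumes "L \<ge> N"
  shows "(\<Sum>\<omega>\<in>{\<omega> \<in> top_bounded (Suc L). event N k m \<omega>}. total_weight q s N M u v \<omega>) =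
    q ^ N * prod_list (map (\<lambda>i. par (u i)) [1..<Suc N]) * event_ratio N M (\<lambda>i. par (u i)) (dual v) k m L"
proof -
  define C where "C y xs \<longleftrightarrow> (\<forall>i\<in>{1..k}. m i = y \<longrightarrow> i \<le> occ (take (Suc i) xs))" for y and xs :: "bool list"
  have ev: "event N k m \<omega> \<longleftrightarrow> (\<forall>y. 1 \<le> y \<and> y \<le> N \<longrightarrow> C y (state_at \<omega> (Suc L) y))" if "\<omega> \<in> top_bounded (Suc L)" for \<omega>
  proof -
    have w: "\<omega> \<in> confs 1 (Suc L) N" "state_at \<omega> (Suc L) 0 = replicate (Suc L) False"
      using that top_bounded_confs[of "Suc L"] by auto
    have "vset \<omega> 0 = {}" unfolding vset_pos[OF w(1)] w(2) by (auto simp: pos_def simp del: replicate_Suc)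
    then have b: "\<omega> ((x, 0), (x, Suc 0)) = 0" for x by (auto simp: vset_def)
    have "event N k m \<omega> \<longleftrightarrow> (\<forall>i\<in>{1..k}. i \<le> occ (take (Suc i) (state_at \<omega> (Suc L) (m i))))"
      unfolding event_def
    proof (intro ball_cong refl)
      fix i assume "i \<in> {1..k}"
      then show "Y N i i \<omega> \<le> enat (m i) \<longleftrightarrow> i \<le> occ (take (Suc i) (state_at \<omega> (Suc L) (m i)))"
        using m_range[of i] by (intro Y_le_iff[OF w(1) b]) auto
    qed
    also have "\<dots> \<longleftrightarrow> (\<forall>y. 1 \<le> y \<and> y \<le> N \<longrightarrow> C y (state_at \<omega> (Suc L) y))"
      unfolding C_def using m_range by blast
    finally show ?thesis .
  qed
  have "{\<omega> \<in> top_bounded (Suc L). event N k m \<omega>} =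
      {\<omega> \<in> top_bounded (Suc L). \<forall>y. 1 \<le> y \<and> y \<le> N \<longrightarrow> C y (state_at \<omega> (Suc L) y)}"
    using ev by blast
  then have "(\<Sum>\<omega>\<in>{\<omega> \<in> top_bounded (Suc L). event N k m \<omega>}. total_weight q s N M u v \<omega>) =
    q ^ N * leveled q C 0 (map (\<lambda>i. par (u i)) [1..<Suc N])
      (\<lambda>xs. foldr (opD q) (dual_rows M v) first_empty xs / prod_list (dual_rows M v) ^ Suc L) (replicate (Suc L) False)"
    by (simp only:) (rule sum_top_bounded, simp)
  also have "\<dots> = q ^ N * prod_list (map (\<lambda>i. par (u i)) [1..<Suc N]) *
    (leveled q (\<lambda>y ys. C y (False # ys)) 0 (map (\<lambda>i. par (u i)) [1..<Suc N])
      (foldr (opD q) (dual_rows M v) (\<lambda>_. 1)) (replicate L False) / prod_list (dual_rows M v) ^ L)"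
    unfolding first_column_stripped by simp
  also have "leveled q (\<lambda>y ys. C y (False # ys)) 0 (map (\<lambda>i. par (u i)) [1..<Suc N])
      (foldr (opD q) (dual_rows M v) (\<lambda>_. 1)) (replicate L False) =
    leveled q (level_cond m k 1) 0 (map (\<lambda>i. par (u i)) [1..<Suc N])
      (foldr (opD q) (dual_rows M v) (\<lambda>_. 1)) (replicate L False)"
  proof (rule leveled_cong)
    fix y and ys :: "bool list" assume len: "length ys = length (replicate L False)"
    \<comment> \<open>Column 0 is empty, so \<open>i\<close> arrows in the columns 0, ..., i mean
      that the columns 1, ..., i are all occupied.\<close>
    have "i \<le> occ (take (Suc i) (False # ys)) \<longleftrightarrow> full i ys" if "i \<in> {1..k}" for i
      using full_iff_occ[of i ys] that len kN assms by simp
    then show "C y (False # ys) = level_cond m k 1 y ys"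
      unfolding C_def level_cond_def by blast
  qed
  also have "\<dots> = guarded q full 1 (map (map (\<lambda>i. par (u i))) (map (segment m) [1..<Suc k]))
      (foldr (opB q) (map (\<lambda>i. par (u i)) [Suc (if k = 0 then 0 else m k)..<Suc N]) (foldr (opD q) (dual_rows M v) (\<lambda>_. 1)))
      (replicate L False)"
    by (rule guarded_leveled[OF m1 mono mk, symmetric])
  finally show ?thesis
    by (simp add: event_ratio_def ratio_def top_def dual_rows del: upt_Suc)
qed

end

theorem path_prob_ratio:
  assumes m1: "k \<ge> 1 \<Longrightarrow> 1 \<le> m 1" and mono: "\<And>r. 1 \<le> r \<Longrightarrow> r < k \<Longrightarrow> m r \<le> m (Suc r)" and mk: "k \<ge> 1 \<Longrightarrow> m k \<le> N"
    and kN: "k \<le> N"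
    and T: "event_ratio N M (\<lambda>i. par (u i)) (dual v) k m \<longlonglongrightarrow> T"
    and T0: "event_ratio N M (\<lambda>i. par (u i)) (dual v) 0 m \<longlonglongrightarrow> T0" "T0 \<noteq> 0"
  shows "path_prob q s N M u v (event N k m) = T / T0"
proof -
  define c where "c = q ^ N * prod_list (map (\<lambda>i. par (u i)) [1..<Suc N])"
  define f where "f = total_weight q s N M u v"
  have c0: "c > 0"
    unfolding c_def using q par_bounds u by (intro mult_pos_pos prod_list_map_pos) (auto simp del: upt_Suc)
  have S: "sum f {\<omega> \<in> top_bounded (Suc L). event N k m \<omega>} = c * event_ratio N M (\<lambda>i. par (u i)) (dual v) k m L"
    if "L \<ge> N" for L
    unfolding f_def c_def using sum_event[OF m1 mono mk kN that] by simp
  have S0: "sum f (top_bounded (Suc L)) = c * event_ratio N M (\<lambda>i. par (u i)) (dual v) 0 m L" if "L \<ge> N" for L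
    unfolding f_def c_def using sum_event[of 0 m L] that by (simp add: event_def)
  have lim0: "(\<lambda>L. sum f (top_bounded (Suc L))) \<longlonglongrightarrow> c * T0"
    by (rule Lim_transform_eventually[OF tendsto_mult_left[OF T0(1)]])
      (use S0 in \<open>auto simp: eventually_sequentially intro!: exI[of _ N]\<close>)
  have lim: "(\<lambda>L. sum f {\<omega> \<in> top_bounded (Suc L). event N k m \<omega>}) \<longlonglongrightarrow> c * T"
    by (rule Lim_transform_eventually[OF tendsto_mult_left[OF T]])
      (use S in \<open>auto simp: eventually_sequentially intro!: exI[of _ N]\<close>)
  have nn: "f \<omega> \<ge> 0" if "\<omega> \<in> path_collections N" for \<omega>
    unfolding f_def using that by (rule total_weight_nonneg)
  have cover: "\<forall>\<^sub>F L in sequentially. X \<subseteq> top_bounded (Suc L)" if "finite X" "X \<subseteq> path_collections N" for X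
    using that
  proof (induction X rule: finite_induct)
    case (insert \<omega> X)
    then obtain L0 where "\<omega> \<in> top_bounded L0" using in_top_bounded[of \<omega>] by auto
    have "\<omega> \<in> top_bounded (Suc L)" if "L0 \<le> L" for L
      using \<open>\<omega> \<in> top_bounded L0\<close> top_bounded_mono[of L0 "Suc L"] that by (simp add: subset_iff)
    then have "\<forall>\<^sub>F L in sequentially. \<omega> \<in> top_bounded (Suc L)"
      unfolding eventually_sequentially by blast
    then show ?case using insert by (auto intro: eventually_conj)
  qed simp
  have sub: "top_bounded L \<subseteq> path_collections N" for L by (auto simp: top_bounded_def)
  obtain B where B: "\<And>L. sum f (top_bounded (Suc L)) \<le> B"
    using convergent_imp_Bseq[OF convergentI[OF lim0]] by (auto simp: Bseq_def abs_le_iff)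
  \<comment> \<open>Without summability \<open>infsum\<close> would be 0 by default. It follows from
    nonnegativity and from the convergence of the sums over the exhausting sets.\<close>
  have summ: "f summable_on path_collections N"
  proof (rule nonneg_bdd_above_summable_on)
    show "bdd_above (sum f ` {F. F \<subseteq> path_collections N \<and> finite F})"
    proof (rule bdd_aboveI)
      fix x assume "x \<in> sum f ` {F. F \<subseteq> path_collections N \<and> finite F}"
      then obtain F where F: "F \<subseteq> path_collections N" "finite F" "x = sum f F" by auto
      from cover[OF F(2,1)] obtain L where "F \<subseteq> top_bounded (Suc L)"
        by (auto simp: eventually_sequentially)
      then have "sum f F \<le> sum f (top_bounded (Suc L))"
        using finite_top_bounded by (intro sum_mono2) (auto intro!: nn subsetD[OF sub])
      then show "x \<le> B" using F B order.trans by blast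
    qed
  qed (rule nn)
  have inf: "infsum f {\<omega> \<in> path_collections N. E \<omega>} = l"
    if "(\<lambda>L. sum f {\<omega> \<in> top_bounded (Suc L). E \<omega>}) \<longlonglongrightarrow> l" for E l
  proof -
    define A where "A = {\<omega> \<in> path_collections N. E \<omega>}"
    have "f summable_on A" by (rule summable_on_subset_banach[OF summ]) (auto simp: A_def)
    then have "(sum f \<longlongrightarrow> infsum f A) (finite_subsets_at_top A)" using has_sum_infsum has_sum_def by blast
    \<comment> \<open>The exhausting sets are cofinal among the finite subsets, so the sum may be
      computed along them.\<close>
    moreover have "filterlim (\<lambda>L. {\<omega> \<in> top_bounded (Suc L). E \<omega>}) (finite_subsets_at_top A) sequentially"
      unfolding filterlim_finite_subsets_at_top
    proof (intro allI impI)
      fix X assume X: "finite X \<and> X \<subseteq> A"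
      then have "\<forall>\<^sub>F L in sequentially. X \<subseteq> top_bounded (Suc L)" by (intro cover) (auto simp: A_def)
      then show "\<forall>\<^sub>F L in sequentially. finite {\<omega> \<in> top_bounded (Suc L). E \<omega>} \<and>
         X \<subseteq> {\<omega> \<in> top_bounded (Suc L). E \<omega>} \<and> {\<omega> \<in> top_bounded (Suc L). E \<omega>} \<subseteq> A"
        by eventually_elim (use X sub finite_top_bounded in \<open>auto simp: A_def\<close>)
    qed
    ultimately have "(\<lambda>L. sum f {\<omega> \<in> top_bounded (Suc L). E \<omega>}) \<longlonglongrightarrow> infsum f A"
      by (rule filterlim_compose)
    then show ?thesis using that LIMSEQ_unique unfolding A_def by blast
  qed
  have Z: "infsum f (path_collections N) = c * T0" using inf[of "\<lambda>_. True"] lim0 by simp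
  have "path_prob q s N M u v (event N k m) = infsum (\<lambda>\<omega>. f \<omega> * (1 / (c * T0))) {\<omega> \<in> path_collections N. event N k m \<omega>}"
    unfolding path_prob_def f_def[symmetric] Z by simp
  also have "\<dots> = infsum f {\<omega> \<in> path_collections N. event N k m \<omega>} * (1 / (c * T0))"
    by (rule infsum_cmult_left')
  also have "\<dots> = T / T0" using inf[OF lim] c0 by simp
  finally show ?thesis .
qed

end

end

section \<open>Iterated contour integrals\<close>

definition smooth_path :: "(real \<Rightarrow> complex) \<Rightarrow> bool" where
  "smooth_path p \<longleftrightarrow> valid_path p \<and> continuous_on {0..1} (\<lambda>t. vector_derivative p (at t))"

lemma smooth_path_linepath: "smooth_path (linepath a b)"
  by (simp add: smooth_path_def)

lemma smooth_path_polynomial: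
  assumes "polynomial_function p"
  shows "smooth_path p"
proof -
  obtain p' where p': "polynomial_function p'" "\<And>x. (p has_vector_derivative (p' x)) (at x)"
    using has_vector_derivative_polynomial_function[OF assms] by blast
  then have "vector_derivative p (at t) = p' t" for t by (simp add: vector_derivative_at)
  then show ?thesis
    using p' assms by (simp add: smooth_path_def valid_path_polynomial_function continuous_on_polymonial_function)
qed

lemma continuous_on_contour_integral_param:
  fixes f :: "'a::topological_space \<Rightarrow> complex \<Rightarrow> complex"
  assumes p: "smooth_path p" and f: "continuous_on (U \<times> path_image p) (\<lambda>(x, w). f x w)"
  shows "continuous_on U (\<lambda>x. contour_integral p (f x))"
proof -
  have c: "continuous_on {0..1} p" "continuous_on {0..1} (\<lambda>t. vector_derivative p (at t))"
    using p valid_path_imp_path by (auto simp: smooth_path_def path_def)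
  have "continuous_on (U \<times> {0..1}) (\<lambda>y. (\<lambda>(x, w). f x w) (fst y, p (snd y)))"
    by (rule continuous_on_compose2[OF f])
      (auto intro!: continuous_intros continuous_on_compose2[OF c(1)] simp: path_image_def)
  moreover have "continuous_on (U \<times> {0..1}) (\<lambda>y. vector_derivative p (at (snd y)))"
    by (rule continuous_on_compose2[OF c(2)]) (auto intro!: continuous_intros)
  ultimately have "continuous_on (U \<times> cbox 0 1) (\<lambda>(x, t). f x (p t) * vector_derivative p (at t))"
    by (auto simp: split_beta intro!: continuous_intros)
  from integral_continuous_on_param[OF this] show ?thesis
    by (simp add: contour_integral_integral)
qed

lemma smooth_path_contour_integrable:
  assumes p: "smooth_path p" and f: "continuous_on (path_image p) f"
  shows "f contour_integrable_on p"
proof -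
  have c: "continuous_on {0..1} p" "continuous_on {0..1} (\<lambda>t. vector_derivative p (at t))"
    using p valid_path_imp_path by (auto simp: smooth_path_def path_def)
  have "continuous_on {0..1} (\<lambda>t. f (p t))"
    by (rule continuous_on_compose2[OF f c(1)]) (auto simp: path_image_def)
  then have "continuous_on {0..1} (\<lambda>t. f (p t) * vector_derivative p (at t))"
    using c(2) by (intro continuous_intros)
  then show ?thesis
    unfolding contour_integrable_on by (rule integrable_continuous_real)
qed

text \<open>By Morera's theorem it suffices to integrate around triangles. Continuity allows the two
  integrations to be exchanged, and the inner one then vanishes by Cauchy's theorem.\<close>

lemma holomorphic_contour_integral_param:
  fixes f :: "complex \<Rightarrow> complex \<Rightarrow> complex"
  assumes p: "smooth_path p" and W: "open W"
    and f: "continuous_on (W \<times> path_image p) (\<lambda>(x, w). f x w)"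
    and hol: "\<And>w. w \<in> path_image p \<Longrightarrow> (\<lambda>x. f x w) holomorphic_on W"
  shows "(\<lambda>x. contour_integral p (f x)) holomorphic_on W"
proof -
  let ?F = "\<lambda>x. contour_integral p (f x)"
  have "?F analytic_on W"
  proof (rule Morera_triangle)
    show "continuous_on W ?F" by (rule continuous_on_contour_integral_param[OF p f])
    show "open W" by (rule W)
    show "convex hull {a, b, c} \<subseteq> W \<longrightarrow> contour_integral (linepath a b) ?F + contour_integral (linepath b c) ?F
        + contour_integral (linepath c a) ?F = 0" for a b c
    proof
      assume abc: "convex hull {a, b, c} \<subseteq> W"
      define I where "I x y w = contour_integral (linepath x y) (\<lambda>z. f z w)" for x y w
      have seg: "closed_segment x y \<subseteq> W" if "{x, y} \<subseteq> {a, b, c}" for x y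
        using abc hull_mono[OF that, of convex] by (simp add: segment_convex_hull)
      have ci: "continuous_on (path_image p) (I x y)" if "{x, y} \<subseteq> {a, b, c}" for x y
        unfolding I_def
      proof (rule continuous_on_contour_integral_param[OF smooth_path_linepath])
        have "continuous_on (path_image p \<times> closed_segment x y) (\<lambda>z. (\<lambda>(x, w). f x w) (snd z, fst z))"
          by (rule continuous_on_compose2[OF f]) (use seg[OF that] in \<open>auto intro!: continuous_intros\<close>)
        then show "continuous_on (path_image p \<times> path_image (linepath x y)) (\<lambda>(w, z). f z w)"
          by (simp add: split_beta)
      qed
      have swap: "contour_integral (linepath x y) ?F = contour_integral p (I x y)" if "{x, y} \<subseteq> {a, b, c}" for x y
        unfolding I_def
      proof (rule contour_integral_swap)
        show "continuous_on (path_image (linepath x y) \<times> path_image p) (\<lambda>(y1, y2). f y1 y2)"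
          by (rule continuous_on_subset[OF f]) (use seg[OF that] in auto)
      qed (use p in \<open>auto simp: smooth_path_def\<close>)
      have "contour_integral (linepath a b) ?F + contour_integral (linepath b c) ?F + contour_integral (linepath c a) ?F
          = contour_integral p (\<lambda>w. I a b w + I b c w + I c a w)"
        by (simp add: swap contour_integral_add contour_integrable_add smooth_path_contour_integrable[OF p] ci)
      also have "\<dots> = contour_integral p (\<lambda>w. 0)"
      proof (rule contour_integral_cong[OF refl])
        fix w assume "w \<in> path_image p"
        then have h: "(\<lambda>x. f x w) holomorphic_on convex hull {a, b, c}"
          using holomorphic_on_subset[OF hol abc] by blast
        have int: "(\<lambda>x. f x w) contour_integrable_on linepath x y" if "{x, y} \<subseteq> {a, b, c}" for x y
        proof (rule contour_integrable_continuous_linepath)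
          have "closed_segment x y \<subseteq> convex hull {a, b, c}"
            using hull_mono[OF that, of convex] by (simp add: segment_convex_hull)
          then show "continuous_on (closed_segment x y) (\<lambda>x. f x w)"
            using h by (meson continuous_on_subset holomorphic_on_imp_continuous_on)
        qed
        have "contour_integral (linepath a b +++ linepath b c +++ linepath c a) (\<lambda>x. f x w) = 0"
          using Cauchy_theorem_triangle[OF h] contour_integral_unique by blast
        then show "I a b w + I b c w + I c a w = 0"
          by (simp add: I_def int valid_path_join contour_integrable_joinI contour_integral_join add.assoc)
      qed
      finally show "contour_integral (linepath a b) ?F + contour_integral (linepath b c) ?F
          + contour_integral (linepath c a) ?F = 0" by simp
    qed
  qed
  then show ?thesis by (rule analytic_imp_holomorphic)
qed

text \<open>Coordinate \<open>0\<close> serves as a parameter, in which only continuity is required.\<close>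

definition polydomain :: "complex set \<Rightarrow> complex set \<Rightarrow> nat set \<Rightarrow> (nat \<Rightarrow> complex) set" where
  "polydomain E W J = {z. z 0 \<in> E \<and> (\<forall>i\<in>J. z i \<in> W)}"

definition separately_holomorphic ::
  "complex set \<Rightarrow> complex set \<Rightarrow> nat set \<Rightarrow> ((nat \<Rightarrow> complex) \<Rightarrow> complex) \<Rightarrow> bool" where
  "separately_holomorphic E W J F \<longleftrightarrow> continuous_on (polydomain E W J) F \<and>
     (\<forall>z\<in>polydomain E W J. \<forall>i\<in>J. (\<lambda>w. F (z(i := w))) holomorphic_on W)"

lemma continuous_on_fun_upd:
  fixes f :: "'a::topological_space \<Rightarrow> 'i \<Rightarrow> 'b::topological_space"
  assumes "continuous_on S f" "continuous_on S g"
  shows "continuous_on S (\<lambda>x. (f x)(i := g x))"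
proof (rule continuous_on_coordinatewise_then_product)
  fix j
  show "continuous_on S (\<lambda>x. ((f x)(i := g x)) j)"
    using assms continuous_on_product_then_coordinatewise[OF assms(1)] by (cases "j = i") auto
qed

lemma separately_holomorphic_contour_integral:
  assumes p: "smooth_path p" "path_image p \<subseteq> W" and W: "open W" and i: "i \<notin> J" "i \<noteq> 0" and J: "0 \<notin> J"
    and F: "separately_holomorphic E W (insert i J) F"
  shows "separately_holomorphic E W J (\<lambda>z. contour_integral p (\<lambda>w. F (z(i := w))))"
proof -
  let ?D = "polydomain E W J"
  have cF: "continuous_on (polydomain E W (insert i J)) F"
    and hF: "\<And>z j. z \<in> polydomain E W (insert i J) \<Longrightarrow> j \<in> insert i J \<Longrightarrow> (\<lambda>w. F (z(j := w))) holomorphic_on W"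
    using F by (auto simp: separately_holomorphic_def)
  have upd: "z(i := w) \<in> polydomain E W (insert i J)" if "z \<in> ?D" "w \<in> W" for z w
    using that i by (auto simp: polydomain_def)
  have c: "continuous_on ?D (\<lambda>z. contour_integral p (\<lambda>w. F (z(i := w))))"
  proof (rule continuous_on_contour_integral_param[OF p(1)])
    have "continuous_on (?D \<times> path_image p) (\<lambda>y. F ((fst y)(i := snd y)))"
      by (rule continuous_on_compose2[OF cF]) (use upd p in \<open>auto intro!: continuous_on_fun_upd continuous_on_fst continuous_on_snd continuous_on_id continuous_on_const\<close>)
    then show "continuous_on (?D \<times> path_image p) (\<lambda>(z, w). F (z(i := w)))" by (simp add: split_beta)
  qed
  have "(\<lambda>x. contour_integral p (\<lambda>w. F (z(j := x, i := w)))) holomorphic_on W" if z: "z \<in> ?D" "j \<in> J" for z j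
  proof (rule holomorphic_contour_integral_param[OF p(1) W])
    have ji: "j \<noteq> i" "j \<noteq> 0" using z i J by (auto intro: ccontr)
    have upd2: "z(j := x, i := w) \<in> polydomain E W (insert i J)" if "x \<in> W" "w \<in> W" for x w
      using that z i ji by (auto simp: polydomain_def)
    have "continuous_on (W \<times> path_image p) (\<lambda>y. F (z(j := fst y, i := snd y)))"
      by (rule continuous_on_compose2[OF cF]) (use upd2 p in \<open>auto intro!: continuous_on_fun_upd continuous_on_fst continuous_on_snd continuous_on_id continuous_on_const\<close>)
    then show "continuous_on (W \<times> path_image p) (\<lambda>(x, w). F (z(j := x, i := w)))" by (simp add: split_beta)
    fix w assume "w \<in> path_image p"
    then have "(\<lambda>x. F (z(i := w, j := x))) holomorphic_on W"
      using hF[OF upd[OF z(1)], of w j] z p by auto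
    then show "(\<lambda>x. F (z(j := x, i := w))) holomorphic_on W" using ji by (simp add: fun_upd_twist)
  qed
  then show ?thesis using c by (simp add: separately_holomorphic_def)
qed

text \<open>The iterated integral evaluates its integrand at points that vanish outside the
  coordinates 1, ..., k. This operation puts the outer variables there, so that they can act as
  parameters.\<close>

definition merge :: "nat \<Rightarrow> (nat \<Rightarrow> 'a) \<Rightarrow> (nat \<Rightarrow> 'a) \<Rightarrow> nat \<Rightarrow> 'a" where
  "merge k z z' = (\<lambda>i. if i \<in> {1..k} then z i else z' i)"

lemma merge_0: "merge 0 z z' = z'"
  by (auto simp: merge_def)

lemma merge_Suc: "merge (Suc k) (z(Suc k := w)) z' = merge k z (z'(Suc k := w))"
  by (auto simp: merge_def fun_eq_iff)

definition iterated_partial ::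
  "nat \<Rightarrow> (real \<Rightarrow> complex) \<Rightarrow> ((nat \<Rightarrow> complex) \<Rightarrow> complex) \<Rightarrow> (nat \<Rightarrow> complex) \<Rightarrow> complex" where
  "iterated_partial k \<gamma> F z' = iterated_contour_integral k \<gamma> (\<lambda>z. F (merge k z z'))"

lemma iterated_partial_Suc:
  "iterated_partial (Suc k) \<gamma> F z' = contour_integral \<gamma> (\<lambda>w. iterated_partial k \<gamma> F (z'(Suc k := w)))"
  by (simp add: iterated_partial_def merge_Suc)

lemma iterated_partial_0: "iterated_partial 0 \<gamma> F = F"
  by (simp add: iterated_partial_def fun_eq_iff merge_0)

lemma iterated_eq_partial: "iterated_contour_integral k \<gamma> F = iterated_partial k \<gamma> F (\<lambda>_. 0)"
proof -
  have "iterated_contour_integral k \<gamma> (\<lambda>z. F (h z)) = iterated_contour_integral k \<gamma> (\<lambda>z. F (h (merge k z (\<lambda>_. 0))))" for h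
  proof (induction k arbitrary: h)
    case (Suc k)
    have "iterated_contour_integral k \<gamma> (\<lambda>z. F (h (z(Suc k := w))))
        = iterated_contour_integral k \<gamma> (\<lambda>z. F (h (merge (Suc k) (z(Suc k := w)) (\<lambda>_. 0))))" for w
    proof -
      have "merge (Suc k) (z(Suc k := w)) (\<lambda>_. 0) = (merge k z (\<lambda>_. 0))(Suc k := w)" for z
        by (auto simp: merge_def fun_eq_iff)
      then show ?thesis using Suc[of "\<lambda>z. h (z(Suc k := w))"] by simp
    qed
    then show ?case by simp
  qed (simp add: merge_0)
  from this[of "\<lambda>z. z"] show ?thesis by (simp add: iterated_partial_def)
qed

lemma separately_holomorphic_iterated:
  assumes p: "smooth_path p" "path_image p \<subseteq> W" and W: "open W"
    and F: "separately_holomorphic E W ({1..k} \<union> J) F" and J: "\<And>i. i \<in> J \<Longrightarrow> i > k"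
  shows "separately_holomorphic E W J (iterated_partial k p F)"
  using F J
proof (induction k arbitrary: J)
  case (Suc k)
  have "{1..k} \<union> insert (Suc k) J = {1..Suc k} \<union> J" by auto
  then have "separately_holomorphic E W (insert (Suc k) J) (iterated_partial k p F)"
    using Suc.prems by (intro Suc.IH) (auto dest: Suc_lessD)
  from separately_holomorphic_contour_integral[OF p W _ _ _ this] Suc.prems(2)
  show ?case by (auto simp: iterated_partial_Suc[abs_def])
qed (simp add: iterated_partial_0)

text \<open>A valid path may have an unbounded derivative and infinite length. Holomorphy of the integrand
  allows it to be replaced by a polynomial path, for which parameter integrals are continuous.\<close>

lemma smooth_path_replacement:
  assumes "valid_path \<gamma>" "path_image \<gamma> \<subseteq> W" "open W"
  obtains p where "smooth_path p" "path_image p \<subseteq> W"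
    "\<And>f. f holomorphic_on W \<Longrightarrow> contour_integral \<gamma> f = contour_integral p f"
proof -
  have "path \<gamma>" using assms valid_path_imp_path by blast
  from contour_integral_nearby_ends[OF assms(3) this assms(2)] obtain d where d: "d > 0"
    and near: "\<And>g h. valid_path g \<Longrightarrow> valid_path h \<Longrightarrow> \<forall>t\<in>{0..1}. norm (g t - \<gamma> t) < d \<and> norm (h t - \<gamma> t) < d \<Longrightarrow>
      pathstart h = pathstart g \<Longrightarrow> pathfinish h = pathfinish g \<Longrightarrow>
      path_image g \<subseteq> W \<and> path_image h \<subseteq> W \<and> (\<forall>f. f holomorphic_on W \<longrightarrow> contour_integral h f = contour_integral g f)"
    by metis
  from path_approx_polynomial_function[OF \<open>path \<gamma>\<close> d] obtain p where
    p: "polynomial_function p" "pathstart p = pathstart \<gamma>" "pathfinish p = pathfinish \<gamma>"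
      "\<And>t. t \<in> {0..1} \<Longrightarrow> norm (p t - \<gamma> t) < d" by blast
  have "path_image p \<subseteq> W \<and> (\<forall>f. f holomorphic_on W \<longrightarrow> contour_integral \<gamma> f = contour_integral p f)"
    using near[of p \<gamma>] p d assms by (auto simp: valid_path_polynomial_function)
  then show thesis using that smooth_path_polynomial[OF p(1)] by blast
qed

text \<open>The paths are exchanged from the innermost variable outwards: once the inner variables
  run along \<open>p\<close>, the partial integral is holomorphic in the next variable, so its path
  may be exchanged as well.\<close>

lemma iterated_partial_smooth:
  assumes \<gamma>: "path_image \<gamma> \<subseteq> W" and p: "smooth_path p" "path_image p \<subseteq> W" and W: "open W"
    and eq: "\<And>f. f holomorphic_on W \<Longrightarrow> contour_integral \<gamma> f = contour_integral p f"
    and F: "separately_holomorphic E W ({1..k} \<union> J) F" and J: "\<And>i. i \<in> J \<Longrightarrow> i > k"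
    and z: "z \<in> polydomain E W J"
  shows "iterated_partial k \<gamma> F z = iterated_partial k p F z"
  using F J z
proof (induction k arbitrary: J z)
  case (Suc k)
  let ?J = "insert (Suc k) J"
  have J': "{1..k} \<union> ?J = {1..Suc k} \<union> J" by auto
  have F': "separately_holomorphic E W ({1..k} \<union> ?J) F" using Suc.prems J' by simp
  have g: "i > k" if "i \<in> ?J" for i using that Suc.prems by (auto dest: Suc_lessD)
  have upd: "z(Suc k := w) \<in> polydomain E W ?J" if "w \<in> W" for w
    using Suc.prems that by (auto simp: polydomain_def)
  obtain w0 where w0: "w0 \<in> W" using \<gamma> path_image_nonempty by blast
  have "iterated_partial (Suc k) \<gamma> F z = contour_integral \<gamma> (\<lambda>w. iterated_partial k p F (z(Suc k := w)))"
    unfolding iterated_partial_Suc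
    using \<gamma> by (intro contour_integral_cong[OF refl] Suc.IH[OF F' g] upd) auto
  also have "\<dots> = contour_integral p (\<lambda>w. iterated_partial k p F (z(Suc k := w)))"
  proof (rule eq)
    have "separately_holomorphic E W ?J (iterated_partial k p F)"
      by (rule separately_holomorphic_iterated[OF p W F' g])
    then have "(\<lambda>w. iterated_partial k p F (z(Suc k := w0, Suc k := w))) holomorphic_on W"
      using upd[OF w0] by (auto simp: separately_holomorphic_def simp del: fun_upd_upd)
    then show "(\<lambda>w. iterated_partial k p F (z(Suc k := w))) holomorphic_on W" by simp
  qed
  also have "\<dots> = iterated_partial (Suc k) p F z" by (simp add: iterated_partial_Suc)
  finally show ?case .
qed (simp add: iterated_partial_0)

lemma separately_holomorphic_iterated_partial:
  assumes \<gamma>: "valid_path \<gamma>" "path_image \<gamma> \<subseteq> W" and W: "open W"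
    and F: "separately_holomorphic E W ({1..k} \<union> J) F" and J: "\<And>i. i \<in> J \<Longrightarrow> i > k"
  shows "separately_holomorphic E W J (iterated_partial k \<gamma> F)"
proof -
  obtain p where p: "smooth_path p" "path_image p \<subseteq> W"
    "\<And>f. f holomorphic_on W \<Longrightarrow> contour_integral \<gamma> f = contour_integral p f"
    using smooth_path_replacement[OF \<gamma> W] by blast
  note sh = separately_holomorphic_iterated[OF p(1,2) W F J]
  have eq: "iterated_partial k \<gamma> F z = iterated_partial k p F z" if "z \<in> polydomain E W J" for z
    by (rule iterated_partial_smooth[OF \<gamma>(2) p(1,2) W p(3) F J that])
  have "(\<lambda>w. iterated_partial k \<gamma> F (z(i := w))) holomorphic_on W" if "z \<in> polydomain E W J" "i \<in> J" for z i
  proof -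
    have "z(i := w) \<in> polydomain E W J" if "w \<in> W" for w
      using \<open>z \<in> _\<close> \<open>i \<in> J\<close> J[OF \<open>i \<in> J\<close>] that by (auto simp: polydomain_def)
    then show ?thesis
      using sh that by (subst holomorphic_cong[OF refl eq]) (auto simp: separately_holomorphic_def)
  qed
  moreover have "continuous_on (polydomain E W J) (iterated_partial k \<gamma> F)"
    using sh eq by (simp add: separately_holomorphic_def cong: continuous_on_cong)
  ultimately show ?thesis by (simp add: separately_holomorphic_def)
qed

lemma iterated_partial_sum:
  assumes \<gamma>: "valid_path \<gamma>" "path_image \<gamma> \<subseteq> W" and W: "open W" and L: "finite L"
    and F: "\<And>l. l \<in> L \<Longrightarrow> separately_holomorphic E W ({1..k} \<union> J) (F l)" and J: "\<And>i. i \<in> J \<Longrightarrow> i > k"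
    and z: "z \<in> polydomain E W J"
  shows "iterated_partial k \<gamma> (\<lambda>z. \<Sum>l\<in>L. c l * F l z) z = (\<Sum>l\<in>L. c l * iterated_partial k \<gamma> (F l) z)"
  using F J z
proof (induction k arbitrary: J z)
  case (Suc k)
  let ?J = "insert (Suc k) J"
  have J': "{1..k} \<union> ?J = {1..Suc k} \<union> J" by auto
  have F': "separately_holomorphic E W ({1..k} \<union> ?J) (F l)" if "l \<in> L" for l using Suc.prems J' that by simp
  have g: "i > k" if "i \<in> ?J" for i using that Suc.prems by (auto dest: Suc_lessD)
  have upd: "z(Suc k := w) \<in> polydomain E W ?J" if "w \<in> W" for w
    using Suc.prems that by (auto simp: polydomain_def)
  obtain w0 where w0: "w0 \<in> W" using \<gamma> path_image_nonempty by blast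
  have int: "(\<lambda>w. iterated_partial k \<gamma> (F l) (z(Suc k := w))) contour_integrable_on \<gamma>" if "l \<in> L" for l
  proof (rule contour_integrable_holomorphic_simple[OF _ W \<gamma>])
    have "separately_holomorphic E W ?J (iterated_partial k \<gamma> (F l))"
      by (rule separately_holomorphic_iterated_partial[OF \<gamma> W F'[OF that] g])
    then have "(\<lambda>w. iterated_partial k \<gamma> (F l) (z(Suc k := w0, Suc k := w))) holomorphic_on W"
      using upd[OF w0] by (auto simp: separately_holomorphic_def simp del: fun_upd_upd)
    then show "(\<lambda>w. iterated_partial k \<gamma> (F l) (z(Suc k := w))) holomorphic_on W" by simp
  qed
  have "iterated_partial (Suc k) \<gamma> (\<lambda>z. \<Sum>l\<in>L. c l * F l z) z
      = contour_integral \<gamma> (\<lambda>w. \<Sum>l\<in>L. c l * iterated_partial k \<gamma> (F l) (z(Suc k := w)))"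
    unfolding iterated_partial_Suc
    using \<gamma> by (intro contour_integral_cong[OF refl] Suc.IH[OF F' g] upd) auto
  also have "\<dots> = (\<Sum>l\<in>L. c l * contour_integral \<gamma> (\<lambda>w. iterated_partial k \<gamma> (F l) (z(Suc k := w))))"
    using L int by (subst contour_integral_sum) (auto intro: contour_integrable_lmul simp: contour_integral_lmul)
  finally show ?case by (simp add: iterated_partial_Suc)
qed (simp add: iterated_partial_0)

lemma iterated_contour_integral_sum:
  assumes "valid_path \<gamma>" "path_image \<gamma> \<subseteq> W" "open W" "finite L"
    and "\<And>l. l \<in> L \<Longrightarrow> separately_holomorphic UNIV W {1..k} (F l)"
  shows "iterated_contour_integral k \<gamma> (\<lambda>z. \<Sum>l\<in>L. c l * F l z) = (\<Sum>l\<in>L. c l * iterated_contour_integral k \<gamma> (F l))"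
  unfolding iterated_eq_partial
  using assms by (intro iterated_partial_sum[of _ _ _ UNIV _ "{}"]) (auto simp: polydomain_def)

text \<open>A simple path meets a finite set for finitely many parameter values only. This admits
  contours that pass through removable singularities of the integrand.\<close>

lemma iterated_contour_integral_cong:
  assumes "simple_path \<gamma>" "finite A"
    and "\<And>z. (\<And>i. i \<in> {1..k} \<Longrightarrow> z i \<in> path_image \<gamma> - A) \<Longrightarrow> F z = G z"
  shows "iterated_contour_integral k \<gamma> F = iterated_contour_integral k \<gamma> G"
  using assms(3)
proof (induction k arbitrary: F G)
  case (Suc k)
  show ?case
    unfolding iterated_contour_integral.simps
  proof (rule contour_integral_spike_finite_simple_path[OF assms(2,1) refl])
    fix w assume w: "w \<in> path_image \<gamma> - A"
    show "iterated_contour_integral k \<gamma> (\<lambda>z. F (z(Suc k := w))) = iterated_contour_integral k \<gamma> (\<lambda>z. G (z(Suc k := w)))"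
      by (rule Suc.IH) (use w in \<open>auto intro!: Suc.prems simp: le_Suc_eq\<close>)
  qed
qed simp

definition prepend :: "'a \<Rightarrow> (nat \<Rightarrow> 'a) \<Rightarrow> nat \<Rightarrow> 'a" where
  "prepend w z = (\<lambda>i. if i = 1 then w else z (i - 1))"

text \<open>The outer variables are renumbered, their indices dropping by one. At coordinate 0 the
  truncated subtraction in \<open>prepend\<close> reads \<open>z 0\<close>, which is therefore reset
  to the default value 0.\<close>

lemma iterated_contour_integral_innermost:
  "iterated_contour_integral (Suc k) \<gamma> F =
     iterated_contour_integral k \<gamma> (\<lambda>z. contour_integral \<gamma> (\<lambda>w. F (prepend w (z(0 := 0)))))"
proof (induction k arbitrary: F)
  case 0
  have "(\<lambda>_. 0)(Suc 0 := w) = prepend w ((\<lambda>_. 0)(0 := 0))" for w :: complex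
    by (auto simp: prepend_def fun_eq_iff)
  then show ?case by (simp only: iterated_contour_integral.simps)
next
  case (Suc k)
  have "(prepend w' (z(0 := 0)))(Suc (Suc k) := w) = prepend w' ((z(Suc k := w))(0 := 0))" for w w' :: complex and z
    by (auto simp: prepend_def fun_eq_iff)
  then have "iterated_contour_integral (Suc k) \<gamma> (\<lambda>z. F (z(Suc (Suc k) := w)))
      = iterated_contour_integral k \<gamma> (\<lambda>z. contour_integral \<gamma> (\<lambda>w'. F (prepend w' ((z(Suc k := w))(0 := 0)))))" for w
    by (simp only: Suc)
  then have "contour_integral \<gamma> (\<lambda>w. iterated_contour_integral (Suc k) \<gamma> (\<lambda>z. F (z(Suc (Suc k) := w))))
      = contour_integral \<gamma> (\<lambda>w. iterated_contour_integral k \<gamma>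
          (\<lambda>z. contour_integral \<gamma> (\<lambda>w'. F (prepend w' ((z(Suc k := w))(0 := 0))))))"
    by (simp only:)
  then show ?case
    by (simp only: iterated_contour_integral.simps(2)[of "Suc k" \<gamma> F]
      iterated_contour_integral.simps(2)[of k \<gamma> "\<lambda>z. contour_integral \<gamma> (\<lambda>w'. F (prepend w' (z(0 := 0))))"])
qed

lemma iterated_contour_integral_continuous_param:
  assumes "valid_path \<gamma>" "path_image \<gamma> \<subseteq> W" "open W" and F: "separately_holomorphic E W {1..k} F"
  shows "continuous_on E (\<lambda>e. iterated_contour_integral k \<gamma> (\<lambda>z. F (z(0 := e))))"
proof -
  have "continuous_on (polydomain E W {}) (iterated_partial k \<gamma> F)"
    using separately_holomorphic_iterated_partial[of \<gamma> W E k "{}" F] assms by (auto simp: separately_holomorphic_def)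
  then have "continuous_on E (\<lambda>e. iterated_partial k \<gamma> F ((\<lambda>_. 0)(0 := e)))"
    by (rule continuous_on_compose2) (auto intro!: continuous_on_fun_upd continuous_on_fst continuous_on_snd continuous_on_id continuous_on_const simp: polydomain_def)
  moreover have "iterated_partial k \<gamma> F ((\<lambda>_. 0)(0 := e)) = iterated_contour_integral k \<gamma> (\<lambda>z. F (z(0 := e)))" for e
  proof -
    have "merge k z ((\<lambda>_. 0)(0 := e)) = (merge k z (\<lambda>_. 0))(0 := e)" for z
      by (auto simp: merge_def fun_eq_iff)
    then show ?thesis
      unfolding iterated_eq_partial[of k \<gamma> "\<lambda>z. F (z(0 := e))"] by (simp add: iterated_partial_def)
  qed
  ultimately show ?thesis by simp
qed

section \<open>Evaluation by residues\<close>

definition pairs :: "nat \<Rightarrow> (nat \<times> nat) set" where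
  "pairs n = {(i, j). 1 \<le> i \<and> i < j \<and> j \<le> n}"

definition coupled :: "real \<Rightarrow> nat \<Rightarrow> (nat \<Rightarrow> complex \<Rightarrow> complex) \<Rightarrow> (nat \<Rightarrow> complex) \<Rightarrow> complex" where
  "coupled q n \<phi> z = (\<Prod>(i, j)\<in>pairs n. (z i - z j) / (z i - q * z j)) * (\<Prod>r=1..n. \<phi> r (z r))"

lemma finite_pairs: "finite (pairs n)"
  by (rule finite_subset[of _ "{1..n} \<times> {1..n}"]) (auto simp: pairs_def)

lemma coupled_prepend:
  "coupled q (Suc n) \<phi> (prepend w z) =
     (\<Prod>j=1..n. (w - z j) / (w - q * z j)) * \<phi> 1 w * coupled q n (\<lambda>r. \<phi> (Suc r)) z"
proof -
  let ?f = "\<lambda>(i, j). (prepend w z i - prepend w z j) / (prepend w z i - q * prepend w z j)"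
  have split: "pairs (Suc n) = (\<lambda>j. (1, Suc j)) ` {1..n} \<union> map_prod Suc Suc ` pairs n"
  proof (intro equalityI subsetI)
    fix x assume x: "x \<in> pairs (Suc n)"
    obtain i j where ij: "x = (i, j)" by force
    show "x \<in> (\<lambda>j. (1, Suc j)) ` {1..n} \<union> map_prod Suc Suc ` pairs n"
    proof (cases "i = 1")
      case True
      then have "x = (1, Suc (j - 1))" "j - 1 \<in> {1..n}" using x ij by (auto simp: pairs_def)
      then show ?thesis by blast
    next
      case False
      then have "x = map_prod Suc Suc (i - 1, j - 1)" "(i - 1, j - 1) \<in> pairs n"
        using x ij by (auto simp: pairs_def)
      then show ?thesis by blast
    qed
  qed (auto simp: pairs_def)
  have "prod ?f (pairs (Suc n)) = prod ?f ((\<lambda>j. (1, Suc j)) ` {1..n}) * prod ?f (map_prod Suc Suc ` pairs n)"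
    unfolding split by (intro prod.union_disjoint finite_imageI finite_pairs) (auto simp: pairs_def)
  also have "prod ?f ((\<lambda>j. (1, Suc j)) ` {1..n}) = (\<Prod>j=1..n. (w - z j) / (w - q * z j))"
    by (subst prod.reindex) (auto simp: inj_on_def prepend_def intro!: prod.cong)
  also have "prod ?f (map_prod Suc Suc ` pairs n) = (\<Prod>(i, j)\<in>pairs n. (z i - z j) / (z i - q * z j))"
    by (subst prod.reindex) (auto simp: inj_on_def prepend_def pairs_def intro!: prod.cong)
  finally have p: "prod ?f (pairs (Suc n)) =
    (\<Prod>j=1..n. (w - z j) / (w - q * z j)) * (\<Prod>(i, j)\<in>pairs n. (z i - z j) / (z i - q * z j))" .
  have "(\<Prod>r=1..Suc n. \<phi> r (prepend w z r)) = \<phi> 1 w * (\<Prod>r=Suc 1..Suc n. \<phi> r (prepend w z r))"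
    by (subst prod.atLeast_Suc_atMost) (simp_all add: prepend_def)
  also have "(\<Prod>r=Suc 1..Suc n. \<phi> r (prepend w z r)) = (\<Prod>r=1..n. \<phi> (Suc r) (z r))"
    unfolding prod.atLeast_Suc_atMost_Suc_shift by (intro prod.cong) (auto simp: prepend_def)
  finally have "(\<Prod>r=1..Suc n. \<phi> r (prepend w z r)) = \<phi> 1 w * (\<Prod>r=1..n. \<phi> (Suc r) (z r))" .
  then show ?thesis using p by (simp add: coupled_def mult_ac)
qed

lemma separately_holomorphic_coupled:
  fixes \<phi> :: "nat \<Rightarrow> complex \<Rightarrow> complex \<Rightarrow> complex"
  assumes sep: "n \<ge> 2 \<Longrightarrow> (\<forall>w\<in>W. \<forall>w'\<in>W. w \<noteq> of_real q * w')"
    and cont: "\<And>r. r \<in> {1..n} \<Longrightarrow> continuous_on (E \<times> W) (\<lambda>(e, w). \<phi> r e w)"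
    and hol: "\<And>r e. r \<in> {1..n} \<Longrightarrow> e \<in> E \<Longrightarrow> \<phi> r e holomorphic_on W"
  shows "separately_holomorphic E W {1..n} (\<lambda>z. coupled q n (\<lambda>r. \<phi> r (z 0)) z)"
  unfolding separately_holomorphic_def
proof (intro conjI ballI)
  let ?D = "polydomain E W {1..n}"
  have coord: "continuous_on A (\<lambda>z::nat \<Rightarrow> complex. z i)" for A i
    by (rule continuous_on_subset[OF continuous_on_product_coordinates]) simp
  have ne: "z i - of_real q * z j \<noteq> 0" if "z \<in> ?D" "(i, j) \<in> pairs n" for z i j
    using that sep by (auto simp: pairs_def polydomain_def)
  have "continuous_on ?D (\<lambda>z. (z i - z j) / (z i - q * z j))" if "(i, j) \<in> pairs n" for i j
    using ne[OF _ that] by (intro continuous_intros coord) auto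
  moreover have "continuous_on ?D (\<lambda>z. (\<lambda>(e, w). \<phi> r e w) (z 0, z r))" if "r \<in> {1..n}" for r
    by (rule continuous_on_compose2[OF cont[OF that]])
      (use that in \<open>auto intro!: continuous_on_Pair coord simp: polydomain_def\<close>)
  ultimately show "continuous_on ?D (\<lambda>z. coupled q n (\<lambda>r. \<phi> r (z 0)) z)"
    unfolding coupled_def by (auto intro!: continuous_on_mult continuous_on_prod)
  fix z l assume z: "z \<in> ?D" and l: "l \<in> {1..n}"
  have upd: "z(l := w) \<in> ?D" if "w \<in> W" for w using z l that by (auto simp: polydomain_def)
  have c: "(\<lambda>w. (z(l := w)) i) holomorphic_on W" for i
    by (cases "i = l") (auto intro!: holomorphic_intros)
  have "(\<lambda>w. ((z(l := w)) i - (z(l := w)) j) / ((z(l := w)) i - q * (z(l := w)) j)) holomorphic_on W"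
    if "(i, j) \<in> pairs n" for i j
    using ne[OF upd that] by (intro holomorphic_intros c) auto
  moreover have "(\<lambda>w. \<phi> r (z 0) ((z(l := w)) r)) holomorphic_on W" if "r \<in> {1..n}" for r
    using hol[OF that, of "z 0"] z by (cases "r = l") (auto simp: polydomain_def)
  moreover have "(z(l := w)) 0 = z 0" for w using l by simp
  ultimately show "(\<lambda>w. coupled q n (\<lambda>r. \<phi> r ((z(l := w)) 0)) (z(l := w))) holomorphic_on W"
    unfolding coupled_def
    by (intro holomorphic_on_mult holomorphic_on_prod) (auto simp del: fun_upd_apply split: prod.splits)
qed

text \<open>The contour and its multiple by \<open>q\<close> are disjoint compact sets and have
  disjoint neighbourhoods \<open>U\<close> and \<open>V\<close>; the points of \<open>U\<close> that
  are mapped into \<open>V\<close> form the required set. The condition \<open>Q\<close> will say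
  that there is a cross factor.\<close>

lemma contour_neighbourhood:
  fixes q :: real and \<gamma> :: "real \<Rightarrow> complex"
  assumes "path \<gamma>" "closed C" "path_image \<gamma> \<inter> C = {}"
    and q: "Q \<Longrightarrow> (\<forall>z\<in>path_image \<gamma>. q * z \<notin> path_image \<gamma>)"
  obtains W where "open W" "path_image \<gamma> \<subseteq> W" "W \<inter> C = {}"
    "Q \<Longrightarrow> (\<forall>w\<in>W. \<forall>w'\<in>W. w \<noteq> complex_of_real q * w')"
proof -
  let ?K = "path_image \<gamma>"
  have K: "compact ?K" by (simp add: assms compact_path_image)
  have qK: "compact ((\<lambda>z. complex_of_real q * z) ` ?K)"
    by (intro compact_continuous_image K continuous_intros)
  show thesis
  proof (cases Q)
    case True
    then have "?K \<inter> (\<lambda>z. complex_of_real q * z) ` ?K = {}" using q by auto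
    then obtain U V where UV: "open U" "open V" "?K \<subseteq> U" "(\<lambda>z. complex_of_real q * z) ` ?K \<subseteq> V" "U \<inter> V = {}"
      using separation_normal_compact[OF K compact_imp_closed[OF qK]] by metis
    have "open ((\<lambda>z. complex_of_real q * z) -` V :: complex set)"
      by (intro open_vimage UV continuous_intros)
    then have "open (U \<inter> (\<lambda>z. complex_of_real q * z) -` V \<inter> - C)" using UV assms by (intro open_Int) auto
    moreover have "?K \<subseteq> U \<inter> (\<lambda>z. complex_of_real q * z) -` V \<inter> - C" using UV assms by auto
    ultimately show thesis using UV by (intro that[of "U \<inter> (\<lambda>z. complex_of_real q * z) -` V \<inter> - C"]) auto
  next
    case False
    then show thesis using assms by (intro that[of "- C"]) auto
  qed
qed

lemma contour_integral_simple_poles: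
  fixes G :: "complex \<Rightarrow> complex" and q :: complex
  assumes \<gamma>: "positively_oriented_contour \<gamma>" and V: "finite V" "V \<subseteq> inside (path_image \<gamma>)"
    and B: "finite B" "B \<subseteq> outside (path_image \<gamma>)" and G: "G holomorphic_on - B"
  shows "contour_integral \<gamma> (\<lambda>w. (\<Prod>x\<in>V. (q * w - x) / (w - x)) * G w) =
    2 * of_real pi * \<i> * (\<Sum>l\<in>V. (q - 1) * l * (\<Prod>x\<in>V - {l}. (q * l - x) / (l - x)) * G l)"
proof -
  let ?f = "\<lambda>w. (\<Prod>x\<in>V. (q * w - x) / (w - x)) * G w"
  have g: "valid_path \<gamma>" "pathfinish \<gamma> = pathstart \<gamma>" "path \<gamma>"
    and wn: "\<And>z. z \<in> inside (path_image \<gamma>) \<Longrightarrow> winding_number \<gamma> z = 1"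
    using \<gamma> by (auto simp: positively_oriented_contour_def valid_path_imp_path)
  have io: "inside (path_image \<gamma>) \<inter> outside (path_image \<gamma>) = {}" by (rule inside_Int_outside)
  have dis: "path_image \<gamma> \<inter> inside (path_image \<gamma>) = {}" "path_image \<gamma> \<inter> outside (path_image \<gamma>) = {}"
    using inside_no_overlap outside_no_overlap by blast+
  have oB: "open (- B)" using B by (simp add: finite_imp_closed open_Compl)
  have "connected (UNIV - B)" using B by (intro connected_open_delete_finite) auto
  then have cB: "connected (- B)" by (simp add: Compl_eq_Diff_UNIV)
  have hol: "?f holomorphic_on - B - V"
    using holomorphic_on_subset[OF G, of "- B - V"] by (intro holomorphic_intros) auto
  have "contour_integral \<gamma> ?f = 2 * pi * \<i> * (\<Sum>p\<in>V. winding_number \<gamma> p * residue ?f p)"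
    by (rule Residue_theorem[OF oB cB V(1) hol g(1,2)])
      (use V B dis g winding_number_zero_in_outside[OF g(3,2)] in auto)
  also have "(\<Sum>p\<in>V. winding_number \<gamma> p * residue ?f p)
      = (\<Sum>l\<in>V. (q - 1) * l * (\<Prod>x\<in>V - {l}. (q * l - x) / (l - x)) * G l)"
  proof (rule sum.cong[OF refl])
    fix l assume l: "l \<in> V"
    \<comment> \<open>At \<open>w = l\<close> the first factor is (q - 1) l, the source of this
      factor of the residue.\<close>
    define H where "H w = (q * w - l) * (\<Prod>x\<in>V - {l}. (q * w - x) / (w - x)) * G w" for w
    have "?f = (\<lambda>w. H w / (w - l))"
      using l V by (simp add: H_def fun_eq_iff prod.remove[of V l])
    moreover have "H holomorphic_on - B - (V - {l})"
      unfolding H_def using holomorphic_on_subset[OF G, of "- B - (V - {l})"] by (intro holomorphic_intros) auto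
    moreover have "open (- B - (V - {l}))" using oB V by (intro open_Diff finite_imp_closed) auto
    moreover have "l \<in> - B - (V - {l})" using l V B io by blast
    ultimately have "residue ?f l = H l" using residue_simple by metis
    then show "winding_number \<gamma> l * residue ?f l = (q - 1) * l * (\<Prod>x\<in>V - {l}. (q * l - x) / (l - x)) * G l"
      using l V wn by (auto simp: H_def algebra_simps)
  qed
  finally show ?thesis by simp
qed

lemma contour_integral_innermost:
  fixes q :: real and V :: "nat \<Rightarrow> complex set" and \<gamma> :: "real \<Rightarrow> complex" and g :: "nat \<Rightarrow> complex \<Rightarrow> complex" and z :: "nat \<Rightarrow> complex"
  assumes \<gamma>: "positively_oriented_contour \<gamma>"
    and V: "\<And>r. r \<in> {1..Suc n} \<Longrightarrow> finite (V r) \<and> V r \<subseteq> inside (path_image \<gamma>) \<and> V 1 \<subseteq> V r"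
    and B: "finite B" "B \<subseteq> outside (path_image \<gamma>)"
    and g: "g 1 holomorphic_on - B"
    and z: "\<And>j. j \<in> {1..n} \<Longrightarrow> z j \<in> path_image \<gamma> \<and> q * z j \<in> outside (path_image \<gamma>)"
  shows "contour_integral \<gamma> (\<lambda>w. coupled q (Suc n) (\<lambda>r w. (\<Prod>x\<in>V r. (q * w - x) / (w - x)) * g r w) (prepend w z)) =
    (\<Sum>l\<in>V 1. (2 * of_real pi * \<i> * ((q - 1) * l * (\<Prod>x\<in>V 1 - {l}. (q * l - x) / (l - x)) * g 1 l)) *
       coupled q n (\<lambda>r w. (\<Prod>x\<in>V (Suc r) - {l}. (q * w - x) / (w - x)) * g (Suc r) w) z)"
proof -
  define C where "C = coupled q n (\<lambda>r w. (\<Prod>x\<in>V (Suc r). (q * w - x) / (w - x)) * g (Suc r) w) z"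
  define G where "G w = (\<Prod>j=1..n. (w - z j) / (w - q * z j)) * g 1 w * C" for w :: complex
  define B' where "B' = B \<union> (\<lambda>j. q * z j) ` {1..n}"
  have hG: "G holomorphic_on - B'"
    unfolding G_def using holomorphic_on_subset[OF g, of "- B'"]
    by (intro holomorphic_intros) (auto simp: B'_def)
  have io: "inside (path_image \<gamma>) \<inter> outside (path_image \<gamma>) = {}" "path_image \<gamma> \<inter> inside (path_image \<gamma>) = {}"
    using inside_Int_outside inside_no_overlap by blast+
  have "contour_integral \<gamma> (\<lambda>w. coupled q (Suc n) (\<lambda>r w. (\<Prod>x\<in>V r. (q * w - x) / (w - x)) * g r w) (prepend w z))
      = contour_integral \<gamma> (\<lambda>w. (\<Prod>x\<in>V 1. (of_real q * w - x) / (w - x)) * G w)"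
    by (simp add: coupled_prepend G_def C_def mult_ac)
  also have "\<dots> = 2 * of_real pi * \<i> * (\<Sum>l\<in>V 1. (of_real q - 1) * l * (\<Prod>x\<in>V 1 - {l}. (of_real q * l - x) / (l - x)) * G l)"
    by (rule contour_integral_simple_poles[OF \<gamma> _ _ _ _ hG]) (use V[of 1] B z in \<open>auto simp: B'_def\<close>)
  also have "\<dots> = (\<Sum>l\<in>V 1. (2 * of_real pi * \<i> * ((q - 1) * l * (\<Prod>x\<in>V 1 - {l}. (q * l - x) / (l - x)) * g 1 l)) *
       coupled q n (\<lambda>r w. (\<Prod>x\<in>V (Suc r) - {l}. (q * w - x) / (w - x)) * g (Suc r) w) z)"
    unfolding sum_distrib_left
  proof (rule sum.cong[OF refl])
    fix l assume l: "l \<in> V 1"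
    have li: "l \<in> inside (path_image \<gamma>)" using V[of 1] l by auto
    \<comment> \<open>The quotient (l - z) / (l - q z) is the reciprocal of (q z - l) / (z - l),
      which occurs in variable \<open>r\<close> because \<open>V 1\<close> is contained in every
      later set.\<close>
    have step: "(l - z r) / (l - q * z r) * ((\<Prod>x\<in>V (Suc r). (q * z r - x) / (z r - x)) * g (Suc r) (z r))
        = (\<Prod>x\<in>V (Suc r) - {l}. (q * z r - x) / (z r - x)) * g (Suc r) (z r)" if "r \<in> {1..n}" for r
    proof -
      have "z r \<noteq> l" "q * z r \<noteq> l" using z[OF that] li io by blast+
      moreover have "finite (V (Suc r))" "l \<in> V (Suc r)" using V[of "Suc r"] l that by auto
      ultimately show ?thesis by (simp add: prod.remove[of _ l] divide_simps) (simp add: algebra_simps)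
    qed
    have "(\<Prod>j=1..n. (l - z j) / (l - q * z j)) * C
        = coupled q n (\<lambda>r w. (\<Prod>x\<in>V (Suc r) - {l}. (q * w - x) / (w - x)) * g (Suc r) w) z"
      unfolding C_def coupled_def mult.left_commute[of "prod _ {1..n}"] prod.distrib[symmetric]
      by (intro arg_cong2[where f = "(*)"] refl prod.cong step)
    then show "2 * of_real pi * \<i> * ((of_real q - 1) * l * (\<Prod>x\<in>V 1 - {l}. (of_real q * l - x) / (l - x)) * G l)
      = (2 * of_real pi * \<i> * ((q - 1) * l * (\<Prod>x\<in>V 1 - {l}. (q * l - x) / (l - x)) * g 1 l)) *
       coupled q n (\<lambda>r w. (\<Prod>x\<in>V (Suc r) - {l}. (q * w - x) / (w - x)) * g (Suc r) w) z"
      by (simp add: G_def mult_ac)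
  qed
  finally show ?thesis .
qed

lemma iterated_contour_integral_residues:
  fixes q :: real and V :: "nat \<Rightarrow> complex set" and \<gamma> :: "real \<Rightarrow> complex" and g :: "nat \<Rightarrow> complex \<Rightarrow> complex"
  assumes \<gamma>: "positively_oriented_contour \<gamma>"
    and V: "\<And>r. r \<in> {1..Suc n} \<Longrightarrow> finite (V r) \<and> V r \<subseteq> inside (path_image \<gamma>) \<and> V 1 \<subseteq> V r"
    and B: "finite B" "B \<subseteq> outside (path_image \<gamma>)"
    and g: "\<And>r. r \<in> {1..Suc n} \<Longrightarrow> g r holomorphic_on - B"
    and sep: "n \<ge> 1 \<Longrightarrow> (\<forall>z\<in>path_image \<gamma>. q * z \<in> outside (path_image \<gamma>))"
  shows "iterated_contour_integral (Suc n) \<gamma> (coupled q (Suc n) (\<lambda>r w. (\<Prod>x\<in>V r. (q * w - x) / (w - x)) * g r w)) =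
    (\<Sum>l\<in>V 1. (2 * of_real pi * \<i> * ((q - 1) * l * (\<Prod>x\<in>V 1 - {l}. (q * l - x) / (l - x)) * g 1 l)) *
       iterated_contour_integral n \<gamma>
         (coupled q n (\<lambda>r w. (\<Prod>x\<in>V (Suc r) - {l}. (q * w - x) / (w - x)) * g (Suc r) w)))"
proof -
  have vp: "valid_path \<gamma>" "path \<gamma>" "simple_path \<gamma>"
    using \<gamma> by (auto simp: positively_oriented_contour_def valid_path_imp_path)
  have dis: "path_image \<gamma> \<inter> inside (path_image \<gamma>) = {}" "path_image \<gamma> \<inter> outside (path_image \<gamma>) = {}"
    using inside_no_overlap outside_no_overlap by blast+
  define C where "C = B \<union> (\<Union>r\<in>{1..Suc n}. V r)"
  have "closed C" unfolding C_def using B V by (intro finite_imp_closed) auto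
  moreover have "path_image \<gamma> \<inter> C = {}" using B V dis by (fastforce simp: C_def)
  moreover have "\<forall>z\<in>path_image \<gamma>. q * z \<notin> path_image \<gamma>" if "n \<ge> 2"
    using sep that dis by fastforce
  ultimately obtain W where W: "open W" "path_image \<gamma> \<subseteq> W" "W \<inter> C = {}"
    "n \<ge> 2 \<Longrightarrow> (\<forall>w\<in>W. \<forall>w'\<in>W. w \<noteq> of_real q * w')"
    using contour_neighbourhood[of \<gamma> C "n \<ge> 2" q] vp by blast
  define F where "F l = coupled q n (\<lambda>r w. (\<Prod>x\<in>V (Suc r) - {l}. (q * w - x) / (w - x)) * g (Suc r) w)" for l
  have hol: "(\<lambda>w. (\<Prod>x\<in>V (Suc r) - {l}. (of_real q * w - x) / (w - x)) * g (Suc r) w) holomorphic_on W"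
    if "r \<in> {1..n}" for r l
    using holomorphic_on_subset[OF g[of "Suc r"], of W] W(3) that
    by (intro holomorphic_intros) (auto simp: C_def disjoint_iff)
  have sh: "separately_holomorphic UNIV W {1..n} (F l)" for l
    unfolding F_def
  proof (rule separately_holomorphic_coupled[where \<phi> = "\<lambda>r e w. (\<Prod>x\<in>V (Suc r) - {l}. (q * w - x) / (w - x)) * g (Suc r) w", OF W(4)])
    fix r assume r: "r \<in> {1..n}"
    show "continuous_on (UNIV \<times> W) (\<lambda>(e, w). (\<Prod>x\<in>V (Suc r) - {l}. (q * w - x) / (w - x)) * g (Suc r) w)"
      unfolding split_beta
      by (rule continuous_on_compose2[OF holomorphic_on_imp_continuous_on[OF hol[OF r]] continuous_on_snd[OF continuous_on_id]]) auto
  qed (use hol in auto)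
  have "iterated_contour_integral (Suc n) \<gamma> (coupled q (Suc n) (\<lambda>r w. (\<Prod>x\<in>V r. (q * w - x) / (w - x)) * g r w))
      = iterated_contour_integral n \<gamma> (\<lambda>z. \<Sum>l\<in>V 1. (2 * of_real pi * \<i> * ((q - 1) * l * (\<Prod>x\<in>V 1 - {l}. (q * l - x) / (l - x)) * g 1 l)) * F l (z(0 := 0)))"
    unfolding iterated_contour_integral_innermost F_def
    by (rule iterated_contour_integral_cong[OF vp(3), of "{}"], simp, rule contour_integral_innermost[where V = V and g = g and B = B, OF \<gamma> _ B])
      (use V g sep in auto)
  also have "\<dots> = iterated_contour_integral n \<gamma> (\<lambda>z. \<Sum>l\<in>V 1. (2 * of_real pi * \<i> * ((q - 1) * l * (\<Prod>x\<in>V 1 - {l}. (q * l - x) / (l - x)) * g 1 l)) * F l z)"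
  proof -
    have "F l (z(0 := 0)) = F l z" for l z
      unfolding F_def coupled_def by (intro arg_cong2[where f = "(*)"] prod.cong) (auto simp: pairs_def)
    then show ?thesis by simp
  qed
  also have "\<dots> = (\<Sum>l\<in>V 1. (2 * of_real pi * \<i> * ((q - 1) * l * (\<Prod>x\<in>V 1 - {l}. (q * l - x) / (l - x)) * g 1 l)) *
       iterated_contour_integral n \<gamma> (F l))"
    using V[of 1] by (intro iterated_contour_integral_sum[OF vp(1) W(2,1) _ sh]) auto
  finally show ?thesis unfolding F_def .
qed

lemma coupled_cong:
  assumes "\<And>r w. r \<in> {1..n} \<Longrightarrow> \<phi> r w = \<psi> r w"
  shows "coupled q n \<phi> = coupled q n \<psi>"
  unfolding coupled_def using assms by (intro ext arg_cong2[where f = "(*)"] refl prod.cong) auto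

section \<open>The nested sum as an iterated contour integral\<close>

context sixv
begin

lemma inj_on_par: "inj_on par {x. s < x}"
proof (rule inj_onI, rule ccontr)
  fix x y assume "x \<in> {x. s < x}" "y \<in> {x. s < x}" "par x = par y" "x \<noteq> y"
  then show False using par_less[of x y] par_less[of y x] by (cases "x < y") auto
qed

lemma par_denominator: "s < x \<Longrightarrow> 0 < x - s * q"
  using mult_strict_left_mono[of q 1 s] s0 q by linarith

text \<open>The map \<open>par\<close> is a Moebius transformation; in its source variable the
  exchange factor becomes the factor (q z - u) / (z - u) of the integrand.\<close>

lemma al_par:
  assumes "s < x" "s < y" "x \<noteq> y"
  shows "al q (par x) (par y) = (q * x - y) / (x - y)"
proof -
  define X where "X = x - s * q"
  define Y where "Y = y - s * q"
  have D: "X > 0" "Y > 0" using par_denominator assms by (auto simp: X_def Y_def)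
  have "s * (1 - q) \<noteq> 0" using s0 q by simp
  have p: "par x = (X - s * (1 - q)) / X" "par y = (Y - s * (1 - q)) / Y"
    by (simp_all add: par_def X_def Y_def algebra_simps)
  have "par y - par x = s * (1 - q) * (y - x) / (X * Y)"
    unfolding p using D by (simp add: divide_simps) (simp add: X_def Y_def algebra_simps)
  moreover have "den q (par x) (par y) = s * (1 - q) * (y - q * x) / (X * Y)"
    unfolding p den_def using D by (simp add: divide_simps) (simp add: X_def Y_def algebra_simps)
  ultimately have "al q (par x) (par y) = (y - q * x) / (y - x)"
    using D \<open>s * (1 - q) \<noteq> 0\<close> by (simp add: al_def)
  then show ?thesis using assms by (simp add: divide_simps) (simp add: algebra_simps)
qed

text \<open>The denominator \<open>q\<close>, once for every variable, is the source of the power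
  q^(-k); the factor \<open>q - 1\<close> reappears in the residues.\<close>

lemma one_minus_par:
  assumes "s < x"
  shows "1 - par x = (q - 1) / (q * (1 - s * x))"
proof -
  have "1 - par x = s * (1 - q) / (x - s * q)"
    using par_denominator[OF assms] by (simp add: par_def divide_simps) (simp add: algebra_simps)
  moreover have "q * (1 - s * x) = - ((x - s * q) / s)"
    using s0 s2q by (simp add: field_simps power2_eq_square)
  ultimately show ?thesis
    using s0 par_denominator[OF assms] by (simp only:) (simp add: divide_simps, simp add: algebra_simps)
qed

lemma coef_par:
  assumes "finite U" "\<And>x. x \<in> U \<Longrightarrow> s < x" "a \<in> U"
  shows "coef q (par a) (par ` U) = (q - 1) / (q * (1 - s * a)) * ((\<Prod>x\<in>U - {a}. par x) * (\<Prod>x\<in>U - {a}. (q * a - x) / (a - x)))"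
proof -
  have inj: "inj_on par (U - {a})" using inj_on_par assms(2) by (auto intro: inj_on_subset)
  have "par ` U - {par a} = par ` (U - {a})"
    using inj_on_image_set_diff[OF inj_on_par, of U "{a}"] assms by auto
  then have "coef q (par a) (par ` U) = (1 - par a) * (\<Prod>x\<in>U - {a}. par x * al q (par a) (par x))"
    unfolding coef_def by (simp add: prod.reindex[OF inj])
  also have "(\<Prod>x\<in>U - {a}. par x * al q (par a) (par x)) = (\<Prod>x\<in>U - {a}. par x * ((q * a - x) / (a - x)))"
    using assms by (intro prod.cong refl arg_cong2[where f = "(*)"] al_par) auto
  finally show ?thesis unfolding prod.distrib using one_minus_par[of a] assms by simp
qed

text \<open>A point \<open>a\<close> chosen in the first set is deleted from all sets that remain,
  which takes \<open>par a\<close> out of that many products. This is the origin of the power of (z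
  - s q) / (z - s) in the integrand; the index \<open>d\<close> of \<open>g\<close> counts the
  remaining variables.\<close>

theorem resum_contour:
  fixes Us :: "real set list" and g :: "nat \<Rightarrow> complex \<Rightarrow> complex" and \<gamma> :: "real \<Rightarrow> complex"
  assumes \<gamma>: "positively_oriented_contour \<gamma>" and B: "finite B" "B \<subseteq> outside (path_image \<gamma>)"
    and "length Us = n"
    and "\<And>U. U \<in> set Us \<Longrightarrow> finite U \<and> (\<forall>x\<in>U. s < x) \<and> complex_of_real ` U \<subseteq> inside (path_image \<gamma>)"
    and "sorted_wrt (\<subseteq>) Us"
    and "\<And>d. d \<in> {1..n} \<Longrightarrow> g d holomorphic_on - B"
    and "\<And>d x. d \<in> {1..n} \<Longrightarrow> x \<in> \<Union>(set Us) \<Longrightarrow>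
      g d (complex_of_real x) = complex_of_real (1 / (par x ^ d * z (par x) * (x * (1 - s * x))))"
    and "n \<ge> 2 \<Longrightarrow> (\<forall>w\<in>path_image \<gamma>. q * w \<in> outside (path_image \<gamma>))"
  shows "complex_of_real (resum q z n (map ((`) par) Us)) =
    complex_of_real (\<Prod>U\<leftarrow>Us. \<Prod>x\<in>U. par x) * (complex_of_real (q powi (- int n)) / (2 * of_real pi * \<i>) ^ n) *
    iterated_contour_integral n \<gamma>
      (coupled q n (\<lambda>r w. (\<Prod>x\<in>complex_of_real ` (Us ! (r - 1)). (q * w - x) / (w - x)) * g (Suc n - r) w))"
  using assms(4-)
proof (induction n arbitrary: Us)
  case 0
  have "pairs 0 = {}" by (auto simp: pairs_def)
  then show ?case using 0 by (simp add: coupled_def)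
next
  case (Suc n)
  obtain U Us' where Us: "Us = U # Us'" using Suc.prems(1) by (cases Us) auto
  have len: "length Us' = n" using Suc.prems(1) Us by simp
  have U: "finite U" "\<And>x. x \<in> U \<Longrightarrow> s < x" "complex_of_real ` U \<subseteq> inside (path_image \<gamma>)"
    using Suc.prems(2)[of U] Us by auto
  have Us': "finite X" "\<And>x. x \<in> X \<Longrightarrow> s < x" "U \<subseteq> X" if "X \<in> set Us'" for X
    using Suc.prems(2)[of X] Suc.prems(3) Us that by auto
  define V where "V r = complex_of_real ` (Us ! (r - 1))" for r
  define c :: complex where "c = 2 * of_real pi * \<i>"
  have c0: "c \<noteq> 0" by (simp add: c_def)
  define W where "W a = map (\<lambda>X. X - {a}) Us'" for a
  define I where "I a = iterated_contour_integral n \<gamma>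
      (coupled q n (\<lambda>r w. (\<Prod>x\<in>complex_of_real ` (W a ! (r - 1)). (q * w - x) / (w - x)) * g (Suc n - r) w))" for a
  define P where "P Us = (\<Prod>U\<leftarrow>Us. \<Prod>x\<in>U. par x)" for Us
  define A where "A a = (\<Prod>x\<in>U - {a}. (q * a - x) / (a - x))" for a
  have IH: "complex_of_real (resum q z n (map ((`) par) (W a))) =
      complex_of_real (P (W a)) * (complex_of_real (q powi (- int n)) / c ^ n) * I a" if "a \<in> U" for a
    unfolding P_def I_def c_def
  proof (rule Suc.IH)
    show "sorted_wrt (\<subseteq>) (W a)"
      using Suc.prems(3) by (auto simp: Us W_def sorted_wrt_map elim: sorted_wrt_mono_rel[rotated])
    show "finite X \<and> (\<forall>x\<in>X. s < x) \<and> complex_of_real ` X \<subseteq> inside (path_image \<gamma>)" if "X \<in> set (W a)" for X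
      using that Suc.prems(2) by (fastforce simp: W_def Us)
    show "g d (complex_of_real x) = complex_of_real (1 / (par x ^ d * z (par x) * (x * (1 - s * x))))"
      if "d \<in> {1..n}" "x \<in> \<Union>(set (W a))" for d x
      by (rule Suc.prems(5)) (use that in \<open>auto simp: W_def Us\<close>)
    show "length (W a) = n" using len by (simp add: W_def)
  qed (use Suc.prems in auto)
  have Vr: "finite (V r) \<and> V r \<subseteq> inside (path_image \<gamma>) \<and> V 1 \<subseteq> V r" if "r \<in> {1..Suc n}" for r
  proof -
    have "r - 1 < length Us" using that len Us by auto
    then have "Us ! (r - 1) \<in> set Us" by simp
    moreover have "U \<subseteq> Us ! (r - 1)"
      using \<open>Us ! (r - 1) \<in> set Us\<close> Us'(3) Us by auto
    ultimately show ?thesis using Suc.prems(2)[of "Us ! (r - 1)"] by (auto simp: V_def Us)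
  qed
  have hol: "g (Suc (Suc n) - r) holomorphic_on - B" if "r \<in> {1..Suc n}" for r
    by (rule Suc.prems(4)) (use that in auto)
  have "iterated_contour_integral (Suc n) \<gamma>
      (coupled q (Suc n) (\<lambda>r w. (\<Prod>x\<in>V r. (q * w - x) / (w - x)) * g (Suc (Suc n) - r) w))
    = (\<Sum>l\<in>V 1. (2 * of_real pi * \<i> * ((q - 1) * l * (\<Prod>x\<in>V 1 - {l}. (q * l - x) / (l - x)) * g (Suc (Suc n) - 1) l)) *
       iterated_contour_integral n \<gamma>
         (coupled q n (\<lambda>r w. (\<Prod>x\<in>V (Suc r) - {l}. (q * w - x) / (w - x)) * g (Suc (Suc n) - Suc r) w)))"
    by (rule iterated_contour_integral_residues[where V = V and g = "\<lambda>r. g (Suc (Suc n) - r)" and B = B, OF \<gamma> _ B])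
      (use Vr hol Suc.prems(6) in auto)
  also have "\<dots> = (\<Sum>a\<in>U. c * (complex_of_real ((q - 1) * a * A a * (1 / (par a ^ Suc n * z (par a) * (a * (1 - s * a)))))) * I a)"
  proof -
    have V1: "V 1 = complex_of_real ` U" by (simp add: V_def Us)
    have inj: "inj_on complex_of_real U" by (simp add: inj_on_def)
    show ?thesis
      unfolding V1 sum.reindex[OF inj] o_def
    proof (rule sum.cong[OF refl])
      fix a assume a: "a \<in> U"
      have sub: "complex_of_real ` U - {complex_of_real a} = complex_of_real ` (U - {a})" by auto
      have "(\<Prod>x\<in>complex_of_real ` U - {complex_of_real a}. (q * complex_of_real a - x) / (complex_of_real a - x)) = of_real (A a)"
        unfolding sub by (subst prod.reindex) (auto simp: inj_on_def A_def)
      moreover have "g (Suc (Suc n) - 1) (complex_of_real a) = complex_of_real (1 / (par a ^ Suc n * z (par a) * (a * (1 - s * a))))"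
        using Suc.prems(5)[of "Suc n" a] a Us by simp
      moreover have "coupled q n (\<lambda>r w. (\<Prod>x\<in>V (Suc r) - {complex_of_real a}. (q * w - x) / (w - x)) * g (Suc (Suc n) - Suc r) w)
          = coupled q n (\<lambda>r w. (\<Prod>x\<in>complex_of_real ` (W a ! (r - 1)). (q * w - x) / (w - x)) * g (Suc n - r) w)"
      proof (rule coupled_cong)
        fix r and w :: complex assume r: "r \<in> {1..n}"
        then have "Us ! r = Us' ! (r - 1)" by (simp add: Us)
        moreover have "W a ! (r - 1) = Us' ! (r - 1) - {a}" unfolding W_def by (rule nth_map) (use r len in auto)
        ultimately have "V (Suc r) - {complex_of_real a} = complex_of_real ` (W a ! (r - 1))"
          by (auto simp: V_def)
        then show "(\<Prod>x\<in>V (Suc r) - {complex_of_real a}. (q * w - x) / (w - x)) * g (Suc (Suc n) - Suc r) w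
          = (\<Prod>x\<in>complex_of_real ` (W a ! (r - 1)). (q * w - x) / (w - x)) * g (Suc n - r) w" by simp
      qed
      ultimately show "2 * of_real pi * \<i> * ((q - 1) * complex_of_real a *
          (\<Prod>x\<in>complex_of_real ` U - {complex_of_real a}. (q * complex_of_real a - x) / (complex_of_real a - x)) *
          g (Suc (Suc n) - 1) (complex_of_real a)) *
          iterated_contour_integral n \<gamma> (coupled q n (\<lambda>r w. (\<Prod>x\<in>V (Suc r) - {complex_of_real a}. (q * w - x) / (w - x)) * g (Suc (Suc n) - Suc r) w))
        = c * (complex_of_real ((q - 1) * a * A a * (1 / (par a ^ Suc n * z (par a) * (a * (1 - s * a)))))) * I a"
        by (simp add: c_def I_def mult_ac)
    qed
  qed
  finally have int: "iterated_contour_integral (Suc n) \<gamma>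
      (coupled q (Suc n) (\<lambda>r w. (\<Prod>x\<in>V r. (q * w - x) / (w - x)) * g (Suc (Suc n) - r) w)) = \<dots>" .
  have P: "P Us = par a ^ Suc n * (\<Prod>x\<in>U - {a}. par x) * P (W a)" if a: "a \<in> U" for a
  proof -
    have "P Us' = par a ^ length Us' * P (W a)"
      unfolding P_def W_def using Us'(1,3) a
    proof (induction Us')
      case (Cons X Xs)
      have "(\<Prod>x\<in>X. par x) = par a * (\<Prod>x\<in>X - {a}. par x)"
        using Cons.prems(1,2)[of X] a by (intro prod.remove) auto
      then show ?case using Cons by (simp add: mult_ac)
    qed simp
    moreover have "(\<Prod>x\<in>U. par x) = par a * (\<Prod>x\<in>U - {a}. par x)" using U a by (intro prod.remove) auto
    ultimately show ?thesis by (simp add: P_def Us len mult_ac)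
  qed
  have "resum q z (Suc n) (map ((`) par) Us)
      = (\<Sum>l\<in>par ` U. coef q l (par ` U) / z l * resum q z n (map (\<lambda>X. X - {l}) (map ((`) par) Us')))"
    by (simp add: Us)
  also have "\<dots> = (\<Sum>a\<in>U. coef q (par a) (par ` U) / z (par a) * resum q z n (map ((`) par) (W a)))"
  proof -
    have inj: "inj_on par U" using inj_on_par U by (auto intro: inj_on_subset)
    have "par ` X - {par a} = par ` (X - {a})" if "X \<in> set Us'" "a \<in> U" for X a
      using inj_on_image_set_diff[OF inj_on_par, of X "{a}"] Us'[OF that(1)] that by auto
    then have "map (\<lambda>X. X - {par a}) (map ((`) par) Us') = map ((`) par) (W a)" if "a \<in> U" for a
      using that by (simp add: W_def)
    then show ?thesis unfolding sum.reindex[OF inj] o_def by (intro sum.cong) auto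
  qed
  finally have res: "resum q z (Suc n) (map ((`) par) Us) = \<dots>" .
  have pw: "q powi (- int (Suc n)) = q powi (- int n) / q"
    unfolding power_int_minus power_int_of_nat by (simp add: divide_inverse)
  have term_eq: "complex_of_real (coef q (par a) (par ` U) / z (par a) * resum q z n (map ((`) par) (W a)))
      = complex_of_real (P Us) * (complex_of_real (q powi (- int (Suc n))) / c ^ Suc n) *
        (c * (complex_of_real ((q - 1) * a * A a * (1 / (par a ^ Suc n * z (par a) * (a * (1 - s * a)))))) * I a)"
    if a: "a \<in> U" for a
  proof -
    have pos: "par a > 0" "a > 0" using par_bounds U(2)[OF a] s0 by (auto intro: less_trans)
    have r: "coef q (par a) (par ` U) / z (par a) * P (W a) * q powi (- int n)
        = P Us * q powi (- int (Suc n)) * ((q - 1) * a * A a * (1 / (par a ^ Suc n * z (par a) * (a * (1 - s * a)))))"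
    proof -
      have "coef q (par a) (par ` U) = (q - 1) / (q * (1 - s * a)) * ((\<Prod>x\<in>U - {a}. par x) * A a)"
        unfolding A_def by (rule coef_par[OF U(1,2) a])
      then show ?thesis unfolding P[OF a] pw using pos q by (simp add: divide_simps)
    qed
    have "complex_of_real (coef q (par a) (par ` U) / z (par a) * resum q z n (map ((`) par) (W a)))
        = complex_of_real (coef q (par a) (par ` U) / z (par a) * P (W a) * q powi (- int n)) / c ^ n * I a"
      by (simp add: IH[OF a] mult_ac)
    also have "\<dots> = complex_of_real (P Us * q powi (- int (Suc n)) *
        ((q - 1) * a * A a * (1 / (par a ^ Suc n * z (par a) * (a * (1 - s * a)))))) / c ^ n * I a"
      unfolding r ..
    finally show ?thesis using c0 by (simp add: mult_ac)
  qed
  have "complex_of_real (resum q z (Suc n) (map ((`) par) Us))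
      = complex_of_real (P Us) * (complex_of_real (q powi (- int (Suc n))) / c ^ Suc n) *
        (\<Sum>a\<in>U. c * (complex_of_real ((q - 1) * a * A a * (1 / (par a ^ Suc n * z (par a) * (a * (1 - s * a)))))) * I a)"
    unfolding res of_real_sum sum_distrib_left by (intro sum.cong refl term_eq)
  then show ?case unfolding int[symmetric] by (simp only: P_def c_def V_def)
qed

end

section \<open>The limiting probability as a contour integral\<close>

definition v_factor :: "real \<Rightarrow> real \<Rightarrow> nat \<Rightarrow> (nat \<Rightarrow> real) \<Rightarrow> nat \<Rightarrow> complex \<Rightarrow> complex" where
  "v_factor q s M v d z = ((z - s * q) / (z - s)) ^ d * (\<Prod>j=1..M. (1 - z * v j) / (1 - q * z * v j)) * (1 / (z * (1 - s * z)))"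

lemma one_variable_factor_eq:
  "one_variable_factor q s M u v k m r = (\<lambda>z. (\<Prod>i=1..m r. (q * z - u i) / (z - u i)) * v_factor q s M v (k - r + 1) z)"
  by (simp add: one_variable_factor_def v_factor_def fun_eq_iff mult.assoc)

lemma meromorphic_v_factor: "v_factor q s M v d meromorphic_on UNIV"
  unfolding v_factor_def[abs_def] by (intro meromorphic_intros)

lemma is_pole_remove_sings_v_factor: "is_pole (remove_sings (v_factor q s M v d)) p \<longleftrightarrow> is_pole (v_factor q s M v d) p"
  using meromorphic_v_factor meromorphic_on_isolated_singularity meromorphic_on_subset
  by (intro is_pole_cong eventually_remove_sings_eq_at refl) blast

text \<open>A finite set that contains all poles of \<open>v_factor\<close>; the entry
  \<open>s * q\<close> is the zero 1/s of \<open>1 - s * z\<close>.\<close>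

definition singular_points :: "real \<Rightarrow> real \<Rightarrow> nat \<Rightarrow> (nat \<Rightarrow> real) \<Rightarrow> real set" where
  "singular_points q s M v = {0, s, s * q} \<union> (\<lambda>j. 1 / (q * v j)) ` {1..M}"

lemma finite_singular_points: "finite (singular_points q s M v)"
  by (simp add: singular_points_def)

lemma concat_segments:
  assumes "\<And>r. 1 \<le> r \<Longrightarrow> r < k \<Longrightarrow> m r \<le> m (Suc r)"
  shows "concat (map (segment m) [1..<Suc k]) = [1..<Suc (if k = 0 then 0 else m k)]"
  using assms
proof (induction k)
  case (Suc k)
  have IH: "concat (map (segment m) [1..<Suc k]) = [1..<Suc (if k = 0 then 0 else m k)]"
    by (rule Suc.IH) (use Suc.prems in auto)
  have seg: "segment m (Suc k) = [Suc (if k = 0 then 0 else m k)..<Suc (m (Suc k))]"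
    by (auto simp: segment_def simp del: upt_Suc)
  have "concat (map (segment m) [1..<Suc (Suc k)]) = concat (map (segment m) [1..<Suc k]) @ segment m (Suc k)"
    by simp
  also have "\<dots> = [1..<Suc (m (Suc k))]"
    unfolding IH seg using upt_add_eq_append[of 1 "Suc (if k = 0 then 0 else m k)" "m (Suc k) - (if k = 0 then 0 else m k)"]
      Suc.prems[of k] by (simp del: upt_Suc)
  finally show ?case by (simp del: upt_Suc)
qed simp

lemma cumul_snoc: "cumul A (Us @ [U]) = cumul A Us @ [A \<union> set (concat Us) \<union> set U]"
  by (induction Us arbitrary: A) (auto simp: Un_assoc)

lemma cumul_segments:
  assumes "\<And>r. 1 \<le> r \<Longrightarrow> r < k \<Longrightarrow> m r \<le> m (Suc r)"
  shows "cumul {} (map (map p) (map (segment m) [1..<Suc k])) = map (\<lambda>r. p ` {1..m r}) [1..<Suc k]"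
  using assms
proof (induction k)
  case (Suc k)
  have IH: "cumul {} (map (map p) (map (segment m) [1..<Suc k])) = map (\<lambda>r. p ` {1..m r}) [1..<Suc k]"
    by (rule Suc.IH) (use Suc.prems in auto)
  have "set (concat (map (map p) (map (segment m) [1..<Suc k]))) \<union> set (map p (segment m (Suc k)))
      = p ` set (concat (map (segment m) [1..<Suc (Suc k)]))"
    by (auto simp: image_Un image_UN)
  also have "\<dots> = p ` {1..m (Suc k)}"
    using concat_segments[of "Suc k" m] Suc.prems by (simp add: atLeastLessThanSuc_atLeastAtMost del: upt_Suc)
  finally show ?case
    using IH cumul_snoc[of "{}" "map (map p) (map (segment m) [1..<Suc k])" "map p (segment m (Suc k))"]
    by (simp del: cumul.simps)
qed simp

context sixv
begin

lemma holomorphic_v_factor: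
  assumes "\<And>j. j \<in> {1..M} \<Longrightarrow> 0 < v j"
  shows "v_factor q s M v d holomorphic_on - complex_of_real ` singular_points q s M v"
proof -
  have ne: "z \<noteq> of_real s" "z \<noteq> 0" "1 - s * z \<noteq> 0" "\<And>j. j \<in> {1..M} \<Longrightarrow> 1 - q * z * v j \<noteq> 0"
    if z: "z \<notin> complex_of_real ` singular_points q s M v" for z :: complex
  proof -
    have *: "z \<noteq> of_real x" if "x \<in> singular_points q s M v" for x using z that by auto
    show "z \<noteq> of_real s" "z \<noteq> 0" using *[of s] *[of 0] by (auto simp: singular_points_def)
    have "z \<noteq> of_real (1 / s)" using *[of "s * q"] by (simp add: singular_points_def sq)
    then show "1 - s * z \<noteq> 0" using s0 by (auto simp: field_simps)
    show "1 - q * z * v j \<noteq> 0" if j: "j \<in> {1..M}" for j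
    proof -
      have "z \<noteq> of_real (1 / (q * v j))" using *[of "1 / (q * v j)"] j unfolding singular_points_def by blast
      then show ?thesis using assms[OF j] q by (auto simp: field_simps)
    qed
  qed
  have ne': "z - of_real s \<noteq> 0" "z * (1 - s * z) \<noteq> 0" "\<And>j. j \<in> {1..M} \<Longrightarrow> 1 - q * z * v j \<noteq> 0"
    if "z \<in> - complex_of_real ` singular_points q s M v" for z :: complex
    using ne[of z] that by simp_all
  show ?thesis
    unfolding v_factor_def[abs_def] by (intro holomorphic_intros ne')
qed

text \<open>This is the value that \<open>resum_contour\<close> demands of \<open>g\<close>: the
  product over \<open>v\<close> is the reciprocal of the Cauchy factor of \<open>x\<close>.\<close>

lemma v_factor_of_real:
  assumes "s < x" "\<And>j. j \<in> {1..M} \<Longrightarrow> 0 < v j \<and> x * v j < 1"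
  shows "v_factor q s M v d (complex_of_real x) =
    complex_of_real (1 / (par x ^ d * (\<Prod>j\<in>{1..M}. al q (par x) (dual v j)) * (x * (1 - s * x))))"
proof -
  have "al q (par x) (dual v j) = (1 - q * x * v j) / (1 - x * v j)" if "j \<in> {1..M}" for j
  proof -
    have "0 < v j" "x * v j < 1" using assms(2)[OF that] by auto
    then have "s * v j < 1" using mult_strict_right_mono[OF assms(1), of "v j"] by linarith
    then have "al q (par x) (dual v j) = (q * x - 1 / v j) / (x - 1 / v j)"
      unfolding dual_def using \<open>0 < v j\<close> \<open>x * v j < 1\<close> assms(1)
      by (intro al_par) (auto simp: field_simps)
    also have "\<dots> = (1 - q * x * v j) / (1 - x * v j)"
      using \<open>0 < v j\<close> \<open>x * v j < 1\<close> by (simp add: divide_simps) (simp add: algebra_simps)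
    finally show ?thesis .
  qed
  then have "(\<Prod>j\<in>{1..M}. al q (par x) (dual v j)) = (\<Prod>j=1..M. (1 - q * x * v j) / (1 - x * v j))"
    by (rule prod.cong[OF refl])
  moreover have "v_factor q s M v d (complex_of_real x) =
    complex_of_real (((x - s * q) / (x - s)) ^ d * (\<Prod>j=1..M. (1 - x * v j) / (1 - q * x * v j)) * (1 / (x * (1 - s * x))))"
    by (simp add: v_factor_def)
  ultimately show ?thesis
    by (simp add: par_def prod_dividef power_divide)
qed

context
  fixes N M k :: nat and u v :: "nat \<Rightarrow> real" and m :: "nat \<Rightarrow> nat" and \<gamma> :: "real \<Rightarrow> complex"
  assumes N: "N \<ge> 1" and M: "M \<ge> 1"
    and u: "\<And>i. 1 \<le> i \<Longrightarrow> i \<le> N \<Longrightarrow> s < u i"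
    and v: "\<And>j. 1 \<le> j \<Longrightarrow> j \<le> M \<Longrightarrow> 0 < v j"
    and uv: "\<And>i j. 1 \<le> i \<Longrightarrow> i \<le> N \<Longrightarrow> 1 \<le> j \<Longrightarrow> j \<le> M \<Longrightarrow> u i * v j < 1"
    and mono: "\<And>r. 1 \<le> r \<Longrightarrow> r < k \<Longrightarrow> m r \<le> m (Suc r)"
    and k: "1 \<le> k" "k \<le> m 1" and mk: "m k \<le> N"
    and adm: "admissible_contour q s N M u v k m \<gamma>"
begin

lemma m_le: "1 \<le> r \<Longrightarrow> r \<le> r' \<Longrightarrow> r' \<le> k \<Longrightarrow> m r \<le> m r'"
proof (induction r')
  case (Suc n)
  then show ?case using mono[of n] by (cases "r = Suc n") (auto intro: order.trans)
qed simp

lemma contour: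
  "positively_oriented_contour \<gamma>" "valid_path \<gamma>" "path \<gamma>" "simple_path \<gamma>"
  using adm by (auto simp: admissible_contour_def positively_oriented_contour_def valid_path_imp_path)

lemma off_contour: "path_image \<gamma> \<inter> inside (path_image \<gamma>) = {}" "path_image \<gamma> \<inter> outside (path_image \<gamma>) = {}"
  using inside_no_overlap outside_no_overlap by blast+

lemma contour_separated:
  fixes z :: complex
  assumes "k \<ge> 2" and z: "z \<in> path_image \<gamma>"
  shows "q * z \<in> outside (path_image \<gamma>)"
proof -
  have "\<forall>i j. 1 \<le> i \<and> i < j \<and> j \<le> k \<longrightarrow>
      (\<forall>z\<in>path_image \<gamma>. q * z \<in> outside (path_image \<gamma>) \<and> z / q \<in> outside (path_image \<gamma>))"
    using adm unfolding admissible_contour_def by (elim conjE)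
  from this[rule_format, of 1 2 z] show ?thesis using \<open>k \<ge> 2\<close> z by simp
qed

definition poles :: "complex set" where
  "poles = {p. \<exists>d\<in>{1..k}. is_pole (v_factor q s M v d) p}"

text \<open>At removable singularities, such as \<open>s * q = 1 / s\<close>, the totalised division gives \<open>v_factor\<close>
  the wrong value, and the contour may pass through such points.\<close>

definition reg :: "nat \<Rightarrow> complex \<Rightarrow> complex" where
  "reg d = remove_sings (v_factor q s M v d)"

lemma poles_singular: "poles \<subseteq> complex_of_real ` singular_points q s M v"
proof
  fix p assume "p \<in> poles"
  then obtain d where d: "is_pole (v_factor q s M v d) p" by (auto simp: poles_def)
  show "p \<in> complex_of_real ` singular_points q s M v"
  proof (rule ccontr)
    assume "p \<notin> complex_of_real ` singular_points q s M v"
    moreover have "open (- complex_of_real ` singular_points q s M v)"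
      using finite_singular_points by (simp add: finite_imp_closed open_Compl)
    ultimately show False
      using d not_is_pole_holomorphic holomorphic_v_factor v by (metis ComplI atLeastAtMost_iff)
  qed
qed

lemma finite_poles: "finite poles"
  using finite_subset[OF poles_singular] finite_singular_points by blast

text \<open>Admissibility speaks about poles of the whole one-variable factor, so no factor (q z -
  u_i) / (z - u_i) may vanish or blow up at a pole x of \<open>v_factor\<close>. Indeed either q x
  \<le> x \<le> s < u_i, or x = 1 / (q v_j) and u_i < 1 / v_j = q x < x.\<close>

lemma poles_outside: "poles \<subseteq> outside (path_image \<gamma>)"
proof
  fix p assume p: "p \<in> poles"
  then obtain d where d: "d \<in> {1..k}" "is_pole (v_factor q s M v d) p" by (auto simp: poles_def)
  from p poles_singular obtain x where x: "p = complex_of_real x" "x \<in> singular_points q s M v" by auto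
  have sq: "s * q < s" using s0 q by simp
  have ux: "x \<noteq> u i \<and> q * x \<noteq> u i" if i: "i \<in> {1..N}" for i
  proof (cases "\<exists>j\<in>{1..M}. x = 1 / (q * v j)")
    case True
    then obtain j where j: "j \<in> {1..M}" "x = 1 / (q * v j)" by auto
    have vj: "0 < v j" "u i * v j < 1" "0 < u i" using v[of j] uv[of i j] u[of i] s0 i j(1) by auto
    have "q * x = 1 / v j" using j q by simp
    moreover have "u i < 1 / v j" using vj by (simp add: field_simps)
    moreover have "1 / v j < x" unfolding j(2) using vj q by (simp add: field_simps)
    ultimately show ?thesis by auto
  next
    case False
    then have "0 \<le> x" "x \<le> s" using x(2) s0 q sq by (auto simp: singular_points_def)
    moreover have "q * x \<le> x" using \<open>0 \<le> x\<close> q by (simp add: mult_left_le_one_le)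
    ultimately show ?thesis using u[of i] i by auto
  qed
  let ?r = "Suc k - d"
  have r: "?r \<in> {1..k}" "k - ?r + 1 = d" using d by auto
  have mr: "m ?r \<le> N" using m_le[of ?r k] r mk by auto
  have ne: "complex_of_real x - u i \<noteq> 0 \<and> q * complex_of_real x - u i \<noteq> 0" if "i \<in> {1..m ?r}" for i
  proof -
    have "x - u i \<noteq> 0" "q * x - u i \<noteq> 0" using ux[of i] that mr by auto
    then have "complex_of_real (x - u i) \<noteq> 0" "complex_of_real (q * x - u i) \<noteq> 0" by (simp_all only: of_real_eq_0_iff not_False_eq_True)
    then show ?thesis by simp
  qed
  have "(\<lambda>z. \<Prod>i=1..m ?r. (q * z - u i) / (z - u i)) analytic_on {p}"
    using ne by (intro analytic_intros) (auto simp: x)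
  moreover have "(\<Prod>i=1..m ?r. (q * p - u i) / (p - u i)) \<noteq> 0"
    using ne by (auto simp: x)
  ultimately have "is_pole (one_variable_factor q s M u v k m ?r) p"
    unfolding one_variable_factor_eq r(2) using d(2) by (intro is_pole_mult_analytic_nonzero1)
  then have "p \<in> (\<lambda>i. complex_of_real (u i)) ` {1..N} \<or> p \<in> outside (path_image \<gamma>)"
    using adm r(1) unfolding admissible_contour_def by blast
  moreover have "p \<notin> (\<lambda>i. complex_of_real (u i)) ` {1..N}" unfolding x(1) using ux by force
  ultimately show "p \<in> outside (path_image \<gamma>)" by blast
qed

lemma reg_holomorphic: "d \<in> {1..k} \<Longrightarrow> reg d holomorphic_on - poles"
proof -
  assume d: "d \<in> {1..k}"
  have "reg d analytic_on - poles"
    unfolding analytic_on_analytic_at[of _ "- poles"]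
  proof
    fix z assume "z \<in> - poles"
    then have "\<not> is_pole (reg d) z" using d by (auto simp: poles_def reg_def is_pole_remove_sings_v_factor)
    then show "reg d analytic_on {z}"
      using nicely_meromorphic_on_imp_analytic_at[OF remove_sings_nicely_meromorphic[OF meromorphic_v_factor]]
      by (simp add: reg_def)
  qed
  then show ?thesis by (rule analytic_imp_holomorphic)
qed

lemma reg_eq: "z \<notin> complex_of_real ` singular_points q s M v \<Longrightarrow> reg d z = v_factor q s M v d z"
proof -
  assume z: "z \<notin> complex_of_real ` singular_points q s M v"
  have "open (- complex_of_real ` singular_points q s M v)"
    using finite_singular_points by (simp add: finite_imp_closed open_Compl)
  then have "v_factor q s M v d analytic_on {z}"
    using holomorphic_on_imp_analytic_at[OF holomorphic_v_factor] z v by auto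
  then show ?thesis by (simp add: reg_def)
qed

text \<open>These are the conditions on the parameters that persist under small
  perturbations.\<close>

definition good :: "(nat \<Rightarrow> real) \<Rightarrow> bool" where
  "good x \<longleftrightarrow> (\<forall>i\<in>{1..N}. s < x i \<and> (\<forall>j\<in>{1..M}. x i * v j < 1))"

lemma good_u: "good u"
  using u uv by (simp add: good_def)

lemma reg_of_real:
  assumes "good x" "i \<in> {1..N}"
  shows "reg d (complex_of_real (x i)) =
    complex_of_real (1 / (par (x i) ^ d * (\<Prod>j\<in>{1..M}. al q (par (x i)) (dual v j)) * (x i * (1 - s * x i))))"
proof -
  have x: "s < x i" "\<And>j. j \<in> {1..M} \<Longrightarrow> 0 < v j \<and> x i * v j < 1" using assms v by (auto simp: good_def)
  have "s * q < s" using s0 q by simp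
  then have "x i \<notin> {0, s, s * q}" using x(1) s0 by auto
  moreover have "x i \<noteq> 1 / (q * v j)" if "j \<in> {1..M}" for j
  proof
    assume "x i = 1 / (q * v j)"
    then have "x i * v j = 1 / q" using x(2)[OF that] by simp
    moreover have "1 < 1 / q" using q by simp
    ultimately show False using x(2)[OF that] by linarith
  qed
  ultimately have "x i \<notin> singular_points q s M v" unfolding singular_points_def by blast
  then have "complex_of_real (x i) \<notin> complex_of_real ` singular_points q s M v"
    by (auto simp only: of_real_eq_iff)
  then show ?thesis using reg_eq v_factor_of_real[OF x] by simp
qed

definition kernel :: "(nat \<Rightarrow> complex) \<Rightarrow> nat \<Rightarrow> complex \<Rightarrow> complex" where
  "kernel x r = (\<lambda>w::complex. (\<Prod>i=1..m r. (of_real q * w - (x i :: complex)) / (w - x i)) * reg (Suc k - r) w)"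

definition contour_value :: "(nat \<Rightarrow> complex) \<Rightarrow> complex" where
  "contour_value x = iterated_contour_integral k \<gamma> (coupled q k (kernel x))"

lemma contour_value_integrand:
  "contour_value (\<lambda>i. u i) = iterated_contour_integral k \<gamma> (integrand q s M u v k m)"
  unfolding contour_value_def
proof (rule iterated_contour_integral_cong[OF contour(4)])
  show "finite (complex_of_real ` singular_points q s M v)" using finite_singular_points by simp
  fix z assume z: "\<And>i. i \<in> {1..k} \<Longrightarrow> z i \<in> path_image \<gamma> - complex_of_real ` singular_points q s M v"
  have "kernel (\<lambda>i. u i) r (z r) = one_variable_factor q s M u v k m r (z r)" if "r \<in> {1..k}" for r
  proof -
    have "Suc k - r = k - r + 1" using that by auto
    then show ?thesis using reg_eq[of "z r"] z[OF that] by (simp add: kernel_def one_variable_factor_eq)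
  qed
  then show "coupled q k (kernel (\<lambda>i. u i)) z = integrand q s M u v k m z"
    unfolding coupled_def integrand_def pairs_def by (intro arg_cong2[where f = "(*)"] refl prod.cong) auto
qed

lemma resum_contour_value:
  assumes x: "good x" "inj_on x {1..N}" "\<And>i. i \<in> {1..N} \<Longrightarrow> complex_of_real (x i) \<in> inside (path_image \<gamma>)"
  shows "complex_of_real (resum q (\<lambda>p. \<Prod>j\<in>{1..M}. al q p (dual v j)) k (map (\<lambda>r. (\<lambda>i. par (x i)) ` {1..m r}) [1..<Suc k])) =
    complex_of_real (\<Prod>r=1..k. \<Prod>i=1..m r. par (x i)) * (complex_of_real (q powi (- int k)) / (2 * of_real pi * \<i>) ^ k) *
    contour_value (\<lambda>i. x i)"
proof -
  define Us where "Us = map (\<lambda>r. x ` {1..m r}) [1..<Suc k]"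
  have nth_Us: "Us ! l = x ` {1..m (Suc l)}" if "l < length Us" for l
    using that by (simp add: Us_def del: upt_Suc)
  have mN: "m r \<le> N" if "r \<in> {1..k}" for r using m_le[of r k] that mk by auto
  have inj: "inj_on x {1..m r}" if "r \<in> {1..k}" for r
    using inj_on_subset[OF x(2), of "{1..m r}"] mN[OF that] by simp
  have "complex_of_real (resum q (\<lambda>p. \<Prod>j\<in>{1..M}. al q p (dual v j)) k (map ((`) par) Us)) =
    complex_of_real (\<Prod>U\<leftarrow>Us. \<Prod>x\<in>U. par x) * (complex_of_real (q powi (- int k)) / (2 * of_real pi * \<i>) ^ k) *
    iterated_contour_integral k \<gamma>
      (coupled q k (\<lambda>r w. (\<Prod>x\<in>complex_of_real ` (Us ! (r - 1)). (q * w - x) / (w - x)) * reg (Suc k - r) w))"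
  proof (rule resum_contour[OF contour(1) finite_poles poles_outside])
    have set_Us: "set Us = (\<lambda>r. x ` {1..m r}) ` {1..k}"
      by (simp add: Us_def atLeastLessThanSuc_atLeastAtMost del: upt_Suc)
    show "length Us = k" by (simp add: Us_def)
    show "finite U \<and> (\<forall>x\<in>U. s < x) \<and> complex_of_real ` U \<subseteq> inside (path_image \<gamma>)" if U: "U \<in> set Us" for U
    proof -
      obtain r where r: "r \<in> {1..k}" "U = x ` {1..m r}" using U unfolding set_Us by blast
      then show ?thesis using x mN[OF r(1)] by (auto simp: good_def)
    qed
    show "sorted_wrt (\<subseteq>) Us"
      unfolding sorted_wrt_iff_nth_less
    proof (intro allI impI)
      fix i j assume ij: "i < j" "j < length Us"
      have "m (Suc i) \<le> m (Suc j)" using ij m_le[of "Suc i" "Suc j"] by (simp add: Us_def del: upt_Suc)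
      then show "Us ! i \<subseteq> Us ! j" using ij nth_Us by (simp add: image_mono)
    qed
    show "reg d holomorphic_on - poles" if "d \<in> {1..k}" for d by (rule reg_holomorphic[OF that])
    show "reg d (complex_of_real y) = complex_of_real (1 / (par y ^ d * (\<Prod>j\<in>{1..M}. al q (par y) (dual v j)) * (y * (1 - s * y))))"
      if y: "y \<in> \<Union>(set Us)" for d y
    proof -
      obtain r i where "r \<in> {1..k}" "y = x i" "i \<in> {1..m r}" using y unfolding set_Us by blast
      then show ?thesis using reg_of_real[OF x(1), of i] mN[of r] by auto
    qed
  qed (use contour_separated in auto)
  moreover have "map ((`) par) Us = map (\<lambda>r. (\<lambda>i. par (x i)) ` {1..m r}) [1..<Suc k]"
    by (simp add: Us_def image_image del: upt_Suc)
  moreover have "(\<Prod>U\<leftarrow>Us. \<Prod>x\<in>U. par x) = (\<Prod>r=1..k. \<Prod>i=1..m r. par (x i))"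
  proof -
    have "(\<Prod>U\<leftarrow>Us. \<Prod>x\<in>U. par x) = (\<Prod>r\<leftarrow>[1..<Suc k]. \<Prod>y\<in>x ` {1..m r}. par y)"
      by (simp add: Us_def o_def del: upt_Suc)
    also have "\<dots> = (\<Prod>r=1..k. \<Prod>y\<in>x ` {1..m r}. par y)"
      by (subst prod.distinct_set_conv_list[symmetric]) (simp_all add: atLeastLessThanSuc_atLeastAtMost del: upt_Suc)
    also have "\<dots> = (\<Prod>r=1..k. \<Prod>i=1..m r. par (x i))"
      by (rule prod.cong[OF refl], subst prod.reindex[OF inj]) auto
    finally show ?thesis .
  qed
  moreover have "coupled q k (\<lambda>r w. (\<Prod>x\<in>complex_of_real ` (Us ! (r - 1)). (q * w - x) / (w - x)) * reg (Suc k - r) w)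
      = coupled q k (kernel (\<lambda>i. x i))"
  proof (rule coupled_cong)
    fix r and w :: complex assume r: "r \<in> {1..k}"
    have "r - 1 < length Us" using r by (auto simp: Us_def simp del: upt_Suc)
    then have "Us ! (r - 1) = x ` {1..m r}" using nth_Us[of "r - 1"] r by simp
    then have "complex_of_real ` (Us ! (r - 1)) = (\<lambda>i. complex_of_real (x i)) ` {1..m r}" by (simp add: image_image)
    moreover have "inj_on (\<lambda>i. complex_of_real (x i)) {1..m r}" using inj[OF r] unfolding inj_on_def of_real_eq_iff .
    ultimately show "(\<Prod>x\<in>complex_of_real ` (Us ! (r - 1)). (q * w - x) / (w - x)) * reg (Suc k - r) w = kernel (\<lambda>i. x i) r w"
      by (simp add: kernel_def prod.reindex)
  qed
  ultimately show ?thesis by (simp add: contour_value_def)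
qed

text \<open>As long as the perturbed parameters stay in small closed discs inside the contour, a
  fixed neighbourhood of the contour is free of poles, even if several parameters coincide.\<close>

lemma contour_value_continuous:
  obtains \<delta> where "\<delta> > 0"
    "continuous_on (cball 0 \<delta>) (\<lambda>e. contour_value (\<lambda>i. complex_of_real (u i) + of_nat i * e))"
    "\<And>e i. e \<in> cball 0 \<delta> \<Longrightarrow> i \<in> {1..N} \<Longrightarrow> complex_of_real (u i) + of_nat i * e \<in> inside (path_image \<gamma>)"
proof -
  have "\<forall>i\<in>{1..N}. \<exists>\<epsilon>>0. cball (complex_of_real (u i)) \<epsilon> \<subseteq> inside (path_image \<gamma>)"
  proof
    fix i assume "i \<in> {1..N}"
    then have "complex_of_real (u i) \<in> inside (path_image \<gamma>)" using adm by (simp add: admissible_contour_def)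
    moreover have "open (inside (path_image \<gamma>))"
      using contour(3) by (simp add: closed_path_image open_inside)
    ultimately show "\<exists>\<epsilon>>0. cball (complex_of_real (u i)) \<epsilon> \<subseteq> inside (path_image \<gamma>)"
      using open_contains_cball by blast
  qed
  then obtain f where f: "\<And>i. i \<in> {1..N} \<Longrightarrow> f i > 0 \<and> cball (complex_of_real (u i)) (f i) \<subseteq> inside (path_image \<gamma>)"
    by metis
  define \<epsilon> where "\<epsilon> = Min (f ` {1..N})"
  have \<epsilon>: "\<epsilon> > 0" "\<And>i. i \<in> {1..N} \<Longrightarrow> \<epsilon> \<le> f i"
    unfolding \<epsilon>_def using f N by (auto simp: Min_gr_iff)
  define C where "C = (\<Union>i\<in>{1..N}. cball (complex_of_real (u i)) \<epsilon>)"
  have Cin: "C \<subseteq> inside (path_image \<gamma>)"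
    unfolding C_def using f \<epsilon>(2) subset_cball by blast
  \<comment> \<open>The i-th parameter moves by i e with i at most \<open>N\<close>, so this keeps
    all of them within \<epsilon>.\<close>
  define \<delta> where "\<delta> = \<epsilon> / N"
  have \<delta>: "\<delta> > 0" using \<epsilon> N by (simp add: \<delta>_def)
  have pert: "complex_of_real (u i) + of_nat i * e \<in> C" if "e \<in> cball 0 \<delta>" "i \<in> {1..N}" for e i
  proof -
    have "real i * norm e \<le> real N * \<delta>" using that \<delta> by (intro mult_mono) auto
    then have "complex_of_real (u i) + of_nat i * e \<in> cball (complex_of_real (u i)) \<epsilon>"
      using N by (simp add: norm_mult \<delta>_def dist_norm)
    then show ?thesis using that(2) unfolding C_def by blast
  qed
  have "closed (C \<union> poles)" unfolding C_def using finite_poles by (intro closed_Un closed_UN finite_imp_closed) auto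
  moreover have "path_image \<gamma> \<inter> (C \<union> poles) = {}" using Cin poles_outside off_contour by blast
  moreover have "\<forall>z\<in>path_image \<gamma>. q * z \<notin> path_image \<gamma>" if k2: "k \<ge> 2"
  proof
    fix z assume "z \<in> path_image \<gamma>"
    then have "q * z \<in> outside (path_image \<gamma>)" using contour_separated[of z] k2 by blast
    then show "q * z \<notin> path_image \<gamma>" using off_contour(2) by blast
  qed
  ultimately obtain W where W: "open W" "path_image \<gamma> \<subseteq> W" "W \<inter> (C \<union> poles) = {}"
    "k \<ge> 2 \<Longrightarrow> (\<forall>w\<in>W. \<forall>w'\<in>W. w \<noteq> of_real q * w')"
    using contour_neighbourhood[of \<gamma> "C \<union> poles" "k \<ge> 2" q] contour(3) by blast
  define \<phi> where "\<phi> r e = kernel (\<lambda>i. complex_of_real (u i) + of_nat i * e) r" for r e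
  have ne: "w - (complex_of_real (u i) + of_nat i * e) \<noteq> 0" if "w \<in> W" "e \<in> cball 0 \<delta>" "i \<in> {1..m r}" "r \<in> {1..k}" for w e i r
  proof -
    have "i \<in> {1..N}" using that m_le[of r k] mk by auto
    then show ?thesis using pert[OF that(2)] W(3) that(1) by fastforce
  qed
  have hreg: "reg (Suc k - r) holomorphic_on W" if "r \<in> {1..k}" for r
    by (rule holomorphic_on_subset[OF reg_holomorphic]) (use that W(3) in auto)
  have "separately_holomorphic (cball 0 \<delta>) W {1..k} (\<lambda>z. coupled q k (\<lambda>r. \<phi> r (z 0)) z)"
  proof (rule separately_holomorphic_coupled[OF W(4)])
    fix r assume r: "r \<in> {1..k}"
    have ne1: "snd y - (complex_of_real (u i) + of_nat i * fst y) \<noteq> 0" if "y \<in> cball 0 \<delta> \<times> W" "i \<in> {1..m r}" for y i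
      using ne[OF _ _ that(2) r, of "snd y" "fst y"] that(1) by auto
    have creg: "continuous_on (cball 0 \<delta> \<times> W) (\<lambda>y. reg (Suc k - r) (snd y))"
      by (rule continuous_on_compose2[OF holomorphic_on_imp_continuous_on[OF hreg[OF r]] continuous_on_snd[OF continuous_on_id]]) auto
    show "continuous_on (cball 0 \<delta> \<times> W) (\<lambda>(e, w). \<phi> r e w)"
      unfolding \<phi>_def kernel_def split_beta by (intro ballI continuous_intros creg ne1)
    show "\<phi> r e holomorphic_on W" if "e \<in> cball 0 \<delta>" for e
      unfolding \<phi>_def kernel_def by (intro holomorphic_intros hreg r ne[OF _ that _ r])
  qed
  from iterated_contour_integral_continuous_param[OF contour(2) W(2,1) this]
  have "continuous_on (cball 0 \<delta>) (\<lambda>e. contour_value (\<lambda>i. complex_of_real (u i) + of_nat i * e))"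
  proof (rule continuous_on_cong[THEN iffD1, OF refl, rotated])
    fix e
    have "coupled q k (\<lambda>r. \<phi> r ((z(0 := e)) 0)) (z(0 := e)) = coupled q k (kernel (\<lambda>i. complex_of_real (u i) + of_nat i * e)) z" for z
      unfolding coupled_def \<phi>_def by (intro arg_cong2[where f = "(*)"] prod.cong) (auto simp: pairs_def)
    then show "iterated_contour_integral k \<gamma> (\<lambda>z. coupled q k (\<lambda>r. \<phi> r ((z(0 := e)) 0)) (z(0 := e)))
        = contour_value (\<lambda>i. complex_of_real (u i) + of_nat i * e)"
      by (simp add: contour_value_def)
  qed
  then show thesis using that[OF \<delta>] pert Cin by blast
qed

definition zeta_prod :: "(nat \<Rightarrow> real) \<Rightarrow> real" where
  "zeta_prod x = (\<Prod>i\<in>{1..N}. \<Prod>j\<in>{1..M}. al q (par (x i)) (dual v j))"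

definition target_value :: "nat \<Rightarrow> (nat \<Rightarrow> real) \<Rightarrow> real" where
  "target_value n x = target (map (segment m) [1..<Suc n]) [Suc (if n = 0 then 0 else m n)..<Suc N] (rev [1..<Suc M]) (\<lambda>i. par (x i)) (dual v)"

lemma indices:
  assumes "n \<le> k"
  shows "concat (map (segment m) [1..<Suc n]) @ [Suc (if n = 0 then 0 else m n)..<Suc N] = [1..<Suc N]"
proof -
  define a where "a = (if n = 0 then 0 else m n)"
  have "concat (map (segment m) [1..<Suc n]) = [1..<Suc a]"
    unfolding a_def by (rule concat_segments) (use mono assms in auto)
  moreover have "a \<le> N" using m_le[of n k] assms mk by (auto simp: a_def)
  ultimately show ?thesis
    using upt_add_eq_append[of 1 "Suc a" "N - a"] by (simp add: a_def[symmetric] del: upt_Suc)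
qed

lemma set_indices:
  "n \<le> k \<Longrightarrow> set (concat (map (segment m) [1..<Suc n]) @ [Suc (if n = 0 then 0 else m n)..<Suc N]) = {1..N}"
  unfolding indices by (simp add: atLeastLessThanSuc_atLeastAtMost del: upt_Suc)

lemma set_dual_indices: "set (rev [1..<Suc M]) = {1..M}"
  by (simp add: atLeastLessThanSuc_atLeastAtMost del: upt_Suc)

lemma dual_unit: "j \<in> {1..M} \<Longrightarrow> 0 < dual v j \<and> dual v j < 1"
proof -
  assume j: "j \<in> {1..M}"
  have "u 1 < 1 / v j" using uv[of 1 j] v[of j] N j by (simp add: field_simps)
  then have "s < 1 / v j" using u[of 1] N by linarith
  then show ?thesis using par_bounds by (simp add: dual_def)
qed

lemma good_less_dual: "good x \<Longrightarrow> i \<in> {1..N} \<Longrightarrow> j \<in> {1..M} \<Longrightarrow> par (x i) < dual v j"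
  unfolding dual_def good_def using v[of j] by (intro par_less) (auto simp: field_simps)

lemma zeta_prod_pos: "good x \<Longrightarrow> zeta_prod x > 0"
  unfolding zeta_prod_def using good_less_dual dual_unit par_bounds
  by (intro prod_pos al_pos ballI) (auto simp: good_def)

lemma target_value_eq:
  assumes "n \<le> k"
  shows "target_value n x = zeta_prod x *
    resum q (\<lambda>p. \<Prod>j\<in>{1..M}. al q p (dual v j)) n (map (\<lambda>r. (\<lambda>i. par (x i)) ` {1..m r}) [1..<Suc n]) /
    (\<Prod>j=1..M. dual v j) ^ n"
proof -
  have "prod_list (map (dual v) (rev [1..<Suc M])) = (\<Prod>j=1..M. dual v j)"
    by (subst prod.distinct_set_conv_list[symmetric]) (simp_all add: atLeastLessThanSuc_atLeastAtMost del: upt_Suc)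
  moreover have "cumul {} (map (map (\<lambda>i. par (x i))) (map (segment m) [1..<Suc n])) = map (\<lambda>r. (\<lambda>i. par (x i)) ` {1..m r}) [1..<Suc n]"
    by (rule cumul_segments) (use mono assms in auto)
  ultimately show ?thesis
    unfolding target_value_def target_def set_indices[OF assms] set_dual_indices zeta_prod_def by (simp del: upt_Suc)
qed

lemma event_ratio_distinct:
  assumes "n \<le> k" "good x" "inj_on x {1..N}"
  shows "event_ratio N M (\<lambda>i. par (x i)) (dual v) n m \<longlonglongrightarrow> target_value n x"
  unfolding event_ratio_def target_value_def
proof (rule ratio_limit_distinct, unfold set_indices[OF assms(1)] set_dual_indices)
  show "distinct (concat (map (segment m) [1..<Suc n]) @ [Suc (if n = 0 then 0 else m n)..<Suc N])"
    unfolding indices[OF assms(1)] by simp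
  have "inj_on par (x ` {1..N})" using assms(2) by (intro inj_on_subset[OF inj_on_par]) (auto simp: good_def)
  then show "inj_on (\<lambda>i. par (x i)) {1..N}" using comp_inj_on[OF assms(3)] by (simp add: o_def)
  show "0 < par (x i) \<and> par (x i) < 1" if "i \<in> {1..N}" for i
    using assms(2) that par_bounds by (simp add: good_def)
qed (use dual_unit good_less_dual assms in auto)

text \<open>Shifts proportional to the index separate equal parameters; the signs 1 and -1 provide
  bounds from both sides.\<close>

definition perturbed :: "real \<Rightarrow> real \<Rightarrow> nat \<Rightarrow> real" where
  "perturbed \<sigma> e i = u i + e * (\<sigma> * real i)"

lemma perturbed_tendsto: "((\<lambda>e. perturbed \<sigma> e i) \<longlongrightarrow> u i) (at_right 0)"
  unfolding perturbed_def by (auto intro!: tendsto_eq_intros)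

lemma par_tendsto:
  assumes "(f \<longlongrightarrow> x) F" "s < x"
  shows "((\<lambda>e. par (f e)) \<longlongrightarrow> par x) F"
  unfolding par_def using par_denominator[OF assms(2)] by (intro tendsto_intros assms) auto

lemma eventually_good: "\<forall>\<^sub>F e in at_right 0. good (perturbed \<sigma> e)"
proof -
  have 1: "\<forall>\<^sub>F e in at_right 0. s < perturbed \<sigma> e i" if "i \<in> {1..N}" for i
    by (rule order_tendstoD(1)[OF perturbed_tendsto]) (use u that in auto)
  have 2: "\<forall>\<^sub>F e in at_right 0. perturbed \<sigma> e i * v j < 1" if "i \<in> {1..N}" "j \<in> {1..M}" for i j
    by (rule order_tendstoD(2)[OF tendsto_mult_right[OF perturbed_tendsto]]) (use uv that in auto)
  show ?thesis
    unfolding good_def by (intro eventually_ball_finite ballI eventually_conj 1 2) auto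
qed

lemma eventually_inj_on: "\<sigma> \<noteq> 0 \<Longrightarrow> \<forall>\<^sub>F e in at_right 0. inj_on (perturbed \<sigma> e) {1..N}"
  unfolding perturbed_def by (rule eventually_inj_on_perturbed) (auto simp: inj_on_def)

lemma zeta_prod_tendsto: "((\<lambda>e. zeta_prod (perturbed \<sigma> e)) \<longlongrightarrow> zeta_prod u) (at_right 0)"
  unfolding zeta_prod_def al_def den_def
proof (intro tendsto_prod tendsto_divide tendsto_intros par_tendsto perturbed_tendsto)
  fix i j assume "i \<in> {1..N}" "j \<in> {1..M}"
  then show "dual v j - par (u i) \<noteq> 0" using good_less_dual[OF good_u, of i j] by simp
qed (use u in auto)

lemma event_ratio_limit:
  assumes "n \<le> k"
    and T: "\<And>\<sigma>. \<sigma> \<in> {1, -1} \<Longrightarrow> ((\<lambda>e. target_value n (perturbed \<sigma> e)) \<longlongrightarrow> T) (at_right 0)"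
  shows "event_ratio N M (\<lambda>i. par (u i)) (dual v) n m \<longlonglongrightarrow> T"
  unfolding event_ratio_def
proof (rule ratio_limit_squeeze[where F = "at_right 0" and um = "\<lambda>e i. par (perturbed (-1) e i)"
      and up = "\<lambda>e i. par (perturbed 1 e i)" and a = "\<lambda>e. target_value n (perturbed (-1) e)"
      and b = "\<lambda>e. target_value n (perturbed 1 e)"], unfold set_indices[OF assms(1)] set_dual_indices)
  show "\<forall>\<^sub>F e in at_right 0. \<forall>i\<in>{1..N}. 0 < par (perturbed (-1) e i) \<and> par (perturbed (-1) e i) \<le> par (u i) \<and>
      par (u i) \<le> par (perturbed 1 e i) \<and> par (perturbed 1 e i) < 1"
    using eventually_good[of 1] eventually_good[of "-1"] eventually_at_right_less[of "0::real"]
  proof eventually_elim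
    case (elim e)
    show ?case
    proof
      fix i assume i: "i \<in> {1..N}"
      have *: "s < perturbed (-1) e i" "s < perturbed 1 e i" using elim i by (auto simp: good_def)
      moreover have "perturbed (-1) e i < u i" "u i < perturbed 1 e i" using elim i by (auto simp: perturbed_def)
      moreover have "s < u i" using u i by simp
      ultimately show "0 < par (perturbed (-1) e i) \<and> par (perturbed (-1) e i) \<le> par (u i) \<and>
          par (u i) \<le> par (perturbed 1 e i) \<and> par (perturbed 1 e i) < 1"
        using par_bounds par_less by (simp add: less_imp_le)
    qed
  qed
  have inj: "\<forall>\<^sub>F e in at_right 0. inj_on (perturbed 1 e) {1..N}" "\<forall>\<^sub>F e in at_right 0. inj_on (perturbed (-1) e) {1..N}"
    by (rule eventually_inj_on; simp)+
  show "\<forall>\<^sub>F e in at_right 0.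
      (ratio (map (segment m) [1..<Suc n]) [Suc (if n = 0 then 0 else m n)..<Suc N] (rev [1..<Suc M])
         (\<lambda>i. par (perturbed (-1) e i)) (dual v) \<longlonglongrightarrow> target_value n (perturbed (-1) e)) \<and>
      (ratio (map (segment m) [1..<Suc n]) [Suc (if n = 0 then 0 else m n)..<Suc N] (rev [1..<Suc M])
         (\<lambda>i. par (perturbed 1 e i)) (dual v) \<longlonglongrightarrow> target_value n (perturbed 1 e))"
    using eventually_good[of 1] eventually_good[of "-1"] inj
  proof eventually_elim
    case (elim e)
    show ?case by (intro conjI event_ratio_distinct[OF assms(1), unfolded event_ratio_def] elim)
  qed
qed (use u par_bounds dual_unit in \<open>auto intro!: T par_tendsto perturbed_tendsto\<close>)

definition limit_value :: complex where
  "limit_value = complex_of_real (zeta_prod u) *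
     (complex_of_real (\<Prod>r=1..k. \<Prod>i=1..m r. par (u i)) * (complex_of_real (q powi (- int k)) / (2 * of_real pi * \<i>) ^ k) *
      contour_value (\<lambda>i. u i)) / complex_of_real ((\<Prod>j=1..M. dual v j) ^ k)"

text \<open>For small e > 0 the perturbed parameters are distinct, so the nested sum equals the
  contour expression, and this one is continuous at e = 0.\<close>

lemma target_value_tendsto:
  assumes "\<sigma> \<in> {1, -1}"
  shows "((\<lambda>e. complex_of_real (target_value k (perturbed \<sigma> e))) \<longlongrightarrow> limit_value) (at_right 0)"
proof -
  obtain \<delta> where \<delta>: "\<delta> > 0"
    "continuous_on (cball 0 \<delta>) (\<lambda>e. contour_value (\<lambda>i. complex_of_real (u i) + of_nat i * e))"
    "\<And>e i. e \<in> cball 0 \<delta> \<Longrightarrow> i \<in> {1..N} \<Longrightarrow> complex_of_real (u i) + of_nat i * e \<in> inside (path_image \<gamma>)"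
    using contour_value_continuous by blast
  have pert: "complex_of_real (perturbed \<sigma> e i) = complex_of_real (u i) + of_nat i * complex_of_real (e * \<sigma>)" for e i
    by (simp add: perturbed_def mult_ac)
  have c: "((\<lambda>e. contour_value (\<lambda>i. complex_of_real (perturbed \<sigma> e i))) \<longlongrightarrow> contour_value (\<lambda>i. u i)) (at_right 0)"
  proof -
    have "isCont (\<lambda>e. contour_value (\<lambda>i. complex_of_real (u i) + of_nat i * e)) 0"
      using continuous_on_interior[OF \<delta>(2), of 0] \<delta>(1) by simp
    moreover have "((\<lambda>e. complex_of_real (e * \<sigma>)) \<longlongrightarrow> 0) (at_right 0)"
      by (auto intro!: tendsto_eq_intros)
    ultimately show ?thesis
      unfolding pert using isCont_tendsto_compose by fastforce
  qed
  have "((\<lambda>e. complex_of_real (zeta_prod (perturbed \<sigma> e)) *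
     (complex_of_real (\<Prod>r=1..k. \<Prod>i=1..m r. par (perturbed \<sigma> e i)) * (complex_of_real (q powi (- int k)) / (2 * of_real pi * \<i>) ^ k) *
      contour_value (\<lambda>i. perturbed \<sigma> e i)) / complex_of_real ((\<Prod>j=1..M. dual v j) ^ k)) \<longlongrightarrow> limit_value) (at_right 0)"
    unfolding limit_value_def
  proof (intro tendsto_mult tendsto_divide tendsto_const tendsto_of_real zeta_prod_tendsto tendsto_prod par_tendsto perturbed_tendsto c)
    fix r i assume "r \<in> {1..k}" "i \<in> {1..m r}"
    then show "s < u i" using m_le[of r k] mk u by auto
  qed (use dual_unit in fastforce)+
  moreover have "\<forall>\<^sub>F e in at_right 0. complex_of_real (zeta_prod (perturbed \<sigma> e)) *
     (complex_of_real (\<Prod>r=1..k. \<Prod>i=1..m r. par (perturbed \<sigma> e i)) * (complex_of_real (q powi (- int k)) / (2 * of_real pi * \<i>) ^ k) *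
      contour_value (\<lambda>i. perturbed \<sigma> e i)) / complex_of_real ((\<Prod>j=1..M. dual v j) ^ k) =
      complex_of_real (target_value k (perturbed \<sigma> e))"
  proof -
    have "\<sigma> \<noteq> 0" using assms by auto
    have "\<forall>\<^sub>F e in at_right 0. e < \<delta>"
      using \<delta>(1) by (intro order_tendstoD(2)[OF tendsto_ident_at]) auto
    then show ?thesis
      using eventually_good[of \<sigma>] eventually_inj_on[OF \<open>\<sigma> \<noteq> 0\<close>] eventually_at_right_less[of "0::real"]
    proof eventually_elim
      case (elim e)
      have "complex_of_real (e * \<sigma>) \<in> cball 0 \<delta>" using assms elim by (auto simp: norm_mult)
      then have "complex_of_real (perturbed \<sigma> e i) \<in> inside (path_image \<gamma>)" if "i \<in> {1..N}" for i
        unfolding pert using \<delta>(3) that by blast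
      from resum_contour_value[OF elim(2,3) this] show ?case
        unfolding target_value_eq[OF order.refl] by simp
    qed
  qed
  ultimately show ?thesis by (rule Lim_transform_eventually)
qed

lemma one_le_m: "1 \<le> r \<Longrightarrow> r \<le> k \<Longrightarrow> 1 \<le> m r"
  using m_le[of 1 r] k by auto

theorem path_prob_contour:
  "complex_of_real (path_prob q s N M u v (event N k m)) =
    complex_of_real ((\<Prod>j=1..M. (1 - q * s * v j) / (1 - s * v j)) ^ k *
      (\<Prod>r=1..k. \<Prod>i=1..m r. (u i - s) / (u i - s * q))) *
    (complex_of_real (q powi (- int k)) / (2 * of_real pi * \<i>) ^ k) *
    iterated_contour_integral k \<gamma> (integrand q s M u v k m)"
proof -
  have bot: "at_right (0::real) \<noteq> bot" by simp
  \<comment> \<open>As a limit of real numbers the contour expression is real, so it can serve as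
    the limit of the ratios.\<close>
  have "((\<lambda>e. Im (complex_of_real (target_value k (perturbed 1 e)))) \<longlongrightarrow> Im limit_value) (at_right 0)"
    by (intro tendsto_Im target_value_tendsto) simp
  then have "Im limit_value = 0"
    using tendsto_unique[OF bot _ tendsto_const] by fastforce
  then have real: "limit_value = complex_of_real (Re limit_value)" by (simp add: complex_eq_iff)
  have T: "event_ratio N M (\<lambda>i. par (u i)) (dual v) k m \<longlonglongrightarrow> Re limit_value"
  proof (rule event_ratio_limit[OF order.refl])
    fix \<sigma> :: real assume "\<sigma> \<in> {1, -1}"
    from tendsto_Re[OF target_value_tendsto[OF this]]
    show "((\<lambda>e. target_value k (perturbed \<sigma> e)) \<longlongrightarrow> Re limit_value) (at_right 0)" by simp
  qed
  \<comment> \<open>Without conditions the ratio belongs to the normalising sum. Its limit, the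
    Cauchy product, cancels in the quotient.\<close>
  have T0: "event_ratio N M (\<lambda>i. par (u i)) (dual v) 0 m \<longlonglongrightarrow> zeta_prod u"
    by (rule event_ratio_limit) (use zeta_prod_tendsto in \<open>auto simp: target_value_eq\<close>)
  have pos: "zeta_prod u > 0" by (rule zeta_prod_pos[OF good_u])
  have D: "1 / (\<Prod>j=1..M. dual v j) ^ k = (\<Prod>j=1..M. (1 - q * s * v j) / (1 - s * v j)) ^ k"
  proof -
    have "dual v j = (1 - s * v j) / (1 - q * s * v j)" if "j \<in> {1..M}" for j
      using v[of j] that by (simp add: dual_def par_def divide_simps) (simp add: algebra_simps)
    then show ?thesis by (simp add: prod_dividef power_divide)
  qed
  have kN: "k \<le> N" using k mk m_le[of 1 k] by linarith
  have "path_prob q s N M u v (event N k m) = Re limit_value / zeta_prod u"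
    by (rule path_prob_ratio[OF N M u v uv _ mono _ kN T T0]) (use pos mk one_le_m in auto)
  then have "complex_of_real (path_prob q s N M u v (event N k m)) = limit_value / complex_of_real (zeta_prod u)"
    using real by simp
  also have "\<dots> = complex_of_real (\<Prod>r=1..k. \<Prod>i=1..m r. par (u i)) * (complex_of_real (q powi (- int k)) / (2 * of_real pi * \<i>) ^ k) *
      contour_value (\<lambda>i. u i) / complex_of_real ((\<Prod>j=1..M. dual v j) ^ k)"
    using pos by (simp add: limit_value_def)
  also have "\<dots> = complex_of_real (1 / (\<Prod>j=1..M. dual v j) ^ k * (\<Prod>r=1..k. \<Prod>i=1..m r. par (u i))) *
      (complex_of_real (q powi (- int k)) / (2 * of_real pi * \<i>) ^ k) * contour_value (\<lambda>i. u i)"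
    by simp
  finally show ?thesis unfolding D contour_value_integrand par_def .
qed

end

end

theorem proposition4p1:
  fixes N M k :: nat and q s :: real and u v :: "nat \<Rightarrow> real" and m :: "nat \<Rightarrow> nat"
    and \<gamma> :: "real \<Rightarrow> complex"
  assumes "1 \<le> N" "1 \<le> M"
    and "0 < q" "q < 1"
    and "s = q powr (- 1 / 2)"
    and "\<forall>i\<in>{1..N}. u i > s"
    and "\<forall>j\<in>{1..M}. v j > 0"
    and "\<forall>i\<in>{1..N}. \<forall>j\<in>{1..M}. u i * v j < 1"
    and "1 \<le> k" "k \<le> m 1" "\<forall>r\<in>{1..<k}. m r \<le> m (r + 1)" "m k \<le> N"
    and "admissible_contour q s N M u v k m \<gamma>"
  shows "complex_of_real (path_prob q s N M u v (\<lambda>\<omega>. \<forall>i\<in>{1..k}. Y N i i \<omega> \<le> enat (m i))) =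
    complex_of_real ((\<Prod>j=1..M. (1 - q * s * v j) / (1 - s * v j)) ^ k *
      (\<Prod>r=1..k. \<Prod>i=1..m r. (u i - s) / (u i - s * q))) *
    (complex_of_real (q powi (- int k)) / (2 * of_real pi * \<i>) ^ k) *
    iterated_contour_integral k \<gamma> (integrand q s M u v k m)"
proof -
  have "s\<^sup>2 = q powr (- 1)" using assms(3) by (simp add: assms(5) power2_eq_square powr_add[symmetric])
  then have "s\<^sup>2 * q = 1" using assms(3) by (simp add: powr_minus)
  moreover have "s > 0" using assms(3) by (simp add: assms(5))
  ultimately interpret sixv q s
    using assms(3,4) by unfold_locales
  have "complex_of_real (path_prob q s N M u v (event N k m)) =
    complex_of_real ((\<Prod>j=1..M. (1 - q * s * v j) / (1 - s * v j)) ^ k *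
      (\<Prod>r=1..k. \<Prod>i=1..m r. (u i - s) / (u i - s * q))) *
    (complex_of_real (q powi (- int k)) / (2 * of_real pi * \<i>) ^ k) *
    iterated_contour_integral k \<gamma> (integrand q s M u v k m)"
    using assms by (intro path_prob_contour) auto
  then show ?thesis by (simp only: event_def[abs_def])
qed

end
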